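(* Consider a sequence (indexed by $N\to\infty$) of non-Gaussian mixed linear models as described in the context. Suppose that (i) $\sigma_t^2>0$ and $0<\operatorname{var}(\alpha_{t1}^2)<\infty$ for $0\le t\le s$; (ii) $|x_i|$ and $\|z_{it}\|_1$, $1\le t\le s$, $1\le i\le N$, are bounded (uniformly in $i,N$); (iii) there is a sequence of diagonal matrices $G=\operatorname{diag}(g_0,\dots,g_s)$ with $g_j>0$, $0\le j\le s$, such that $G^{-1}\mathcal GG^{-1}$ is bounded from above as well as from below, and $\lambda_{\min}(X'V^{-1}X)\to\infty$; (iv) for $0\le j,k\le s$, $(g_jg_k)^{-1}\sum_{l=1}^Lh_l|c_{j,k,l}|$ is bounded and $(g_jg_k)^{-2}\sum_{l_1,l_2=1}^Lh_{l_1,l_2}|c_{j,k,l_1}c_{j,k,l_2}|\to0$; (v) for $0\le j,k\le s$, $(g_jg_k)^{-1}g_{j,k}(\delta)\to0$ and $(g_jg_k)^{-1}\sum_{l=1}^Lh_ld_{j,k,l}(\delta)\to0$, uniformly in $N$, as $\delta\to0$. Suppose furthermore that the REML estimator satisfies $\Sigma_{\mathrm R}^{-1/2}(\hat\theta-\theta)\to N(0,I_{s+1})$ in distribution. Let $K$ be a known $(s+1)\times r$ matrix with $\operatorname{rank}(K)=r$ and $\varphi\in\mathbb R^r$ a specified vector. Then, under the null hypothesis $\mathrm H_0:K'\theta=\varphi$, $$\hat\chi^2=(K'\hat\theta-\varphi)'(K'\hat\Sigma_{\mathrm R}K)^{-1}(K'\hat\theta-\varphi)\longrightarrow\chi_r^2\quad\text{in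 distribution}.$$
   Context: Model (for each $N$): $y=X\beta+Z_1\alpha_1+\cdots+Z_s\alpha_s+\varepsilon$, where $y$ is $N\times1$, $X$ ($N\times p$, rank $p$) and $Z_t$ ($N\times m_t$) are known real matrices, $\beta\in\mathbb R^p$ is unknown, $\alpha_t$ is an $m_t\times1$ vector of random effects, $\varepsilon$ an $N\times1$ vector of errors. The vectors $\alpha_1,\dots,\alpha_s,\varepsilon$ are independent; the components of $\alpha_t$ are i.i.d. with mean $0$, variance $\sigma_t^2$; the components of $\varepsilon$ are i.i.d. with mean $0$, variance $\sigma_0^2$. No normality is assumed. Put $\alpha_0=\varepsilon$, $Z_0=I$ ($N\times N$ identity), $m_0=N$; $\lambda=\sigma_0^2$, $\gamma_t=\sigma_t^2/\sigma_0^2$, $\gamma_0=1$; $\theta=(\theta_0,\dots,\theta_s)'=(\lambda,\gamma_1,\dots,\gamma_s)'$, with parameter space $\Theta=\{\lambda>0,\gamma_t\ge0\}$; $u=y-X\beta$. The number $s$, the true $\theta$, the matrix $K$, the vector $\varphi$ and the component distributions of $\alpha_0,\dots,\alpha_s$ do not depend on $N$; the other quantities (matrices, dimensions, $L$, $g_j$, etc.) may depend on $N$, the subscript $N$ being suppressed. Notation. $x_i'$ is the $i$th row of $X$; $z_{it}'$ is the $i$th row of $Z_t$. $|\cdot|$ is the Euclidean norm of a vector (cardinality for sets), $\|a\|_1=\sum_l|a_l|$, $a_1\cdot a_2\cdots a_k=\sum_la_{1l}\cdots a_{kl}$. For matrices $\|M\|=\{\lambda_{\max}(M'M)\}^{1/2}$;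 a sequence of matrices $M$ is bounded from above if $\|M\|$ is bounded, and bounded from below if $\|M^{-1}\|$ is bounded. "With $\theta$ replaced by $\tilde\theta$" means the same formula evaluated at $\tilde\theta$. $V=\lambda(I+\gamma_1Z_1Z_1'+\cdots+\gamma_sZ_sZ_s')$, $P=V^{-1}-V^{-1}X(X'V^{-1}X)^{-1}X'V^{-1}$. Gaussian restricted log-likelihood: $l_{\mathrm R}(\theta)=c-\frac12\{\log|T'VT|+y'Py\}$ ($|\cdot|$ here determinant), $T$ any $N\times(N-p)$ matrix of rank $N-p$ with $T'X=0$. $\partial l_{\mathrm R}/\partial\theta_j=u'B_ju-\mathrm E(u'B_ju)$ with $B_0=(2\lambda)^{-1}P$, $B_j=(\lambda/2)PZ_jZ_j'P$ ($1\le j\le s$); $B_{j,i_1,i_2}$ is the $(i_1,i_2)$ entry of $B_j$. $\mathcal I_1=\operatorname{Var}(\partial l_{\mathrm R}/\partial\theta)$ and $\mathcal I_2=\mathrm E(\partial^2l_{\mathrm R}/\partial\theta\partial\theta')$ at the true parameters and under the true distribution; $\Sigma_{\mathrm R}=\mathcal I_2^{-1}\mathcal I_1\mathcal I_2^{-1}$. $\mathcal G=(\mathcal G_{j,k})_{0\le j,k\le s}$, $\mathcal G_{j,k}=2\operatorname{tr}(B_jVB_kV)$; one has $\mathcal I_2=-\mathcal G$, which depends only on $\theta$ (and the design). $\kappa_t=\mathrm E(\alpha_{t1}^4)-3\sigma_t^4$; $\Gamma(i_1,i_2)=\sum_{t=0}^s\gamma_t(z_{i_1t}\cdot z_{i_2t})$.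 $f(i_1,\dots,i_4)=\sum_{t=0}^s\kappa_t\,z_{i_1t}\cdot z_{i_2t}\cdot z_{i_3t}\cdot z_{i_4t}$ is regarded as a linear function of $\kappa=(\kappa_t)_{0\le t\le s}$, i.e. identified with its coefficient vector; $f_1,\dots,f_L$ are the distinct nonzero functions arising for $(i_1,\dots,i_4)\in\{1,\dots,N\}^4$. $h_l=|\{(i_1,\dots,i_4):f(i_1,\dots,i_4)=f_l\}|$ and $$c_{j,k,l}=\frac1{h_l}\sum_{f(i_1,\dots,i_4)=f_l}B_{j,i_1,i_2}B_{k,i_3,i_4},\qquad c_{j,k}(i_1,\dots,i_4)=c_{j,k,l}\ \text{ if } f(i_1,\dots,i_4)=f_l.$$ Let $w_i'=(z_{i0}',z_{i1}',\dots,z_{is}')$ and let $d_i$ be the $0/1$ vector of the same dimension whose components equal $1$ exactly where $w_i$ is nonzero. $h_{l_1,l_2}$ is the number of $(i_1,\dots,i_8)$ with $f(i_1,\dots,i_4)=f_{l_1}$, $f(i_5,\dots,i_8)=f_{l_2}$ and $(d_{i_1}+\cdots+d_{i_4})\cdot(d_{i_5}+\cdots+d_{i_8})\ne0$. For $\delta>0$, $g_{j,k}(\delta)=\sup_{\tilde\theta\in\Theta,|\tilde\theta-\theta|\le\delta}|\tilde{\mathcal G}_{j,k}-\mathcal G_{j,k}|$ and $d_{j,k,l}(\delta)=\sup_{\tilde\theta\in\Theta,|\tilde\theta-\theta|\le\delta}|\tilde c_{j,k,l}-c_{j,k,l}|$, where $\tilde{\mathcal G}$, $\tilde c_{j,k,l}$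 are $\mathcal G$, $c_{j,k,l}$ with $\theta$ replaced by $\tilde\theta$. Estimators. $\hat\theta\in\Theta$ is the REML estimator: the maximizer of $l_{\mathrm R}$ over $\Theta$ for balanced data, and a sieved maximizer (maximizer over a suitable sequence of sieve subsets of $\Theta$, in the sense of Jiang, Ann. Statist. 25 (1997) 1781–1803) for unbalanced data. By that earlier work, $\sigma_t^2>0$ ($0\le t\le s$) and the first part of (iii) guarantee $\hat\theta\to\theta$ in probability; this known consistency is to be taken as part of what "REML estimator" means here. $\hat V$, $\hat c_{j,k}$, $\hat B_j$, $\hat\Gamma$, etc. denote the quantities with $\theta$ replaced by $\hat\theta$; $\hat\beta=(X'\hat V^{-1}X)^{-1}X'\hat V^{-1}y$; $\hat u_i=y_i-x_i'\hat\beta$. The POQUIM is $\hat{\mathcal I}_1=(\hat{\mathcal I}_{1,1,jk}+\hat{\mathcal I}_{1,2,jk})_{0\le j,k\le s}$ with $$\hat{\mathcal I}_{1,1,jk}=\sum_{f(i_1,\dots,i_4)\ne0}\hat c_{j,k}(i_1,\dots,i_4)\hat u_{i_1}\hat u_{i_2}\hat u_{i_3}\hat u_{i_4},$$ $$\hat{\mathcal I}_{1,2,jk}=2\operatorname{tr}(\hat B_j\hat V\hat B_k\hat V)-3\hat\lambda^2\sum_{f(i_1,\dots,i_4)\ne0}\hat c_{j,k}(i_1,\dots,i_4)\hat\Gamma(i_1,i_3)\hat\Gamma(i_2,i_4).$$ $\hat{\mathcal I}_2$ is $\mathcal I_2$ with $\theta$ replaced by $\hat\theta$, and the POQUIM estimator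 of $\Sigma_{\mathrm R}$ is $\hat\Sigma_{\mathrm R}=\hat{\mathcal I}_2^{-1}\hat{\mathcal I}_1\hat{\mathcal I}_2^{-1}$. Inverses of random matrices are defined arbitrarily on events where the matrix is singular. *)

theory Defs
  imports
    "HOL-Probability.Probability"
    "Jordan_Normal_Form.DL_Rank"
    "Jordan_Normal_Form.Gauss_Jordan_Elimination"
    "Jordan_Normal_Form.Spectral_Radius"
begin

hide_type (open) Finite_Cartesian_Product.vec
hide_const (open) Finite_Cartesian_Product.vec Finite_Cartesian_Product.row
  Finite_Cartesian_Product.rows Finite_Cartesian_Product.column Cartesian_Space.rank
  Determinants.det
unbundle no vec_syntax


section \<open>Matrices and random matrices\<close>

text \<open>The value at a singular matrix is the unspecified term \<^term>\<open>the None\<close>.  Inverses of random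
  matrices that may be singular are handled by \<open>random_inverse\<close> below.\<close>

definition mat_inv :: "real mat \<Rightarrow> real mat" where
  "mat_inv A = the (mat_inverse A)"

definition mat_tr :: "real mat \<Rightarrow> real" where
  "mat_tr A = (\<Sum>i<dim_row A. A $$ (i, i))"

definition vec_norm2 :: "real vec \<Rightarrow> real" where
  "vec_norm2 v = sqrt (scalar_prod v v)"

text \<open>Used for symmetric matrices only, whose (real) spectrum is nonempty.\<close>

definition lambda_max :: "real mat \<Rightarrow> real" where
  "lambda_max A = Max (spectrum A)"

definition lambda_min :: "real mat \<Rightarrow> real" where
  "lambda_min A = Min (spectrum A)"

definition mat_norm2 :: "real mat \<Rightarrow> real" where
  "mat_norm2 A = sqrt (lambda_max (transpose_mat A * A))"

definition mats_bounded_above :: "(nat \<Rightarrow> real mat) \<Rightarrow> bool" where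
  "mats_bounded_above A \<longleftrightarrow> (\<exists>C. \<forall>n. mat_norm2 (A n) \<le> C)"

definition mats_bounded_below :: "(nat \<Rightarrow> real mat) \<Rightarrow> bool" where
  "mats_bounded_below A \<longleftrightarrow>
     (\<exists>C. \<forall>n. invertible_mat (A n) \<and> mat_norm2 (mat_inv (A n)) \<le> C)"

definition psd_mat :: "real mat \<Rightarrow> bool" where
  "psd_mat A \<longleftrightarrow> square_mat A \<and> transpose_mat A = A \<and>
     (\<forall>v \<in> carrier_vec (dim_row A). 0 \<le> scalar_prod v (A *\<^sub>v v))"

definition mat_sqrt :: "real mat \<Rightarrow> real mat" where
  "mat_sqrt A = (THE R. psd_mat R \<and> R * R = A)"

definition random_vec :: "'w measure \<Rightarrow> nat \<Rightarrow> ('w \<Rightarrow> real vec) \<Rightarrow> bool" where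
  "random_vec M d V \<longleftrightarrow> (\<forall>\<omega>\<in>space M. V \<omega> \<in> carrier_vec d) \<and>
     (\<forall>i<d. (\<lambda>\<omega>. V \<omega> $ i) \<in> borel_measurable M)"

definition random_mat :: "'w measure \<Rightarrow> nat \<Rightarrow> nat \<Rightarrow> ('w \<Rightarrow> real mat) \<Rightarrow> bool" where
  "random_mat M d e A \<longleftrightarrow> (\<forall>\<omega>\<in>space M. A \<omega> \<in> carrier_mat d e) \<and>
     (\<forall>i<d. \<forall>j<e. (\<lambda>\<omega>. A \<omega> $$ (i, j)) \<in> borel_measurable M)"

text \<open>\<open>B\<close> is a random matrix that equals the inverse of \<open>A\<close> wherever \<open>A\<close> is
  nonsingular and is arbitrary (but measurable) elsewhere.\<close>

definition random_inverse :: "'w measure \<Rightarrow> nat \<Rightarrow> ('w \<Rightarrow> real mat) \<Rightarrow> ('w \<Rightarrow> real mat) \<Rightarrow> bool" where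
  "random_inverse M d A B \<longleftrightarrow> random_mat M d d B \<and>
     (\<forall>\<omega>\<in>space M. invertible_mat (A \<omega>) \<longrightarrow> inverts_mat (A \<omega>) (B \<omega>) \<and> inverts_mat (B \<omega>) (A \<omega>))"


section \<open>Convergence of random vectors\<close>

definition variance_of :: "'w measure \<Rightarrow> ('w \<Rightarrow> real) \<Rightarrow> real" where
  "variance_of M U = (\<integral>\<omega>. (U \<omega> - (\<integral>\<omega>'. U \<omega>' \<partial>M))\<^sup>2 \<partial>M)"

definition covariance_of :: "'w measure \<Rightarrow> ('w \<Rightarrow> real) \<Rightarrow> ('w \<Rightarrow> real) \<Rightarrow> real" where
  "covariance_of M U W =
     (\<integral>\<omega>. (U \<omega> - (\<integral>\<omega>'. U \<omega>' \<partial>M)) * (W \<omega> - (\<integral>\<omega>'. W \<omega>' \<partial>M)) \<partial>M)"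

definition vec_tendsto_in_prob ::
    "(nat \<Rightarrow> 'w measure) \<Rightarrow> (nat \<Rightarrow> 'w \<Rightarrow> real vec) \<Rightarrow> real vec \<Rightarrow> bool" where
  "vec_tendsto_in_prob M V v \<longleftrightarrow>
     (\<forall>e>0. (\<lambda>n. measure (M n) {\<omega> \<in> space (M n). vec_norm2 (V n \<omega> - v) > e}) \<longlonglongrightarrow> 0)"

text \<open>Weak convergence to $N(0, I_d)$, tested against bounded continuous functions.  A point of
  $\mathbb R^d$ is padded with zeros to a point of \<^typ>\<open>nat \<Rightarrow> real\<close> (with the product topology); every
  bounded continuous function on $\mathbb R^d$ is the restriction of one on \<^typ>\<open>nat \<Rightarrow> real\<close>.\<close>

definition tendsto_std_normal ::
    "nat \<Rightarrow> (nat \<Rightarrow> 'w measure) \<Rightarrow> (nat \<Rightarrow> 'w \<Rightarrow> real vec) \<Rightarrow> bool" where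
  "tendsto_std_normal d M V \<longleftrightarrow>
     (\<forall>g :: (nat \<Rightarrow> real) \<Rightarrow> real. continuous_on UNIV g \<and> bounded (range g) \<longrightarrow>
        (\<lambda>n. \<integral>\<omega>. g (\<lambda>i. if i < d then V n \<omega> $ i else 0) \<partial>M n)
          \<longlonglongrightarrow> (\<integral>z. g (\<lambda>i. if i < d then z i else 0) \<partial>(\<Pi>\<^sub>M i\<in>{..<d}. std_normal_distribution)))"

text \<open>The law of the sum of squares of \<open>r\<close> independent standard normal variables.\<close>

definition chi_square :: "nat \<Rightarrow> real measure" where
  "chi_square r = distr (\<Pi>\<^sub>M i\<in>{..<r}. std_normal_distribution) borel (\<lambda>z. \<Sum>i<r. (z i)\<^sup>2)"


section \<open>The design of a linear mixed model\<close>

text \<open>\<open>ranZ D t\<close> is the matrix $Z_t$ for $1 \le t \le s$; its other values are never used.  All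
  row and column indices start at 0.\<close>

record lmm_design =
  nfac :: nat
  fixX :: "real mat"
  ranZ :: "nat \<Rightarrow> real mat"

definition nobs :: "lmm_design \<Rightarrow> nat" where
  "nobs D = dim_row (fixX D)"

definition Zmat :: "lmm_design \<Rightarrow> nat \<Rightarrow> real mat" where
  "Zmat D t = (if t = 0 then 1\<^sub>m (nobs D) else ranZ D t)"

definition neff :: "lmm_design \<Rightarrow> nat \<Rightarrow> nat" where
  "neff D t = dim_col (Zmat D t)"

definition valid_design :: "lmm_design \<Rightarrow> bool" where
  "valid_design D \<longleftrightarrow>
     0 < dim_col (fixX D) \<and> vec_space.rank (nobs D) (fixX D) = dim_col (fixX D) \<and>
     (\<forall>t\<in>{1..nfac D}. dim_row (ranZ D t) = nobs D)"

text \<open>Parameter vectors are $\theta = (\lambda, \gamma_1, \dots, \gamma_s)'$.\<close>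

definition param_space :: "nat \<Rightarrow> real vec set" where
  "param_space s = {\<theta> \<in> carrier_vec (s + 1). 0 < \<theta> $ 0 \<and> (\<forall>t\<in>{1..s}. 0 \<le> \<theta> $ t)}"

definition gam :: "real vec \<Rightarrow> nat \<Rightarrow> real" where
  "gam \<theta> t = (if t = 0 then 1 else \<theta> $ t)"

definition true_param :: "nat \<Rightarrow> (nat \<Rightarrow> real) \<Rightarrow> real vec" where
  "true_param s \<sigma>sq = vec (s + 1) (\<lambda>t. if t = 0 then \<sigma>sq 0 else \<sigma>sq t / \<sigma>sq 0)"

definition Vmat :: "lmm_design \<Rightarrow> real vec \<Rightarrow> real mat" where
  "Vmat D \<theta> = mat (nobs D) (nobs D) (\<lambda>(i, k).
     \<theta> $ 0 * ((1\<^sub>m (nobs D)) $$ (i, k) +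
       (\<Sum>t=1..nfac D. \<theta> $ t * (Zmat D t * transpose_mat (Zmat D t)) $$ (i, k))))"

definition Pmat :: "lmm_design \<Rightarrow> real vec \<Rightarrow> real mat" where
  "Pmat D \<theta> = (let X = fixX D; W = mat_inv (Vmat D \<theta>) in
     W - W * X * mat_inv (transpose_mat X * W * X) * transpose_mat X * W)"

definition Bmat :: "lmm_design \<Rightarrow> real vec \<Rightarrow> nat \<Rightarrow> real mat" where
  "Bmat D \<theta> j =
     (if j = 0 then (1 / (2 * \<theta> $ 0)) \<cdot>\<^sub>m Pmat D \<theta>
      else (\<theta> $ 0 / 2) \<cdot>\<^sub>m (Pmat D \<theta> * Zmat D j * transpose_mat (Zmat D j) * Pmat D \<theta>))"

definition Gent :: "lmm_design \<Rightarrow> real vec \<Rightarrow> nat \<Rightarrow> nat \<Rightarrow> real" where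
  "Gent D \<theta> j k = 2 * mat_tr (Bmat D \<theta> j * Vmat D \<theta> * Bmat D \<theta> k * Vmat D \<theta>)"

definition Gmat :: "lmm_design \<Rightarrow> real vec \<Rightarrow> real mat" where
  "Gmat D \<theta> = mat (nfac D + 1) (nfac D + 1) (\<lambda>(j, k). Gent D \<theta> j k)"

definition diag_of :: "nat \<Rightarrow> (nat \<Rightarrow> real) \<Rightarrow> real mat" where
  "diag_of d g = mat d d (\<lambda>(i, j). if i = j then g i else 0)"


section \<open>The coefficients of the fourth moments\<close>

type_synonym quad = "nat \<times> nat \<times> nat \<times> nat"

definition quads :: "lmm_design \<Rightarrow> quad set" where
  "quads D = {..<nobs D} \<times> {..<nobs D} \<times> {..<nobs D} \<times> {..<nobs D}"

text \<open>The linear function $f(i_1,\dots,i_4)$ of $\kappa$, as its coefficient vector.\<close>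

definition fcoef :: "lmm_design \<Rightarrow> quad \<Rightarrow> real vec" where
  "fcoef D = (\<lambda>(i1, i2, i3, i4). vec (nfac D + 1) (\<lambda>t.
     \<Sum>q<neff D t. Zmat D t $$ (i1, q) * Zmat D t $$ (i2, q) * Zmat D t $$ (i3, q) * Zmat D t $$ (i4, q)))"

text \<open>The set $\{f_1,\dots,f_L\}$; its elements are used below in place of the index $l$.\<close>

definition fvals :: "lmm_design \<Rightarrow> real vec set" where
  "fvals D = fcoef D ` quads D - {0\<^sub>v (nfac D + 1)}"

definition fclass :: "lmm_design \<Rightarrow> real vec \<Rightarrow> quad set" where
  "fclass D \<phi> = {q \<in> quads D. fcoef D q = \<phi>}"

definition hcount :: "lmm_design \<Rightarrow> real vec \<Rightarrow> real" where
  "hcount D \<phi> = real (card (fclass D \<phi>))"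

definition ccoef :: "lmm_design \<Rightarrow> real vec \<Rightarrow> nat \<Rightarrow> nat \<Rightarrow> real vec \<Rightarrow> real" where
  "ccoef D \<theta> j k \<phi> = (1 / hcount D \<phi>) *
     (\<Sum>(i1, i2, i3, i4) \<in> fclass D \<phi>. Bmat D \<theta> j $$ (i1, i2) * Bmat D \<theta> k $$ (i3, i4))"

text \<open>The entry of $d_i$ at the position of $w_i$ that holds the entry $(i, q)$ of $Z_t$.\<close>

definition dind :: "lmm_design \<Rightarrow> nat \<Rightarrow> nat \<Rightarrow> nat \<Rightarrow> nat" where
  "dind D i t q = (if Zmat D t $$ (i, q) \<noteq> 0 then 1 else 0)"

definition dsum :: "lmm_design \<Rightarrow> quad \<Rightarrow> nat \<Rightarrow> nat \<Rightarrow> nat" where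
  "dsum D = (\<lambda>(i1, i2, i3, i4) t q. dind D i1 t q + dind D i2 t q + dind D i3 t q + dind D i4 t q)"

definition hcount2 :: "lmm_design \<Rightarrow> real vec \<Rightarrow> real vec \<Rightarrow> real" where
  "hcount2 D \<phi>1 \<phi>2 = real (card {(q1, q2). q1 \<in> fclass D \<phi>1 \<and> q2 \<in> fclass D \<phi>2 \<and>
     (\<Sum>t\<le>nfac D. \<Sum>q<neff D t. dsum D q1 t q * dsum D q2 t q) \<noteq> 0})"

text \<open>The suprema below are finite for $\delta < \lambda$, in particular for all small \<open>\<delta>\<close>; only
  the behaviour as \<open>\<delta>\<close> tends to 0 matters.\<close>

definition param_nbhd :: "lmm_design \<Rightarrow> real vec \<Rightarrow> real \<Rightarrow> real vec set" where
  "param_nbhd D \<theta> \<delta> = {\<theta>' \<in> param_space (nfac D). vec_norm2 (\<theta>' - \<theta>) \<le> \<delta>}"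

definition gdev :: "lmm_design \<Rightarrow> real vec \<Rightarrow> nat \<Rightarrow> nat \<Rightarrow> real \<Rightarrow> real" where
  "gdev D \<theta> j k \<delta> = (SUP \<theta>' \<in> param_nbhd D \<theta> \<delta>. \<bar>Gent D \<theta>' j k - Gent D \<theta> j k\<bar>)"

definition ddev :: "lmm_design \<Rightarrow> real vec \<Rightarrow> nat \<Rightarrow> nat \<Rightarrow> real vec \<Rightarrow> real \<Rightarrow> real" where
  "ddev D \<theta> j k \<phi> \<delta> = (SUP \<theta>' \<in> param_nbhd D \<theta> \<delta>. \<bar>ccoef D \<theta>' j k \<phi> - ccoef D \<theta> j k \<phi>\<bar>)"


section \<open>The mixed linear model\<close>

definition effect_law :: "real measure \<Rightarrow> real \<Rightarrow> bool" where
  "effect_law \<mu> v \<longleftrightarrow> prob_space \<mu> \<and> sets \<mu> = sets borel \<and>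
     integrable \<mu> (\<lambda>x. x) \<and> (\<integral>x. x \<partial>\<mu>) = 0 \<and>
     integrable \<mu> (\<lambda>x. x\<^sup>2) \<and> variance_of \<mu> (\<lambda>x. x) = v"

text \<open>\<open>\<alpha> t q\<close> is component \<open>q\<close> of the vector $\alpha_t$, with $\alpha_0 = \varepsilon$.\<close>

definition mixed_effects ::
    "'w measure \<Rightarrow> lmm_design \<Rightarrow> (nat \<Rightarrow> real measure) \<Rightarrow> (nat \<Rightarrow> nat \<Rightarrow> 'w \<Rightarrow> real) \<Rightarrow> bool" where
  "mixed_effects M D law \<alpha> \<longleftrightarrow> prob_space M \<and>
     prob_space.indep_vars M (\<lambda>t. \<Pi>\<^sub>M q\<in>{..<neff D t}. borel)
       (\<lambda>t \<omega>. \<lambda>q\<in>{..<neff D t}. \<alpha> t q \<omega>) {..nfac D} \<and>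
     (\<forall>t\<le>nfac D. prob_space.indep_vars M (\<lambda>_. borel) (\<alpha> t) {..<neff D t} \<and>
        (\<forall>q<neff D t. distr M borel (\<alpha> t q) = law t))"

definition response ::
    "lmm_design \<Rightarrow> real vec \<Rightarrow> (nat \<Rightarrow> nat \<Rightarrow> 'w \<Rightarrow> real) \<Rightarrow> 'w \<Rightarrow> real vec" where
  "response D \<beta> \<alpha> \<omega> = vec (nobs D) (\<lambda>i. (fixX D *\<^sub>v \<beta>) $ i +
     (\<Sum>t\<le>nfac D. (Zmat D t *\<^sub>v vec (neff D t) (\<lambda>q. \<alpha> t q \<omega>)) $ i))"


section \<open>Restricted likelihood and information matrices\<close>

definition contrast_mat :: "lmm_design \<Rightarrow> real mat \<Rightarrow> bool" where
  "contrast_mat D T \<longleftrightarrow> T \<in> carrier_mat (nobs D) (nobs D - dim_col (fixX D)) \<and>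
     vec_space.rank (nobs D) T = nobs D - dim_col (fixX D) \<and>
     transpose_mat T * fixX D = 0\<^sub>m (nobs D - dim_col (fixX D)) (dim_col (fixX D))"

definition restr_loglik :: "lmm_design \<Rightarrow> real mat \<Rightarrow> real \<Rightarrow> real vec \<Rightarrow> real vec \<Rightarrow> real" where
  "restr_loglik D T c y \<theta> =
     c - (ln (Determinant.det (transpose_mat T * Vmat D \<theta> * T)) + scalar_prod y (Pmat D \<theta> *\<^sub>v y)) / 2"

definition vec_upd :: "real vec \<Rightarrow> nat \<Rightarrow> real \<Rightarrow> real vec" where
  "vec_upd v j x = vec (dim_vec v) (\<lambda>i. if i = j then x else v $ i)"

definition partial_deriv :: "nat \<Rightarrow> (real vec \<Rightarrow> real) \<Rightarrow> real vec \<Rightarrow> real" where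
  "partial_deriv j F v = deriv (\<lambda>x. F (vec_upd v j x)) (v $ j)"

definition info1 ::
    "'w measure \<Rightarrow> lmm_design \<Rightarrow> real mat \<Rightarrow> real \<Rightarrow> ('w \<Rightarrow> real vec) \<Rightarrow> real vec \<Rightarrow> real mat" where
  "info1 M D T c y \<theta> = mat (nfac D + 1) (nfac D + 1) (\<lambda>(j, k).
     covariance_of M (\<lambda>\<omega>. partial_deriv j (restr_loglik D T c (y \<omega>)) \<theta>)
                     (\<lambda>\<omega>. partial_deriv k (restr_loglik D T c (y \<omega>)) \<theta>))"

definition info2 ::
    "'w measure \<Rightarrow> lmm_design \<Rightarrow> real mat \<Rightarrow> real \<Rightarrow> ('w \<Rightarrow> real vec) \<Rightarrow> real vec \<Rightarrow> real mat" where
  "info2 M D T c y \<theta> = mat (nfac D + 1) (nfac D + 1) (\<lambda>(j, k).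
     \<integral>\<omega>. partial_deriv j (partial_deriv k (restr_loglik D T c (y \<omega>))) \<theta> \<partial>M)"

definition SigmaR ::
    "'w measure \<Rightarrow> lmm_design \<Rightarrow> real mat \<Rightarrow> real \<Rightarrow> ('w \<Rightarrow> real vec) \<Rightarrow> real vec \<Rightarrow> real mat" where
  "SigmaR M D T c y \<theta> =
     mat_inv (info2 M D T c y \<theta>) * info1 M D T c y \<theta> * mat_inv (info2 M D T c y \<theta>)"


section \<open>REML and POQUIM estimators\<close>

text \<open>A sieve is a sequence of subsets that approximates the parameter space; the constant
  sequence \<^term>\<open>\<lambda>n. param_space s\<close>, which gives the maximizer over the full space, is one.\<close>

definition sieve :: "nat \<Rightarrow> (nat \<Rightarrow> real vec set) \<Rightarrow> bool" where
  "sieve s S \<longleftrightarrow> (\<forall>n. S n \<subseteq> param_space s) \<and>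
     (\<forall>\<theta>\<in>param_space s. \<forall>e>0. \<forall>\<^sub>F n in sequentially. \<exists>\<theta>'\<in>S n. vec_norm2 (\<theta>' - \<theta>) < e)"

text \<open>A maximizer need not exist for every outcome, so the maximization is required with
  probability tending to one.  Consistency is part of the notion.\<close>

definition reml_estimator ::
    "nat \<Rightarrow> (nat \<Rightarrow> 'w measure) \<Rightarrow> (nat \<Rightarrow> lmm_design) \<Rightarrow> (nat \<Rightarrow> real mat) \<Rightarrow> (nat \<Rightarrow> real) \<Rightarrow>
     (nat \<Rightarrow> 'w \<Rightarrow> real vec) \<Rightarrow> real vec \<Rightarrow> (nat \<Rightarrow> 'w \<Rightarrow> real vec) \<Rightarrow> bool" where
  "reml_estimator s M D T c y \<theta> est \<longleftrightarrow>
     (\<forall>n. random_vec (M n) (s + 1) (est n) \<and> (\<forall>\<omega>\<in>space (M n). est n \<omega> \<in> param_space s)) \<and>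
     (\<exists>S A. sieve s S \<and>
        (\<forall>n. A n \<in> sets (M n) \<and>
          (\<forall>\<omega>\<in>A n. est n \<omega> \<in> S n \<and>
            (\<forall>\<theta>'\<in>S n. restr_loglik (D n) (T n) (c n) (y n \<omega>) \<theta>'
                        \<le> restr_loglik (D n) (T n) (c n) (y n \<omega>) (est n \<omega>)))) \<and>
        (\<lambda>n. measure (M n) (A n)) \<longlonglongrightarrow> 1) \<and>
     vec_tendsto_in_prob M est \<theta>"

definition beta_hat :: "lmm_design \<Rightarrow> real vec \<Rightarrow> real vec \<Rightarrow> real vec" where
  "beta_hat D \<theta> y = (let X = fixX D; W = mat_inv (Vmat D \<theta>) in
     (mat_inv (transpose_mat X * W * X) * transpose_mat X * W) *\<^sub>v y)"

definition u_hat :: "lmm_design \<Rightarrow> real vec \<Rightarrow> real vec \<Rightarrow> real vec" where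
  "u_hat D \<theta> y = y - fixX D *\<^sub>v beta_hat D \<theta> y"

definition Gam :: "lmm_design \<Rightarrow> real vec \<Rightarrow> nat \<Rightarrow> nat \<Rightarrow> real" where
  "Gam D \<theta> i1 i2 = (\<Sum>t\<le>nfac D. gam \<theta> t * scalar_prod (row (Zmat D t) i1) (row (Zmat D t) i2))"

definition nonzero_quads :: "lmm_design \<Rightarrow> quad set" where
  "nonzero_quads D = {q \<in> quads D. fcoef D q \<noteq> 0\<^sub>v (nfac D + 1)}"

definition poquim11 :: "lmm_design \<Rightarrow> real vec \<Rightarrow> real vec \<Rightarrow> nat \<Rightarrow> nat \<Rightarrow> real" where
  "poquim11 D \<theta> y j k = (\<Sum>(i1, i2, i3, i4) \<in> nonzero_quads D.
     ccoef D \<theta> j k (fcoef D (i1, i2, i3, i4)) *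
     (u_hat D \<theta> y $ i1 * u_hat D \<theta> y $ i2 * u_hat D \<theta> y $ i3 * u_hat D \<theta> y $ i4))"

definition poquim12 :: "lmm_design \<Rightarrow> real vec \<Rightarrow> nat \<Rightarrow> nat \<Rightarrow> real" where
  "poquim12 D \<theta> j k = 2 * mat_tr (Bmat D \<theta> j * Vmat D \<theta> * Bmat D \<theta> k * Vmat D \<theta>) -
     3 * (\<theta> $ 0)\<^sup>2 * (\<Sum>(i1, i2, i3, i4) \<in> nonzero_quads D.
       ccoef D \<theta> j k (fcoef D (i1, i2, i3, i4)) * Gam D \<theta> i1 i3 * Gam D \<theta> i2 i4)"

text \<open>To be evaluated at the REML estimate and the data.\<close>

definition poquim :: "lmm_design \<Rightarrow> real vec \<Rightarrow> real vec \<Rightarrow> real mat" where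
  "poquim D \<theta> y = mat (nfac D + 1) (nfac D + 1) (\<lambda>(j, k).
     poquim11 D \<theta> y j k + poquim12 D \<theta> j k)"

text \<open>The expected Hessian \<^term>\<open>info2\<close> at the true parameter equals $-\mathcal G$, which is a function
  of the parameter (and the design) only; this function is what is evaluated at the estimate.\<close>

definition info2_at :: "lmm_design \<Rightarrow> real vec \<Rightarrow> real mat" where
  "info2_at D \<theta> = - Gmat D \<theta>"

end

theory Submission
  imports Defs
begin

text \<open>Write $\Sigma$ for $\Sigma_{\mathrm R}$.  Conditions (iv), (v) and a truncation argument for the
  products of four components of $u$ show that each entry of $\hat{\mathcal I}_1$ differs from that of
  $\mathcal I_1$ by $o_P(g_j g_k)$; the residuals $\hat u_i$ are compared with $u_i$ by a bound that is
  uniform over a neighbourhood of $\theta$.  After rescaling by $G$, (iii) and the lower bound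
  $\kappa_t > -2 \sigma_t^4$ (the variance of $\alpha_{t1}^2$ is positive) keep $\mathcal G$ and
  $\mathcal I_1$ away from singularity, so $\hat\Sigma$ is close to $\Sigma$ relative to $\Sigma$ and
  the statistic is close, relative to itself, to the same statistic with $\Sigma$.  The latter is $|Q_n Z_n|^2$ with
  $Q_n Q_n' = I_r$ and $Z_n$ asymptotically standard normal.  As $Q_n$ need not converge, one passes to
  convergent subsequences of $Q_n$ for the Laplace transforms; by rotation invariance they all have the
  same limit, which is that of $\chi^2_r$.\<close>

section \<open>Finitely supported matrices\<close>

text \<open>The estimate depends on all the data, so no moment of a residual at the estimate can be
  computed. Every comparison is therefore made for all \<theta>' near \<theta> at once, against one
  random variable in which \<theta>' does not occur; only this variable is integrated, and Markov's
  inequality is applied to it. Truncation is forced by the moments: with four moments, a product of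
  four components of u has a mean but perhaps no variance, while the second half of (iv) controls
  variances. The rates g_j may differ and K mixes the coordinates, so K' \<Sigma> K has no diagonal
  normalization; closeness relative to the form of \<Sigma> itself passes through K without loss.
  Dimensions change with n, and algebra, norms and limits are needed together. Hence matrices of all
  sizes live in one type, a vector is a matrix of width one, and sizes are side conditions
  \<open>mat_dims\<close>.\<close>

typedef fmat = "{f :: nat => nat => real. \<exists>n. \<forall>i j. n <= i \<or> n <= j \<longrightarrow> f i j = 0}"
  morphisms ent Abs_fmat
  by (rule exI[of _ "\<lambda>_ _. 0"]) simp

setup_lifting type_definition_fmat

lemma fmat_eqI: "(\<And>i j. ent A i j = ent B i j) ==> A = B"
  by (simp add: ent_inject[symmetric] ext)

definition of_fun :: "nat => nat => (nat => nat => real) => fmat" where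
  "of_fun m n f = Abs_fmat (\<lambda>i j. if i < m \<and> j < n then f i j else 0)"

lemma ent_of_fun [simp]: "ent (of_fun m n f) i j = (if i < m \<and> j < n then f i j else 0)"
  unfolding of_fun_def by (subst Abs_fmat_inverse) (auto intro!: exI[of _ "max m n"])

text \<open>Only a bound on the support, so that a matrix has many admissible sizes; several
  matrices can then be given one common square size.\<close>

definition mat_dims :: "nat => nat => fmat => bool" where
  "mat_dims m n A \<longleftrightarrow> (\<forall>i j. m <= i \<or> n <= j \<longrightarrow> ent A i j = 0)"

lemma mat_dims_of_fun [simp]: "mat_dims m n (of_fun m n f)"
  by (auto simp: mat_dims_def)

lemma mat_dims_mono: "mat_dims m n A ==> m <= m' ==> n <= n' ==> mat_dims m' n' A"
  by (auto simp: mat_dims_def)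

lemma mat_dims_exists: "\<exists>n. mat_dims n n A"
  using ent[of A] by (auto simp: mat_dims_def)

lemma mat_dims_exists2: "\<exists>n. mat_dims n n A \<and> mat_dims n n B"
proof -
  obtain n m where "mat_dims n n A" "mat_dims m m B" using mat_dims_exists by blast
  then show ?thesis by (intro exI[of _ "max n m"]) (auto intro: mat_dims_mono)
qed

lemma mat_dims_exists3: "\<exists>n. mat_dims n n A \<and> mat_dims n n B \<and> mat_dims n n C"
proof -
  obtain n m where "mat_dims n n A" "mat_dims n n B" "mat_dims m m C"
    using mat_dims_exists mat_dims_exists2 by metis
  then show ?thesis by (intro exI[of _ "max n m"]) (auto intro: mat_dims_mono)
qed

text \<open>Any bound on the support would do. The choice becomes invisible through
  \<open>ent_times_gen\<close> and \<open>inner_fmat_gen\<close>, which allow every other range of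
  summation.\<close>

definition bnd :: "fmat => nat" where "bnd A = (SOME n. mat_dims n n A)"

lemma bnd: "mat_dims (bnd A) (bnd A) A"
  unfolding bnd_def by (rule someI_ex[OF mat_dims_exists])

lemma sum_lessThan_irrelevant:
  fixes f :: "nat => 'a::comm_monoid_add"
  assumes "\<And>i. m <= i ==> f i = 0" "\<And>i. n <= i ==> f i = 0"
  shows "sum f {..<m} = sum f {..<n}"
  by (rule sum.mono_neutral_cong) (use assms in \<open>auto simp: not_less\<close>)

text \<open>A ring without unit: the identity of infinite size has infinite support. The matrices
  \<open>idm n\<close> act as local units instead.\<close>

instantiation fmat :: ring
begin

lift_definition zero_fmat :: fmat is "\<lambda>_ _. 0" by simp
lift_definition plus_fmat :: "fmat => fmat => fmat" is "\<lambda>f g i j. f i j + g i j"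
proof -
  fix f g :: "nat => nat => real"
  assume "\<exists>n. \<forall>i j. n <= i \<or> n <= j \<longrightarrow> f i j = 0" "\<exists>n. \<forall>i j. n <= i \<or> n <= j \<longrightarrow> g i j = 0"
  then obtain n m where "\<forall>i j. n <= i \<or> n <= j \<longrightarrow> f i j = 0" "\<forall>i j. m <= i \<or> m <= j \<longrightarrow> g i j = 0" by blast
  then show "\<exists>n. \<forall>i j. n <= i \<or> n <= j \<longrightarrow> f i j + g i j = 0" by (intro exI[of _ "max n m"]) auto
qed
lift_definition minus_fmat :: "fmat => fmat => fmat" is "\<lambda>f g i j. f i j - g i j"
proof -
  fix f g :: "nat => nat => real"
  assume "\<exists>n. \<forall>i j. n <= i \<or> n <= j \<longrightarrow> f i j = 0" "\<exists>n. \<forall>i j. n <= i \<or> n <= j \<longrightarrow> g i j = 0"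
  then obtain n m where "\<forall>i j. n <= i \<or> n <= j \<longrightarrow> f i j = 0" "\<forall>i j. m <= i \<or> m <= j \<longrightarrow> g i j = 0" by blast
  then show "\<exists>n. \<forall>i j. n <= i \<or> n <= j \<longrightarrow> f i j - g i j = 0" by (intro exI[of _ "max n m"]) auto
qed
lift_definition uminus_fmat :: "fmat => fmat" is "\<lambda>f i j. - f i j" by auto

definition times_fmat :: "fmat => fmat => fmat" where
  "times_fmat A B = of_fun (bnd A) (bnd B) (\<lambda>i k. \<Sum>j<bnd A. ent A i j * ent B j k)"

lemma ent_simps [simp]:
  "ent 0 i j = 0" "ent (A + B) i j = ent A i j + ent B i j"
  "ent (A - B) i j = ent A i j - ent B i j" "ent (- A) i j = - ent A i j"
  by (transfer; simp)+

lemma ent_times_gen: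
  assumes "\<And>j. n <= j ==> ent A i j * ent B j k = 0"
  shows "ent (A * B) i k = (\<Sum>j<n. ent A i j * ent B j k)"
proof -
  have *: "(\<Sum>j<bnd A. ent A i j * ent B j k) = (\<Sum>j<n. ent A i j * ent B j k)"
    by (rule sum_lessThan_irrelevant) (use bnd[of A] assms in \<open>auto simp: mat_dims_def\<close>)
  moreover have "\<not> (i < bnd A \<and> k < bnd B) ==> (\<Sum>j<bnd A. ent A i j * ent B j k) = 0"
    using bnd[of A] bnd[of B] by (intro sum.neutral) (auto simp: mat_dims_def)
  ultimately show ?thesis by (auto simp: times_fmat_def)
qed

lemma ent_times_left: "mat_dims m n A ==> ent (A * B) i k = (\<Sum>j<n. ent A i j * ent B j k)"
  by (rule ent_times_gen) (auto simp: mat_dims_def)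

lemma ent_times_right: "mat_dims m n B ==> ent (A * B) i k = (\<Sum>j<m. ent A i j * ent B j k)"
  by (rule ent_times_gen) (auto simp: mat_dims_def)

instance
proof
  fix A B C :: fmat
  show "A + B + C = A + (B + C)" "A + B = B + A" "0 + A = A" "- A + A = 0" "A - B = A + - B"
    by (auto intro!: fmat_eqI)
  obtain n where n: "mat_dims n n A" "mat_dims n n B" "mat_dims n n C" using mat_dims_exists3 by blast
  have n': "mat_dims n n (A * B)" "mat_dims n n (A + B)" "mat_dims n n (B + C)"
    using n by (auto simp: mat_dims_def ent_times_left[OF n(1)])
  show "A * B * C = A * (B * C)"
  proof (rule fmat_eqI)
    fix i j
    show "ent (A * B * C) i j = ent (A * (B * C)) i j"
      by (simp add: ent_times_left[OF n(1)] ent_times_left[OF n(2)] ent_times_left[OF n'(1)]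
          sum_distrib_left sum_distrib_right mult.assoc) (rule sum.swap)
  qed
  show "(A + B) * C = A * C + B * C"
    by (rule fmat_eqI) (simp add: ent_times_right[OF n(3)] algebra_simps sum.distrib)
  show "A * (B + C) = A * B + A * C"
    by (rule fmat_eqI) (simp add: ent_times_left[OF n(1)] algebra_simps sum.distrib)
qed

end

lemma ent_sum [simp]: "ent (sum f S) i j = (\<Sum>x\<in>S. ent (f x) i j)"
  by (induction S rule: infinite_finite_induct) auto

instantiation fmat :: real_vector
begin

lift_definition scaleR_fmat :: "real => fmat => fmat" is "\<lambda>c f i j. c * f i j" by auto

lemma ent_scaleR [simp]: "ent (c *\<^sub>R A) i j = c * ent A i j"
  by transfer simp

instance
  by standard (auto intro!: fmat_eqI simp: algebra_simps)

end

text \<open>The induced norm is the Frobenius norm. It is submultiplicative, which makes products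
  continuous; the operator norm \<open>mat_norm2\<close> enters only through
  \<open>norm_mult_le_mat_norm2\<close>.\<close>

instantiation fmat :: real_inner
begin

definition inner_fmat :: "fmat => fmat => real" where
  "inner_fmat A B = (\<Sum>i<bnd A. \<Sum>j<bnd A. ent A i j * ent B i j)"
definition norm_fmat :: "fmat => real" where "norm_fmat A = sqrt (inner A A)"
definition dist_fmat :: "fmat => fmat => real" where "dist_fmat A B = norm (A - B)"
definition sgn_fmat :: "fmat => fmat" where "sgn_fmat A = A /\<^sub>R norm A"
definition uniformity_fmat :: "(fmat \<times> fmat) filter" where
  "uniformity_fmat = (INF e\<in>{0<..}. principal {(x, y). dist x y < e})"
definition open_fmat :: "fmat set => bool" where
  "open_fmat U = (\<forall>x\<in>U. eventually (\<lambda>(x', y). x' = x \<longrightarrow> y \<in> U) uniformity)"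

lemma inner_fmat_gen:
  assumes "\<And>i j. m <= i \<or> n <= j ==> ent A i j * ent B i j = 0"
  shows "inner A B = (\<Sum>i<m. \<Sum>j<n. ent A i j * ent B i j)"
proof -
  have "inner A B = (\<Sum>i<bnd A. \<Sum>j<n. ent A i j * ent B i j)"
    unfolding inner_fmat_def
    by (rule sum.cong[OF refl], rule sum_lessThan_irrelevant)
       (use bnd[of A] assms in \<open>auto simp: mat_dims_def\<close>)
  also have "\<dots> = (\<Sum>i<m. \<Sum>j<n. ent A i j * ent B i j)"
    by (rule sum_lessThan_irrelevant)
       (use bnd[of A] assms in \<open>auto simp: mat_dims_def intro!: sum.neutral\<close>)
  finally show ?thesis .
qed

lemma inner_fmat_left: "mat_dims m n A ==> inner A B = (\<Sum>i<m. \<Sum>j<n. ent A i j * ent B i j)"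
  by (rule inner_fmat_gen) (auto simp: mat_dims_def)

lemma inner_fmat_right: "mat_dims m n B ==> inner A B = (\<Sum>i<m. \<Sum>j<n. ent A i j * ent B i j)"
  by (rule inner_fmat_gen) (auto simp: mat_dims_def)

instance
proof
  fix A B C :: fmat and a :: real
  show "dist A B = norm (A - B)" "sgn A = A /\<^sub>R norm A" "norm A = sqrt (inner A A)"
    "(uniformity :: (fmat \<times> fmat) filter) = (INF e\<in>{0<..}. principal {(x, y). dist x y < e})"
    by (simp_all add: dist_fmat_def sgn_fmat_def norm_fmat_def uniformity_fmat_def)
  fix U :: "fmat set"
  show "open U = (\<forall>x\<in>U. eventually (\<lambda>(x', y). x' = x \<longrightarrow> y \<in> U) uniformity)"
    by (simp add: open_fmat_def)
  obtain n where n: "mat_dims n n A" "mat_dims n n B" "mat_dims n n C" using mat_dims_exists3 by blast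
  show "inner A B = inner B A"
    by (simp add: inner_fmat_left[OF n(1)] inner_fmat_left[OF n(2)] mult.commute)
  show "inner (A + B) C = inner A C + inner B C" "inner (a *\<^sub>R A) C = a * inner A C"
    by (simp_all add: inner_fmat_right[OF n(3)] algebra_simps sum.distrib sum_distrib_left)
  show "0 <= inner A A"
    by (simp add: inner_fmat_left[OF n(1)] sum_nonneg)
  show "(inner A A = 0) = (A = 0)"
  proof
    assume "inner A A = 0"
    then have "\<forall>i<n. \<forall>j<n. ent A i j = 0"
      by (auto simp: inner_fmat_left[OF n(1)] sum_nonneg_eq_0_iff sum_nonneg)
    with n(1) show "A = 0" by (intro fmat_eqI) (auto simp: mat_dims_def not_less[symmetric])
  next
    assume "A = 0" then show "inner A A = 0" using inner_fmat_left[OF n(1), of A] by simp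
  qed
qed

end

lift_definition trp :: "fmat => fmat" is "\<lambda>f i j. f j i" by blast

lemma ent_trp [simp]: "ent (trp A) i j = ent A j i"
  by transfer simp

lemma mat_dims_trp [simp]: "mat_dims n m (trp A) \<longleftrightarrow> mat_dims m n A"
  by (auto simp: mat_dims_def)

lemma trp_simps [simp]:
  "trp (trp A) = A" "trp 0 = 0" "trp (A + B) = trp A + trp B" "trp (A - B) = trp A - trp B"
  "trp (- A) = - trp A" "trp (c *\<^sub>R A) = c *\<^sub>R trp A" "trp (sum f S) = (\<Sum>x\<in>S. trp (f x))"
  by (auto intro!: fmat_eqI)

lemma trp_mult: "trp (A * B) = trp B * trp A"
proof (rule fmat_eqI)
  obtain n where n: "mat_dims n n A" "mat_dims n n B" using mat_dims_exists2 by blast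
  have n': "mat_dims n n (trp B)" using n by simp
  show "ent (trp (A * B)) i j = ent (trp B * trp A) i j" for i j
    by (simp add: ent_times_left[OF n(1)] ent_times_left[OF n'] mult.commute)
qed

lemma inner_trp [simp]: "inner (trp A) (trp B) = inner A B"
proof -
  obtain n where n: "mat_dims n n A" using mat_dims_exists by blast
  then have n': "mat_dims n n (trp A)" by simp
  show ?thesis by (simp add: inner_fmat_left[OF n'] inner_fmat_left[OF n]) (rule sum.swap)
qed

lemma norm_trp [simp]: "norm (trp A) = norm A"
  by (simp add: norm_eq_sqrt_inner)

text \<open>Transposition is the adjoint of multiplication. Nearly all manipulations of quadratic
  forms below move a factor across the inner product by this rule.\<close>

lemma inner_times_left: "inner (A * B) C = inner B (trp A * C)"
proof -
  obtain n where n: "mat_dims n n A" "mat_dims n n B" "mat_dims n n C" using mat_dims_exists3 by blast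
  have n': "mat_dims n n (trp A)" using n by simp
  have "inner (A * B) C = (\<Sum>i<n. \<Sum>j<n. \<Sum>k<n. ent A i k * ent B k j * ent C i j)"
    by (simp add: inner_fmat_right[OF n(3)] ent_times_left[OF n(1)] sum_distrib_right)
  also have "\<dots> = (\<Sum>i<n. \<Sum>k<n. \<Sum>j<n. ent A i k * ent B k j * ent C i j)"
    by (intro sum.cong refl sum.swap)
  also have "\<dots> = (\<Sum>k<n. \<Sum>i<n. \<Sum>j<n. ent A i k * ent B k j * ent C i j)"
    by (rule sum.swap)
  also have "\<dots> = (\<Sum>k<n. \<Sum>j<n. \<Sum>i<n. ent A i k * ent B k j * ent C i j)"
    by (intro sum.cong refl sum.swap)
  also have "\<dots> = inner B (trp A * C)"
    by (simp add: inner_fmat_left[OF n(2)] ent_times_left[OF n'] sum_distrib_left mult_ac)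
  finally show ?thesis .
qed

lemma inner_times_right: "inner (A * B) C = inner A (C * trp B)"
proof -
  have "inner (A * B) C = inner (trp B * trp A) (trp C)" by (metis inner_trp trp_mult)
  also have "\<dots> = inner (trp A) (B * trp C)" by (simp add: inner_times_left)
  also have "\<dots> = inner A (C * trp B)" by (metis inner_trp trp_mult trp_simps(1))
  finally show ?thesis .
qed

instance fmat :: real_normed_algebra
proof
  fix A B :: fmat and a :: real
  obtain n where n: "mat_dims n n A" "mat_dims n n B" using mat_dims_exists2 by blast
  show "a *\<^sub>R A * B = a *\<^sub>R (A * B)" "A * a *\<^sub>R B = a *\<^sub>R (A * B)"
    by (auto intro!: fmat_eqI simp: ent_times_right[OF n(2)] ent_times_left[OF n(1)] sum_distrib_left mult_ac)
  have AB: "mat_dims n n (A * B)" using n by (auto simp: mat_dims_def ent_times_left[OF n(1)])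
  have "(norm (A * B))\<^sup>2 = (\<Sum>i<n. \<Sum>k<n. (\<Sum>j<n. ent A i j * ent B j k)\<^sup>2)"
    unfolding power2_norm_eq_inner by (simp add: inner_fmat_left[OF AB] ent_times_left[OF n(1)] power2_eq_square)
  also have "\<dots> <= (\<Sum>i<n. \<Sum>k<n. (\<Sum>j<n. (ent A i j)\<^sup>2) * (\<Sum>j<n. (ent B j k)\<^sup>2))"
    by (intro sum_mono Cauchy_Schwarz_ineq_sum)
  also have "\<dots> = (\<Sum>i<n. \<Sum>j<n. (ent A i j)\<^sup>2) * (\<Sum>k<n. \<Sum>j<n. (ent B j k)\<^sup>2)"
    by (simp add: sum_product)
  also have "(\<Sum>k<n. \<Sum>j<n. (ent B j k)\<^sup>2) = (\<Sum>j<n. \<Sum>k<n. (ent B j k)\<^sup>2)"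
    by (rule sum.swap)
  also have "(\<Sum>i<n. \<Sum>j<n. (ent A i j)\<^sup>2) * \<dots> = (norm A * norm B)\<^sup>2"
    unfolding power_mult_distrib power2_norm_eq_inner
    by (simp add: inner_fmat_left[OF n(1)] inner_fmat_left[OF n(2)] power2_eq_square)
  finally show "norm (A * B) <= norm A * norm B"
    by (rule power2_le_imp_le) simp
qed

definition idm :: "nat => fmat" where "idm n = of_fun n n (\<lambda>i j. if i = j then 1 else 0)"

lemma mat_dims_idm [simp]: "mat_dims n n (idm n)" by (simp add: idm_def)

lemma trp_idm [simp]: "trp (idm n) = idm n" by (auto intro!: fmat_eqI simp: idm_def)

lemma ent_idm: "ent (idm n) i j = (if i < n \<and> i = j then 1 else 0)" by (simp add: idm_def)

lemma idm_mult_left [simp]: "mat_dims m n A ==> idm m * A = A"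
proof (rule fmat_eqI)
  fix i j assume "mat_dims m n A"
  then have "ent (idm m * A) i j = (\<Sum>k<m. if k = i then ent A i j else 0)"
    unfolding ent_times_left[OF mat_dims_idm] by (intro sum.cong refl) (auto simp: ent_idm mat_dims_def)
  also have "\<dots> = ent A i j"
    using \<open>mat_dims m n A\<close> by (auto simp: mat_dims_def not_less)
  finally show "ent (idm m * A) i j = ent A i j" .
qed

lemma idm_mult_right [simp]: "mat_dims m n A ==> A * idm n = A"
  using idm_mult_left[of n m "trp A"] by (metis mat_dims_trp trp_idm trp_mult trp_simps(1))

lemma idm_mult_left_iff: "idm m * A = A \<longleftrightarrow> (\<forall>i j. m <= i \<longrightarrow> ent A i j = 0)"
proof
  assume "idm m * A = A"
  then show "\<forall>i j. m <= i \<longrightarrow> ent A i j = 0"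
    by (metis (no_types, lifting) ent_times_left[OF mat_dims_idm] ent_idm leD mult_zero_left sum.neutral)
next
  assume a: "\<forall>i j. m <= i \<longrightarrow> ent A i j = 0"
  obtain n where "mat_dims n n A" using mat_dims_exists by blast
  then have "mat_dims m n A" using a by (auto simp: mat_dims_def)
  then show "idm m * A = A" by simp
qed

text \<open>Turns a condition on the support into two equations, so that sizes of products follow
  from associativity alone.\<close>

lemma mat_dims_alt: "mat_dims m n A \<longleftrightarrow> idm m * A = A \<and> A * idm n = A"
proof
  assume a: "idm m * A = A \<and> A * idm n = A"
  then have "idm n * trp A = trp A" by (metis trp_idm trp_mult)
  with a show "mat_dims m n A" unfolding idm_mult_left_iff mat_dims_def by simp
qed simp

lemma mat_dims_mult [intro]: "mat_dims m n A ==> mat_dims n k B ==> mat_dims m k (A * B)"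
  unfolding mat_dims_alt by (metis mult.assoc)

lemma mat_dims_simps [simp, intro]:
  "mat_dims m n 0" "mat_dims m n A ==> mat_dims m n B ==> mat_dims m n (A + B)"
  "mat_dims m n A ==> mat_dims m n B ==> mat_dims m n (A - B)"
  "mat_dims m n A ==> mat_dims m n (- A)" "mat_dims m n A ==> mat_dims m n (c *\<^sub>R A)"
  by (auto simp: mat_dims_def)

lemma mat_dims_sum [intro]: "(\<And>x. x \<in> S ==> mat_dims m n (f x)) ==> mat_dims m n (sum f S)"
  by (auto simp: mat_dims_def)

lemma abs_ent_le_norm: "\<bar>ent A i j\<bar> <= norm A"
proof -
  obtain n where n: "mat_dims n n A" using mat_dims_exists by blast
  show ?thesis
  proof (cases "i < n \<and> j < n")
    case True
    have "(ent A i j)\<^sup>2 <= (\<Sum>j<n. (ent A i j)\<^sup>2)"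
      using True by (intro member_le_sum) auto
    also have "\<dots> <= (\<Sum>i<n. \<Sum>j<n. (ent A i j)\<^sup>2)"
      using True by (intro member_le_sum[where f = "\<lambda>i. \<Sum>j<n. (ent A i j)\<^sup>2"]) (auto intro: sum_nonneg)
    also have "\<dots> = (norm A)\<^sup>2"
      unfolding power2_norm_eq_inner by (simp add: inner_fmat_left[OF n] power2_eq_square)
    finally show ?thesis by (simp add: abs_le_square_iff[symmetric])
  next
    case False then show ?thesis using n by (auto simp: mat_dims_def not_less)
  qed
qed

lemma bounded_linear_trp: "bounded_linear trp"
  by (rule bounded_linear_intro[of _ 1]) auto

lemma norm_le_sum_ent:
  assumes "mat_dims m n A"
  shows "norm A <= (\<Sum>i<m. \<Sum>j<n. \<bar>ent A i j\<bar>)"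
proof -
  have "norm A = L2_set (\<lambda>p. \<bar>ent A (fst p) (snd p)\<bar>) ({..<m}\<times>{..<n})"
    by (simp add: norm_eq_sqrt_inner L2_set_def inner_fmat_left[OF assms] power2_eq_square sum.cartesian_product case_prod_beta)
  also have "\<dots> <= (\<Sum>p\<in>{..<m}\<times>{..<n}. \<bar>ent A (fst p) (snd p)\<bar>)"
    by (rule L2_set_le_sum) auto
  finally show ?thesis
    by (simp add: sum.cartesian_product case_prod_beta)
qed

definition trc :: "fmat => real" where "trc A = (\<Sum>i<bnd A. ent A i i)"

lemma trc_gen: "mat_dims n n A ==> trc A = (\<Sum>i<n. ent A i i)"
  unfolding trc_def by (rule sum_lessThan_irrelevant) (use bnd[of A] in \<open>auto simp: mat_dims_def\<close>)

lemma trc_mult: "trc (A * B) = inner (trp A) B"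
proof -
  obtain n where n: "mat_dims n n A" "mat_dims n n B" using mat_dims_exists2 by blast
  then have n': "mat_dims n n (trp A)" by simp
  show ?thesis by (simp add: trc_gen[OF mat_dims_mult[OF n]] ent_times_left[OF n(1)] inner_fmat_left[OF n']) (rule sum.swap)
qed

lemma trc_commute: "trc (A * B) = trc (B * A)"
  by (metis inner_commute inner_trp trc_mult trp_simps(1))

lemma trc_linear [simp]: "trc 0 = 0" "trc (A + B) = trc A + trc B" "trc (A - B) = trc A - trc B"
  "trc (c *\<^sub>R A) = c * trc A" "trc (trp A) = trc A" "trc (- A) = - trc A"
proof -
  obtain n where n: "mat_dims n n A" "mat_dims n n B" using mat_dims_exists2 by blast
  note t = trc_gen[of n]
  show "trc 0 = 0" by (subst t) auto
  show "trc (A + B) = trc A + trc B" "trc (A - B) = trc A - trc B"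
    "trc (c *\<^sub>R A) = c * trc A" "trc (trp A) = trc A" "trc (- A) = - trc A"
    using n by (auto simp add: t[of A] t[of B] t[of "A + B"] t[of "A - B"] t[of "c *\<^sub>R A"] t[of "- A"]
        t[of "trp A"] sum.distrib sum_subtractf sum_distrib_left sum_negf)
qed

subsection \<open>Embedding of sized matrices\<close>

definition fm :: "real mat => fmat" where
  "fm A = of_fun (dim_row A) (dim_col A) (\<lambda>i j. A $$ (i, j))"

definition fv :: "real vec => fmat" where
  "fv v = of_fun (dim_vec v) 1 (\<lambda>i _. v $ i)"

lemma mat_dims_fm [simp]: "mat_dims (dim_row A) (dim_col A) (fm A)" by (simp add: fm_def)
lemma mat_dims_fv [simp]: "mat_dims (dim_vec v) 1 (fv v)" by (simp add: fv_def)

lemma mat_dims_fm_carrier: "A \<in> carrier_mat m n ==> mat_dims m n (fm A)"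
  by (auto simp: fm_def mat_dims_def)
lemma mat_dims_fv_carrier: "v \<in> carrier_vec m ==> mat_dims m 1 (fv v)"
  by (auto simp: fv_def mat_dims_def)

lemma ent_fm: "i < dim_row A ==> j < dim_col A ==> ent (fm A) i j = A $$ (i, j)" by (simp add: fm_def)
lemma ent_fv: "i < dim_vec v ==> ent (fv v) i 0 = v $ i" by (simp add: fv_def)

lemma fm_mult: "dim_col A = dim_row B ==> fm (A * B) = fm A * fm B"
  by (rule fmat_eqI, subst ent_times_left[OF mat_dims_fm])
     (auto simp: fm_def scalar_prod_def atLeast0LessThan intro!: sum.cong)

lemma fm_add: "dim_row A = dim_row B ==> dim_col A = dim_col B ==> fm (A + B) = fm A + fm B"
  by (rule fmat_eqI) (auto simp: fm_def)

lemma fm_diff: "dim_row A = dim_row B ==> dim_col A = dim_col B ==> fm (A - B) = fm A - fm B"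
  by (rule fmat_eqI) (auto simp: fm_def)

lemma fm_uminus: "fm (- A) = - fm A"
  by (rule fmat_eqI) (auto simp: fm_def)

lemma fm_smult: "fm (c \<cdot>\<^sub>m A) = c *\<^sub>R fm A"
  by (rule fmat_eqI) (auto simp: fm_def)

lemma fm_transpose: "fm (transpose_mat A) = trp (fm A)"
  by (rule fmat_eqI) (auto simp: fm_def)

lemma fm_one: "fm (1\<^sub>m n) = idm n"
  by (rule fmat_eqI) (auto simp: fm_def idm_def)

lemma fm_mult_vec: "dim_col A = dim_vec v ==> fv (A *\<^sub>v v) = fm A * fv v"
  by (rule fmat_eqI, subst ent_times_left[OF mat_dims_fm])
     (auto simp: fm_def fv_def scalar_prod_def atLeast0LessThan intro!: sum.cong)

lemma fv_diff: "dim_vec v = dim_vec w ==> fv (v - w) = fv v - fv w"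
  by (rule fmat_eqI) (auto simp: fv_def)

lemma inner_fv: "dim_vec v = dim_vec w ==> inner (fv v) (fv w) = scalar_prod v w"
  by (subst inner_fmat_left[OF mat_dims_fv]) (simp add: fv_def scalar_prod_def atLeast0LessThan)

lemma norm_fv: "norm (fv v) = vec_norm2 v"
  by (simp add: norm_eq_sqrt_inner inner_fv vec_norm2_def)

lemma trc_fm: "dim_row A = dim_col A ==> trc (fm A) = mat_tr A"
  using trc_gen[of "dim_row A" "fm A"] mat_dims_fm[of A] by (simp add: mat_tr_def ent_fm)

lemma fm_inject: "fm A = fm B ==> dim_row A = dim_row B ==> dim_col A = dim_col B ==> A = B"
  by (rule eq_matI) (auto simp: ent_fm[symmetric])

lemma fm_surj: 
  assumes "mat_dims m n A" obtains B where "B \<in> carrier_mat m n" "fm B = A"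
proof (rule that[of "mat m n (\<lambda>(i, j). ent A i j)"])
  show "fm (mat m n (\<lambda>(i, j). ent A i j)) = A"
    using assms by (intro fmat_eqI) (auto simp: fm_def mat_dims_def not_less)
qed simp

lemma fv_surj: 
  assumes "mat_dims n 1 A" obtains v where "v \<in> carrier_vec n" "fv v = A"
proof (rule that[of "vec n (\<lambda>i. ent A i 0)"])
  show "fv (vec n (\<lambda>i. ent A i 0)) = A"
    using assms by (intro fmat_eqI) (auto simp: fv_def mat_dims_def not_less)
qed simp

subsection \<open>Quadratic forms\<close>

definition unit_col :: "nat => fmat" where "unit_col j = of_fun (Suc j) 1 (\<lambda>i _. if i = j then 1 else 0)"

lemma ent_unit_col: "ent (unit_col j) i k = (if i = j \<and> k = 0 then 1 else 0)"
  by (auto simp: unit_col_def)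

lemma mat_dims_unit_col: "j < n ==> mat_dims n 1 (unit_col j)"
  by (auto simp: mat_dims_def ent_unit_col)

lemma idm_eq_sum: "idm n = (\<Sum>j<n. unit_col j * trp (unit_col j))"
proof (rule fmat_eqI)
  fix i k
  have *: "ent (unit_col j * trp (unit_col j)) i k = (if j = i then if i = k then 1 else 0 else 0)" for j
    by (subst ent_times_left[OF mat_dims_unit_col[OF lessI]]) (auto simp: ent_unit_col)
  show "ent (idm n) i k = ent (\<Sum>j<n. unit_col j * trp (unit_col j)) i k"
    by (simp add: * ent_idm)
qed

lemma inner_cols:
  assumes "mat_dims m n x"
  shows "inner x y = (\<Sum>j<n. inner (x * unit_col j) (y * unit_col j))"
proof -
  have "inner x y = inner (x * idm n) y" using assms by simp
  also have "\<dots> = (\<Sum>j<n. inner (x * unit_col j) (y * unit_col j))"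
    by (simp add: idm_eq_sum sum_distrib_left inner_sum_left mult.assoc[symmetric] inner_times_right)
  finally show ?thesis .
qed

text \<open>The whole type is infinite dimensional, so bounded closed sets are compact for a fixed
  size only. There the entries range over a product of intervals, which is compact by Tychonoff, and
  the matrix depends continuously on them.\<close>

lemma compact_fmat: "compact {A. mat_dims m n A \<and> norm A <= c}"
proof -
  define K where "K = (PiE UNIV (\<lambda>_. {-c..c}) :: (nat \<times> nat => real) set)"
  define F where "F f = (\<Sum>i<m. \<Sum>j<n. f (i, j) *\<^sub>R (unit_col i * trp (unit_col j)))" for f :: "nat \<times> nat => real"
  have "compactin (product_topology (\<lambda>_. euclidean) UNIV) K"
    unfolding K_def compactin_PiE by auto
  then have K: "compact K"
    by (simp add: euclidean_product_topology)
  have "continuous_on K F"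
    unfolding F_def
    by (intro continuous_intros continuous_on_subset[OF continuous_on_product_coordinates]) auto
  then have "compact (F ` K)" using K by (rule compact_continuous_image)
  moreover have "closed {A :: fmat. norm A <= c}"
    by (intro closed_Collect_le continuous_intros)
  ultimately have "compact (F ` K \<inter> {A. norm A <= c})" by (rule compact_Int_closed)
  also have "F ` K \<inter> {A. norm A <= c} = {A. mat_dims m n A \<and> norm A <= c}"
  proof -
    have e: "ent (unit_col i * trp (unit_col j)) a b = (if i = a \<and> j = b then 1 else 0)" for i j a b
      by (subst ent_times_left[OF mat_dims_unit_col[OF lessI]]) (auto simp: ent_unit_col)
    have "ent (F f) a b = (\<Sum>i<m. if i = a then \<Sum>j<n. if j = b then f (a, b) else 0 else 0)" for f a b
      unfolding F_def ent_sum ent_scaleR e by (intro sum.cong refl) (auto simp: mult_delta_right)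
    then have ent_F: "ent (F f) a b = (if a < m \<and> b < n then f (a, b) else 0)" for f a b
      by simp
    have "mat_dims m n (F f)" for f by (auto simp: mat_dims_def ent_F)
    moreover have "A \<in> F ` K" if "mat_dims m n A" "norm A <= c" for A
    proof (rule image_eqI)
      show "A = F (\<lambda>(i, j). ent A i j)"
        by (rule fmat_eqI) (use that in \<open>auto simp: ent_F mat_dims_def\<close>)
      show "(\<lambda>(i, j). ent A i j) \<in> K"
      proof -
        have "- c <= ent A a b \<and> ent A a b <= c" for a b
          using abs_ent_le_norm[of A a b] that(2) by linarith
        then show ?thesis by (auto simp: K_def)
      qed
    qed
    ultimately show ?thesis by auto
  qed
  finally show ?thesis .
qed

lemma idm_idm [simp]: "idm n * idm n = idm n"
  using idm_mult_left[OF mat_dims_idm] .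

definition psdm :: "fmat => bool" where
  "psdm A \<longleftrightarrow> trp A = A \<and> (\<forall>x. 0 <= inner x (A * x))"

lemma psdm_nonneg: "psdm A ==> 0 <= inner x (A * x)" by (simp add: psdm_def)
lemma psdm_sym: "psdm A ==> trp A = A" by (simp add: psdm_def)

lemma inner_sym_swap: "trp A = A ==> inner x (A * y) = inner y (A * x)"
  by (metis inner_commute inner_times_left)

text \<open>\<open>psdm\<close> quantifies over arguments of every width. The form splits over the
  columns of its argument, and the support of A cuts these columns down to height d.\<close>

lemma psdm_colI:
  assumes "trp A = A" "\<And>x. mat_dims d 1 x ==> 0 <= inner x (A * x)" "mat_dims d d A"
  shows "psdm A"
  unfolding psdm_def
proof (intro conjI allI)
  fix x
  obtain n0 where "mat_dims n0 n0 x" using mat_dims_exists by blast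
  then obtain n where n: "mat_dims n n x" "d <= n"
    by (intro that[of "max n0 d"]) (auto intro: mat_dims_mono[of n0 n0])
  have "inner x (A * x) = inner (idm d * x) (A * (idm d * x))"
  proof -
    have "idm d * (A * (idm d * x)) = A * x" using assms(3) by (metis mat_dims_alt mult.assoc)
    then show ?thesis by (simp add: inner_times_left)
  qed
  also have "\<dots> = (\<Sum>j<n. inner (idm d * x * unit_col j) (A * (idm d * x) * unit_col j))"
  proof (rule inner_cols)
    show "mat_dims n n (idm d * x)"
      using n by (intro mat_dims_mult[of _ n]) (auto intro: mat_dims_mono[OF mat_dims_idm])
  qed
  also have "\<dots> \<ge> 0"
  proof (intro sum_nonneg)
    fix j assume "j \<in> {..<n}"
    have "mat_dims d 1 (idm d * x * unit_col j)"
    proof -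
      have "idm d * (idm d * x * unit_col j) = idm d * x * unit_col j"
        by (metis idm_idm mult.assoc)
      moreover have "idm d * x * unit_col j * idm 1 = idm d * x * unit_col j"
        using mat_dims_unit_col[OF lessI, of j] by (simp add: mult.assoc)
      ultimately show ?thesis unfolding mat_dims_alt by blast
    qed
    from assms(2)[OF this] show "0 <= inner (idm d * x * unit_col j) (A * (idm d * x) * unit_col j)"
      by (simp add: mult.assoc)
  qed
  finally show "0 <= inner x (A * x)" .
qed (fact assms(1))

lemma psdm_Cauchy_Schwarz:
  assumes "psdm A"
  shows "(inner x (A * y))\<^sup>2 <= inner x (A * x) * inner y (A * y)"
proof -
  have s: "inner y (A * x) = inner x (A * y)" using assms by (intro inner_sym_swap) (simp add: psdm_def)
  let ?a = "inner x (A * x)" and ?b = "inner x (A * y)" and ?c = "inner y (A * y)"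
  have q: "0 <= ?a + 2 * t * ?b + t\<^sup>2 * ?c" for t
  proof -
    have "0 <= inner (x + t *\<^sub>R y) (A * (x + t *\<^sub>R y))" using assms by (simp add: psdm_def)
    also have "\<dots> = ?a + 2 * t * ?b + t\<^sup>2 * ?c"
      by (simp add: inner_add_left inner_add_right distrib_left s power2_eq_square algebra_simps)
    finally show ?thesis .
  qed
  have a: "0 <= ?a" and c: "0 <= ?c" using assms by (auto simp: psdm_def)
  show ?thesis
  proof (cases "?c = 0")
    case True
    have "?b = 0"
    proof (rule ccontr)
      assume "?b \<noteq> 0"
      \<comment> \<open>With ?c = 0 the polynomial is affine in t, and this t gives it the value
        -1.\<close>
      with q[of "- (?a + 1) / (2 * ?b)"] True show False by (simp add: field_simps)
    qed
    then show ?thesis using a c by simp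
  next
    case False
    then have "0 < ?c" using c by simp
    with q[of "- ?b / ?c"] have "0 <= ?a - ?b\<^sup>2 / ?c" by (simp add: power2_eq_square field_simps)
    then show ?thesis using \<open>0 < ?c\<close> by (simp add: field_simps)
  qed
qed

lemma psdm_eq_0: 
  assumes "psdm A" "inner x (A * x) = 0" shows "A * x = 0"
proof -
  have "(inner x (A * (A * x)))\<^sup>2 <= 0"
    using psdm_Cauchy_Schwarz[OF assms(1), of x "A * x"] assms(2) by simp
  then have "inner x (A * (A * x)) = 0" by simp
  then have "inner (A * x) (A * x) = 0"
    using inner_times_left[of A x "A * x"] assms(1) by (simp add: psdm_def)
  then show ?thesis by simp
qed

lemma psdm_gram: "psdm (A * trp A)"
  by (auto simp: psdm_def trp_mult mult.assoc) (metis inner_ge_zero inner_times_left trp_simps(1))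

lemma psdm_gram': "psdm (trp A * A)"
  using psdm_gram[of "trp A"] by simp

lemma psdm_add: "psdm A ==> psdm B ==> psdm (A + B)"
  by (simp add: psdm_def distrib_right inner_add_right)

lemma psdm_scaleR: "psdm A ==> 0 <= c ==> psdm (c *\<^sub>R A)"
  by (simp add: psdm_def)

lemma psdm_sum: "(\<And>i. i \<in> S ==> psdm (A i)) ==> psdm (sum A S)"
  by (simp add: psdm_def sum_distrib_right inner_sum_right sum_nonneg)

lemma psdm_conj: 
  assumes "psdm A" shows "psdm (trp B * A * B)"
  unfolding psdm_def
proof (intro conjI allI)
  show "trp (trp B * A * B) = trp B * A * B" using assms by (simp add: psdm_def trp_mult mult.assoc)
  fix x
  have "inner x (trp B * A * B * x) = inner (B * x) (A * (B * x))"
    by (simp add: mult.assoc inner_times_left)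
  then show "0 <= inner x (trp B * A * B * x)" using assms by (simp add: psdm_def)
qed

text \<open>A row times a column is again a matrix, so scalars produced by products appear as
  multiples of \<open>idm 1\<close>.\<close>

lemma col_gram:
  assumes "mat_dims d 1 v" "mat_dims d 1 w" shows "trp v * w = inner v w *\<^sub>R idm 1"
proof (rule fmat_eqI)
  have v': "mat_dims 1 d (trp v)" using assms by simp
  fix i j
  show "ent (trp v * w) i j = ent (inner v w *\<^sub>R idm 1) i j"
    using assms
    by (cases "i = 0 \<and> j = 0") (auto simp: ent_times_left[OF v'] inner_fmat_left[OF assms(1)] ent_idm mat_dims_def)
qed

text \<open>Take a minimizer v of the form on the unit sphere of the range of E. Nothing is
  differentiated: E A E - \<mu> E is positive semidefinite and its form vanishes at v, so it
  annihilates v. Since A commutes with E, this says that v is an eigenvector of A.\<close>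

lemma rayleigh_min:
  assumes E: "trp E = E" "E * E = E" "E \<noteq> 0" "mat_dims d d E"
    and A: "trp A = A" "A * E = E * A"
  obtains v \<mu> where "mat_dims d 1 v" "E * v = v" "norm v = 1" "A * v = \<mu> *\<^sub>R v"
    "\<And>x. mat_dims d 1 x ==> E * x = x ==> \<mu> * (norm x)\<^sup>2 <= inner x (A * x)"
proof -
  define S where "S = {v. mat_dims d 1 v \<and> norm v <= 1} \<inter> {v. E * v = v \<and> norm v = 1}"
  have "closed {v. E * v = v \<and> norm v = 1}"
    by (intro closed_Collect_conj closed_Collect_eq continuous_intros)
  then have "compact S" unfolding S_def by (intro compact_Int_closed compact_fmat)
  have S_I: "(1 / norm x) *\<^sub>R x \<in> S" if "mat_dims d 1 x" "E * x = x" "x \<noteq> 0" for x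
    using that by (auto simp: S_def)
  \<comment> \<open>A nonzero column of E provides a point of the sphere.\<close>
  obtain i j where ij: "ent E i j \<noteq> 0" using E(3) by (metis ent_simps(1) fmat_eqI)
  then have "i < d" "j < d" using E(4) by (auto simp: mat_dims_def not_less[symmetric])
  have "ent (E * unit_col j) i 0 = ent E i j"
    using \<open>j < d\<close> by (simp add: ent_times_left[OF E(4)] ent_unit_col mult_delta_right)
  then have "E * unit_col j \<noteq> 0" using ij by auto
  moreover have "mat_dims d 1 (E * unit_col j)"
    using E(4) mat_dims_unit_col[OF \<open>j < d\<close>] by (rule mat_dims_mult)
  ultimately have "S \<noteq> {}"
    using S_I[of "E * unit_col j"] E(2) by (auto simp: mult.assoc[symmetric])
  moreover have "continuous_on S (\<lambda>v. inner v (A * v))" by (intro continuous_intros)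
  ultimately obtain v where v: "v \<in> S" "\<And>x. x \<in> S ==> inner v (A * v) <= inner x (A * x)"
    using continuous_attains_inf[OF \<open>compact S\<close>] by blast
  define \<mu> where "\<mu> = inner v (A * v)"
  have min: "\<mu> * (norm x)\<^sup>2 <= inner x (A * x)" if "mat_dims d 1 x" "E * x = x" for x
  proof (cases "x = 0")
    case False
    from v(2)[OF S_I[OF that False]] False show ?thesis
      by (simp add: \<mu>_def power2_eq_square field_simps)
  qed simp
  have v': "mat_dims d 1 v" "E * v = v" "norm v = 1" using v(1) by (auto simp: S_def)
  define B where "B = E * A * E - \<mu> *\<^sub>R E"
  have dEAE: "mat_dims d d (E * (A * E))"
    unfolding mat_dims_alt by (metis E(4) mat_dims_alt mult.assoc)
  have "psdm B"
  proof (rule psdm_colI)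
    show "trp B = B" using E A by (simp add: B_def trp_mult mult.assoc)
    show "mat_dims d d B"
    proof -
      show ?thesis using E(4) dEAE by (simp add: B_def mult.assoc)
    qed
    fix x assume x: "mat_dims d 1 x"
    have "inner x (B * x) = inner (E * x) (A * (E * x)) - \<mu> * inner (E * x) (E * x)"
    proof -
      have "inner x (E * A * E * x) = inner (E * x) (A * (E * x))"
        using E(1) by (simp add: inner_times_left mult.assoc)
      moreover have "inner x (E * x) = inner (E * x) (E * x)"
        using E(1,2) by (metis inner_times_left mult.assoc)
      ultimately show ?thesis by (simp add: B_def left_diff_distrib inner_diff_right)
    qed
    moreover have "\<mu> * (norm (E * x))\<^sup>2 <= inner (E * x) (A * (E * x))"
      using x E by (intro min) (auto simp: mult.assoc[symmetric])
    ultimately show "0 <= inner x (B * x)" by (simp add: power2_norm_eq_inner)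
  qed
  moreover have Bv: "B * v = A * v - \<mu> *\<^sub>R v"
  proof -
    have "E * A * E * v = E * (A * v)" using v'(2) by (simp add: mult.assoc)
    also have "\<dots> = A * v" using A(2) v'(2) by (metis mult.assoc)
    finally show ?thesis using v'(2) by (simp add: B_def left_diff_distrib)
  qed
  moreover have "inner v (B * v) = 0" 
    using v'(3) by (simp add: Bv inner_diff_right power2_norm_eq_inner[symmetric]) (simp add: \<mu>_def)
  ultimately have "A * v = \<mu> *\<^sub>R v" using psdm_eq_0[of B v] by simp
  then show ?thesis using that[OF v'] min by blast
qed

text \<open>Deflation: split off one eigenvector from the range of the projector \<open>E\<close> at a time.\<close>

lemma psdm_sqrt_exists_proj:
  assumes "psdm A"
  shows "trp E = E ==> E * E = E ==> mat_dims d d E ==> A * E = E * A ==> trc E = real n ==>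
    \<exists>R. psdm R \<and> R * R = E * A \<and> E * R = R \<and> R * E = R"
proof (induction n arbitrary: E)
  case 0
  have "inner E E = trc (trp E * E)" by (simp add: trc_mult)
  then have "E = 0" using 0 by simp
  then show ?case by (intro exI[of _ 0]) (simp add: psdm_def)
next
  case (Suc n)
  then have "E \<noteq> 0" by auto
  obtain v \<mu> where v: "mat_dims d 1 v" "E * v = v" "norm v = 1" "A * v = \<mu> *\<^sub>R v"
    using rayleigh_min[OF Suc.prems(1,2) \<open>E \<noteq> 0\<close> Suc.prems(3) psdm_sym[OF assms] Suc.prems(4)] by metis
  define F where "F = v * trp v"
  have vv: "trp v * v = idm 1"
    using col_gram[OF v(1,1)] v(3) by (simp add: power2_norm_eq_inner[symmetric])
  have vE: "trp v * E = trp v" using v(2) Suc.prems(1) by (metis trp_mult)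
  have vA: "trp v * A = \<mu> *\<^sub>R trp v" using v(4) psdm_sym[OF assms] by (metis trp_mult trp_simps(6))
  have Fv: "F * v = v" using vv v(1) by (simp add: F_def mult.assoc)
  have FF: "F * F = F" using Fv by (simp add: F_def mult.assoc[symmetric])
  have EF: "E * F = F" "F * E = F" using v(2) vE by (simp_all add: F_def mult.assoc[symmetric]) (simp add: mult.assoc vE)
  have AF: "A * F = \<mu> *\<^sub>R F" "F * A = \<mu> *\<^sub>R F"
    using v(4) vA by (simp_all add: F_def mult.assoc[symmetric]) (simp add: mult.assoc vA)
  have tF: "trp F = F" by (simp add: F_def trp_mult)
  have "trc F = 1"
  proof -
    have "trc F = trc (trp v * v)" unfolding F_def by (rule trc_commute)
    then show ?thesis using vv trc_gen[OF mat_dims_idm, of 1] by (simp add: ent_idm)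
  qed
  have dF: "mat_dims d d F" using v(1) unfolding F_def by (intro mat_dims_mult[of _ 1]) auto
  have "\<exists>R. psdm R \<and> R * R = (E - F) * A \<and> (E - F) * R = R \<and> R * (E - F) = R"
    by (rule Suc.IH)
       (use Suc.prems dF in \<open>auto simp: tF FF EF AF left_diff_distrib right_diff_distrib \<open>trc F = 1\<close>\<close>)
  then obtain R where R: "psdm R" "R * R = (E - F) * A" "(E - F) * R = R" "R * (E - F) = R" by blast
  have RF: "R * F = 0" "F * R = 0"
  proof -
    have "R * F = R * (E - F) * F" by (simp add: R)
    also have "\<dots> = 0" by (simp add: mult.assoc left_diff_distrib EF FF)
    finally show "R * F = 0" .
    then show "F * R = 0" by (metis R(1) psdm_sym tF trp_mult trp_simps(2))
  qed
  have ER: "E * R = R" "R * E = R"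
    using R(3,4) RF by (simp_all add: left_diff_distrib right_diff_distrib)
  have \<mu>: "0 <= \<mu>"
    using psdm_nonneg[OF assms, of v] v(3,4) by (simp add: power2_norm_eq_inner[symmetric])
  show ?case
  proof (intro exI conjI)
    show "psdm (R + sqrt \<mu> *\<^sub>R F)"
      using R(1) psdm_gram[of v] \<mu> by (intro psdm_add psdm_scaleR) (auto simp: F_def)
    show "(R + sqrt \<mu> *\<^sub>R F) * (R + sqrt \<mu> *\<^sub>R F) = E * A"
      using \<mu> by (simp add: distrib_left distrib_right RF FF R(2) left_diff_distrib AF)
    show "E * (R + sqrt \<mu> *\<^sub>R F) = R + sqrt \<mu> *\<^sub>R F" by (simp add: distrib_left EF ER)
    show "(R + sqrt \<mu> *\<^sub>R F) * E = R + sqrt \<mu> *\<^sub>R F" by (simp add: distrib_right EF ER)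
  qed
qed

lemma psdm_sqrt_exists:
  assumes "psdm A" "mat_dims d d A"
  obtains R where "psdm R" "mat_dims d d R" "R * R = A"
proof -
  have "\<exists>R. psdm R \<and> R * R = idm d * A \<and> idm d * R = R \<and> R * idm d = R"
    by (rule psdm_sqrt_exists_proj[OF assms(1), of _ d d]) 
       (use assms(2) in \<open>auto simp: trc_gen[OF mat_dims_idm] ent_idm\<close>)
  then show ?thesis using that assms(2) unfolding mat_dims_alt by metis
qed

text \<open>With D = R - S the equation becomes R D + D S = 0. Paired with D it is a sum of two
  nonnegative forms, so both vanish, R D = S D = 0 and D D = 0. This is what gives the description
  by \<open>THE\<close> in \<open>mat_sqrt\<close> a value.\<close>

lemma psdm_sqrt_unique:
  assumes R: "psdm R" and S: "psdm S" and eq: "R * R = S * S"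
  shows "R = S"
proof -
  define D where "D = R - S"
  have tD: "trp D = D" using R S by (simp add: D_def psdm_def)
  have "R * D + D * S = 0" using eq by (simp add: D_def algebra_simps)
  then have "inner D (R * D) + inner D (D * S) = 0" by (metis inner_add_right inner_zero_right)
  moreover have "inner D (D * S) = inner D (S * D)"
    using inner_trp[of D "D * S"] tD psdm_sym[OF S] by (simp add: trp_mult)
  ultimately have "inner D (R * D) = 0" "inner D (S * D) = 0"
    using psdm_nonneg[OF R, of D] psdm_nonneg[OF S, of D] by linarith+
  then have "R * D = 0" "S * D = 0" using psdm_eq_0 R S by blast+
  then have "D * D = 0" by (simp add: D_def left_diff_distrib)
  then have "inner D D = 0" using trc_mult[of "trp D" D] tD by simp
  then show ?thesis by (simp add: D_def)
qed

subsection \<open>Inverses, spectrum and square roots of sized matrices\<close>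

lemma fv_eq_0: "v \<in> carrier_vec n ==> fv v = 0 \<longleftrightarrow> v = 0\<^sub>v n"
proof
  assume "v \<in> carrier_vec n" "fv v = 0"
  then have "v $ i = 0" if "i < n" for i using ent_fv[of i v] that by auto
  with \<open>v \<in> carrier_vec n\<close> show "v = 0\<^sub>v n" by (intro eq_vecI) auto
qed (auto intro!: fmat_eqI simp: fv_def)

text \<open>Nonsingularity arises later from positive definiteness, that is, as injectivity on
  columns. In these terms the unspecified value of \<open>mat_inv\<close> is excluded.\<close>

lemma mat_inv_left_right:
  assumes A: "A \<in> carrier_mat n n" and inj: "\<And>v. mat_dims n 1 v ==> fm A * v = 0 ==> v = 0"
  shows "mat_inv A \<in> carrier_mat n n" "A * mat_inv A = 1\<^sub>m n" "mat_inv A * A = 1\<^sub>m n" "invertible_mat A"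
    "Determinant.det A \<noteq> 0"
proof -
  show d: "Determinant.det A \<noteq> 0"
  proof
    assume "Determinant.det A = 0"
    then obtain v where v: "v \<in> carrier_vec n" "v \<noteq> 0\<^sub>v n" "A *\<^sub>v v = 0\<^sub>v n"
      using det_0_iff_vec_prod_zero_field[OF A] by blast
    have "fm A * fv v = fv (A *\<^sub>v v)" using A v(1) by (subst fm_mult_vec) auto
    also have "\<dots> = 0" using v(3) fv_eq_0[of "0\<^sub>v n" n] by simp
    finally have "fv v = 0" using inj mat_dims_fv_carrier[OF v(1)] by blast
    then show False using v fv_eq_0 by blast
  qed
  have "A \<in> Units (ring_mat TYPE(real) n ())" by (rule det_non_zero_imp_unit[OF A d])
  then obtain B where B: "mat_inverse A = Some B" using mat_inverse(1)[OF A] by fastforce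
  from mat_inverse(2)[OF A this] show "mat_inv A \<in> carrier_mat n n" "A * mat_inv A = 1\<^sub>m n" "mat_inv A * A = 1\<^sub>m n"
    by (auto simp: mat_inv_def B)
  then show "invertible_mat A" using A by (auto simp: invertible_mat_def inverts_mat_def)
qed

lemma fm_mat_inv:
  assumes A: "A \<in> carrier_mat n n" and inj: "\<And>v. mat_dims n 1 v ==> fm A * v = 0 ==> v = 0"
  shows "fm A * fm (mat_inv A) = idm n" "fm (mat_inv A) * fm A = idm n" "mat_dims n n (fm (mat_inv A))"
proof -
  note * = mat_inv_left_right[OF assms]
  show "fm A * fm (mat_inv A) = idm n" "fm (mat_inv A) * fm A = idm n"
    using A *(1,2,3) by (simp_all add: fm_mult[symmetric] fm_one[symmetric])
  show "mat_dims n n (fm (mat_inv A))" using *(1) by (rule mat_dims_fm_carrier)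
qed

lemma invertible_inj:
  assumes A: "A \<in> carrier_mat n n" and "invertible_mat A" "mat_dims n k v" "fm A * v = 0"
  shows "v = 0"
proof -
  obtain B where B: "A * B = 1\<^sub>m n" "B * A = 1\<^sub>m (dim_row B)"
    using assms(1,2) by (auto simp: invertible_mat_def inverts_mat_def)
  have "dim_row B = n" using B A by (metis carrier_matD(2) index_mult_mat(3) index_one_mat(3))
  then have "fm (B * A) = idm n" using B by (simp add: fm_one)
  moreover have "dim_col B = dim_row A" using B(1) A \<open>dim_row B = n\<close> by (metis carrier_matD(1) index_mult_mat(3) index_one_mat(3))
  ultimately have "idm n = fm B * fm A" by (simp add: fm_mult)
  then have "v = fm B * fm A * v" using assms(3) by (metis idm_mult_left)
  then show ?thesis using assms(4) by (simp add: mult.assoc)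
qed

lemma idm_eq_0_iff: "idm n = 0 \<longleftrightarrow> n = 0"
proof
  assume "idm n = 0"
  then have "ent (idm n) 0 0 = 0" by simp
  then show "n = 0" by (simp add: ent_idm split: if_splits)
qed (auto intro!: fmat_eqI simp: ent_idm)

lemma spectrumI:
  assumes A: "A \<in> carrier_mat d d" and v: "mat_dims d 1 v" "norm v = 1" "fm A * v = \<mu> *\<^sub>R v"
  shows "\<mu> \<in> spectrum A"
proof -
  obtain w where w: "w \<in> carrier_vec d" "fv w = v" using fv_surj[OF v(1)] by blast
  have "A *\<^sub>v w = \<mu> \<cdot>\<^sub>v w"
  proof (rule eq_vecI)
    fix i assume i: "i < dim_vec (\<mu> \<cdot>\<^sub>v w)"
    have "fv (A *\<^sub>v w) = \<mu> *\<^sub>R fv w" using A w v(3) by (simp add: fm_mult_vec)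
    then have "ent (fv (A *\<^sub>v w)) i 0 = \<mu> * ent (fv w) i 0" by simp
    then show "(A *\<^sub>v w) $ i = (\<mu> \<cdot>\<^sub>v w) $ i" using i A w(1) by (simp add: ent_fv)
  qed (use A w in auto)
  moreover have "w \<noteq> 0\<^sub>v d" using w v(2) fv_eq_0[OF w(1)] by auto
  ultimately show ?thesis using A w(1) by (auto simp: spectrum_def eigenvalue_def eigenvector_def)
qed

text \<open>The minimum of the form over the unit sphere is an eigenvalue, hence not below the least
  element of the finite spectrum. For d = 0 the spectrum is empty, and the claim holds because x =
  0.\<close>

lemma lambda_min_le:
  assumes A: "A \<in> carrier_mat d d" "trp (fm A) = fm A" and x: "mat_dims d 1 x"
  shows "lambda_min A * (norm x)\<^sup>2 <= inner x (fm A * x)"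
proof (cases "d = 0")
  case True
  then have "x = 0" using x by (auto intro!: fmat_eqI simp: mat_dims_def)
  then show ?thesis by simp
next
  case False
  then have "idm d \<noteq> 0" by (simp add: idm_eq_0_iff)
  have dA: "mat_dims d d (fm A)" using A(1) by (rule mat_dims_fm_carrier)
  then have c: "fm A * idm d = idm d * fm A" by simp
  obtain v \<mu> where v: "mat_dims d 1 v" "norm v = 1" "fm A * v = \<mu> *\<^sub>R v"
    "\<And>x. mat_dims d 1 x ==> idm d * x = x ==> \<mu> * (norm x)\<^sup>2 <= inner x (fm A * x)"
    using rayleigh_min[OF trp_idm _ \<open>idm d \<noteq> 0\<close> mat_dims_idm A(2) c] by (metis idm_mult_left mat_dims_idm)
  have "lambda_min A <= \<mu>"
    unfolding lambda_min_def using spectrumI[OF A(1) v(1-3)] card_finite_spectrum(1)[OF A(1)] by simp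
  then have "lambda_min A * (norm x)\<^sup>2 <= \<mu> * (norm x)\<^sup>2" by (intro mult_right_mono) auto
  also have "\<dots> <= inner x (fm A * x)" using x by (intro v(4)) auto
  finally show ?thesis .
qed

lemma le_lambda_max:
  assumes A: "A \<in> carrier_mat d d" "trp (fm A) = fm A" and x: "mat_dims d 1 x"
  shows "inner x (fm A * x) <= lambda_max A * (norm x)\<^sup>2"
proof (cases "d = 0")
  case True
  then have "x = 0" using x by (auto intro!: fmat_eqI simp: mat_dims_def)
  then show ?thesis by simp
next
  case False
  then have "idm d \<noteq> 0" by (simp add: idm_eq_0_iff)
  have dA: "mat_dims d d (fm A)" using A(1) by (rule mat_dims_fm_carrier)
  then have c: "(- fm A) * idm d = idm d * (- fm A)" by simp
  have s: "trp (- fm A) = - fm A" using A(2) by simp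
  obtain v \<mu> where v: "mat_dims d 1 v" "norm v = 1" "- fm A * v = \<mu> *\<^sub>R v"
    "\<And>x. mat_dims d 1 x ==> idm d * x = x ==> \<mu> * (norm x)\<^sup>2 <= inner x (- fm A * x)"
    using rayleigh_min[OF trp_idm _ \<open>idm d \<noteq> 0\<close> mat_dims_idm s c] by (metis idm_mult_left mat_dims_idm)
  have "fm A * v = (- \<mu>) *\<^sub>R v" using v(3) by (metis minus_equation_iff minus_mult_left scaleR_minus_left)
  from spectrumI[OF A(1) v(1,2) this] have "- \<mu> <= lambda_max A"
    unfolding lambda_max_def using card_finite_spectrum(1)[OF A(1)] by simp
  then have "- \<mu> * (norm x)\<^sup>2 <= lambda_max A * (norm x)\<^sup>2" by (intro mult_right_mono) auto
  moreover have "\<mu> * (norm x)\<^sup>2 <= inner x (- fm A * x)" using x by (intro v(4)) auto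
  ultimately show ?thesis by simp
qed

lemma norm_mult_le_mat_norm2:
  assumes A: "A \<in> carrier_mat d e" and x: "mat_dims e 1 x" and C: "mat_norm2 A <= C"
  shows "norm (fm A * x) <= C * norm x"
proof (cases "x = 0")
  case False
  have fm_AA: "fm (transpose_mat A * A) = trp (fm A) * fm A" using A by (simp add: fm_mult fm_transpose)
  have le: "(norm (fm A * x))\<^sup>2 <= lambda_max (transpose_mat A * A) * (norm x)\<^sup>2"
    using le_lambda_max[of "transpose_mat A * A" e x] A x
    by (simp add: fm_AA trp_mult power2_norm_eq_inner inner_times_left mult.assoc)
  moreover have "0 <= (norm (fm A * x))\<^sup>2" "0 < (norm x)\<^sup>2" using False by auto
  ultimately have "0 <= lambda_max (transpose_mat A * A)"
    by (metis linorder_not_le mult_neg_pos order_le_less_trans)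
  then have "norm (fm A * x) <= mat_norm2 A * norm x"
    unfolding mat_norm2_def using real_sqrt_le_mono[OF le] by (simp add: real_sqrt_mult)
  also have "\<dots> <= C * norm x" using C by (intro mult_right_mono) auto
  finally show ?thesis .
qed simp

lemma psd_mat_iff: "A \<in> carrier_mat d d ==> psd_mat A \<longleftrightarrow> psdm (fm A)"
proof
  assume A: "A \<in> carrier_mat d d" and p: "psdm (fm A)"
  have "fm (transpose_mat A) = fm A" using p by (simp add: fm_transpose psdm_def)
  then have "transpose_mat A = A" using A by (intro fm_inject) auto
  moreover have "0 <= scalar_prod v (A *\<^sub>v v)" if "v \<in> carrier_vec d" for v
    using psdm_nonneg[OF p, of "fv v"] that A by (simp add: fm_mult_vec[symmetric] inner_fv)
  ultimately show "psd_mat A" using A by (auto simp: psd_mat_def)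
next
  assume A: "A \<in> carrier_mat d d" and p: "psd_mat A"
  show "psdm (fm A)"
  proof (rule psdm_colI)
    show "trp (fm A) = fm A" using p by (simp add: psd_mat_def fm_transpose[symmetric])
    show "mat_dims d d (fm A)" using A by (rule mat_dims_fm_carrier)
    fix x assume "mat_dims d 1 x"
    then obtain v where v: "v \<in> carrier_vec d" "fv v = x" using fv_surj by blast
    then show "0 <= inner x (fm A * x)"
      using p A by (auto simp: psd_mat_def fm_mult_vec[symmetric] inner_fv)
  qed
qed

lemma mat_sqrt:
  assumes A: "A \<in> carrier_mat d d" and p: "psdm (fm A)"
  shows "mat_sqrt A \<in> carrier_mat d d" "psdm (fm (mat_sqrt A))" "fm (mat_sqrt A) * fm (mat_sqrt A) = fm A"
proof -
  obtain R where R: "psdm R" "mat_dims d d R" "R * R = fm A"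
    using psdm_sqrt_exists[OF p mat_dims_fm_carrier[OF A]] by blast
  obtain B where B: "B \<in> carrier_mat d d" "fm B = R" using fm_surj[OF R(2)] by blast
  have "mat_sqrt A = B"
    unfolding mat_sqrt_def
  proof (rule the_equality)
    show "psd_mat B \<and> B * B = A"
      using psd_mat_iff[OF B(1)] B R A by (auto intro!: fm_inject simp: fm_mult)
    fix C assume C: "psd_mat C \<and> C * C = A"
    then have "dim_row C = d" "dim_col C = dim_row C"
      using A by (auto simp: psd_mat_def)
    then have Cd: "C \<in> carrier_mat d d" by auto
    then have "fm C * fm C = R * R" using C R by (simp add: fm_mult[symmetric])
    then have "fm C = fm B" using psdm_sqrt_unique C psd_mat_iff[OF Cd] R(1) B(2) by blast
    then show "C = B" using Cd B(1) by (intro fm_inject) auto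
  qed
  then show "mat_sqrt A \<in> carrier_mat d d" "psdm (fm (mat_sqrt A))" "fm (mat_sqrt A) * fm (mat_sqrt A) = fm A"
    using B R by auto
qed

lemma fm_zero: "fm (0\<^sub>m a b) = 0"
  by (rule fmat_eqI) (auto simp: fm_def)

text \<open>A maximal independent set of columns has as many elements as there are columns, so the
  columns are distinct. Only then does independence of the set of columns exclude a nontrivial
  relation between them.\<close>

lemma full_rank_inj:
  fixes A :: "real mat"
  assumes A: "A \<in> carrier_mat n nc" and r: "vec_space.rank n A = nc"
    and v: "mat_dims nc 1 v" "fm A * v = 0"
  shows "v = 0"
proof (rule ccontr)
  interpret vec_space "TYPE(real)" n .
  assume "v \<noteq> 0"
  obtain w where w: "w \<in> carrier_vec nc" "fv w = v" using fv_surj[OF v(1)] by blast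
  have "w \<noteq> 0\<^sub>v nc" using \<open>v \<noteq> 0\<close> w fv_eq_0 by blast
  have "fv (A *\<^sub>v w) = 0" using A w v(2) by (subst fm_mult_vec) auto
  then have "A *\<^sub>v w = 0\<^sub>v n" using fv_eq_0[OF mult_mat_vec_carrier[OF A w(1)]] by blast
  obtain S where S: "maximal S (\<lambda>T. T \<subseteq> set (cols A) \<and> lin_indpt T)"
    using maximal_exists[of "(\<lambda>T. T \<subseteq> set (cols A) \<and> lin_indpt T)" "card (set (cols A))" "{}"]
    by (meson List.finite_set card_mono empty_iff empty_subsetI finite_lin_indpt2 rev_finite_subset)
  then have "rank A = card S" using rank_card_indpt[OF A] by blast
  also have "card S <= card (set (cols A))" using S by (simp add: card_mono maximal_def)
  finally have "length (cols A) <= card (set (cols A))" using r A by simp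
  then have dist: "distinct (cols A)" by (metis card_distinct card_length le_antisym)
  show False
    using lin_depI[OF A w(1) \<open>w \<noteq> 0\<^sub>v nc\<close> \<open>A *\<^sub>v w = 0\<^sub>v n\<close> dist] full_rank_lin_indpt[OF A r dist] by blast
qed

lemma inj_inverse_exists:
  assumes A: "mat_dims n n A" and inj: "\<And>v. mat_dims n 1 v ==> A * v = 0 ==> v = 0"
  obtains B where "mat_dims n n B" "A * B = idm n" "B * A = idm n"
proof -
  obtain C where C: "C \<in> carrier_mat n n" "fm C = A" using fm_surj[OF A] by blast
  show ?thesis using fm_mat_inv[OF C(1)] inj that C(2) by blast
qed

text \<open>If n < p, the matrix padded to p rows is square and injective, hence invertible,
  although its row with index n is zero.\<close>

lemma inj_dim_le:
  assumes A: "mat_dims n p A" and inj: "\<And>v. mat_dims p 1 v ==> A * v = 0 ==> v = 0"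
  shows "p <= n"
proof (rule ccontr)
  assume "\<not> p <= n"
  then have "n < p" by simp
  then have dA: "mat_dims p p A" using A by (auto simp: mat_dims_def)
  obtain B where B: "A * B = idm p" using inj_inverse_exists[OF dA inj] by blast
  have "ent (A * B) n n = 0" using A by (auto simp: ent_times_left[OF A] mat_dims_def)
  then show False using B \<open>n < p\<close> by (simp add: ent_idm)
qed

text \<open>Leibniz expansion: a permutation other than the identity moves at least two points, so
  at h = 0 each of its products still contains a zero factor after one factor has been
  differentiated.\<close>

lemma det_one_deriv:
  fixes F :: "real mat"
  assumes F: "F \<in> carrier_mat q q"
  shows "((\<lambda>h. Determinant.det (1\<^sub>m q + h \<cdot>\<^sub>m F)) has_real_derivative mat_tr F) (at 0)"
proof -
  define G where "G = (\<lambda>p i (h::real). (if i = p i then 1 else 0) + h * F $$ (i, p i))"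
  have d: "Determinant.det (1\<^sub>m q + h \<cdot>\<^sub>m F) = (\<Sum>p | p permutes {0..<q}. signof p * (\<Prod>i = 0..<q. G p i h))" for h
  proof -
    have "(1\<^sub>m q + h \<cdot>\<^sub>m F) $$ (i, p i) = G p i h" if "p permutes {0..<q}" "i \<in> {0..<q}" for p i
      using F that permutes_in_image[OF that(1), of i] by (auto simp: G_def)
    then show ?thesis using F by (auto simp: det_def intro!: sum.cong prod.cong)
  qed
  have "((\<lambda>h. \<Sum>p | p permutes {0..<q}. signof p * (\<Prod>i = 0..<q. G p i h)) has_real_derivative
      (\<Sum>p | p permutes {0..<q}. signof p * (\<Sum>i = 0..<q. F $$ (i, p i) * (\<Prod>k\<in>{0..<q} - {i}. G p k 0)))) (at 0)"
    by (intro DERIV_sum DERIV_cmult has_field_derivative_prod) (auto simp: G_def intro!: derivative_eq_intros)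
  also have "(\<Sum>p | p permutes {0..<q}. signof p * (\<Sum>i = 0..<q. F $$ (i, p i) * (\<Prod>k\<in>{0..<q} - {i}. G p k 0)))
      = (\<Sum>p | p permutes {0..<q}. if p = id then mat_tr F else 0)"
  proof (intro sum.cong refl)
    fix p assume "p \<in> {p. p permutes {0..<q}}"
    then have p: "p permutes {0..<q}" by simp
    show "signof p * (\<Sum>i = 0..<q. F $$ (i, p i) * (\<Prod>k\<in>{0..<q} - {i}. G p k 0)) = (if p = id then mat_tr F else 0)"
    proof (cases "p = id")
      case True
      then show ?thesis using F by (simp add: G_def mat_tr_def atLeast0LessThan)
    next
      case False
      then obtain a where a: "p a \<noteq> a" by (auto simp: fun_eq_iff)
      then have a': "a \<in> {0..<q}" using p by (auto simp: permutes_def)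
      \<comment> \<open>A second moved point, for the case in which the differentiated factor is the
        one at \<open>a\<close>.\<close>
      have b: "p (p a) \<noteq> p a" using a p by (metis permutes_inj injD)
      have b': "p a \<in> {0..<q}" using a' p by (simp only: permutes_in_image)
      have "(\<Prod>k\<in>{0..<q} - {i}. G p k 0) = 0" for i
      proof (cases "i = a")
        case True
        then show ?thesis using a b b' by (intro prod_zero bexI[of _ "p a"]) (auto simp: G_def)
      next
        case False
        then show ?thesis using a a' by (intro prod_zero bexI[of _ a]) (auto simp: G_def)
      qed
      then show ?thesis using False by simp
    qed
  qed
  also have "\<dots> = mat_tr F" by (simp add: permutes_id finite_permutations)
  finally show ?thesis unfolding d .
qed

text \<open>C + h E factors as C (1 + h C^{-1} E), which reduces to \<open>det_one_deriv\<close>.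
  The logarithm needs det C > 0; the square root of C exhibits this determinant as a square.\<close>

lemma ln_det_deriv:
  fixes C E :: "real mat"
  assumes C: "C \<in> carrier_mat q q" "psdm (fm C)" and E: "E \<in> carrier_mat q q"
    and inj: "\<And>v. mat_dims q 1 v ==> fm C * v = 0 ==> v = 0"
  shows "((\<lambda>h. ln (Determinant.det (C + h \<cdot>\<^sub>m E))) has_real_derivative mat_tr (mat_inv C * E)) (at 0)"
proof -
  note iC = mat_inv_left_right[OF C(1) inj]
  define R where "R = mat_sqrt C"
  have R: "R \<in> carrier_mat q q" "R * R = C"
    using mat_sqrt[OF C] C(1) by (auto simp: R_def fm_mult[symmetric] intro!: fm_inject)
  have "Determinant.det C = Determinant.det R * Determinant.det R" using det_mult[OF R(1,1)] R(2) by simp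
  then have pos: "0 < Determinant.det C" using iC(5)
    by (metis mult_zero_left not_real_square_gt_zero)
  have eq: "Determinant.det (C + h \<cdot>\<^sub>m E) = Determinant.det C * Determinant.det (1\<^sub>m q + h \<cdot>\<^sub>m (mat_inv C * E))" for h
  proof -
    have "C * (1\<^sub>m q + h \<cdot>\<^sub>m (mat_inv C * E)) = C + h \<cdot>\<^sub>m (C * (mat_inv C * E))"
      using C(1) E iC(1) by (subst mult_add_distrib_mat[of _ q q]) (auto simp: mult_smult_distrib[of _ q q])
    also have "C * (mat_inv C * E) = E"
      using C(1) E iC(1,2) by (subst assoc_mult_mat[symmetric, of _ q q _ q _ q]) auto
    finally show ?thesis using det_mult[of C q "1\<^sub>m q + h \<cdot>\<^sub>m (mat_inv C * E)"] C(1) E iC(1) by auto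
  qed
  have 0: "Determinant.det (1\<^sub>m q + 0 \<cdot>\<^sub>m (mat_inv C * E)) = 1"
  proof -
    have "1\<^sub>m q + 0 \<cdot>\<^sub>m (mat_inv C * E) = 1\<^sub>m q" using E iC(1) by (intro eq_matI) auto
    then show ?thesis by simp
  qed
  have "((\<lambda>h. Determinant.det C * Determinant.det (1\<^sub>m q + h \<cdot>\<^sub>m (mat_inv C * E))) has_real_derivative
     Determinant.det C * mat_tr (mat_inv C * E)) (at 0)"
    by (intro DERIV_cmult det_one_deriv) (use E iC in auto)
  from DERIV_chain2[OF DERIV_ln_divide this] show ?thesis unfolding eq using pos 0 by simp
qed

section \<open>One design of fixed size: V, P and their identities\<close>

locale lmm =
  fixes D :: lmm_design
  assumes valid: "valid_design D"
begin

abbreviation "N \<equiv> nobs D"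
abbreviation "s \<equiv> nfac D"
abbreviation "p \<equiv> dim_col (fixX D)"

definition "Zf t = fm (Zmat D t)"
definition "Wf t = Zf t * trp (Zf t)"
definition "Xf = fm (fixX D)"
text \<open>The variance of a component of alpha_t in terms of \<theta>, that is \<lambda>
  \<gamma>_t; at the true parameter it is \<open>\<sigma>sq t\<close>.\<close>

definition "varc \<theta> t = \<theta> $ 0 * gam \<theta> t"
definition "Vf \<theta> = (\<Sum>t\<le>s. varc \<theta> t *\<^sub>R Wf t)"
definition "Vi \<theta> = fm (mat_inv (Vmat D \<theta>))"
definition "XVX \<theta> = trp Xf * Vi \<theta> * Xf"
definition "Ci \<theta> = fm (mat_inv (transpose_mat (fixX D) * mat_inv (Vmat D \<theta>) * fixX D))"
text \<open>The generalized least squares matrix: \<open>beta_hat\<close> is this matrix applied to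
  the response.\<close>

definition "Af \<theta> = Ci \<theta> * trp Xf * Vi \<theta>"
definition "Pf \<theta> = fm (Pmat D \<theta>)"
definition "Bf \<theta> j = fm (Bmat D \<theta> j)"

lemma Zmat_carrier: "t <= s ==> Zmat D t \<in> carrier_mat N (neff D t)"
  using valid by (auto simp: Zmat_def neff_def valid_design_def nobs_def intro!: carrier_matI)

lemma Z_dims: "t <= s ==> mat_dims N (neff D t) (Zf t)"
  unfolding Zf_def by (rule mat_dims_fm_carrier[OF Zmat_carrier])

lemma W_dims: "t <= s ==> mat_dims N N (Wf t)"
  unfolding Wf_def by (rule mat_dims_mult[of _ "neff D t"]) (auto simp: Z_dims)

lemma W_psd: "psdm (Wf t)" unfolding Wf_def by (rule psdm_gram)

lemma W_sym [simp]: "trp (Wf t) = Wf t" using W_psd by (rule psdm_sym)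

lemma W_0: "Wf 0 = idm N"
  by (simp add: Wf_def Zf_def Zmat_def fm_one)

lemma X_dims: "mat_dims N p Xf"
  unfolding Xf_def by (rule mat_dims_fm_carrier) (auto simp: nobs_def)

lemma X_inj: "mat_dims p k v ==> Xf * v = 0 ==> v = 0"
proof -
  assume v: "mat_dims p k v" "Xf * v = 0"
  have c: "v * unit_col j = 0" if "j < k" for j
  proof (rule full_rank_inj[of "fixX D" N])
    show "fixX D \<in> carrier_mat N p" by (auto simp: nobs_def)
    show "vec_space.rank N (fixX D) = p" using valid by (simp add: valid_design_def)
    show "mat_dims p 1 (v * unit_col j)" using v(1) mat_dims_unit_col[OF that] by (rule mat_dims_mult)
    show "fm (fixX D) * (v * unit_col j) = 0" using v(2) by (simp add: Xf_def mult.assoc[symmetric])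
  qed
  have "inner v v = 0" using inner_cols[OF v(1), of v] c by simp
  then show "v = 0" by simp
qed

lemma Vmat_carrier: "Vmat D \<theta> \<in> carrier_mat N N" by (simp add: Vmat_def)

lemma fm_Vmat: "fm (Vmat D \<theta>) = Vf \<theta>"
proof (rule fmat_eqI)
  fix i k
  have t: "ent (Wf t) i k = (Zmat D t * transpose_mat (Zmat D t)) $$ (i, k)" if "i < N" "k < N" "t <= s" for t
  proof -
    have "Wf t = fm (Zmat D t * transpose_mat (Zmat D t))"
      by (simp add: Wf_def Zf_def fm_mult fm_transpose)
    then show ?thesis using that Zmat_carrier[OF that(3)] by (subst ent_fm[symmetric]) auto
  qed
  show "ent (fm (Vmat D \<theta>)) i k = ent (Vf \<theta>) i k"
  proof (cases "i < N \<and> k < N")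
    case True
    have "ent (Vf \<theta>) i k = (\<Sum>t\<in>insert 0 {1..s}. varc \<theta> t * ent (Wf t) i k)"
      unfolding Vf_def ent_sum ent_scaleR by (rule sum.cong) auto
    also have "\<dots> = \<theta> $ 0 * ent (idm N) i k + (\<Sum>t\<in>{1..s}. \<theta> $ 0 * (\<theta> $ t * ent (Wf t) i k))"
      by (subst sum.insert) (auto simp: varc_def gam_def W_0 mult_ac intro!: sum.cong)
    also have "\<dots> = \<theta> $ 0 * (ent (idm N) i k + (\<Sum>t\<in>{1..s}. \<theta> $ t * (Zmat D t * transpose_mat (Zmat D t)) $$ (i, k)))"
      using True t by (simp add: distrib_left sum_distrib_left)
    finally show ?thesis using True by (simp add: Vmat_def ent_fm ent_idm)
  next
    case False
    then show ?thesis using W_dims by (auto simp: Vf_def fm_def Vmat_def mat_dims_def intro!: sum.neutral)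
  qed
qed

lemma V_dims [simp]: "mat_dims N N (Vf \<theta>)"
  using mat_dims_fm_carrier[OF Vmat_carrier] by (simp add: fm_Vmat)

lemma V_sym [simp]: "trp (Vf \<theta>) = Vf \<theta>" by (simp add: Vf_def)

lemma varc_nonneg: "\<theta> \<in> param_space s ==> t <= s ==> 0 <= varc \<theta> t"
  by (auto simp: varc_def gam_def param_space_def)

lemma varc_0: "varc \<theta> 0 = \<theta> $ 0" by (simp add: varc_def gam_def)

lemma V_psd: "\<theta> \<in> param_space s ==> psdm (Vf \<theta>)"
  unfolding Vf_def by (intro psdm_sum psdm_scaleR W_psd) (auto intro: varc_nonneg)

text \<open>The other components of V are positive semidefinite. With all variances positive this
  bounds every W_t by a multiple of V, the source of the estimates for residuals.\<close>

lemma V_ge: 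
  assumes "\<theta> \<in> param_space s" "t <= s"
  shows "varc \<theta> t * inner x (Wf t * x) <= inner x (Vf \<theta> * x)"
proof -
  have "varc \<theta> t * inner x (Wf t * x) <= (\<Sum>t\<le>s. varc \<theta> t * inner x (Wf t * x))"
    using assms by (intro member_le_sum) (auto intro!: mult_nonneg_nonneg varc_nonneg psdm_nonneg[OF W_psd])
  then show ?thesis by (simp add: Vf_def sum_distrib_right inner_sum_right)
qed

lemma V_ge_norm:
  assumes "\<theta> \<in> param_space s" "mat_dims N k x"
  shows "\<theta> $ 0 * (norm x)\<^sup>2 <= inner x (Vf \<theta> * x)"
  using V_ge[OF assms(1), of 0 x] assms(2) by (simp add: varc_0 W_0 power2_norm_eq_inner)

lemma param_pos: "\<theta> \<in> param_space s ==> 0 < \<theta> $ 0" by (simp add: param_space_def)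

lemma V_inj: 
  assumes "\<theta> \<in> param_space s" "mat_dims N k x" "Vf \<theta> * x = 0" shows "x = 0"
  using V_ge_norm[OF assms(1,2)] param_pos[OF assms(1)] assms(3)
  by (simp add: mult_le_0_iff)

context
  fixes \<theta> assumes th: "\<theta> \<in> param_space s"
begin

lemma V_Vi: "Vf \<theta> * Vi \<theta> = idm N" "Vi \<theta> * Vf \<theta> = idm N" "mat_dims N N (Vi \<theta>)"
  using fm_mat_inv[OF Vmat_carrier[of \<theta>]] V_inj[OF th] by (auto simp: fm_Vmat Vi_def)

lemma Vinv_carrier: "mat_inv (Vmat D \<theta>) \<in> carrier_mat N N"
  using mat_inv_left_right(1)[OF Vmat_carrier[of \<theta>]] V_inj[OF th] by (auto simp: fm_Vmat)

lemma Vi_sym: "trp (Vi \<theta>) = Vi \<theta>"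
proof -
  have "trp (Vi \<theta>) = trp (Vi \<theta>) * (Vf \<theta> * Vi \<theta>)" using V_Vi by simp
  also have "\<dots> = trp (Vf \<theta> * Vi \<theta>) * Vi \<theta>" by (simp add: trp_mult mult.assoc)
  finally show ?thesis using V_Vi by simp
qed

lemma Vi_form: 
  "inner x (Vi \<theta> * y) = inner (Vi \<theta> * x) (Vf \<theta> * (Vi \<theta> * y))"
proof -
  have "Vi \<theta> * y = Vi \<theta> * (Vf \<theta> * (Vi \<theta> * y))"
    using V_Vi by (metis idm_mult_right mult.assoc)
  then show ?thesis using Vi_sym by (metis inner_times_left)
qed

lemma Vi_psd: "psdm (Vi \<theta>)"
  using Vi_form Vi_sym psdm_nonneg[OF V_psd[OF th]] by (simp add: psdm_def)

lemma fm_XVX: "fm (transpose_mat (fixX D) * mat_inv (Vmat D \<theta>) * fixX D) = XVX \<theta>"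
  using Vinv_carrier by (simp add: XVX_def Xf_def Vi_def fm_mult fm_transpose nobs_def)

lemma XVX_carrier: "transpose_mat (fixX D) * mat_inv (Vmat D \<theta>) * fixX D \<in> carrier_mat p p"
  by auto

lemma XVX_sym: "trp (XVX \<theta>) = XVX \<theta>" by (simp add: XVX_def trp_mult Vi_sym mult.assoc)

lemma XVX_inj: assumes "mat_dims p k x" "XVX \<theta> * x = 0" shows "x = 0"
proof -
  have "inner (Xf * x) (Vi \<theta> * (Xf * x)) = inner x (XVX \<theta> * x)"
    by (simp add: XVX_def inner_times_left mult.assoc)
  then have "Vi \<theta> * (Xf * x) = 0" using assms(2) by (intro psdm_eq_0[OF Vi_psd]) simp
  then have "Vf \<theta> * (Vi \<theta> * (Xf * x)) = 0" by simp
  then have "Xf * x = 0" using V_Vi(1) X_dims by (metis idm_mult_left mult.assoc)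
  then show ?thesis using X_inj assms(1) by blast
qed

lemma Ci: "XVX \<theta> * Ci \<theta> = idm p" "Ci \<theta> * XVX \<theta> = idm p" "mat_dims p p (Ci \<theta>)"
  using fm_mat_inv[OF XVX_carrier] XVX_inj by (auto simp: fm_XVX Ci_def)

lemma Cinv_carrier: "mat_inv (transpose_mat (fixX D) * mat_inv (Vmat D \<theta>) * fixX D) \<in> carrier_mat p p"
  using mat_inv_left_right(1)[OF XVX_carrier] XVX_inj by (auto simp: fm_XVX)

lemma Ci_sym: "trp (Ci \<theta>) = Ci \<theta>"
proof -
  have "trp (Ci \<theta>) = trp (Ci \<theta>) * (XVX \<theta> * Ci \<theta>)" using Ci by simp
  also have "\<dots> = trp (XVX \<theta> * Ci \<theta>) * Ci \<theta>" by (simp add: trp_mult XVX_sym mult.assoc)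
  finally show ?thesis using Ci by simp
qed

lemma Pmat_carrier: "Pmat D \<theta> \<in> carrier_mat N N"
  using Vinv_carrier by (auto simp: Pmat_def Let_def)

lemma Pf_eq: "Pf \<theta> = Vi \<theta> - Vi \<theta> * Xf * Af \<theta>"
  using Vinv_carrier Cinv_carrier
  by (simp add: Pf_def Pmat_def Let_def Vi_def Xf_def Af_def Ci_def fm_diff fm_mult fm_transpose nobs_def mult.assoc)

lemma P_dims: "mat_dims N N (Pf \<theta>)"
  unfolding Pf_def by (rule mat_dims_fm_carrier[OF Pmat_carrier])

lemma A_dims: "mat_dims p N (Af \<theta>)"
  unfolding Af_def by (intro mat_dims_mult[of p N _ N] mat_dims_mult[of p p _ N]) (auto simp: Ci V_Vi X_dims)

lemma A_X: "Af \<theta> * Xf = idm p"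
  using Ci(2) by (simp add: Af_def XVX_def mult.assoc)

lemma P_sym: "trp (Pf \<theta>) = Pf \<theta>"
  by (simp add: Pf_eq Af_def trp_mult Vi_sym Ci_sym mult.assoc)

lemma V_P: "Vf \<theta> * Pf \<theta> = idm N - Xf * Af \<theta>"
proof -
  have "Vf \<theta> * (Vi \<theta> * Xf * Af \<theta>) = Xf * Af \<theta>"
    using V_Vi X_dims by (metis idm_mult_left mult.assoc)
  then show ?thesis by (simp add: Pf_eq right_diff_distrib V_Vi)
qed

lemma P_V: "Pf \<theta> * Vf \<theta> = idm N - trp (Af \<theta>) * trp Xf"
  using arg_cong[OF V_P, of trp] by (simp add: trp_mult P_sym)

lemma P_X: "Pf \<theta> * Xf = 0"
  using X_dims A_X V_Vi by (simp add: Pf_eq left_diff_distrib mult.assoc)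

lemma X_P: "trp Xf * Pf \<theta> = 0"
  using arg_cong[OF P_X, of trp] by (simp add: trp_mult P_sym)

lemma P_V_P: "Pf \<theta> * Vf \<theta> * Pf \<theta> = Pf \<theta>"
  using X_P P_dims by (simp add: P_V left_diff_distrib mult.assoc)

lemma P_form: "inner x (Pf \<theta> * y) = inner (Pf \<theta> * x) (Vf \<theta> * (Pf \<theta> * y))"
  by (metis P_V_P P_sym inner_times_left mult.assoc)

text \<open>By \<open>P_form\<close> the form of P at x is the form of V at P x, which is at least
  \<lambda> |P x|^2. The bound involves \<lambda> only and is therefore uniform near
  \<theta>.\<close>

lemma norm_P_mult: "\<theta> $ 0 * norm (Pf \<theta> * x) <= norm x"
proof -
  obtain n where "mat_dims n n x" using mat_dims_exists by blast
  then have "mat_dims (max n N) (max n N) (Pf \<theta> * x)"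
    using P_dims by (intro mat_dims_mult[of _ "max n N"]) (auto elim!: mat_dims_mono)
  moreover have "idm N * (Pf \<theta> * x) = Pf \<theta> * x" using P_dims by (metis idm_mult_left mult.assoc)
  ultimately have dx: "mat_dims N (max n N) (Pf \<theta> * x)"
    unfolding idm_mult_left_iff by (auto simp: mat_dims_def)
  have "\<theta> $ 0 * (norm (Pf \<theta> * x))\<^sup>2 <= inner x (Pf \<theta> * x)"
    using V_ge_norm[OF th dx] P_form[of x x] by simp
  also have "\<dots> <= norm x * norm (Pf \<theta> * x)" by (rule norm_cauchy_schwarz)
  finally show ?thesis
    by (cases "norm (Pf \<theta> * x) = 0") (auto simp: power2_eq_square)
qed

lemma norm_P: "\<theta> $ 0 * norm (Pf \<theta>) <= norm (idm N)"
  using norm_P_mult[of "idm N"] P_dims by simp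

end

text \<open>Write V1 and P1 for the matrices at \<open>\<theta>'\<close>. As P and P1 annihilate X,
  both P V1 P1 = P and P V P1 = P1 hold. The identity is exact, so it yields the derivative of P and
  also the residuals at a positive distance from \<theta>.\<close>

lemma P_resolvent:
  assumes "\<theta> \<in> param_space s" "\<theta>' \<in> param_space s"
  shows "Pf \<theta>' = Pf \<theta> - Pf \<theta> * (Vf \<theta>' - Vf \<theta>) * Pf \<theta>'"
proof -
  have "Pf \<theta> * Vf \<theta>' * Pf \<theta>' = Pf \<theta>"
    using V_P[OF assms(2)] P_X[OF assms(1)] P_dims[OF assms(1)] 
    by (simp add: mult.assoc right_diff_distrib) (simp add: mult.assoc[symmetric])
  moreover have "Pf \<theta> * Vf \<theta> * Pf \<theta>' = Pf \<theta>'"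
    using P_V[OF assms(1)] X_P[OF assms(2)] P_dims[OF assms(2)] by (simp add: left_diff_distrib mult.assoc)
  ultimately show ?thesis by (simp add: right_diff_distrib left_diff_distrib)
qed

text \<open>The square matrix \<open>[X, V T]\<close> is injective and both sides agree on it.\<close>

lemma P_eq_contrast:
  assumes th: "\<theta> \<in> param_space s" and T: "contrast_mat D T"
  shows "mat_inv (transpose_mat T * Vmat D \<theta> * T) \<in> carrier_mat (N - p) (N - p)"
    "\<And>v. mat_dims (N - p) 1 v ==> fm (transpose_mat T * Vmat D \<theta> * T) * v = 0 ==> v = 0"
    "fm T * fm (mat_inv (transpose_mat T * Vmat D \<theta> * T)) * trp (fm T) = Pf \<theta>"
    "psdm (fm (transpose_mat T * Vmat D \<theta> * T))"
proof -
  define q where "q = N - p"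
  have "p <= N" using inj_dim_le[OF X_dims] X_inj by blast
  then have N: "N = p + q" by (simp add: q_def)
  have Tc: "T \<in> carrier_mat N q" and "vec_space.rank N T = q" and "transpose_mat T * fixX D = 0\<^sub>m q p"
    using T by (auto simp: contrast_mat_def q_def)
  define Tf where "Tf = fm T"
  have dT: "mat_dims N q Tf" unfolding Tf_def using Tc by (rule mat_dims_fm_carrier)
  have T_inj: "v = 0" if "mat_dims q 1 v" "Tf * v = 0" for v
    using full_rank_inj[OF Tc] \<open>vec_space.rank N T = q\<close> that by (simp add: Tf_def)
  have "fm (transpose_mat T * fixX D) = trp Tf * Xf"
    using Tc by (simp add: fm_mult fm_transpose Tf_def Xf_def nobs_def)
  then have TX: "trp Tf * Xf = 0"
    using \<open>transpose_mat T * fixX D = 0\<^sub>m q p\<close> by (simp add: fm_zero)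
  define C where "C = transpose_mat T * Vmat D \<theta> * T"
  have Cc: "C \<in> carrier_mat q q" using Tc by (auto simp: C_def)
  have fC: "fm C = trp Tf * Vf \<theta> * Tf"
    using Tc Vmat_carrier[of \<theta>] by (simp add: C_def fm_mult fm_transpose Tf_def fm_Vmat mult.assoc)
  show psd: "psdm (fm (transpose_mat T * Vmat D \<theta> * T))"
    using psdm_conj[OF V_psd[OF th], of Tf] fC by (simp add: C_def)
  have C_inj: "v = 0" if "mat_dims q 1 v" "fm C * v = 0" for v
  proof -
    have "inner (Tf * v) (Vf \<theta> * (Tf * v)) = inner v (fm C * v)"
      by (simp add: fC inner_times_left mult.assoc)
    then have "Vf \<theta> * (Tf * v) = 0" using that(2) by (intro psdm_eq_0[OF V_psd[OF th]]) simp
    then have "Tf * v = 0" using V_inj[OF th mat_dims_mult[OF dT that(1)]] by simp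
    then show ?thesis using T_inj that(1) by simp
  qed
  then show "\<And>v. mat_dims (N - p) 1 v ==> fm (transpose_mat T * Vmat D \<theta> * T) * v = 0 ==> v = 0"
    by (simp add: C_def q_def)
  show "mat_inv (transpose_mat T * Vmat D \<theta> * T) \<in> carrier_mat (N - p) (N - p)"
    using mat_inv_left_right(1)[OF Cc C_inj] by (simp add: C_def q_def)
  define Q where "Q = fm (mat_inv C)"
  have Q: "fm C * Q = idm q" "Q * fm C = idm q" "mat_dims q q Q"
    using fm_mat_inv[OF Cc C_inj] by (auto simp: Q_def)
  \<comment> \<open>\<open>E1\<close> and \<open>E2\<close> select the first p and the last q
    coordinates; with them the block matrix becomes the sum \<open>H\<close> below.\<close>
  define E1 where "E1 = of_fun p N (\<lambda>i j. if i = j then 1 else 0)"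
  define E2 where "E2 = of_fun q N (\<lambda>i j. if j = i + p then 1 else 0)"
  have dE: "mat_dims p N E1" "mat_dims q N E2" by (simp_all add: E1_def E2_def)
  then have dE': "mat_dims N p (trp E1)" "mat_dims N q (trp E2)" by simp_all
  have EE: "trp E1 * E1 + trp E2 * E2 = idm N"
  proof (rule fmat_eqI)
    fix i j
    have "(\<Sum>k<p. ent E1 k i * ent E1 k j) = (\<Sum>k<p. if k = i then if i < N \<and> i = j then 1 else 0 else 0)"
      by (intro sum.cong refl) (auto simp: E1_def)
    moreover have "(\<Sum>k<q. ent E2 k i * ent E2 k j) = (\<Sum>k<q. if k = i - p then if p <= i \<and> i < N \<and> i = j then 1 else 0 else 0)"
      by (intro sum.cong refl) (auto simp: E2_def)
    ultimately show "ent (trp E1 * E1 + trp E2 * E2) i j = ent (idm N) i j"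
      using N by (auto simp: ent_times_left[OF dE'(1)] ent_times_left[OF dE'(2)] ent_idm)
  qed
  define H where "H = Xf * E1 + Vf \<theta> * Tf * E2"
  have dH: "mat_dims N N H"
    unfolding H_def by (intro mat_dims_simps mat_dims_mult[OF X_dims dE(1)] mat_dims_mult[OF mat_dims_mult[OF V_dims dT] dE(2)])
  have "v = 0" if v: "mat_dims N 1 v" "H * v = 0" for v
  proof -
    have "trp Tf * (H * v) = fm C * (E2 * v)"
      using TX by (simp add: H_def fC distrib_left distrib_right mult.assoc) (simp add: mult.assoc[symmetric])
    then have 2: "E2 * v = 0" using C_inj mat_dims_mult[OF dE(2) v(1)] v(2) by simp
    then have "Xf * (E1 * v) = 0" using v(2) by (simp add: H_def distrib_right mult.assoc)
    then have 1: "E1 * v = 0" using X_inj mat_dims_mult[OF dE(1) v(1)] by simp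
    have "v = (trp E1 * E1 + trp E2 * E2) * v" using EE v(1) by simp
    then show ?thesis by (simp add: distrib_right mult.assoc 1 2)
  qed
  then obtain B where B: "H * B = idm N" using inj_inverse_exists[OF dH] by blast
  define P2 where "P2 = Tf * Q * trp Tf"
  have dP2: "mat_dims N N P2"
    unfolding P2_def using dT by (intro mat_dims_mult[OF mat_dims_mult[OF dT Q(3)]]) simp
  have "P2 * Xf = 0" using TX by (simp add: P2_def mult.assoc)
  moreover have "P2 * (Vf \<theta> * Tf) = Tf"
  proof -
    have "P2 * (Vf \<theta> * Tf) = Tf * (Q * fm C)" by (simp add: P2_def fC mult.assoc)
    then show ?thesis using Q(2) dT by simp
  qed
  moreover have "Pf \<theta> * (Vf \<theta> * Tf) = Tf"
  proof -
    have "trp Xf * Tf = 0" using arg_cong[OF TX, of trp] by (simp add: trp_mult)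
    then show ?thesis using P_V[OF th] dT by (simp add: mult.assoc[symmetric] left_diff_distrib) (simp add: mult.assoc)
  qed
  ultimately have "(P2 - Pf \<theta>) * H = 0"
    using P_X[OF th] by (simp add: H_def distrib_left left_diff_distrib mult.assoc[symmetric])
  then have "(P2 - Pf \<theta>) * (H * B) = 0" by (simp add: mult.assoc[symmetric])
  then have "P2 = Pf \<theta>" using B dP2 P_dims[OF th] by (simp add: left_diff_distrib)
  then show "fm T * fm (mat_inv (transpose_mat T * Vmat D \<theta> * T)) * trp (fm T) = Pf \<theta>"
    by (simp add: P2_def Tf_def Q_def C_def)
qed

end

section \<open>Derivatives of the restricted likelihood\<close>

lemma diff_flip: "a = b - c ==> b - a = (c :: 'a :: ab_group_add)"
  by simp

context lmm
begin

text \<open>The interior of the parameter space, where a partial derivative sees a two-sided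
  neighbourhood. The true parameter lies in it because all variances are positive.\<close>

definition "param_int = {\<theta> \<in> carrier_vec (s + 1). \<forall>i\<le>s. 0 < \<theta> $ i}"
text \<open>The partial derivatives of V. As V is affine in each single coordinate,
  \<open>V_upd\<close> and \<open>dV_upd\<close> hold without remainder, and \<open>ddVf j j\<close>
  is 0.\<close>

definition "dVf \<theta> j = (if j = 0 then (\<Sum>t\<le>s. gam \<theta> t *\<^sub>R Wf t) else \<theta> $ 0 *\<^sub>R Wf j)"
definition "ddVf j k = (if j = 0 \<and> k \<noteq> 0 then Wf k else if j \<noteq> 0 \<and> k = 0 then Wf j else 0)"

lemma param_int: "\<theta> \<in> param_int ==> \<theta> \<in> param_space s"
  by (auto simp: param_int_def param_space_def intro: less_imp_le)

lemma dV_dims: "j <= s ==> mat_dims N N (dVf \<theta> j)"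
  by (auto simp: dVf_def W_dims intro!: mat_dims_sum)

lemma dV_sym [simp]: "trp (dVf \<theta> j) = dVf \<theta> j" by (simp add: dVf_def)
lemma ddV_sym [simp]: "trp (ddVf j k) = ddVf j k" by (simp add: ddVf_def)

lemma V_eq_dV: "Vf \<theta> = \<theta> $ 0 *\<^sub>R dVf \<theta> 0"
  by (simp add: Vf_def dVf_def varc_def scaleR_sum_right)

text \<open>For j = 0 this rests on V = \<lambda> dV_0 and P V P = P. It removes the case
  distinction of \<open>Bmat\<close> from everything that follows.\<close>

lemma Bf_eq:
  assumes "\<theta> \<in> param_space s" "j <= s"
  shows "Bf \<theta> j = (1/2) *\<^sub>R (Pf \<theta> * dVf \<theta> j * Pf \<theta>)"
proof (cases "j = 0")
  case True
  have "Pf \<theta> * dVf \<theta> 0 * Pf \<theta> = (1 / \<theta> $ 0) *\<^sub>R (Pf \<theta> * Vf \<theta> * Pf \<theta>)"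
    using param_pos[OF assms(1)] by (simp add: V_eq_dV)
  then show ?thesis using True P_V_P[OF assms(1)] by (simp add: Bf_def Bmat_def fm_smult Pf_def)
next
  case False
  then show ?thesis 
    using Pmat_carrier[OF assms(1)] Zmat_carrier[OF assms(2)]
    by (simp add: Bf_def Bmat_def fm_smult fm_mult fm_transpose dVf_def Wf_def Zf_def Pf_def mult.assoc)
qed

lemma Bmat_carrier: 
  assumes "\<theta> \<in> param_space s" "j <= s"
  shows "Bmat D \<theta> j \<in> carrier_mat N N"
  using Pmat_carrier[OF assms(1)] by (auto simp: Bmat_def)

lemma B_dims: "\<theta> \<in> param_space s ==> j <= s ==> mat_dims N N (Bf \<theta> j)"
  unfolding Bf_def by (rule mat_dims_fm_carrier[OF Bmat_carrier])

lemma B_sym: "\<theta> \<in> param_space s ==> j <= s ==> trp (Bf \<theta> j) = Bf \<theta> j"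
  by (simp add: Bf_eq P_sym trp_mult mult.assoc)

lemma Gent_trc:
  assumes "\<theta> \<in> param_space s" "j <= s" "k <= s"
  shows "Gent D \<theta> j k = 2 * trc (Bf \<theta> j * Vf \<theta> * Bf \<theta> k * Vf \<theta>)"
  using Bmat_carrier[OF assms(1,2)] Bmat_carrier[OF assms(1,3)] Vmat_carrier[of \<theta>]
  by (simp add: Gent_def trc_fm[symmetric] fm_mult Bf_def fm_Vmat mult.assoc)

lemma Gent_sym:
  assumes "\<theta> \<in> param_space s" "j <= s" "k <= s"
  shows "Gent D \<theta> j k = Gent D \<theta> k j"
  using assms trc_commute[of "Bf \<theta> j * Vf \<theta>" "Bf \<theta> k * Vf \<theta>"] by (simp add: Gent_trc mult.assoc)

text \<open>Both factors V are absorbed by P V P = P after a cyclic shift. In this form the trace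
  can be recognized in the expected Hessian.\<close>

lemma Gent_trc_P:
  assumes th: "\<theta> \<in> param_space s" and "j <= s" "k <= s"
  shows "Gent D \<theta> j k = trc (Pf \<theta> * dVf \<theta> j * Pf \<theta> * dVf \<theta> k) / 2"
proof -
  let ?P = "Pf \<theta>" and ?V = "Vf \<theta>"
  have a: "?P * (?V * (?P * A)) = ?P * A" for A using P_V_P[OF th] by (metis mult.assoc)
  have "trc (?P * dVf \<theta> j * ?P * ?V * (?P * dVf \<theta> k * ?P) * ?V) = trc (?P * dVf \<theta> j * (?P * ?V * ?P) * dVf \<theta> k * ?P * ?V)"
    by (simp add: mult.assoc)
  also have "\<dots> = trc ((?P * dVf \<theta> j * ?P * dVf \<theta> k) * (?P * ?V))"
    by (simp add: a mult.assoc)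
  also have "\<dots> = trc ((?P * ?V * ?P) * dVf \<theta> j * ?P * dVf \<theta> k)"
    by (subst trc_commute) (simp add: mult.assoc)
  finally show ?thesis using assms by (simp add: Gent_trc Bf_eq mult.assoc a)
qed

lemma vec_upd_same: "vec_upd \<theta> j (\<theta> $ j) = \<theta>"
  by (auto simp: vec_upd_def)

lemma vec_upd_index: "i < dim_vec \<theta> ==> vec_upd \<theta> j x $ i = (if i = j then x else \<theta> $ i)"
  by (simp add: vec_upd_def)

lemma V_upd:
  assumes "\<theta> \<in> carrier_vec (s + 1)" "j <= s"
  shows "Vf (vec_upd \<theta> j x) = Vf \<theta> + (x - \<theta> $ j) *\<^sub>R dVf \<theta> j"
proof -
  have v: "varc (vec_upd \<theta> j x) t = varc \<theta> t + (x - \<theta> $ j) * (if j = 0 then gam \<theta> t else if t = j then \<theta> $ 0 else 0)"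
    if "t <= s" for t
    using that assms by (auto simp: varc_def gam_def vec_upd_index algebra_simps)
  have d: "dVf \<theta> j = (\<Sum>t\<le>s. (if j = 0 then gam \<theta> t else if t = j then \<theta> $ 0 else 0) *\<^sub>R Wf t)"
  proof (cases "j = 0")
    case False
    have "(\<Sum>t\<le>s. (if t = j then \<theta> $ 0 else 0) *\<^sub>R Wf t) = (\<Sum>t\<le>s. if t = j then \<theta> $ 0 *\<^sub>R Wf j else 0)"
      by (intro sum.cong) auto
    then show ?thesis using False assms(2) by (simp add: dVf_def)
  qed (simp add: dVf_def)
  show ?thesis
    unfolding d by (simp add: Vf_def v scaleR_sum_right scaleR_add_left sum.distrib)
qed

lemma dV_upd:
  assumes "\<theta> \<in> carrier_vec (s + 1)" "j <= s" "k <= s"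
  shows "dVf (vec_upd \<theta> j x) k = dVf \<theta> k + (x - \<theta> $ j) *\<^sub>R ddVf j k"
proof (cases "k = 0")
  case False
  then show ?thesis using assms by (auto simp: dVf_def ddVf_def vec_upd_index algebra_simps)
next
  case True
  show ?thesis
  proof (cases "j = 0")
    case True
    have "gam (vec_upd \<theta> j x) t = gam \<theta> t" if "t <= s" for t
      using that assms True by (auto simp: gam_def vec_upd_index)
    then show ?thesis using \<open>k = 0\<close> True by (simp add: dVf_def ddVf_def)
  next
    case False
    have v: "gam (vec_upd \<theta> j x) t = gam \<theta> t + (if t = j then x - \<theta> $ j else 0)" if "t <= s" for t
      using that assms False by (auto simp: gam_def vec_upd_index)
    have "(\<Sum>t\<le>s. (if t = j then x - \<theta> $ j else 0) *\<^sub>R Wf t) = (\<Sum>t\<le>s. if t = j then (x - \<theta> $ j) *\<^sub>R Wf j else 0)"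
      by (intro sum.cong) auto
    then show ?thesis using \<open>k = 0\<close> False assms by (simp add: dVf_def ddVf_def v scaleR_add_left sum.distrib)
  qed
qed

lemma upd_param_int:
  assumes "\<theta> \<in> param_int" "0 < x" "j <= s"
  shows "vec_upd \<theta> j x \<in> param_int"
  using assms by (auto simp: param_int_def vec_upd_index) (simp add: vec_upd_def)

lemma eventually_upd:
  assumes "\<theta> \<in> param_int" "j <= s"
  shows "\<forall>\<^sub>F x in nhds (\<theta> $ j). vec_upd \<theta> j x \<in> param_int \<and> \<theta> $ 0 / 2 <= vec_upd \<theta> j x $ 0"
proof -
  have "0 < \<theta> $ j" using assms by (auto simp: param_int_def)
  then have "\<forall>\<^sub>F x in nhds (\<theta> $ j). \<theta> $ j / 2 < x" by (intro eventually_nhds_in_open[of "{_<..}", simplified]) auto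
  then show ?thesis
  proof eventually_elim
    case (elim x)
    then have "0 < x" using \<open>0 < \<theta> $ j\<close> by linarith
    then show ?case using upd_param_int[OF assms(1) _ assms(2), of x] elim assms
      by (auto simp: param_int_def vec_upd_index)
  qed
qed

lemma P_upd:
  assumes "\<theta> \<in> param_int" "j <= s" "vec_upd \<theta> j x \<in> param_int"
  shows "Pf (vec_upd \<theta> j x) = Pf \<theta> - (x - \<theta> $ j) *\<^sub>R (Pf \<theta> * dVf \<theta> j * Pf (vec_upd \<theta> j x))"
  using P_resolvent[OF param_int[OF assms(1)] param_int[OF assms(3)]] assms(1,2)
  by (simp add: V_upd param_int_def)

text \<open>Two applications of the resolvent identity show that the error of the linear
  approximation is exactly h^2 P dV P dV P1, where P1 is taken at the moved point. It is quadratic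
  in the step h, since P1 stays bounded as long as \<lambda> keeps half its value; this is the
  factor 2 in \<open>K\<close>.\<close>

lemma P_deriv:
  assumes th: "\<theta> \<in> param_int" and j: "j <= s"
  shows "((\<lambda>x. Pf (vec_upd \<theta> j x)) has_vector_derivative - (Pf \<theta> * dVf \<theta> j * Pf \<theta>)) (at (\<theta> $ j))"
proof -
  let ?P = "Pf \<theta>" and ?d = "dVf \<theta> j"
  have t0: "0 < \<theta> $ 0" using th by (simp add: param_int_def)
  define K where "K = norm (?P * ?d * ?P * ?d) * (2 * norm (idm N) / \<theta> $ 0)"
  have ev: "\<forall>\<^sub>F x in at (\<theta> $ j). x \<noteq> \<theta> $ j \<and> vec_upd \<theta> j x \<in> param_int \<and> \<theta> $ 0 / 2 <= vec_upd \<theta> j x $ 0"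
    using eventually_upd[OF assms] by (auto simp: eventually_at_filter elim: eventually_mono)
  have "\<forall>\<^sub>F x in at (\<theta> $ j). norm (norm (Pf (vec_upd \<theta> j x) - Pf (vec_upd \<theta> j (\<theta> $ j)) - (x - \<theta> $ j) *\<^sub>R - (?P * ?d * ?P)) / norm (x - \<theta> $ j))
      <= \<bar>x - \<theta> $ j\<bar> * K"
    using ev
  proof eventually_elim
    case (elim x)
    define h where "h = x - \<theta> $ j"
    define P' where "P' = Pf (vec_upd \<theta> j x)"
    have P': "P' = ?P - h *\<^sub>R (?P * ?d * P')" using P_upd[OF th j] elim by (simp add: P'_def h_def)
    then have *: "?P - P' = h *\<^sub>R (?P * ?d * P')" by (rule diff_flip)
    have "P' - ?P - h *\<^sub>R - (?P * ?d * ?P) = h *\<^sub>R (?P * ?d * (?P - P'))"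
    proof -
      have "P' - ?P = - (h *\<^sub>R (?P * ?d * P'))" using * by (metis minus_diff_eq)
      then show ?thesis by (simp add: right_diff_distrib scaleR_diff_right mult.assoc)
    qed
    also have "\<dots> = (h * h) *\<^sub>R (?P * ?d * ?P * ?d * P')" unfolding * by (simp add: mult.assoc)
    finally have "norm (P' - ?P - h *\<^sub>R - (?P * ?d * ?P)) = \<bar>h\<bar> * \<bar>h\<bar> * norm (?P * ?d * ?P * ?d * P')"
      by (simp add: abs_mult)
    also have "\<dots> <= \<bar>h\<bar> * \<bar>h\<bar> * K"
    proof (intro mult_left_mono)
      have "norm P' <= norm (idm N) / vec_upd \<theta> j x $ 0"
        using norm_P[OF param_int, of "vec_upd \<theta> j x"] elim t0 by (simp add: P'_def field_simps)
      also have "\<dots> <= norm (idm N) / (\<theta> $ 0 / 2)"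
        using elim t0 by (intro divide_left_mono) auto
      finally have "norm P' <= 2 * norm (idm N) / \<theta> $ 0" by (simp add: mult.commute)
      then have "norm (?P * ?d * ?P * ?d) * norm P' <= K" unfolding K_def by (rule mult_left_mono) simp
      then show "norm (?P * ?d * ?P * ?d * P') <= K" by (rule order_trans[OF norm_mult_ineq])
    qed simp_all
    finally show ?case using elim by (simp add: vec_upd_same h_def P'_def field_simps)
  qed
  moreover have "((\<lambda>x. \<bar>x - \<theta> $ j\<bar> * K) \<longlongrightarrow> 0) (at (\<theta> $ j))"
    by (rule tendsto_eq_intros refl | simp)+
  ultimately have "((\<lambda>x. norm (Pf (vec_upd \<theta> j x) - Pf (vec_upd \<theta> j (\<theta> $ j)) - (x - \<theta> $ j) *\<^sub>R - (?P * ?d * ?P)) / norm (x - \<theta> $ j)) \<longlongrightarrow> 0) (at (\<theta> $ j))"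
    by (rule Lim_null_comparison)
  then show ?thesis
    unfolding has_vector_derivative_def has_derivative_iff_norm
    by (intro conjI bounded_linear_scaleR_left)
qed

lemma restr_loglik_eq:
  assumes "\<theta> \<in> param_space s" "y \<in> carrier_vec N"
  shows "restr_loglik D T c y \<theta> = c - (ln (Determinant.det (transpose_mat T * Vmat D \<theta> * T)) + inner (fv y) (Pf \<theta> * fv y)) / 2"
  using assms(2) Pmat_carrier[OF assms(1)]
  by (simp add: restr_loglik_def Pf_def fm_mult_vec[symmetric] inner_fv)

text \<open>The determinant contributes the trace of (T' V T)^{-1} T' dV T. By
  \<open>P_eq_contrast\<close> and a cyclic shift it equals the trace of P dV, and T
  disappears.\<close>

lemma restr_loglik_deriv:
  assumes th: "\<theta> \<in> param_int" and j: "j <= s" and y: "y \<in> carrier_vec N" and T: "contrast_mat D T"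
  shows "((\<lambda>x. restr_loglik D T c y (vec_upd \<theta> j x)) has_real_derivative
    - trc (Pf \<theta> * dVf \<theta> j) / 2 + inner (fv y) (Bf \<theta> j * fv y)) (at (\<theta> $ j))"
proof -
  let ?P = "Pf \<theta>" and ?d = "dVf \<theta> j"
  have th': "\<theta> \<in> param_space s" using th by (rule param_int)
  have thc: "\<theta> \<in> carrier_vec (s + 1)" using th by (simp add: param_int_def)
  define q where "q = N - p"
  have Tc: "T \<in> carrier_mat N q" using T by (simp add: contrast_mat_def q_def)
  obtain d where d: "d \<in> carrier_mat N N" "fm d = ?d" using fm_surj[OF dV_dims[OF j]] by blast
  define C where "C = transpose_mat T * Vmat D \<theta> * T"
  define E where "E = transpose_mat T * d * T"
  note PC = P_eq_contrast[OF th' T, folded C_def q_def]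
  have Cc: "C \<in> carrier_mat q q" and Ec: "E \<in> carrier_mat q q" using Tc by (auto simp: C_def E_def)
  have TVT: "transpose_mat T * Vmat D (vec_upd \<theta> j x) * T = C + (x - \<theta> $ j) \<cdot>\<^sub>m E" for x
  proof (rule fm_inject)
    show "fm (transpose_mat T * Vmat D (vec_upd \<theta> j x) * T) = fm (C + (x - \<theta> $ j) \<cdot>\<^sub>m E)"
      using Tc d Vmat_carrier by (simp add: C_def E_def fm_mult fm_add fm_smult fm_transpose fm_Vmat V_upd[OF thc j] distrib_left distrib_right carrier_matD[OF Vmat_carrier] mult.assoc)
  qed (use Cc Ec Tc in auto)
  have "((\<lambda>x. ln (Determinant.det (C + (x - \<theta> $ j) \<cdot>\<^sub>m E))) has_real_derivative mat_tr (mat_inv C * E) * 1) (at (\<theta> $ j))"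
    by (rule DERIV_chain2[where g = "\<lambda>x. x - \<theta> $ j"])
       (use ln_det_deriv[OF Cc PC(4) Ec PC(2)] in \<open>auto intro!: derivative_eq_intros\<close>)
  also have "mat_tr (mat_inv C * E) * 1 = trc (?P * ?d)"
  proof -
    have "mat_tr (mat_inv C * E) = trc (fm (mat_inv C) * (trp (fm T) * ?d * fm T))"
      using PC(1) Ec Tc d by (simp add: trc_fm[symmetric] fm_mult E_def fm_transpose mult.assoc)
    also have "\<dots> = trc ((fm (mat_inv C) * (trp (fm T) * ?d)) * fm T)" by (simp add: mult.assoc)
    also have "\<dots> = trc (fm T * (fm (mat_inv C) * (trp (fm T) * ?d)))" by (rule trc_commute)
    also have "\<dots> = trc (?P * ?d)" using PC(3) by (simp add: mult.assoc[symmetric])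
    finally show ?thesis by simp
  qed
  finally have 1: "((\<lambda>x. ln (Determinant.det (transpose_mat T * Vmat D (vec_upd \<theta> j x) * T))) has_real_derivative trc (?P * ?d)) (at (\<theta> $ j))"
    by (simp add: TVT)
  have "bounded_linear (\<lambda>A. inner (fv y) (A * fv y))"
    by (intro bounded_linear_compose[OF bounded_linear_inner_right bounded_linear_mult_left])
  from bounded_linear.has_vector_derivative[OF this P_deriv[OF th j]]
  have 2: "((\<lambda>x. inner (fv y) (Pf (vec_upd \<theta> j x) * fv y)) has_real_derivative - 2 * inner (fv y) (Bf \<theta> j * fv y)) (at (\<theta> $ j))"
    using Bf_eq[OF th' j] by (simp add: has_real_derivative_iff_has_vector_derivative)
  have "((\<lambda>x. c - (ln (Determinant.det (transpose_mat T * Vmat D (vec_upd \<theta> j x) * T)) + inner (fv y) (Pf (vec_upd \<theta> j x) * fv y)) / 2)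
      has_real_derivative - trc (?P * ?d) / 2 + inner (fv y) (Bf \<theta> j * fv y)) (at (\<theta> $ j))"
    by (rule DERIV_cong[OF DERIV_diff[OF DERIV_const DERIV_cdivide[OF DERIV_add[OF 1 2], of 2]]]) (simp add: field_simps)
  moreover have "\<forall>\<^sub>F x in nhds (\<theta> $ j). restr_loglik D T c y (vec_upd \<theta> j x) =
      c - (ln (Determinant.det (transpose_mat T * Vmat D (vec_upd \<theta> j x) * T)) + inner (fv y) (Pf (vec_upd \<theta> j x) * fv y)) / 2"
    using eventually_upd[OF th j] by eventually_elim (auto intro!: restr_loglik_eq param_int y)
  ultimately show ?thesis by (subst DERIV_cong_ev[OF refl _ refl])
qed

lemma partial_deriv_loglik:
  assumes "\<theta> \<in> param_int" "j <= s" "y \<in> carrier_vec N" "contrast_mat D T"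
  shows "partial_deriv j (restr_loglik D T c y) \<theta> = - trc (Pf \<theta> * dVf \<theta> j) / 2 + inner (fv y) (Bf \<theta> j * fv y)"
  unfolding partial_deriv_def by (rule DERIV_imp_deriv[OF restr_loglik_deriv[OF assms]])

text \<open>The derivative of \<open>Bf \<theta> k\<close> in direction j; its quadratic form is the
  random part of the Hessian.\<close>

definition "Mf \<theta> j k = (1/2) *\<^sub>R (Pf \<theta> * (ddVf j k - dVf \<theta> j * Pf \<theta> * dVf \<theta> k - dVf \<theta> k * Pf \<theta> * dVf \<theta> j) * Pf \<theta>)"

lemma partial_deriv2_loglik:
  assumes th: "\<theta> \<in> param_int" and j: "j <= s" and k: "k <= s" and y: "y \<in> carrier_vec N" and T: "contrast_mat D T"
  shows "partial_deriv j (partial_deriv k (restr_loglik D T c y)) \<theta> =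
    (trc (Pf \<theta> * dVf \<theta> j * Pf \<theta> * dVf \<theta> k) - trc (Pf \<theta> * ddVf j k)) / 2 + inner (fv y) (Mf \<theta> j k * fv y)"
proof -
  let ?P = "Pf \<theta>" and ?d = "dVf \<theta>" and ?u = "vec_upd \<theta> j"
  have th': "\<theta> \<in> param_space s" using th by (rule param_int)
  have thc: "\<theta> \<in> carrier_vec (s + 1)" using th by (simp add: param_int_def)
  note dP = P_deriv[OF th j]
  have dD: "((\<lambda>x. dVf (?u x) k) has_vector_derivative ddVf j k) (at (\<theta> $ j))"
    unfolding dV_upd[OF thc j k] by (auto intro!: derivative_eq_intros)
  have PD: "((\<lambda>x. Pf (?u x) * dVf (?u x) k) has_vector_derivative (?P * ddVf j k - ?P * ?d j * ?P * ?d k)) (at (\<theta> $ j))"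
    using has_vector_derivative_mult[OF dP dD] by (simp add: vec_upd_same)
  have PDP: "((\<lambda>x. Pf (?u x) * dVf (?u x) k * Pf (?u x)) has_vector_derivative 2 *\<^sub>R Mf \<theta> j k) (at (\<theta> $ j))"
    using has_vector_derivative_mult[OF PD dP]
    by (simp add: vec_upd_same Mf_def right_diff_distrib left_diff_distrib mult.assoc algebra_simps)
  have tr: "trc (Pf \<theta>' * A) = inner (idm N) (Pf \<theta>' * A)" if "\<theta>' \<in> param_int" for \<theta>' A
    using trc_mult[of "idm N" "Pf \<theta>' * A"] P_dims[OF param_int[OF that]] by (simp add: mult.assoc[symmetric])
  have 1: "((\<lambda>x. inner (idm N) (Pf (?u x) * dVf (?u x) k)) has_real_derivative
      inner (idm N) (?P * ddVf j k - ?P * ?d j * ?P * ?d k)) (at (\<theta> $ j))"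
    unfolding has_real_derivative_iff_has_vector_derivative
    by (rule bounded_linear.has_vector_derivative[OF bounded_linear_inner_right PD])
  have "bounded_linear (\<lambda>A. inner (fv y) (A * fv y))"
    by (intro bounded_linear_compose[OF bounded_linear_inner_right bounded_linear_mult_left])
  from bounded_linear.has_vector_derivative[OF this PDP]
  have 2: "((\<lambda>x. inner (fv y) (Pf (?u x) * dVf (?u x) k * Pf (?u x) * fv y)) has_real_derivative
      2 * inner (fv y) (Mf \<theta> j k * fv y)) (at (\<theta> $ j))"
    by (simp add: has_real_derivative_iff_has_vector_derivative)
  have "((\<lambda>x. - inner (idm N) (Pf (?u x) * dVf (?u x) k) / 2 + inner (fv y) (Pf (?u x) * dVf (?u x) k * Pf (?u x) * fv y) / 2)
      has_real_derivative - inner (idm N) (?P * ddVf j k - ?P * ?d j * ?P * ?d k) / 2 + inner (fv y) (Mf \<theta> j k * fv y)) (at (\<theta> $ j))"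
    by (auto intro!: derivative_eq_intros 1 2)
  moreover have "\<forall>\<^sub>F x in nhds (\<theta> $ j). partial_deriv k (restr_loglik D T c y) (?u x) =
     - inner (idm N) (Pf (?u x) * dVf (?u x) k) / 2 + inner (fv y) (Pf (?u x) * dVf (?u x) k * Pf (?u x) * fv y) / 2"
    using eventually_upd[OF th j] 
    by eventually_elim (auto simp: partial_deriv_loglik[OF _ k y T] tr Bf_eq[OF param_int k])
  ultimately have "((\<lambda>x. partial_deriv k (restr_loglik D T c y) (?u x))
      has_real_derivative - inner (idm N) (?P * ddVf j k - ?P * ?d j * ?P * ?d k) / 2 + inner (fv y) (Mf \<theta> j k * fv y)) (at (\<theta> $ j))"
    by (subst DERIV_cong_ev[OF refl _ refl])
  then have "partial_deriv j (partial_deriv k (restr_loglik D T c y)) \<theta> =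
     - inner (idm N) (?P * ddVf j k - ?P * ?d j * ?P * ?d k) / 2 + inner (fv y) (Mf \<theta> j k * fv y)"
    unfolding partial_deriv_def[of j] by (rule DERIV_imp_deriv)
  then show ?thesis by (simp add: inner_diff_right tr[OF th] mult.assoc diff_divide_distrib)
qed

lemma Mf_X:
  assumes "\<theta> \<in> param_space s"
  shows "Mf \<theta> j k * Xf = 0" "trp Xf * Mf \<theta> j k = 0"
proof -
  show "Mf \<theta> j k * Xf = 0" using P_X[OF assms] by (simp add: Mf_def mult.assoc)
  have "trp Xf * (Pf \<theta> * A) = 0" for A using X_P[OF assms] by (simp add: mult.assoc[symmetric])
  then show "trp Xf * Mf \<theta> j k = 0" by (simp add: Mf_def mult.assoc)
qed

lemma Bf_X:
  assumes "\<theta> \<in> param_space s" "j <= s"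
  shows "Bf \<theta> j * Xf = 0" "trp Xf * Bf \<theta> j = 0"
proof -
  show "Bf \<theta> j * Xf = 0" using P_X[OF assms(1)] by (simp add: Bf_eq[OF assms] mult.assoc)
  have "trp Xf * (Pf \<theta> * A) = 0" for A using X_P[OF assms(1)] by (simp add: mult.assoc[symmetric])
  then show "trp Xf * Bf \<theta> j = 0" by (simp add: Bf_eq[OF assms] mult.assoc)
qed

text \<open>Score and Hessian are forms in y. This replaces y by u, because the matrices of these
  forms annihilate X from both sides.\<close>

lemma form_shift:
  assumes "A * Xf = 0" "trp Xf * A = 0"
  shows "inner (Xf * b + u) (A * (Xf * b + u)) = inner u (A * u)"
proof -
  have "A * (Xf * b + u) = A * u" using assms(1) by (simp add: distrib_left mult.assoc[symmetric])
  moreover have "inner (Xf * b) (A * u) = 0"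
    using assms(2) by (simp add: inner_times_left mult.assoc[symmetric])
  ultimately show ?thesis by (simp add: inner_add_left)
qed

lemma Mf_dims:
  assumes "\<theta> \<in> param_space s"
  shows "mat_dims N N (Mf \<theta> j k)"
proof -
  have "idm N * Mf \<theta> j k = Mf \<theta> j k" "Mf \<theta> j k * idm N = Mf \<theta> j k"
    using P_dims[OF assms] by (simp_all add: Mf_def mult.assoc) (simp add: mult.assoc[symmetric])
  then show ?thesis unfolding mat_dims_alt by blast
qed

text \<open>P V P = P turns the trace of P A P V into that of P A. The terms with second derivatives
  of V then cancel, and of the trace of P dV_j P dV_k there remains 1/2 - 1 = -1/2.\<close>

lemma trc_Mf_V:
  assumes th: "\<theta> \<in> param_space s" and j: "j <= s" and k: "k <= s"
  shows "(trc (Pf \<theta> * dVf \<theta> j * Pf \<theta> * dVf \<theta> k) - trc (Pf \<theta> * ddVf j k)) / 2 + trc (Mf \<theta> j k * Vf \<theta>) = - Gent D \<theta> j k"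
proof -
  let ?P = "Pf \<theta>" and ?V = "Vf \<theta>"
  have c: "trc (?P * A * ?P * ?V) = trc (?P * A)" for A
  proof -
    have "trc (?P * A * ?P * ?V) = trc ((?P * A) * (?P * ?V))" by (simp add: mult.assoc)
    also have "\<dots> = trc ((?P * ?V * ?P) * A)" by (subst trc_commute) (simp add: mult.assoc)
    finally show ?thesis by (simp add: P_V_P[OF th])
  qed
  have "trc (?P * (dVf \<theta> k * ?P * dVf \<theta> j)) = trc (?P * (dVf \<theta> j * ?P * dVf \<theta> k))"
    using trc_commute[of "?P * dVf \<theta> k" "?P * dVf \<theta> j"] by (simp add: mult.assoc)
  then have "trc (Mf \<theta> j k * ?V) = (trc (?P * ddVf j k) - 2 * trc (?P * (dVf \<theta> j * ?P * dVf \<theta> k))) / 2"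
    by (simp add: Mf_def c) (simp add: right_diff_distrib mult.assoc)
  then show ?thesis using Gent_trc_P[OF assms] by (simp add: mult.assoc field_simps)
qed

end

text \<open>Cauchy-Schwarz twice. Fourth powers are the highest that the moment assumptions allow to
  integrate.\<close>

lemma weighted_sum_pow4:
  fixes w x :: "'a => real"
  assumes w: "\<And>i. i \<in> A ==> 0 <= w i"
  shows "(\<Sum>i\<in>A. w i * x i) ^ 4 <= (\<Sum>i\<in>A. w i) ^ 3 * (\<Sum>i\<in>A. w i * x i ^ 4)"
proof -
  have cs: "(\<Sum>i\<in>A. w i * z i)\<^sup>2 <= (\<Sum>i\<in>A. w i) * (\<Sum>i\<in>A. w i * (z i)\<^sup>2)" for z :: "'a => real"
  proof -
    have "(\<Sum>i\<in>A. w i * z i) = (\<Sum>i\<in>A. sqrt (w i) * (sqrt (w i) * z i))"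
      using w by (intro sum.cong) (auto simp: mult.assoc[symmetric])
    then have "(\<Sum>i\<in>A. w i * z i)\<^sup>2 <= (\<Sum>i\<in>A. (sqrt (w i))\<^sup>2) * (\<Sum>i\<in>A. (sqrt (w i) * z i)\<^sup>2)"
      using Cauchy_Schwarz_ineq_sum by metis
    also have "\<dots> = (\<Sum>i\<in>A. w i) * (\<Sum>i\<in>A. w i * (z i)\<^sup>2)"
      using w by (auto simp: power_mult_distrib intro!: arg_cong2[where f = "(*)"] sum.cong)
    finally show ?thesis .
  qed
  have w0: "0 <= (\<Sum>i\<in>A. w i)" using w by (rule sum_nonneg)
  have "(\<Sum>i\<in>A. w i * x i) ^ 4 = ((\<Sum>i\<in>A. w i * x i)\<^sup>2)\<^sup>2" by simp
  also have "\<dots> <= ((\<Sum>i\<in>A. w i) * (\<Sum>i\<in>A. w i * (x i)\<^sup>2))\<^sup>2"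
    using cs[of x] by (rule power_mono) simp
  also have "\<dots> = (\<Sum>i\<in>A. w i)\<^sup>2 * (\<Sum>i\<in>A. w i * (x i)\<^sup>2)\<^sup>2" by (simp add: power_mult_distrib)
  also have "\<dots> <= (\<Sum>i\<in>A. w i)\<^sup>2 * ((\<Sum>i\<in>A. w i) * (\<Sum>i\<in>A. w i * ((x i)\<^sup>2)\<^sup>2))"
    by (intro mult_left_mono cs) simp
  finally show ?thesis by (simp add: power3_eq_cube power2_eq_square[of "sum w A"] mult.assoc)
qed

lemma abs_trc_mult_le: "\<bar>trc (A * B)\<bar> <= norm A * norm B"
  using Cauchy_Schwarz_ineq2[of "trp A" B] by (simp add: trc_mult)

section \<open>Bounds over a neighbourhood of the parameter\<close>

context lmm
begin

lemma nbhd_coord: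
  assumes "\<theta> \<in> carrier_vec (s + 1)" "\<theta>' \<in> param_nbhd D \<theta> \<delta>" "i <= s"
  shows "\<bar>\<theta>' $ i - \<theta> $ i\<bar> <= \<delta>"
proof -
  have th': "\<theta>' \<in> carrier_vec (s + 1)" using assms(2) by (simp add: param_nbhd_def param_space_def)
  have "\<theta>' $ i - \<theta> $ i = ent (fv (\<theta>' - \<theta>)) i 0" using th' assms by (simp add: ent_fv)
  also have "\<bar>\<dots>\<bar> <= norm (fv (\<theta>' - \<theta>))" by (rule abs_ent_le_norm)
  also have "\<dots> <= \<delta>" using assms(2) by (simp add: norm_fv param_nbhd_def)
  finally show ?thesis .
qed

lemma param_space_carrier: "\<theta> \<in> param_space s ==> \<theta> \<in> carrier_vec (s + 1)"
  by (simp add: param_space_def)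

text \<open>Concerns one fixed design. It makes the suprema in \<open>gdev\<close> and
  \<open>ddev\<close> genuine upper bounds, since a supremum of an unbounded set of reals is
  unspecified; \<delta> is restricted to keep \<lambda> away from 0.\<close>

lemma nbhd_bounded:
  assumes th: "\<theta> \<in> param_space s" and \<delta>: "\<delta> <= \<theta> $ 0 / 2"
  shows "\<exists>K\<ge>0. \<forall>\<theta>'\<in>param_nbhd D \<theta> \<delta>. norm (Vf \<theta>') <= K \<and> (\<forall>j\<le>s. norm (Bf \<theta>' j) <= K)"
proof -
  define b where "b = 1 + norm (fv \<theta>) + \<bar>\<delta>\<bar>"
  define w where "w = (\<Sum>t\<le>s. norm (Wf t))"
  define q where "q = 2 * norm (idm N) / \<theta> $ 0"
  have t0: "0 < \<theta> $ 0" using th by (rule param_pos)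
  have b: "1 <= b" by (simp add: b_def)
  have q0: "0 <= q" using t0 by (simp add: q_def)
  have w0: "0 <= w" unfolding w_def by (intro sum_nonneg) auto
  have "norm (Vf \<theta>') <= b * b * w \<and> (\<forall>j\<le>s. norm (Bf \<theta>' j) <= q * (b * w) * q)" if "\<theta>' \<in> param_nbhd D \<theta> \<delta>" for \<theta>'
  proof -
    have th': "\<theta>' \<in> param_space s" using that by (simp add: param_nbhd_def)
    have c: "\<bar>\<theta>' $ i\<bar> <= b" if "i <= s" for i
    proof -
      have "\<bar>\<theta> $ i\<bar> <= norm (fv \<theta>)"
        using abs_ent_le_norm[of "fv \<theta>" i 0] that param_space_carrier[OF th] by (simp add: ent_fv)
      then show ?thesis
        using nbhd_coord[OF param_space_carrier[OF th] \<open>\<theta>' \<in> param_nbhd D \<theta> \<delta>\<close> that] by (simp add: b_def)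
    qed
    have g: "\<bar>gam \<theta>' i\<bar> <= b" if "i <= s" for i using c[OF that] b by (simp add: gam_def)
    have "norm (Vf \<theta>') <= (\<Sum>t\<le>s. norm (varc \<theta>' t *\<^sub>R Wf t))" unfolding Vf_def by (rule norm_sum)
    also have "\<dots> <= (\<Sum>t\<le>s. b * b * norm (Wf t))"
      using c g b by (intro sum_mono) (auto simp: varc_def abs_mult intro!: mult_right_mono mult_mono)
    finally have V: "norm (Vf \<theta>') <= b * b * w" by (simp add: w_def sum_distrib_left)
    have dV: "norm (dVf \<theta>' j) <= b * w" if j: "j <= s" for j
    proof (cases "j = 0")
      case True
      have "norm (dVf \<theta>' 0) <= (\<Sum>t\<le>s. norm (gam \<theta>' t *\<^sub>R Wf t))" unfolding dVf_def by (simp, rule norm_sum[THEN order_trans], simp)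
      also have "\<dots> <= (\<Sum>t\<le>s. b * norm (Wf t))" using g by (intro sum_mono) (auto intro!: mult_right_mono)
      finally show ?thesis using True by (simp add: w_def sum_distrib_left)
    next
      case False
      have "norm (Wf j) <= w" unfolding w_def using j by (intro member_le_sum) auto
      then show ?thesis using False c[of 0] b by (auto simp: dVf_def intro!: mult_mono)
    qed
    have "\<theta> $ 0 / 2 <= \<theta>' $ 0"
      using nbhd_coord[OF param_space_carrier[OF th] that, of 0] \<delta> by simp
    then have "\<theta> $ 0 / 2 * norm (Pf \<theta>') <= norm (idm N)"
      using norm_P[OF th'] by (meson mult_right_mono norm_ge_zero order_trans)
    then have P: "norm (Pf \<theta>') <= q" using t0 by (simp add: q_def field_simps)
    have "norm (Bf \<theta>' j) <= q * (b * w) * q" if j: "j <= s" for j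
    proof -
      have "norm (Bf \<theta>' j) <= norm (Pf \<theta>' * dVf \<theta>' j * Pf \<theta>')" using Bf_eq[OF th' j] by simp
      also have "\<dots> <= norm (Pf \<theta>') * norm (dVf \<theta>' j) * norm (Pf \<theta>')"
        by (meson mult_right_mono norm_ge_zero norm_mult_ineq order_trans)
      also have "\<dots> <= q * (b * w) * q"
        using P dV[OF j] b w0 q0 by (intro mult_mono) auto
      finally show ?thesis .
    qed
    then show ?thesis using V by blast
  qed
  then show ?thesis
    by (intro exI[of _ "max 0 (max (b * b * w) (q * (b * w) * q))"]) (auto simp: le_max_iff_disj)
qed

lemma Bmat_ent: 
  assumes "\<theta> \<in> param_space s" "j <= s" "a < N" "b < N"
  shows "Bmat D \<theta> j $$ (a, b) = ent (Bf \<theta> j) a b"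
  using Bmat_carrier[OF assms(1,2)] assms(3,4) by (simp add: Bf_def ent_fm)

lemma gdev_ge:
  assumes th: "\<theta> \<in> param_space s" and \<delta>: "\<delta> <= \<theta> $ 0 / 2" and jk: "j <= s" "k <= s" and th': "\<theta>' \<in> param_nbhd D \<theta> \<delta>"
  shows "\<bar>Gent D \<theta>' j k - Gent D \<theta> j k\<bar> <= gdev D \<theta> j k \<delta>"
  unfolding gdev_def
proof (rule cSUP_upper[OF th'])
  obtain K where K: "0 <= K" "\<And>\<theta>'. \<theta>' \<in> param_nbhd D \<theta> \<delta> ==> norm (Vf \<theta>') <= K \<and> (\<forall>j\<le>s. norm (Bf \<theta>' j) <= K)"
    using nbhd_bounded[OF th \<delta>] by blast
  show "bdd_above ((\<lambda>\<theta>'. \<bar>Gent D \<theta>' j k - Gent D \<theta> j k\<bar>) ` param_nbhd D \<theta> \<delta>)"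
  proof (rule bdd_aboveI2)
    fix \<theta>' assume a: "\<theta>' \<in> param_nbhd D \<theta> \<delta>"
    then have p: "\<theta>' \<in> param_space s" by (simp add: param_nbhd_def)
    have "\<bar>trc ((Bf \<theta>' j * Vf \<theta>') * (Bf \<theta>' k * Vf \<theta>'))\<bar> <= norm (Bf \<theta>' j * Vf \<theta>') * norm (Bf \<theta>' k * Vf \<theta>')"
      by (rule abs_trc_mult_le)
    also have "\<dots> <= (norm (Bf \<theta>' j) * norm (Vf \<theta>')) * (norm (Bf \<theta>' k) * norm (Vf \<theta>'))"
      by (intro mult_mono norm_mult_ineq) auto
    also have "\<dots> <= (K * K) * (K * K)" using K(2)[OF a] K(1) jk by (intro mult_mono) auto
    finally have "\<bar>Gent D \<theta>' j k\<bar> <= 2 * ((K * K) * (K * K))" by (simp add: Gent_trc[OF p jk] mult.assoc)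
    then show "\<bar>Gent D \<theta>' j k - Gent D \<theta> j k\<bar> <= 2 * ((K * K) * (K * K)) + \<bar>Gent D \<theta> j k\<bar>" by linarith
  qed
qed

lemma ddev_ge:
  assumes th: "\<theta> \<in> param_space s" and \<delta>: "\<delta> <= \<theta> $ 0 / 2" and jk: "j <= s" "k <= s" and th': "\<theta>' \<in> param_nbhd D \<theta> \<delta>"
  shows "\<bar>ccoef D \<theta>' j k \<phi> - ccoef D \<theta> j k \<phi>\<bar> <= ddev D \<theta> j k \<phi> \<delta>"
  unfolding ddev_def
proof (rule cSUP_upper[OF th'])
  obtain K where K: "0 <= K" "\<And>\<theta>'. \<theta>' \<in> param_nbhd D \<theta> \<delta> ==> norm (Vf \<theta>') <= K \<and> (\<forall>j\<le>s. norm (Bf \<theta>' j) <= K)"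
    using nbhd_bounded[OF th \<delta>] by blast
  show "bdd_above ((\<lambda>\<theta>'. \<bar>ccoef D \<theta>' j k \<phi> - ccoef D \<theta> j k \<phi>\<bar>) ` param_nbhd D \<theta> \<delta>)"
  proof (rule bdd_aboveI2)
    fix \<theta>' assume a: "\<theta>' \<in> param_nbhd D \<theta> \<delta>"
    then have p: "\<theta>' \<in> param_space s" by (simp add: param_nbhd_def)
    have "\<bar>\<Sum>(i1, i2, i3, i4) \<in> fclass D \<phi>. Bmat D \<theta>' j $$ (i1, i2) * Bmat D \<theta>' k $$ (i3, i4)\<bar>
      <= (\<Sum>(i1, i2, i3, i4) \<in> fclass D \<phi>. \<bar>Bmat D \<theta>' j $$ (i1, i2) * Bmat D \<theta>' k $$ (i3, i4)\<bar>)"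
      by (rule order_trans[OF sum_abs]) (auto intro!: sum_mono)
    also have "\<dots> <= (\<Sum>q \<in> fclass D \<phi>. K * K)"
    proof (intro sum_mono, clarify)
      fix i1 i2 i3 i4 assume "(i1, i2, i3, i4) \<in> fclass D \<phi>"
      then have i: "i1 < N" "i2 < N" "i3 < N" "i4 < N" by (auto simp: fclass_def quads_def)
      have "\<bar>ent (Bf \<theta>' j) i1 i2\<bar> <= K" "\<bar>ent (Bf \<theta>' k) i3 i4\<bar> <= K"
        using K(2)[OF a] jk abs_ent_le_norm order_trans by blast+
      then show "\<bar>Bmat D \<theta>' j $$ (i1, i2) * Bmat D \<theta>' k $$ (i3, i4)\<bar> <= K * K"
        using i K(1) by (simp add: Bmat_ent[OF p jk(1)] Bmat_ent[OF p jk(2)] abs_mult mult_mono)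
    qed
    also have "\<dots> = hcount D \<phi> * (K * K)" by (simp add: hcount_def)
    finally have "\<bar>ccoef D \<theta>' j k \<phi>\<bar> <= \<bar>1 / hcount D \<phi>\<bar> * (hcount D \<phi> * (K * K))"
      unfolding ccoef_def abs_mult by (intro mult_left_mono) auto
    then show "\<bar>ccoef D \<theta>' j k \<phi> - ccoef D \<theta> j k \<phi>\<bar> <= \<bar>1 / hcount D \<phi>\<bar> * (hcount D \<phi> * (K * K)) + \<bar>ccoef D \<theta> j k \<phi>\<bar>" by linarith
  qed
qed

subsection \<open>Residuals at nearby parameters\<close>

text \<open>At the true parameter this is the variance of the linear form of u with coefficients
  a.\<close>

definition "qV \<theta> a = inner a (Vf \<theta> * a)"

text \<open>The terms of a Neumann series. If v = u - (sum of c_t W_t) P v, the form of v with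
  coefficients a is that of u, minus the sum over t of c_t times the form of v with coefficients P
  W_t a. Iterating m times produces all words of m factors P W_t applied to a. Absolute values are
  summed so that the c_t, which carry the other parameter, leave behind only a factor
  \<eta>^m.\<close>

primrec Sser :: "real vec => nat => fmat => fmat => real" where
  "Sser \<theta> 0 a u = \<bar>inner a u\<bar>"
| "Sser \<theta> (Suc m) a u = (\<Sum>t\<le>s. Sser \<theta> m (Pf \<theta> * Wf t * a) u)"

lemma Sser_nonneg: "0 <= Sser \<theta> m a u"
  by (induction m arbitrary: a) (auto intro: sum_nonneg)

lemma Sser_split:
  assumes th: "\<theta> \<in> param_space s" and v: "v = u - (\<Sum>t\<le>s. c t *\<^sub>R Wf t) * (Pf \<theta> * v)"
    and c: "\<And>t. t <= s ==> \<bar>c t\<bar> <= \<eta>"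
  shows "Sser \<theta> m a v <= Sser \<theta> m a u + \<eta> * Sser \<theta> (Suc m) a v"
proof (induction m arbitrary: a)
  case 0
  have "inner a v = inner a u - inner a ((\<Sum>t\<le>s. c t *\<^sub>R Wf t) * (Pf \<theta> * v))"
    by (subst v) (simp only: inner_diff_right)
  also have "inner a ((\<Sum>t\<le>s. c t *\<^sub>R Wf t) * (Pf \<theta> * v)) = (\<Sum>t\<le>s. c t * inner (Pf \<theta> * Wf t * a) v)"
    using P_sym[OF th] by (simp add: sum_distrib_right inner_sum_right inner_times_left mult.assoc)
  finally have "\<bar>inner a v\<bar> <= \<bar>inner a u\<bar> + \<bar>\<Sum>t\<le>s. c t * inner (Pf \<theta> * Wf t * a) v\<bar>" by linarith
  also have "\<bar>\<Sum>t\<le>s. c t * inner (Pf \<theta> * Wf t * a) v\<bar> <= (\<Sum>t\<le>s. \<bar>c t * inner (Pf \<theta> * Wf t * a) v\<bar>)" by (rule sum_abs)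
  also have "\<dots> <= (\<Sum>t\<le>s. \<eta> * \<bar>inner (Pf \<theta> * Wf t * a) v\<bar>)"
    using c by (intro sum_mono) (auto simp: abs_mult intro!: mult_right_mono)
  finally show ?case by (simp add: sum_distrib_left)
next
  case (Suc m)
  have "Sser \<theta> (Suc m) a v <= (\<Sum>t\<le>s. Sser \<theta> m (Pf \<theta> * Wf t * a) u + \<eta> * Sser \<theta> (Suc m) (Pf \<theta> * Wf t * a) v)"
    unfolding Sser.simps(2)[of \<theta> m a] by (intro sum_mono Suc)
  then show ?case by (simp add: sum.distrib sum_distrib_left)
qed

lemma Sser_expand:
  assumes "\<theta> \<in> param_space s" "v = u - (\<Sum>t\<le>s. c t *\<^sub>R Wf t) * (Pf \<theta> * v)"
    "\<And>t. t <= s ==> \<bar>c t\<bar> <= \<eta>" "0 <= \<eta>"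
  shows "\<bar>inner a v\<bar> <= (\<Sum>m<M. \<eta> ^ m * Sser \<theta> m a u) + \<eta> ^ M * Sser \<theta> M a v"
proof (induction M)
  case (Suc M)
  have "\<eta> ^ M * Sser \<theta> M a v <= \<eta> ^ M * (Sser \<theta> M a u + \<eta> * Sser \<theta> (Suc M) a v)"
    using Sser_split[OF assms(1-3)] assms(4) by (intro mult_left_mono) auto
  then show ?case using Suc by (simp add: distrib_left mult.assoc mult.left_commute del: Sser.simps)
qed simp

lemma qV_nonneg: "\<theta> \<in> param_space s ==> 0 <= qV \<theta> a"
  unfolding qV_def by (intro psdm_nonneg V_psd)

text \<open>Let b = P W_t a. By \<open>P_form\<close>, qV(b) pairs a with W_t b. Cauchy-Schwarz for
  W_t and W_t \<le> C V bound its square by C^2 qV(a) qV(b), and one factor qV(b) cancels.\<close>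

lemma PW_contract:
  assumes th: "\<theta> \<in> param_space s" and t: "t <= s" and C: "0 <= C" "1 <= C * varc \<theta> t"
  shows "qV \<theta> (Pf \<theta> * Wf t * a) <= C\<^sup>2 * qV \<theta> a"
proof -
  define b where "b = Pf \<theta> * Wf t * a"
  have W: "inner x (Wf t * x) <= C * qV \<theta> x" for x
  proof -
    have "inner x (Wf t * x) <= (C * varc \<theta> t) * inner x (Wf t * x)"
      using mult_right_mono[OF C(2) psdm_nonneg[OF W_psd, of x t]] by simp
    also have "\<dots> <= C * qV \<theta> x" using V_ge[OF th t, of x] C by (simp add: qV_def mult.assoc mult_left_mono)
    finally show ?thesis .
  qed
  have "qV \<theta> b = inner a (Wf t * b)"
    using P_form[OF th, of "Wf t * a" "Wf t * a"] by (simp add: b_def qV_def mult.assoc inner_times_left)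
  then have "(qV \<theta> b)\<^sup>2 <= inner a (Wf t * a) * inner b (Wf t * b)"
    using psdm_Cauchy_Schwarz[OF W_psd] by metis
  also have "\<dots> <= (C * qV \<theta> a) * (C * qV \<theta> b)"
    by (intro mult_mono W psdm_nonneg[OF W_psd]) (use C qV_nonneg[OF th] in auto)
  finally have "qV \<theta> b * qV \<theta> b <= (C\<^sup>2 * qV \<theta> a) * qV \<theta> b" by (simp add: power2_eq_square mult_ac)
  then have "qV \<theta> b <= C\<^sup>2 * qV \<theta> a"
    using qV_nonneg[OF th, of b] qV_nonneg[OF th, of a] C
    by (cases "qV \<theta> b = 0") (auto simp: mult_le_cancel_right)
  then show ?thesis by (simp add: b_def)
qed

lemma PW_dims: "\<theta> \<in> param_space s ==> t <= s ==> mat_dims N 1 a ==> mat_dims N 1 (Pf \<theta> * Wf t * a)"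
  by (intro mat_dims_mult[of N N _ 1] mat_dims_mult[of N N _ N] P_dims W_dims)

text \<open>There are (s + 1)^m words, and each factor P W_t multiplies the root of
  \<open>qV\<close> by at most C. The dependence on v is crude: the bound serves convergence at a
  fixed outcome, while moments are treated in \<open>Sser_moment\<close>.\<close>

lemma Sser_le:
  assumes th: "\<theta> \<in> param_space s" and C: "0 <= C" "\<And>t. t <= s ==> 1 <= C * varc \<theta> t"
  shows "mat_dims N 1 a ==> Sser \<theta> m a v <= (real (s + 1) * C) ^ m * (sqrt (qV \<theta> a) * (norm v / sqrt (\<theta> $ 0)))"
proof (induction m arbitrary: a)
  case 0
  have t0: "0 < \<theta> $ 0" using th by (rule param_pos)
  have "norm a <= sqrt (qV \<theta> a / \<theta> $ 0)"
    using V_ge_norm[OF th 0] t0 by (intro real_le_rsqrt) (simp add: qV_def field_simps)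
  then have "norm a * norm v <= sqrt (qV \<theta> a / \<theta> $ 0) * norm v" by (rule mult_right_mono) simp
  then show ?case using Cauchy_Schwarz_ineq2[of a v] by (simp add: real_sqrt_divide)
next
  case (Suc m)
  have "Sser \<theta> (Suc m) a v <= (\<Sum>t\<le>s. (real (s + 1) * C) ^ m * (sqrt (qV \<theta> (Pf \<theta> * Wf t * a)) * (norm v / sqrt (\<theta> $ 0))))"
    unfolding Sser.simps using Suc.prems by (intro sum_mono Suc.IH PW_dims[OF th]) auto
  also have "\<dots> <= (\<Sum>t\<le>s. (real (s + 1) * C) ^ m * ((C * sqrt (qV \<theta> a)) * (norm v / sqrt (\<theta> $ 0))))"
  proof (intro sum_mono mult_left_mono mult_right_mono)
    fix t assume "t \<in> {..s}"
    then have "sqrt (qV \<theta> (Pf \<theta> * Wf t * a)) <= sqrt (C\<^sup>2 * qV \<theta> a)"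
      using PW_contract[OF th _ C(1)] C(2) by (intro real_sqrt_le_mono) auto
    then show "sqrt (qV \<theta> (Pf \<theta> * Wf t * a)) <= C * sqrt (qV \<theta> a)" using C(1) by (simp add: real_sqrt_mult)
  qed (use C param_pos[OF th] in auto)
  finally show ?case by (simp add: mult_ac)
qed

text \<open>\<open>weighted_sum_pow4\<close> with weights 2^{-m}, after writing \<eta>^m as 2^{-m}
  (2 \<eta>)^m. The weights add up to at most 2, whence 8 = 2^3. The coefficients of all forms of u
  in it are fixed at \<theta>, so it can be integrated term by term.\<close>

definition dom4 :: "real vec => real => fmat => fmat => real" where
  "dom4 \<theta> \<eta> a u = 8 * (\<Sum>m. (1/2) ^ m * ((2 * \<eta>) ^ m * Sser \<theta> m a u) ^ 4)"

lemma summable_dom4: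
  assumes th: "\<theta> \<in> param_space s" and C: "0 <= C" "\<And>t. t <= s ==> 1 <= C * varc \<theta> t"
    and \<eta>: "0 <= \<eta>" "4 * \<eta> * (real (s + 1) * C) <= 1" and a: "mat_dims N 1 a"
  shows "summable (\<lambda>m. (1/2) ^ m * ((2 * \<eta>) ^ m * Sser \<theta> m a u) ^ 4)"
proof (rule summable_comparison_test')
  define B where "B = sqrt (qV \<theta> a) * (norm u / sqrt (\<theta> $ 0))"
  show "summable (\<lambda>m. (1/2 :: real) ^ m * B ^ 4)" by (intro summable_mult2 summable_geometric) simp
  fix m :: nat
  have "(2 * \<eta>) ^ m * Sser \<theta> m a u <= (2 * \<eta>) ^ m * ((real (s + 1) * C) ^ m * B)"
    unfolding B_def using \<eta> by (intro mult_left_mono Sser_le[OF th C a]) auto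
  also have "\<dots> = (2 * \<eta> * (real (s + 1) * C)) ^ m * B" by (simp add: power_mult_distrib)
  also have "\<dots> <= 1 * B"
    using \<eta> C(1) qV_nonneg[OF th] param_pos[OF th] unfolding B_def
    by (intro mult_right_mono power_le_one) (auto intro!: mult_nonneg_nonneg)
  finally have "((2 * \<eta>) ^ m * Sser \<theta> m a u) ^ 4 <= B ^ 4"
    using \<eta> Sser_nonneg by (intro power_mono) auto
  then show "norm ((1/2) ^ m * ((2 * \<eta>) ^ m * Sser \<theta> m a u) ^ 4) <= (1/2) ^ m * B ^ 4"
    by (simp add: abs_mult)
qed

text \<open>The partial sums of the series stay below the fourth root of \<open>dom4\<close>, and
  the remainder is at most B times a power of q = \<eta> (s + 1) C < 1. The coefficients c do not
  occur on the right, so one bound serves all nearby parameters.\<close>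

lemma dom4_ge:
  assumes th: "\<theta> \<in> param_space s" and C: "0 <= C" "\<And>t. t <= s ==> 1 <= C * varc \<theta> t"
    and \<eta>: "0 <= \<eta>" "4 * \<eta> * (real (s + 1) * C) <= 1" and a: "mat_dims N 1 a"
    and v: "v = u - (\<Sum>t\<le>s. c t *\<^sub>R Wf t) * (Pf \<theta> * v)" and c: "\<And>t. t <= s ==> \<bar>c t\<bar> <= \<eta>"
  shows "inner a v ^ 4 <= dom4 \<theta> \<eta> a u"
proof -
  define F where "F m = (1/2) ^ m * ((2 * \<eta>) ^ m * Sser \<theta> m a u) ^ 4" for m
  define B where "B = sqrt (qV \<theta> a) * (norm v / sqrt (\<theta> $ 0))"
  have F: "summable F" unfolding F_def by (rule summable_dom4[OF th C \<eta> a])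
  have F0: "0 <= F m" for m by (simp add: F_def)
  then have dom0: "0 <= dom4 \<theta> \<eta> a u" using suminf_nonneg[OF F] unfolding dom4_def F_def[symmetric] by simp
  have part: "(\<Sum>m<M. \<eta> ^ m * Sser \<theta> m a u) <= root 4 (dom4 \<theta> \<eta> a u)" for M
  proof -
    have "(\<Sum>m<M. \<eta> ^ m * Sser \<theta> m a u) = (\<Sum>m<M. (1/2) ^ m * ((2 * \<eta>) ^ m * Sser \<theta> m a u))"
      by (intro sum.cong refl) (simp add: power_mult_distrib power_divide)
    also have "\<dots> ^ 4 <= (\<Sum>m<M. (1/2) ^ m) ^ 3 * sum F {..<M}"
      unfolding F_def by (rule weighted_sum_pow4) simp
    also have "\<dots> <= 2 ^ 3 * suminf F"
    proof (intro mult_mono power_mono)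
      show "(\<Sum>m<M. (1/2 :: real) ^ m) <= 2"
        using sum_le_suminf[of "\<lambda>m. (1/2 :: real) ^ m" "{..<M}"] suminf_geometric[of "1/2 :: real"]
        by (simp add: summable_geometric)
      show "sum F {..<M} <= suminf F" using F F0 by (intro sum_le_suminf) auto
    qed (auto intro!: sum_nonneg F0)
    finally have "(\<Sum>m<M. \<eta> ^ m * Sser \<theta> m a u) ^ 4 <= dom4 \<theta> \<eta> a u"
      unfolding dom4_def F_def[symmetric] by simp
    then have "root 4 ((\<Sum>m<M. \<eta> ^ m * Sser \<theta> m a u) ^ 4) <= root 4 (dom4 \<theta> \<eta> a u)" by simp
    then show ?thesis using \<eta>(1) by (simp add: real_root_power_cancel sum_nonneg Sser_nonneg)
  qed
  define q where "q = \<eta> * (real (s + 1) * C)"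
  have q: "0 <= q" "q < 1" using \<eta> C(1) by (auto simp: q_def)
  have le: "\<bar>inner a v\<bar> <= root 4 (dom4 \<theta> \<eta> a u) + q ^ M * B" for M
  proof -
    have "\<eta> ^ M * Sser \<theta> M a v <= \<eta> ^ M * ((real (s + 1) * C) ^ M * B)"
      unfolding B_def using \<eta> by (intro mult_left_mono Sser_le[OF th C a]) auto
    also have "\<dots> = q ^ M * B" by (simp add: q_def power_mult_distrib)
    finally show ?thesis using Sser_expand[OF th v c \<eta>(1), where a = a and M = M] part[of M] by linarith
  qed
  have "(\<lambda>M. root 4 (dom4 \<theta> \<eta> a u) + q ^ M * B) \<longlonglongrightarrow> root 4 (dom4 \<theta> \<eta> a u) + 0 * B"
    using q by (intro tendsto_intros LIMSEQ_power_zero) auto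
  then have "\<bar>inner a v\<bar> <= root 4 (dom4 \<theta> \<eta> a u)"
    using le by (intro LIMSEQ_le_const[where X = "\<lambda>M. root 4 (dom4 \<theta> \<eta> a u) + q ^ M * B"]) auto
  then have "\<bar>inner a v\<bar> ^ 4 <= root 4 (dom4 \<theta> \<eta> a u) ^ 4" by (intro power_mono) auto
  then show ?thesis using dom0 by simp
qed

text \<open>Row i of the hat matrix X A, written as a column.\<close>

definition "lev \<theta> i = trp (Xf * Af \<theta>) * unit_col i"

lemma lev_dims: "\<theta> \<in> param_space s ==> i < N ==> mat_dims N 1 (lev \<theta> i)"
  unfolding lev_def by (intro mat_dims_mult[of N N _ 1] mat_dims_unit_col) (auto intro: mat_dims_mult[OF X_dims A_dims])

lemma A_V_A:
  assumes th: "\<theta> \<in> param_space s"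
  shows "Af \<theta> * Vf \<theta> * trp (Af \<theta>) = Ci \<theta>"
proof -
  have a: "Vf \<theta> * (Vi \<theta> * (Xf * B)) = Xf * B" for B
    using V_Vi(1)[OF th] X_dims by (metis idm_mult_left mult.assoc)
  have "Vf \<theta> * trp (Af \<theta>) = Xf * Ci \<theta>"
    by (simp add: Af_def trp_mult Vi_sym[OF th] Ci_sym[OF th] mult.assoc a)
  then have "Af \<theta> * Vf \<theta> * trp (Af \<theta>) = Af \<theta> * Xf * Ci \<theta>" by (simp add: mult.assoc)
  then show ?thesis using A_X[OF th] Ci(3)[OF th] by simp
qed

text \<open>\<open>qV\<close> of this vector is x_i' (X' V^{-1} X)^{-1} x_i, the variance of a
  fitted value. Bounded rows of X and a large smallest eigenvalue of X' V^{-1} X make it small, and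
  with it the distance between residuals and errors.\<close>

lemma qV_lev:
  assumes th: "\<theta> \<in> param_space s" and i: "i < N"
    and l: "0 < l" "l <= lambda_min (transpose_mat (fixX D) * mat_inv (Vmat D \<theta>) * fixX D)"
  shows "qV \<theta> (lev \<theta> i) <= (vec_norm2 (row (fixX D) i))\<^sup>2 / l"
proof -
  define x where "x = trp Xf * unit_col i"
  define c where "c = Ci \<theta> * x"
  have i': "i < dim_row (fixX D)" using i by (simp add: nobs_def)
  have dx: "mat_dims p 1 x" unfolding x_def using X_dims mat_dims_unit_col[OF i] by (intro mat_dims_mult[of p N]) auto
  have dc: "mat_dims p 1 c" unfolding c_def by (rule mat_dims_mult[OF Ci(3)[OF th] dx])
  have xc: "x = XVX \<theta> * c" using Ci(1)[OF th] dx by (simp add: c_def mult.assoc[symmetric])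
  have "x = fv (row (fixX D) i)"
  proof (rule fmat_eqI)
    fix a b
    show "ent x a b = ent (fv (row (fixX D) i)) a b"
      using i' X_dims i by (auto simp: x_def ent_times_right[OF mat_dims_unit_col[OF i]] ent_unit_col mult_delta_right Xf_def fm_def fv_def nobs_def)
  qed
  then have nx: "norm x = vec_norm2 (row (fixX D) i)" by (simp add: norm_fv)
  have "l * (norm c)\<^sup>2 <= lambda_min (transpose_mat (fixX D) * mat_inv (Vmat D \<theta>) * fixX D) * (norm c)\<^sup>2"
    using l by (intro mult_right_mono) auto
  also have "\<dots> <= inner c x"
    using lambda_min_le[OF XVX_carrier[OF th] _ dc] fm_XVX[OF th] XVX_sym[OF th] xc by simp
  finally have 1: "l * (norm c)\<^sup>2 <= inner c x" .
  have 2: "inner c x <= norm c * norm x" by (rule norm_cauchy_schwarz)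
  have "l * norm c <= norm x"
  proof (cases "c = 0")
    case False
    have "(l * norm c) * norm c <= norm x * norm c" using 1 2 by (simp add: power2_eq_square mult_ac)
    then show ?thesis using False by simp
  qed simp
  then have "norm c <= norm x / l" using l by (simp add: field_simps)
  then have "norm c * norm x <= norm x / l * norm x" by (rule mult_right_mono) simp
  then have "inner c x <= (norm x)\<^sup>2 / l" using 2 by (simp add: power2_eq_square)
  moreover have "qV \<theta> (lev \<theta> i) = inner c x"
  proof -
    have "qV \<theta> (lev \<theta> i) = inner x (Af \<theta> * Vf \<theta> * trp (Af \<theta>) * x)"
      by (simp add: qV_def lev_def x_def trp_mult inner_times_left mult.assoc)
    then show ?thesis by (simp add: A_V_A[OF th] c_def inner_commute)
  qed
  ultimately show ?thesis using nx by simp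
qed

text \<open>The correction \<open>X (b - \<beta>)\<close> to the residuals at \<open>\<theta>'\<close>, in terms of linear forms fixed at \<open>\<theta>\<close>.\<close>

lemma u_hat_eq:
  assumes th: "\<theta> \<in> param_space s" and th': "\<theta>' \<in> param_space s"
    and y: "y \<in> carrier_vec N" "fv y = Xf * b + u" and b: "mat_dims p 1 b" and u: "mat_dims N 1 u" and i: "i < N"
  defines "v \<equiv> u - (Vf \<theta>' - Vf \<theta>) * (Pf \<theta>' * u)"
  shows "u_hat D \<theta>' y $ i = ent u i 0 - inner (lev \<theta> i) v"
    "v = u - (\<Sum>t\<le>s. (varc \<theta>' t - varc \<theta> t) *\<^sub>R Wf t) * (Pf \<theta> * v)"
proof -
  define \<Delta> where "\<Delta> = Vf \<theta>' - Vf \<theta>"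
  have \<Delta>: "(\<Sum>t\<le>s. (varc \<theta>' t - varc \<theta> t) *\<^sub>R Wf t) = \<Delta>"
    by (simp add: \<Delta>_def Vf_def scaleR_diff_left sum_subtractf)
  have Pv: "Pf \<theta> * v = Pf \<theta>' * u"
  proof -
    have "Pf \<theta> * v = (Pf \<theta> - Pf \<theta> * \<Delta> * Pf \<theta>') * u"
      by (simp add: v_def \<Delta>_def left_diff_distrib right_diff_distrib mult.assoc)
    also have "\<dots> = Pf \<theta>' * u" using P_resolvent[OF th th'] by (simp add: \<Delta>_def)
    finally show ?thesis .
  qed
  then show "v = u - (\<Sum>t\<le>s. (varc \<theta>' t - varc \<theta> t) *\<^sub>R Wf t) * (Pf \<theta> * v)"
    unfolding \<Delta> by (simp add: v_def \<Delta>_def)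
  have AVP: "Af \<theta> * (Vf \<theta> * (Pf \<theta>' * u)) = 0"
  proof -
    have "Af \<theta> * Vf \<theta> = Ci \<theta> * trp Xf"
      using V_Vi(2)[OF th] X_dims by (simp add: Af_def mult.assoc)
    then have "Af \<theta> * (Vf \<theta> * (Pf \<theta>' * u)) = Ci \<theta> * (trp Xf * Pf \<theta>') * u"
      by (metis mult.assoc)
    then show ?thesis using X_P[OF th'] by simp
  qed
  \<comment> \<open>At \<open>\<theta>'\<close> the vector u minus V P u lies in the range of X,
    which every least squares matrix inverts, and the other part of v is annihilated by
    \<open>AVP\<close>. So fitting v at \<theta> gives the coefficients of u at
    \<open>\<theta>'\<close>.\<close>
  have Av: "Af \<theta> * v = Af \<theta>' * u"
  proof -
    have "v = u - Vf \<theta>' * Pf \<theta>' * u + Vf \<theta> * (Pf \<theta>' * u)"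
      by (simp add: v_def left_diff_distrib mult.assoc)
    also have "u - Vf \<theta>' * Pf \<theta>' * u = Xf * (Af \<theta>' * u)"
      using u by (simp add: V_P[OF th'] left_diff_distrib mult.assoc)
    finally have "Af \<theta> * v = Af \<theta> * Xf * (Af \<theta>' * u)" by (simp add: distrib_left AVP mult.assoc)
    then show ?thesis using A_X[OF th] A_dims[OF th'] u by (metis idm_mult_left mult.assoc)
  qed
  have bh: "beta_hat D \<theta>' y \<in> carrier_vec p"
    unfolding beta_hat_def Let_def
    by (rule mult_mat_vec_carrier[OF _ y(1)], rule mult_carrier_mat[OF _ Vinv_carrier[OF th']],
        rule mult_carrier_mat[OF Cinv_carrier[OF th']]) (auto simp: nobs_def)
  have bh': "fv (beta_hat D \<theta>' y) = Af \<theta>' * fv y"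
    using Vinv_carrier[OF th'] Cinv_carrier[OF th'] y(1)
    by (auto simp: beta_hat_def Let_def fm_mult_vec fm_mult fm_transpose Af_def Ci_def Xf_def Vi_def nobs_def mult.assoc)
  have "u_hat D \<theta>' y $ i = ent (fv (u_hat D \<theta>' y)) i 0"
    using i y(1) by (subst ent_fv) (auto simp: u_hat_def nobs_def)
  also have "fv (u_hat D \<theta>' y) = fv y - Xf * (Af \<theta>' * fv y)"
    using y(1) bh bh' by (simp add: u_hat_def fv_diff fm_mult_vec Xf_def nobs_def)
  also have "\<dots> = u - Xf * (Af \<theta>' * u)"
  proof -
    have "Xf * (Af \<theta>' * (Xf * b)) = Xf * b"
      using A_X[OF th'] b by (metis idm_mult_left mult.assoc)
    then show ?thesis by (simp add: y(2) distrib_left)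
  qed
  also have "ent \<dots> i 0 = ent u i 0 - ent (Xf * Af \<theta> * v) i 0" by (simp add: Av mult.assoc)
  also have "ent (Xf * Af \<theta> * v) i 0 = inner (unit_col i) (Xf * Af \<theta> * v)"
    by (subst inner_fmat_left[OF mat_dims_unit_col[OF i]]) (use i in \<open>simp add: ent_unit_col mult_delta_left\<close>)
  also have "\<dots> = inner (lev \<theta> i) v" by (simp add: lev_def inner_times_left)
  finally show "u_hat D \<theta>' y $ i = ent u i 0 - inner (lev \<theta> i) v" .
qed

end

subsection \<open>Moments of linear forms in independent variables\<close>

text \<open>The model states independence of the vectors alpha_t and, separately, of the components
  inside each; moments need all components jointly. Filling the missing positions of a finite
  subfamily with \<open>UNIV\<close> turns it into full rectangles, where the two hypotheses
  multiply.\<close>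

lemma (in prob_space) indep_vars_Sigma:
  fixes a :: "'t => 'q => 'a => real"
  assumes fin: "finite T" "\<And>t. t \<in> T ==> finite (Q t)"
    and A: "indep_vars (\<lambda>t. \<Pi>\<^sub>M q\<in>Q t. borel) (\<lambda>t \<omega>. \<lambda>q\<in>Q t. a t q \<omega>) T"
    and B: "\<And>t. t \<in> T ==> indep_vars (\<lambda>_. borel) (a t) (Q t)"
  shows "indep_vars (\<lambda>_. borel) (\<lambda>p. a (fst p) (snd p)) (Sigma T Q)"
  unfolding indep_vars_def2
proof (intro conjI ballI indep_setsI)
  have rv: "random_variable borel (a t q)" if "t \<in> T" "q \<in> Q t" for t q
    using B[OF that(1)] that(2) by (auto simp: indep_vars_def2)
  show "random_variable borel (a (fst p) (snd p))" if "p \<in> Sigma T Q" for p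
    using that rv by auto
  show "{a (fst p) (snd p) -` S \<inter> space M |S. S \<in> sets borel} \<subseteq> events" if "p \<in> Sigma T Q" for p
    using that rv by (auto intro: measurable_sets)
  fix E J
  assume J: "J \<noteq> {}" "J \<subseteq> Sigma T Q" "finite J"
    and E: "\<forall>j\<in>J. E j \<in> {a (fst j) (snd j) -` S \<inter> space M |S. S \<in> sets borel}"
  from E have "\<forall>j\<in>J. \<exists>S. S \<in> sets borel \<and> E j = a (fst j) (snd j) -` S \<inter> space M" by auto
  then obtain S where S: "\<And>j. j \<in> J ==> S j \<in> sets borel \<and> E j = a (fst j) (snd j) -` S j \<inter> space M" by metis
  define S' where "S' j = (if j \<in> J then S j else UNIV)" for j
  have S': "S' j \<in> sets borel" for j using S by (auto simp: S'_def)
  define F where "F t = PiE (Q t) (\<lambda>q. S' (t, q))" for t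
  define vec where "vec t \<omega> = (\<lambda>q\<in>Q t. a t q \<omega>)" for t \<omega>
  have "T \<noteq> {}" using J by auto
  have "(\<Inter>j\<in>J. E j) = (\<Inter>t\<in>T. vec t -` F t \<inter> space M)"
  proof (intro equalityI subsetI)
    fix \<omega> assume w: "\<omega> \<in> (\<Inter>j\<in>J. E j)"
    then have sp: "\<omega> \<in> space M" using J(1) S by auto
    have wE: "\<omega> \<in> E j" if "j \<in> J" for j using w that by blast
    have "a t q \<omega> \<in> S' (t, q)" for t q using wE[of "(t, q)"] S[of "(t, q)"] by (cases "(t, q) \<in> J") (auto simp: S'_def)
    then show "\<omega> \<in> (\<Inter>t\<in>T. vec t -` F t \<inter> space M)" using sp by (auto simp: vec_def F_def)
  next
    fix \<omega> assume w: "\<omega> \<in> (\<Inter>t\<in>T. vec t -` F t \<inter> space M)"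
    have wt: "vec t \<omega> \<in> F t \<and> \<omega> \<in> space M" if "t \<in> T" for t using w that by blast
    show "\<omega> \<in> (\<Inter>j\<in>J. E j)"
    proof
      fix j assume j: "j \<in> J"
      then have "vec (fst j) \<omega> \<in> F (fst j)" "\<omega> \<in> space M" "snd j \<in> Q (fst j)" using wt[of "fst j"] J(2) by auto
      then show "\<omega> \<in> E j" using S[OF j] j by (auto simp: vec_def F_def S'_def PiE_iff split: if_splits)
    qed
  qed
  then have "prob (\<Inter>j\<in>J. E j) = (\<Prod>t\<in>T. prob (vec t -` F t \<inter> space M))"
    using indep_varsD_finite[OF A \<open>T \<noteq> {}\<close> fin(1), of F] fin(2) S' unfolding vec_def F_def
    by (simp add: sets_PiM_I_finite)
  also have "\<dots> = (\<Prod>t\<in>T. \<Prod>q\<in>Q t. prob (a t q -` S' (t, q) \<inter> space M))"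
  proof (intro prod.cong refl)
    fix t assume t: "t \<in> T"
    show "prob (vec t -` F t \<inter> space M) = (\<Prod>q\<in>Q t. prob (a t q -` S' (t, q) \<inter> space M))"
    proof (cases "Q t = {}")
      case True
      then have "vec t -` F t \<inter> space M = space M" by (auto simp: vec_def F_def)
      then show ?thesis using True by (simp add: prob_space)
    next
      case False
      have "vec t -` F t \<inter> space M = (\<Inter>q\<in>Q t. a t q -` S' (t, q) \<inter> space M)"
        using False by (auto simp: vec_def F_def)
      then show ?thesis using indep_varsD_finite[OF B[OF t] False fin(2)[OF t]] S' by simp
    qed
  qed
  also have "\<dots> = (\<Prod>p\<in>Sigma T Q. prob (a (fst p) (snd p) -` S' p \<inter> space M))"
    using fin by (subst prod.Sigma) (auto simp: case_prod_beta)
  also have "\<dots> = (\<Prod>p\<in>J. prob (a (fst p) (snd p) -` S' p \<inter> space M))"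
    using J fin by (intro prod.mono_neutral_right) (auto simp: S'_def prob_space)
  also have "\<dots> = (\<Prod>j\<in>J. prob (E j))" using S by (intro prod.cong) (auto simp: S'_def)
  finally show "prob (\<Inter>j\<in>J. E j) = (\<Prod>j\<in>J. prob (E j))" .
qed

lemma abs_prod4_le:
  fixes a b c d :: real
  shows "\<bar>a * b * c * d\<bar> <= (a ^ 4 + b ^ 4 + c ^ 4 + d ^ 4) / 4"
proof -
  have e: "\<bar>x * y\<bar> <= (x\<^sup>2 + y\<^sup>2) / 2" for x y :: real
    using sum_squares_bound[of "\<bar>x\<bar>" "\<bar>y\<bar>"] by (simp add: abs_mult)
  have "\<bar>a * b * c * d\<bar> = \<bar>(a * b) * (c * d)\<bar>" by (simp add: mult.assoc)
  also have "\<dots> <= ((a * b)\<^sup>2 + (c * d)\<^sup>2) / 2" by (rule e)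
  also have "\<dots> <= ((a ^ 4 + b ^ 4) / 2 + (c ^ 4 + d ^ 4) / 2) / 2"
  proof (intro divide_right_mono add_mono)
    show "(a * b)\<^sup>2 <= (a ^ 4 + b ^ 4) / 2" "(c * d)\<^sup>2 <= (c ^ 4 + d ^ 4) / 2"
      using e[of "a\<^sup>2" "b\<^sup>2"] e[of "c\<^sup>2" "d\<^sup>2"] by (simp_all add: power_mult_distrib)
  qed simp
  finally show ?thesis by argo
qed

lemma (in prob_space) integrable_prod4:
  fixes X1 X2 X3 X4 :: "'a => real"
  assumes [measurable]: "X1 \<in> borel_measurable M" "X2 \<in> borel_measurable M" "X3 \<in> borel_measurable M" "X4 \<in> borel_measurable M"
    and i: "integrable M (\<lambda>\<omega>. X1 \<omega> ^ 4)" "integrable M (\<lambda>\<omega>. X2 \<omega> ^ 4)" "integrable M (\<lambda>\<omega>. X3 \<omega> ^ 4)" "integrable M (\<lambda>\<omega>. X4 \<omega> ^ 4)"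
  shows "integrable M (\<lambda>\<omega>. X1 \<omega> * X2 \<omega> * X3 \<omega> * X4 \<omega>)"
proof (rule Bochner_Integration.integrable_bound)
  show "integrable M (\<lambda>\<omega>. (X1 \<omega> ^ 4 + X2 \<omega> ^ 4 + X3 \<omega> ^ 4 + X4 \<omega> ^ 4) / 4)" using i by simp
  show "AE \<omega> in M. norm (X1 \<omega> * X2 \<omega> * X3 \<omega> * X4 \<omega>) <= norm ((X1 \<omega> ^ 4 + X2 \<omega> ^ 4 + X3 \<omega> ^ 4 + X4 \<omega> ^ 4) / 4)"
    by (intro AE_I2) (metis abs_prod4_le abs_ge_self order_trans real_norm_def)
qed measurable

locale indep_effects = prob_space M for M :: "'w measure" +
  fixes \<xi> :: "'i => 'w => real" and I :: "'i set"
  assumes fin: "finite I"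
    and indep: "indep_vars (\<lambda>_. borel) \<xi> I"
    and int4: "\<And>p. p \<in> I ==> integrable M (\<lambda>\<omega>. \<xi> p \<omega> ^ 4)"
    and mean0: "\<And>p. p \<in> I ==> expectation (\<xi> p) = 0"
begin

definition "mv p = expectation (\<lambda>\<omega>. \<xi> p \<omega> ^ 2)"
text \<open>The fourth cumulant of a centred variable, the only place where the law differs from a
  normal one as far as fourth moments are concerned.\<close>

definition "kap p = expectation (\<lambda>\<omega>. \<xi> p \<omega> ^ 4) - 3 * (mv p)\<^sup>2"
definition "lin J a \<omega> = (\<Sum>p\<in>J. a p * \<xi> p \<omega>)"

lemma rv [measurable]: "p \<in> I ==> \<xi> p \<in> borel_measurable M"
  using indep by (auto simp: indep_vars_def2)

lemma lin_measurable [measurable]: "J \<subseteq> I ==> lin J a \<in> borel_measurable M"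
  unfolding lin_def by (intro borel_measurable_sum borel_measurable_times borel_measurable_const) (use rv in auto)

lemma lin_pow4_le: "lin J a \<omega> ^ 4 <= (\<Sum>p\<in>J. \<bar>a p\<bar>) ^ 3 * (\<Sum>p\<in>J. \<bar>a p\<bar> * \<xi> p \<omega> ^ 4)"
proof -
  have "lin J a \<omega> = (\<Sum>p\<in>J. \<bar>a p\<bar> * (sgn (a p) * \<xi> p \<omega>))"
    unfolding lin_def by (intro sum.cong refl) (simp add: mult.assoc[symmetric] abs_mult_sgn)
  also have "\<dots> ^ 4 <= (\<Sum>p\<in>J. \<bar>a p\<bar>) ^ 3 * (\<Sum>p\<in>J. \<bar>a p\<bar> * (sgn (a p) * \<xi> p \<omega>) ^ 4)"
    by (rule weighted_sum_pow4) simp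
  also have "(\<Sum>p\<in>J. \<bar>a p\<bar> * (sgn (a p) * \<xi> p \<omega>) ^ 4) = (\<Sum>p\<in>J. \<bar>a p\<bar> * \<xi> p \<omega> ^ 4)"
    by (intro sum.cong refl) (auto simp: sgn_real_def power_mult_distrib)
  finally show ?thesis .
qed

lemma lin_int4: "J \<subseteq> I ==> integrable M (\<lambda>\<omega>. lin J a \<omega> ^ 4)"
proof (rule Bochner_Integration.integrable_bound)
  assume J: "J \<subseteq> I"
  show "integrable M (\<lambda>\<omega>. (\<Sum>p\<in>J. \<bar>a p\<bar>) ^ 3 * (\<Sum>p\<in>J. \<bar>a p\<bar> * \<xi> p \<omega> ^ 4))"
    using int4 J by (intro integrable_mult_right Bochner_Integration.integrable_sum) auto
  show "AE \<omega> in M. norm (lin J a \<omega> ^ 4) <= norm ((\<Sum>p\<in>J. \<bar>a p\<bar>) ^ 3 * (\<Sum>p\<in>J. \<bar>a p\<bar> * \<xi> p \<omega> ^ 4))"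
  proof (intro AE_I2)
    fix \<omega>
    show "norm (lin J a \<omega> ^ 4) <= norm ((\<Sum>p\<in>J. \<bar>a p\<bar>) ^ 3 * (\<Sum>p\<in>J. \<bar>a p\<bar> * \<xi> p \<omega> ^ 4))"
      using lin_pow4_le[of J a \<omega>] sum_nonneg[of J "\<lambda>p. \<bar>a p\<bar> * \<xi> p \<omega> ^ 4"] by (simp add: abs_mult)
  qed
  show "(\<lambda>\<omega>. lin J a \<omega> ^ 4) \<in> borel_measurable M" using J by measurable
qed

lemma lin_prod4_int: "J \<subseteq> I ==> integrable M (\<lambda>\<omega>. lin J a \<omega> * lin J b \<omega> * lin J c \<omega> * lin J d \<omega>)"
  by (intro integrable_prod4 lin_int4) auto

lemma lin_prod3_int: "J \<subseteq> I ==> integrable M (\<lambda>\<omega>. lin J a \<omega> * lin J b \<omega> * lin J c \<omega>)"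
  using integrable_prod4[of "lin J a" "lin J b" "lin J c" "\<lambda>_. 1"] lin_int4 by simp

lemma lin_prod2_int: "J \<subseteq> I ==> integrable M (\<lambda>\<omega>. lin J a \<omega> * lin J b \<omega>)"
  using integrable_prod4[of "lin J a" "lin J b" "\<lambda>_. 1" "\<lambda>_. 1"] lin_int4 by simp

lemma lin_int: "J \<subseteq> I ==> integrable M (\<lambda>\<omega>. lin J a \<omega>)"
  using integrable_prod4[of "lin J a" "\<lambda>_. 1" "\<lambda>_. 1" "\<lambda>_. 1"] lin_int4 by simp

lemma pow_int: "p \<in> I ==> k <= 4 ==> integrable M (\<lambda>\<omega>. \<xi> p \<omega> ^ k)"
proof (rule Bochner_Integration.integrable_bound)
  assume p: "p \<in> I" and k: "k <= 4"
  show "integrable M (\<lambda>\<omega>. 1 + \<xi> p \<omega> ^ 4)" using int4[OF p] by simp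
  have "\<bar>x\<bar> ^ k <= 1 + x ^ 4" for x :: real
  proof (cases "\<bar>x\<bar> <= 1")
    case True
    then have "\<bar>x\<bar> ^ k <= 1" by (simp add: power_le_one)
    moreover have "0 <= x ^ 4" by simp
    ultimately show ?thesis by linarith
  next
    case False
    then have "\<bar>x\<bar> ^ k <= \<bar>x\<bar> ^ 4" using k by (intro power_increasing) auto
    then show ?thesis by simp
  qed
  then show "AE \<omega> in M. norm (\<xi> p \<omega> ^ k) <= norm (1 + \<xi> p \<omega> ^ 4)"
    by (intro AE_I2) (simp add: power_abs)
  show "(\<lambda>\<omega>. \<xi> p \<omega> ^ k) \<in> borel_measurable M" using p by measurable
qed

text \<open>General functions of disjoint blocks are allowed because the rule serves the moment
  inductions as well as the truncated products, which are not linear in the effects.\<close>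

lemma disjoint_mult:
  assumes AB: "A \<inter> B = {}" "A \<subseteq> I" "B \<subseteq> I"
    and F[measurable]: "F \<in> borel_measurable (PiM A (\<lambda>_. borel))" and G[measurable]: "G \<in> borel_measurable (PiM B (\<lambda>_. borel))"
    and i: "integrable M (\<lambda>\<omega>. F (\<lambda>i\<in>A. \<xi> i \<omega>))" "integrable M (\<lambda>\<omega>. G (\<lambda>i\<in>B. \<xi> i \<omega>))"
  shows "expectation (\<lambda>\<omega>. F (\<lambda>i\<in>A. \<xi> i \<omega>) * G (\<lambda>i\<in>B. \<xi> i \<omega>)) = expectation (\<lambda>\<omega>. F (\<lambda>i\<in>A. \<xi> i \<omega>)) * expectation (\<lambda>\<omega>. G (\<lambda>i\<in>B. \<xi> i \<omega>) :: real)"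
    "integrable M (\<lambda>\<omega>. F (\<lambda>i\<in>A. \<xi> i \<omega>) * G (\<lambda>i\<in>B. \<xi> i \<omega>))"
proof -
  have "indep_var borel (F \<circ> (\<lambda>\<omega>. \<lambda>i\<in>A. \<xi> i \<omega>)) borel (G \<circ> (\<lambda>\<omega>. \<lambda>i\<in>B. \<xi> i \<omega>))"
    by (rule indep_var_compose[OF indep_var_restrict[OF indep AB] F G])
  then have "indep_var borel (\<lambda>\<omega>. F (\<lambda>i\<in>A. \<xi> i \<omega>)) borel (\<lambda>\<omega>. G (\<lambda>i\<in>B. \<xi> i \<omega>))" by (simp add: comp_def)
  from indep_var_lebesgue_integral[OF this i] indep_var_integrable[OF this i]
  show "expectation (\<lambda>\<omega>. F (\<lambda>i\<in>A. \<xi> i \<omega>) * G (\<lambda>i\<in>B. \<xi> i \<omega>)) = expectation (\<lambda>\<omega>. F (\<lambda>i\<in>A. \<xi> i \<omega>)) * expectation (\<lambda>\<omega>. G (\<lambda>i\<in>B. \<xi> i \<omega>) :: real)"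
    "integrable M (\<lambda>\<omega>. F (\<lambda>i\<in>A. \<xi> i \<omega>) * G (\<lambda>i\<in>B. \<xi> i \<omega>))" .
qed

text \<open>\<open>lin\<close> as a function of the restricted family of variables, the shape that
  \<open>disjoint_mult\<close> requires.\<close>

definition "lf J a x = (\<Sum>p\<in>J. a p * x p)" for x :: "'i => real" and a :: "'i => real"

lemma lf_measurable [measurable]: "lf J a \<in> borel_measurable (PiM J (\<lambda>_. borel))"
  unfolding lf_def by (intro borel_measurable_sum borel_measurable_times borel_measurable_const measurable_component_singleton)

lemma lf_lin: "lf J a (\<lambda>i\<in>J. \<xi> i \<omega>) = lin J a \<omega>"
  by (simp add: lf_def lin_def)

lemma pow_mult:
  assumes p: "p \<in> I" "J \<subseteq> I" "p \<notin> J" and k: "k <= 4"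
    and G: "G \<in> borel_measurable (PiM J (\<lambda>_. borel))" and i: "integrable M (\<lambda>\<omega>. G (\<lambda>i\<in>J. \<xi> i \<omega>))"
  shows "expectation (\<lambda>\<omega>. \<xi> p \<omega> ^ k * G (\<lambda>i\<in>J. \<xi> i \<omega>)) = expectation (\<lambda>\<omega>. \<xi> p \<omega> ^ k) * expectation (\<lambda>\<omega>. G (\<lambda>i\<in>J. \<xi> i \<omega>) :: real)"
    "integrable M (\<lambda>\<omega>. \<xi> p \<omega> ^ k * G (\<lambda>i\<in>J. \<xi> i \<omega>))"
proof -
  have "(\<lambda>x. (x p :: real) ^ k) \<in> borel_measurable (PiM {p} (\<lambda>_. borel))"
    by (intro borel_measurable_power measurable_component_singleton) simp
  from disjoint_mult[OF _ _ p(2) this G, simplified] pow_int[OF p(1) k] p i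
  show "expectation (\<lambda>\<omega>. \<xi> p \<omega> ^ k * G (\<lambda>i\<in>J. \<xi> i \<omega>)) = expectation (\<lambda>\<omega>. \<xi> p \<omega> ^ k) * expectation (\<lambda>\<omega>. G (\<lambda>i\<in>J. \<xi> i \<omega>) :: real)"
    "integrable M (\<lambda>\<omega>. \<xi> p \<omega> ^ k * G (\<lambda>i\<in>J. \<xi> i \<omega>))" by auto
qed

lemma lin_insert: "finite J ==> p \<notin> J ==> lin (insert p J) a \<omega> = lin J a \<omega> + a p * \<xi> p \<omega>"
  by (simp add: lin_def)

lemma lin_mean: "J \<subseteq> I ==> expectation (lin J a) = 0"
proof -
  assume J: "J \<subseteq> I"
  have "expectation (lin J a) = (\<Sum>p\<in>J. a p * expectation (\<xi> p))"
    unfolding lin_def using pow_int[of _ 1] J by (subst Bochner_Integration.integral_sum) auto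
  then show ?thesis using mean0 J by (auto intro!: sum.neutral)
qed

definition "S2 J a b = (\<Sum>p\<in>J. mv p * a p * b p)"
definition "S4 J a b c d = (\<Sum>p\<in>J. kap p * a p * b p * c p * d p)"

lemma lin_moment2:
  assumes "J \<subseteq> I"
  shows "expectation (\<lambda>\<omega>. lin J a \<omega> * lin J b \<omega>) = S2 J a b"
proof -
  have "finite J" using assms fin by (rule finite_subset)
  then show ?thesis using assms
  proof (induction J)
    case (insert p J)
    then have p: "p \<in> I" "J \<subseteq> I" "p \<notin> J" by auto
    let ?A = "lin J a" and ?B = "lin J b"
    have e: "lin (insert p J) a \<omega> * lin (insert p J) b \<omega> =
      ?A \<omega> * ?B \<omega> + (\<xi> p \<omega> ^ 1 * (a p * lf J b (\<lambda>i\<in>J. \<xi> i \<omega>) + b p * lf J a (\<lambda>i\<in>J. \<xi> i \<omega>)) + a p * b p * \<xi> p \<omega> ^ 2)" for \<omega>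
      using insert by (simp add: lin_insert lf_lin algebra_simps power2_eq_square)
    have G: "integrable M (\<lambda>\<omega>. a p * lf J b (\<lambda>i\<in>J. \<xi> i \<omega>) + b p * lf J a (\<lambda>i\<in>J. \<xi> i \<omega>))"
      using lin_int[OF p(2)] by (simp add: lf_lin)
    have k: "(1 :: nat) <= 4" by simp
    have gm: "(\<lambda>x. a p * lf J b x + b p * lf J a x) \<in> borel_measurable (PiM J (\<lambda>_. borel))" by measurable
    note m = pow_mult[OF p k gm G]
    have i2: "integrable M (\<lambda>\<omega>. a p * b p * \<xi> p \<omega> ^ 2)" using pow_int[OF p(1), of 2] by simp
    have "expectation (\<lambda>\<omega>. \<xi> p \<omega> ^ 1) = 0" using mean0[OF p(1)] by simp
    then have "expectation (\<lambda>\<omega>. lin (insert p J) a \<omega> * lin (insert p J) b \<omega>) = S2 J a b + (0 + a p * b p * mv p)"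
      unfolding e Bochner_Integration.integral_add[OF lin_prod2_int[OF p(2)] Bochner_Integration.integrable_add[OF m(2) i2]]
        Bochner_Integration.integral_add[OF m(2) i2] m(1) insert.IH[OF p(2)]
      by (simp add: mv_def)
    then show ?case using insert by (simp add: S2_def)
  qed (simp add: lin_def S2_def)
qed

text \<open>Induction on the index set, expanding in powers of the new variable. Its first power has
  mean 0, the third is paired with a linear form of mean 0, the second with covariances of the old
  forms, and the fourth contributes the cumulant plus three squared variances.\<close>

lemma lin_moment4:
  assumes "J \<subseteq> I"
  shows "expectation (\<lambda>\<omega>. lin J a \<omega> * lin J b \<omega> * lin J c \<omega> * lin J d \<omega>) =
    S4 J a b c d + S2 J a b * S2 J c d + S2 J a c * S2 J b d + S2 J a d * S2 J b c"
proof -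
  have "finite J" using assms fin by (rule finite_subset)
  then show ?thesis using assms
  proof (induction J)
    case (insert p J)
    then have p: "p \<in> I" "J \<subseteq> I" "p \<notin> J" by auto
    have S2i: "S2 (insert p J) x y = mv p * x p * y p + S2 J x y" for x y using insert by (simp add: S2_def)
    have S4i: "S4 (insert p J) a b c d = kap p * a p * b p * c p * d p + S4 J a b c d" using insert by (simp add: S4_def)
    let ?A = "lf J a" and ?B = "lf J b" and ?C = "lf J c" and ?D = "lf J d"
    let ?r = "\<lambda>\<omega>. \<lambda>i\<in>J. \<xi> i \<omega>"
    define G1 where "G1 x = a p * (?B x * ?C x * ?D x) + b p * (?A x * ?C x * ?D x) + c p * (?A x * ?B x * ?D x) + d p * (?A x * ?B x * ?C x)" for x
    define G2 where "G2 x = a p * b p * (?C x * ?D x) + a p * c p * (?B x * ?D x) + a p * d p * (?B x * ?C x)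
      + b p * c p * (?A x * ?D x) + b p * d p * (?A x * ?C x) + c p * d p * (?A x * ?B x)" for x
    define G3 where "G3 x = a p * b p * c p * ?D x + a p * b p * d p * ?C x + a p * c p * d p * ?B x + b p * c p * d p * ?A x" for x
    have [measurable]: "G1 \<in> borel_measurable (PiM J (\<lambda>_. borel))" "G2 \<in> borel_measurable (PiM J (\<lambda>_. borel))" "G3 \<in> borel_measurable (PiM J (\<lambda>_. borel))"
      unfolding G1_def[abs_def] G2_def[abs_def] G3_def[abs_def] by measurable
    have i1: "integrable M (\<lambda>\<omega>. G1 (?r \<omega>))" unfolding G1_def lf_lin
      by (intro Bochner_Integration.integrable_add integrable_mult_right lin_prod3_int p)
    have i2: "integrable M (\<lambda>\<omega>. G2 (?r \<omega>))" unfolding G2_def lf_lin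
      by (intro Bochner_Integration.integrable_add integrable_mult_right lin_prod2_int p)
    have i3: "integrable M (\<lambda>\<omega>. G3 (?r \<omega>))" unfolding G3_def lf_lin
      by (intro Bochner_Integration.integrable_add integrable_mult_right lin_int p)
    have e2: "expectation (\<lambda>\<omega>. G2 (?r \<omega>)) = a p * b p * S2 J c d + a p * c p * S2 J b d + a p * d p * S2 J b c
      + b p * c p * S2 J a d + b p * d p * S2 J a c + c p * d p * S2 J a b"
      unfolding G2_def lf_lin
      using lin_prod2_int[OF p(2)] lin_moment2[OF p(2)] by simp
    have e3: "expectation (\<lambda>\<omega>. G3 (?r \<omega>)) = 0"
      unfolding G3_def lf_lin using lin_int[OF p(2)] lin_mean[OF p(2)] by simp
    have gm: "G1 \<in> borel_measurable (PiM J (\<lambda>_. borel))" "G2 \<in> borel_measurable (PiM J (\<lambda>_. borel))" "G3 \<in> borel_measurable (PiM J (\<lambda>_. borel))"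
      by measurable
    have k: "(1 :: nat) <= 4" "(2 :: nat) <= 4" "(3 :: nat) <= 4" by auto
    note m1 = pow_mult[OF p k(1) gm(1) i1] and m2 = pow_mult[OF p k(2) gm(2) i2] and m3 = pow_mult[OF p k(3) gm(3) i3]
    have e: "lin (insert p J) a \<omega> * lin (insert p J) b \<omega> * lin (insert p J) c \<omega> * lin (insert p J) d \<omega> =
      lin J a \<omega> * lin J b \<omega> * lin J c \<omega> * lin J d \<omega> + (\<xi> p \<omega> ^ 1 * G1 (?r \<omega>) + (\<xi> p \<omega> ^ 2 * G2 (?r \<omega>) + (\<xi> p \<omega> ^ 3 * G3 (?r \<omega>)
        + a p * b p * c p * d p * \<xi> p \<omega> ^ 4)))" for \<omega>
      using insert by (simp add: lin_insert lf_lin G1_def G2_def G3_def algebra_simps power2_eq_square power3_eq_cube power4_eq_xxxx)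
    have i4: "integrable M (\<lambda>\<omega>. a p * b p * c p * d p * \<xi> p \<omega> ^ 4)" using int4[OF p(1)] by simp
    note j3 = Bochner_Integration.integrable_add[OF m3(2) i4]
    note j2 = Bochner_Integration.integrable_add[OF m2(2) j3]
    note j1 = Bochner_Integration.integrable_add[OF m1(2) j2]
    have "expectation (\<lambda>\<omega>. lin (insert p J) a \<omega> * lin (insert p J) b \<omega> * lin (insert p J) c \<omega> * lin (insert p J) d \<omega>) =
      expectation (\<lambda>\<omega>. lin J a \<omega> * lin J b \<omega> * lin J c \<omega> * lin J d \<omega>) + (expectation (\<lambda>\<omega>. \<xi> p \<omega> ^ 1 * G1 (?r \<omega>))
        + (expectation (\<lambda>\<omega>. \<xi> p \<omega> ^ 2 * G2 (?r \<omega>)) + (expectation (\<lambda>\<omega>. \<xi> p \<omega> ^ 3 * G3 (?r \<omega>)) + expectation (\<lambda>\<omega>. a p * b p * c p * d p * \<xi> p \<omega> ^ 4))))"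
      unfolding e Bochner_Integration.integral_add[OF lin_prod4_int[OF p(2)] j1] Bochner_Integration.integral_add[OF m1(2) j2]
        Bochner_Integration.integral_add[OF m2(2) j3] Bochner_Integration.integral_add[OF m3(2) i4] ..
    also have "expectation (\<lambda>\<omega>. \<xi> p \<omega> ^ 1 * G1 (?r \<omega>)) = 0" unfolding m1(1) using mean0[OF p(1)] by simp
    also have "expectation (\<lambda>\<omega>. \<xi> p \<omega> ^ 2 * G2 (?r \<omega>)) = mv p * (a p * b p * S2 J c d + a p * c p * S2 J b d + a p * d p * S2 J b c
      + b p * c p * S2 J a d + b p * d p * S2 J a c + c p * d p * S2 J a b)" unfolding m2(1) e2 by (simp add: mv_def)
    also have "expectation (\<lambda>\<omega>. \<xi> p \<omega> ^ 3 * G3 (?r \<omega>)) = 0" unfolding m3(1) e3 by simp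
    also have "expectation (\<lambda>\<omega>. a p * b p * c p * d p * \<xi> p \<omega> ^ 4) = a p * b p * c p * d p * (kap p + 3 * (mv p)\<^sup>2)"
      by (simp add: kap_def)
    also have "expectation (\<lambda>\<omega>. lin J a \<omega> * lin J b \<omega> * lin J c \<omega> * lin J d \<omega>) =
      S4 J a b c d + S2 J a b * S2 J c d + S2 J a c * S2 J b d + S2 J a d * S2 J b c" using p(2) by (rule insert.IH)
    finally show ?case
      unfolding S2i S4i by (simp add: algebra_simps power2_eq_square)
  qed (simp add: lin_def S2_def S4_def)
qed

text \<open>For nonnegative numbers the sum of squares is at most the square of the sum, so the
  cumulant part is also controlled by the squared variance. The number of effects does not
  enter.\<close>

lemma lin_pow4_expect:
  assumes k: "0 <= k" "\<And>p. p \<in> I ==> kap p <= k * (mv p)\<^sup>2"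
  shows "expectation (\<lambda>\<omega>. lin I a \<omega> ^ 4) <= (k + 3) * (S2 I a a)\<^sup>2"
proof -
  have mv: "0 <= mv p" for p unfolding mv_def by simp
  have "expectation (\<lambda>\<omega>. lin I a \<omega> ^ 4) = S4 I a a a a + 3 * (S2 I a a)\<^sup>2"
    using lin_moment4[of I a a a a] by (simp add: power4_eq_xxxx power2_eq_square)
  also have "S4 I a a a a <= (\<Sum>p\<in>I. k * (mv p * a p * a p)\<^sup>2)"
    unfolding S4_def
  proof (intro sum_mono)
    fix p assume "p \<in> I"
    then have "kap p * a p ^ 4 <= k * (mv p)\<^sup>2 * a p ^ 4" by (intro mult_right_mono k) auto
    then show "kap p * a p * a p * a p * a p <= k * (mv p * a p * a p)\<^sup>2"
      by (simp add: power4_eq_xxxx power2_eq_square mult_ac)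
  qed
  also have "\<dots> = k * (\<Sum>p\<in>I. (mv p * a p * a p)\<^sup>2)" by (simp add: sum_distrib_left)
  also have "\<dots> <= k * (S2 I a a)\<^sup>2"
  proof (intro mult_left_mono k)
    have n: "0 <= mv p * a p * a p" for p using mv[of p] by (simp add: mult.assoc)
    have "(\<Sum>p\<in>I. (mv p * a p * a p)\<^sup>2) <= (\<Sum>p\<in>I. mv p * a p * a p * S2 I a a)"
    proof (intro sum_mono)
      fix p assume "p \<in> I"
      then have "mv p * a p * a p <= S2 I a a" unfolding S2_def using n fin by (intro member_le_sum) auto
      then show "(mv p * a p * a p)\<^sup>2 <= mv p * a p * a p * S2 I a a"
        unfolding power2_eq_square by (intro mult_left_mono n)
    qed
    also have "\<dots> = (S2 I a a)\<^sup>2" by (simp add: S2_def sum_distrib_right power2_eq_square)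
    finally show "(\<Sum>p\<in>I. (mv p * a p * a p)\<^sup>2) <= (S2 I a a)\<^sup>2" .
  qed
  finally show ?thesis by (simp add: algebra_simps)
qed

end

section \<open>The model at a fixed sample size: moments and information matrices\<close>

locale lmm_model = lmm D for D +
  fixes M :: "'w measure" and law :: "nat => real measure" and \<sigma>sq :: "nat => real"
    and \<alpha> :: "nat => nat => 'w => real" and \<beta> :: "real vec" and y :: "'w => real vec"
  assumes eff: "mixed_effects M D law \<alpha>"
    and laws: "\<And>t. t <= nfac D ==> effect_law (law t) (\<sigma>sq t)"
    and pos: "\<And>t. t <= nfac D ==> 0 < \<sigma>sq t"
    and law4: "\<And>t. t <= nfac D ==> integrable (law t) (\<lambda>x. x ^ 4)"
    and beta: "\<beta> \<in> carrier_vec (dim_col (fixX D))"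
    and y_eq: "y = response D \<beta> \<alpha>"
begin

abbreviation "idx \<equiv> Sigma {..s} (\<lambda>t. {..<neff D t})"
abbreviation "th \<equiv> true_param s \<sigma>sq"
abbreviation "ef e \<equiv> \<alpha> (fst e) (snd e)"
definition "kp t = (\<integral>x. x ^ 4 \<partial>law t) - 3 * (\<sigma>sq t)\<^sup>2"

lemma law_sets: "t <= s ==> sets (law t) = sets borel" using laws by (simp add: effect_law_def)

lemma ef_law:
  assumes "e \<in> idx"
  shows "ef e \<in> borel_measurable M" "distr M borel (ef e) = law (fst e)"
proof -
  have ps: "prob_space M" and iv: "prob_space.indep_vars M (\<lambda>_. borel) (\<alpha> (fst e)) {..<neff D (fst e)}"
    using eff assms by (auto simp: mixed_effects_def)
  show "ef e \<in> borel_measurable M" using iv assms unfolding prob_space.indep_vars_def2[OF ps] by auto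
  show "distr M borel (ef e) = law (fst e)" using eff assms by (auto simp: mixed_effects_def)
qed

lemma ef_integral:
  fixes g :: "real => real"
  assumes "e \<in> idx" "g \<in> borel_measurable borel"
  shows "(\<integral>\<omega>. g (ef e \<omega>) \<partial>M) = (\<integral>x. g x \<partial>law (fst e))"
    "integrable M (\<lambda>\<omega>. g (ef e \<omega>)) \<longleftrightarrow> integrable (law (fst e)) g"
  using integral_distr[OF ef_law(1)[OF assms(1)] assms(2)] integrable_distr_eq[OF ef_law(1)[OF assms(1)] assms(2)]
  by (simp_all add: ef_law(2)[OF assms(1)])

sublocale indep_effects M ef idx
proof -
  interpret prob_space M using eff by (simp add: mixed_effects_def)
  show "indep_effects M ef idx"
  proof
    show "finite idx" by auto
    show "indep_vars (\<lambda>_. borel) ef idx"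
      using eff by (intro indep_vars_Sigma) (auto simp: mixed_effects_def)
    fix e assume e: "e \<in> idx"
    then have "fst e <= s" by auto
    show "integrable M (\<lambda>\<omega>. ef e \<omega> ^ 4)" using ef_integral(2)[OF e, of "\<lambda>x. x ^ 4"] law4[OF \<open>fst e <= s\<close>] by simp
    show "expectation (ef e) = 0" using ef_integral(1)[OF e, of "\<lambda>x. x"] laws[OF \<open>fst e <= s\<close>] by (simp add: effect_law_def)
  qed
qed

lemma law_2: "t <= s ==> (\<integral>x. x\<^sup>2 \<partial>law t) = \<sigma>sq t"
proof -
  assume "t <= s"
  then have "(\<integral>x. x \<partial>law t) = 0" and v: "variance_of (law t) (\<lambda>x. x) = \<sigma>sq t" using laws[of t] by (auto simp: effect_law_def)
  then have "variance_of (law t) (\<lambda>x. x) = (\<integral>x. x\<^sup>2 \<partial>law t)" unfolding variance_of_def by simp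
  then show ?thesis using v by simp
qed

lemma mv_eq: "e \<in> idx ==> mv e = \<sigma>sq (fst e)"
  unfolding mv_def by (subst ef_integral(1)[where g = "\<lambda>x. x\<^sup>2"]) (auto simp: law_2)

lemma kap_eq: "e \<in> idx ==> kap e = kp (fst e)"
  unfolding kap_def kp_def mv_eq by (subst ef_integral(1)[where g = "\<lambda>x. x ^ 4"]) auto

text \<open>Expanding the square. Positivity of this variance is the source of kappa_t > -2
  sigma_t^4, on which the lower bound for the first information matrix rests.\<close>

lemma kp_variance: "t <= s ==> kp t = variance_of (law t) (\<lambda>x. x\<^sup>2) - 2 * (\<sigma>sq t)\<^sup>2"
proof -
  assume t: "t <= s"
  interpret L: prob_space "law t" using laws[OF t] by (simp add: effect_law_def)
  have i2: "integrable (law t) (\<lambda>x. x\<^sup>2)" using laws[OF t] by (simp add: effect_law_def)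
  have i4: "integrable (law t) (\<lambda>x. x ^ 4)" by (rule law4[OF t])
  have "variance_of (law t) (\<lambda>x. x\<^sup>2) = (\<integral>x. x ^ 4 - 2 * \<sigma>sq t * x\<^sup>2 + (\<sigma>sq t)\<^sup>2 \<partial>law t)"
    unfolding variance_of_def law_2[OF t]
    by (intro Bochner_Integration.integral_cong refl) (simp add: power2_eq_square power4_eq_xxxx algebra_simps)
  also have "\<dots> = (\<integral>x. x ^ 4 \<partial>law t) - 2 * \<sigma>sq t * \<sigma>sq t + (\<sigma>sq t)\<^sup>2"
    using i2 i4 law_2[OF t] L.prob_space by simp
  finally show ?thesis by (simp add: kp_def power2_eq_square)
qed

lemma th_int: "th \<in> param_int"
  using pos by (auto simp: param_int_def true_param_def)

lemma th_ps: "th \<in> param_space s" by (rule param_int[OF th_int])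

lemma varc_th: "t <= s ==> varc th t = \<sigma>sq t"
  using pos[of 0] by (auto simp: varc_def gam_def true_param_def)

text \<open>Indexing the effects of all t by one set of pairs makes u, V and the fourth cumulants
  single sums over columns.\<close>

definition "zc e = Zf (fst e) * unit_col (snd e)"
definition "u \<omega> = (\<Sum>e\<in>idx. ef e \<omega> *\<^sub>R zc e)"
definition "zi i e = ent (zc e) i 0"

lemma zc_dims: "e \<in> idx ==> mat_dims N 1 (zc e)"
  unfolding zc_def by (rule mat_dims_mult[OF Z_dims mat_dims_unit_col]) auto

lemma zi_eq: "e \<in> idx ==> i < N ==> zi i e = Zmat D (fst e) $$ (i, snd e)"
proof -
  assume e: "e \<in> idx" and i: "i < N"
  then have "fst e <= s" "snd e < neff D (fst e)" by auto
  then show ?thesis using i Zmat_carrier[of "fst e"]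
    unfolding zi_def zc_def ent_times_left[OF Z_dims[OF \<open>fst e <= s\<close>]]
    by (simp add: ent_unit_col mult_delta_right Zf_def ent_fm)
qed

lemma u_dims: "mat_dims N 1 (u \<omega>)"
  unfolding u_def by (intro mat_dims_sum mat_dims_simps zc_dims)

lemma inner_u: "inner a (u \<omega>) = lin idx (\<lambda>e. inner a (zc e)) \<omega>"
  by (simp add: u_def lin_def inner_sum_right mult.commute)

lemma ent_u: "ent (u \<omega>) i 0 = lin idx (zi i) \<omega>"
  by (simp add: u_def lin_def zi_def mult.commute)

lemma y_carrier: "y \<omega> \<in> carrier_vec N" by (simp add: y_eq response_def)

lemma fv_y: "fv (y \<omega>) = Xf * fv \<beta> + u \<omega>"
proof (rule fmat_eqI)
  fix i j
  have d: "mat_dims N 1 (Xf * fv \<beta>)" using mat_dims_mult[OF X_dims mat_dims_fv_carrier[OF beta]] .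
  show "ent (fv (y \<omega>)) i j = ent (Xf * fv \<beta> + u \<omega>) i j"
  proof (cases "i < N \<and> j = 0")
    case True
    have "Xf * fv \<beta> = fv (fixX D *\<^sub>v \<beta>)" using beta by (simp add: Xf_def fm_mult_vec)
    then have 1: "ent (Xf * fv \<beta>) i 0 = (fixX D *\<^sub>v \<beta>) $ i" using True by (simp add: ent_fv nobs_def)
    have "ent (u \<omega>) i 0 = (\<Sum>e\<in>idx. Zmat D (fst e) $$ (i, snd e) * ef e \<omega>)"
      unfolding ent_u lin_def using True by (intro sum.cong) (auto simp: zi_eq)
    also have "\<dots> = (\<Sum>t\<le>s. \<Sum>q<neff D t. Zmat D t $$ (i, q) * \<alpha> t q \<omega>)"
      by (subst sum.Sigma) (auto simp: case_prod_beta)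
    also have "\<dots> = (\<Sum>t\<le>s. (Zmat D t *\<^sub>v vec (neff D t) (\<lambda>q. \<alpha> t q \<omega>)) $ i)"
      using True Zmat_carrier by (intro sum.cong refl) (auto simp: scalar_prod_def atLeast0LessThan carrier_matD[OF Zmat_carrier] intro!: sum.cong)
    finally show ?thesis using True 1 by (simp add: ent_fv y_eq response_def)
  next
    case False
    then show ?thesis using d u_dims[of \<omega>] mat_dims_fv_carrier[OF y_carrier[of \<omega>]] by (auto simp: mat_dims_def not_less)
  qed
qed

lemma V_zc: "Vf th = (\<Sum>e\<in>idx. mv e *\<^sub>R (zc e * trp (zc e)))"
proof -
  have "Wf t = (\<Sum>q<neff D t. zc (t, q) * trp (zc (t, q)))" if "t <= s" for t
  proof -
    have "Wf t = Zf t * idm (neff D t) * trp (Zf t)" using Z_dims[OF that] by (simp add: Wf_def)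
    then show ?thesis
      by (simp add: idm_eq_sum zc_def trp_mult sum_distrib_left sum_distrib_right mult.assoc)
  qed
  then have "Vf th = (\<Sum>t\<le>s. \<Sum>q<neff D t. \<sigma>sq t *\<^sub>R (zc (t, q) * trp (zc (t, q))))"
    by (simp add: Vf_def varc_th scaleR_sum_right)
  also have "\<dots> = (\<Sum>e\<in>idx. \<sigma>sq (fst e) *\<^sub>R (zc e * trp (zc e)))"
    by (subst sum.Sigma) (auto simp: case_prod_beta)
  also have "\<dots> = (\<Sum>e\<in>idx. mv e *\<^sub>R (zc e * trp (zc e)))" by (intro sum.cong refl) (simp add: mv_eq)
  finally show ?thesis .
qed

lemma inner_rank1:
  assumes "mat_dims n 1 z" "mat_dims n 1 a" "mat_dims n 1 b"
  shows "inner a (z * trp z * b) = inner a z * inner b z"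
proof -
  have "inner a (z * trp z * b) = inner (trp z * a) (trp z * b)" by (simp add: mult.assoc inner_times_left)
  also have "\<dots> = inner z a * (inner z b * inner (idm 1) (idm 1))"
    using col_gram[OF assms(1,2)] col_gram[OF assms(1,3)] by simp
  also have "inner (idm 1) (idm 1) = 1" by (simp add: inner_fmat_left[OF mat_dims_idm] ent_idm)
  finally show ?thesis by (simp add: inner_commute)
qed

lemma S2_inner:
  assumes "mat_dims N 1 a" "mat_dims N 1 b"
  shows "S2 idx (\<lambda>e. inner a (zc e)) (\<lambda>e. inner b (zc e)) = inner a (Vf th * b)"
proof -
  have "inner a (Vf th * b) = (\<Sum>e\<in>idx. mv e * inner a (zc e * trp (zc e) * b))"
    by (simp add: V_zc sum_distrib_right inner_sum_right)
  also have "\<dots> = (\<Sum>e\<in>idx. mv e * inner a (zc e) * inner b (zc e))"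
    by (intro sum.cong refl) (simp add: inner_rank1[OF zc_dims assms])
  finally show ?thesis by (simp add: S2_def)
qed

lemma ent_inner: "i < n ==> mat_dims n 1 a ==> ent a i 0 = inner (unit_col i) a"
  by (subst inner_fmat_left[OF mat_dims_unit_col]) (auto simp: ent_unit_col mult_delta_left)

lemma ent_mat_inner:
  assumes "mat_dims m n A" "i < m" "k < n"
  shows "inner (unit_col i) (A * unit_col k) = ent A i k"
proof -
  have "inner (unit_col i) (A * unit_col k) = ent (A * unit_col k) i 0"
    by (rule ent_inner[symmetric, OF assms(2) mat_dims_mult[OF assms(1) mat_dims_unit_col[OF assms(3)]]])
  also have "\<dots> = ent A i k"
    unfolding ent_times_left[OF assms(1)] using assms(3) by (simp add: ent_unit_col mult_delta_right)
  finally show ?thesis .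
qed

lemma S2_zi:
  assumes "a < N" "b < N"
  shows "S2 idx (zi a) (zi b) = ent (Vf th) a b"
proof -
  have "S2 idx (zi a) (zi b) = S2 idx (\<lambda>e. inner (unit_col a) (zc e)) (\<lambda>e. inner (unit_col b) (zc e))"
    unfolding S2_def by (intro sum.cong refl) (auto simp: zi_def ent_inner[OF assms(1) zc_dims] ent_inner[OF assms(2) zc_dims])
  also have "\<dots> = ent (Vf th) a b"
    unfolding S2_inner[OF mat_dims_unit_col[OF assms(1)] mat_dims_unit_col[OF assms(2)]] by (rule ent_mat_inner[OF V_dims assms])
  finally show ?thesis .
qed

definition "uu = (\<lambda>(a, b, c, d) \<omega>. ent (u \<omega>) a 0 * ent (u \<omega>) b 0 * ent (u \<omega>) c 0 * ent (u \<omega>) d 0)"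
definition "kf = (\<lambda>(a, b, c, d). S4 idx (zi a) (zi b) (zi c) (zi d))"
definition "VV = (\<lambda>(a, b, c, d). ent (Vf th) a b * ent (Vf th) c d)"

lemma uu_int: "integrable M (uu q)"
  by (cases q) (simp add: uu_def ent_u lin_prod4_int)

lemma uu_expect:
  assumes "a < N" "b < N" "c < N" "d < N"
  shows "expectation (uu (a, b, c, d)) = kf (a, b, c, d) + VV (a, b, c, d) + VV (a, c, b, d) + VV (a, d, b, c)"
  using lin_moment4[of idx "zi a" "zi b" "zi c" "zi d"] assms by (simp add: uu_def ent_u kf_def VV_def S2_zi)

text \<open>The joint cumulant of four components sees the indices only through f. This is why
  products of entries of B_j and B_k may be averaged over the classes of f.\<close>

lemma kf_fcoef:
  assumes "q \<in> quads D"
  shows "kf q = (\<Sum>t\<le>s. kp t * fcoef D q $ t)"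
proof -
  obtain a b c d where q: "q = (a, b, c, d)" by (cases q) auto
  have i: "a < N" "b < N" "c < N" "d < N" using assms by (auto simp: quads_def q)
  have "kf q = (\<Sum>e\<in>idx. kp (fst e) * (Zmat D (fst e) $$ (a, snd e) * Zmat D (fst e) $$ (b, snd e) * Zmat D (fst e) $$ (c, snd e) * Zmat D (fst e) $$ (d, snd e)))"
    unfolding kf_def q S4_def using i by (auto intro!: sum.cong simp: zi_eq kap_eq mult.assoc)
  also have "\<dots> = (\<Sum>t\<le>s. \<Sum>q<neff D t. kp t * (Zmat D t $$ (a, q) * Zmat D t $$ (b, q) * Zmat D t $$ (c, q) * Zmat D t $$ (d, q)))"
    by (subst sum.Sigma) (auto simp: case_prod_beta)
  also have "\<dots> = (\<Sum>t\<le>s. kp t * fcoef D q $ t)" by (simp add: q fcoef_def sum_distrib_left)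
  finally show ?thesis .
qed

text \<open>Quadratic forms in \<open>u\<close>.\<close>

definition "qf B \<omega> = inner (u \<omega>) (B * u \<omega>)"

lemma inner_quad:
  assumes "mat_dims N N B" "mat_dims N 1 x"
  shows "inner x (B * x) = (\<Sum>a<N. \<Sum>b<N. ent B a b * (ent x a 0 * ent x b 0))"
proof -
  have "inner x (B * x) = (\<Sum>a<N. ent x a 0 * ent (B * x) a 0)" by (simp add: inner_fmat_left[OF assms(2)])
  also have "\<dots> = (\<Sum>a<N. \<Sum>b<N. ent B a b * (ent x a 0 * ent x b 0))"
    by (simp add: ent_times_left[OF assms(1)] sum_distrib_left mult_ac)
  finally show ?thesis .
qed

lemma sum_quads: "(\<Sum>(a, b, c, d)\<in>quads D. F a b c d) = (\<Sum>a<N. \<Sum>b<N. \<Sum>c<N. \<Sum>d<N. (F a b c d :: real))"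
  by (simp add: quads_def sum.cartesian_product[symmetric])

lemma sum4_product:
  fixes F G :: "nat => nat => real"
  shows "(\<Sum>a<n. \<Sum>b<n. F a b) * (\<Sum>c<n. \<Sum>d<n. G c d) = (\<Sum>a<n. \<Sum>b<n. \<Sum>c<n. \<Sum>d<n. F a b * G c d)"
  unfolding sum_distrib_right unfolding sum_distrib_left ..

lemma quad_product:
  assumes "mat_dims N N B" "mat_dims N N C" "mat_dims N 1 x"
  shows "inner x (B * x) * inner x (C * x) = (\<Sum>(a, b, c, d)\<in>quads D. ent B a b * ent C c d * (ent x a 0 * ent x b 0 * ent x c 0 * ent x d 0))"
  unfolding sum_quads inner_quad[OF assms(1,3)] inner_quad[OF assms(2,3)] sum4_product
  by (simp add: mult_ac)

lemma qf_int: "mat_dims N N B ==> integrable M (qf B)"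
proof -
  assume B: "mat_dims N N B"
  have "qf B = (\<lambda>\<omega>. \<Sum>a<N. \<Sum>b<N. ent B a b * (lin idx (zi a) \<omega> * lin idx (zi b) \<omega>))"
    by (simp add: fun_eq_iff qf_def inner_quad[OF B u_dims] ent_u)
  then show ?thesis by (simp add: lin_prod2_int)
qed

lemma qf_expect: "mat_dims N N B ==> trp B = B ==> expectation (qf B) = trc (B * Vf th)"
proof -
  assume B: "mat_dims N N B" "trp B = B"
  have "qf B = (\<lambda>\<omega>. \<Sum>a<N. \<Sum>b<N. ent B a b * (lin idx (zi a) \<omega> * lin idx (zi b) \<omega>))"
    by (simp add: fun_eq_iff qf_def inner_quad[OF B(1) u_dims] ent_u)
  then have "expectation (qf B) = (\<Sum>a<N. \<Sum>b<N. ent B a b * ent (Vf th) a b)"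
    by (simp add: lin_prod2_int lin_moment2 S2_zi)
  then show ?thesis using B by (simp add: trc_mult inner_fmat_left[OF B(1)])
qed

lemma qf_prod_int: "mat_dims N N B ==> mat_dims N N C ==> integrable M (\<lambda>\<omega>. qf B \<omega> * qf C \<omega>)"
  and qf_prod_expect: "mat_dims N N B ==> mat_dims N N C ==> expectation (\<lambda>\<omega>. qf B \<omega> * qf C \<omega>) = (\<Sum>(a, b, c, d)\<in>quads D. ent B a b * ent C c d * expectation (uu (a, b, c, d)))"
proof -
  assume B: "mat_dims N N B" "mat_dims N N C"
  have e: "(\<lambda>\<omega>. qf B \<omega> * qf C \<omega>) = (\<lambda>\<omega>. \<Sum>(a, b, c, d)\<in>quads D. ent B a b * ent C c d * uu (a, b, c, d) \<omega>)"
    unfolding qf_def fun_eq_iff quad_product[OF B u_dims] by (simp add: uu_def)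
  show "integrable M (\<lambda>\<omega>. qf B \<omega> * qf C \<omega>)"
    unfolding e by (intro Bochner_Integration.integrable_sum) (auto simp: case_prod_beta intro!: integrable_mult_right uu_int)
  show "expectation (\<lambda>\<omega>. qf B \<omega> * qf C \<omega>) = (\<Sum>(a, b, c, d)\<in>quads D. ent B a b * ent C c d * expectation (uu (a, b, c, d)))"
    unfolding e by (subst Bochner_Integration.integral_sum) (auto simp: case_prod_beta intro!: integrable_mult_right uu_int sum.cong)
qed

definition "Kq B C = (\<Sum>(a, b, c, d)\<in>quads D. ent B a b * ent C c d * kf (a, b, c, d))"

text \<open>The fourth moment is a cumulant plus three pairings. The pairing (ab)(cd) cancels
  against the product of the means, the other two give the same trace by symmetry of B, C and V, and
  the cumulants add up to \<open>Kq\<close>.\<close>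

lemma qf_cov:
  assumes B: "mat_dims N N B" "trp B = B" and C: "mat_dims N N C" "trp C = C"
  shows "covariance_of M (\<lambda>\<omega>. b + qf B \<omega>) (\<lambda>\<omega>. c + qf C \<omega>) = Kq B C + 2 * trc (B * Vf th * C * Vf th)"
proof -
  let ?V = "Vf th"
  have "covariance_of M (\<lambda>\<omega>. b + qf B \<omega>) (\<lambda>\<omega>. c + qf C \<omega>) = expectation (\<lambda>\<omega>. (qf B \<omega> - expectation (qf B)) * (qf C \<omega> - expectation (qf C)))"
    using qf_int[OF B(1)] qf_int[OF C(1)] prob_space by (simp add: covariance_of_def)
  also have "\<dots> = expectation (\<lambda>\<omega>. qf B \<omega> * qf C \<omega> - expectation (qf C) * qf B \<omega> - expectation (qf B) * qf C \<omega> + expectation (qf B) * expectation (qf C))"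
    by (intro Bochner_Integration.integral_cong refl) (simp add: algebra_simps)
  also have "\<dots> = expectation (\<lambda>\<omega>. qf B \<omega> * qf C \<omega>) - expectation (qf B) * expectation (qf C)"
    using qf_int[OF B(1)] qf_int[OF C(1)] qf_prod_int[OF B(1) C(1)] prob_space by simp
  also have "expectation (\<lambda>\<omega>. qf B \<omega> * qf C \<omega>) = (\<Sum>(a, b, c, d)\<in>quads D. ent B a b * ent C c d * (kf (a, b, c, d) + VV (a, b, c, d) + VV (a, c, b, d) + VV (a, d, b, c)))"
    unfolding qf_prod_expect[OF B(1) C(1)] by (intro sum.cong refl) (auto simp: quads_def uu_expect)
  also have "\<dots> = Kq B C + (\<Sum>(a, b, c, d)\<in>quads D. ent B a b * ent C c d * VV (a, b, c, d)) + (\<Sum>(a, b, c, d)\<in>quads D. ent B a b * ent C c d * VV (a, c, b, d))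
     + (\<Sum>(a, b, c, d)\<in>quads D. ent B a b * ent C c d * VV (a, d, b, c))"
    unfolding Kq_def sum.distrib[symmetric] by (intro sum.cong refl) (auto simp: distrib_left)
  also have "(\<Sum>(a, b, c, d)\<in>quads D. ent B a b * ent C c d * VV (a, b, c, d)) = expectation (qf B) * expectation (qf C)"
    unfolding sum_quads qf_expect[OF B] qf_expect[OF C] trc_mult B(2) C(2) inner_fmat_left[OF B(1)] inner_fmat_left[OF C(1)] VV_def sum4_product
    by (simp add: mult_ac)
  also have t: "(\<Sum>(a, b, c, d)\<in>quads D. ent B a b * ent C c d * VV (a, c, b, d)) = trc (B * ?V * C * ?V)"
  proof -
    have Vs: "ent ?V a b = ent ?V b a" for a b by (metis V_sym ent_trp)
    have Bs: "ent B a b = ent B b a" for a b by (metis B(2) ent_trp)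
    have dBV: "mat_dims N N (B * ?V)" "mat_dims N N (C * ?V)" using B(1) C(1) by (auto intro: mat_dims_mult)
    have "trc (B * ?V * C * ?V) = (\<Sum>a<N. \<Sum>d<N. ent (B * ?V) a d * ent (C * ?V) d a)"
      using trc_gen[OF mat_dims_mult[OF dBV]] by (simp add: mult.assoc[of "B * ?V"] ent_times_left[OF dBV(1), where B = "C * ?V"])
    also have "\<dots> = (\<Sum>a<N. \<Sum>c<N. \<Sum>b<N. \<Sum>d<N. ent B a b * ent ?V b c * (ent C c d * ent ?V d a))"
      by (simp add: ent_times_left[OF B(1)] ent_times_left[OF C(1)] sum_product)
    also have "\<dots> = (\<Sum>a<N. \<Sum>b<N. \<Sum>c<N. \<Sum>d<N. ent B a b * ent ?V b c * (ent C c d * ent ?V d a))"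
      by (intro sum.cong refl sum.swap)
    also have "\<dots> = (\<Sum>a<N. \<Sum>b<N. \<Sum>c<N. \<Sum>d<N. ent B b a * ent ?V b c * (ent C c d * ent ?V d a))"
      by (intro sum.cong refl arg_cong2[where f = "(*)"] Bs)
    also have "\<dots> = (\<Sum>b<N. \<Sum>a<N. \<Sum>c<N. \<Sum>d<N. ent B b a * ent ?V b c * (ent C c d * ent ?V d a))"
      by (rule sum.swap)
    also have "\<dots> = (\<Sum>a<N. \<Sum>b<N. \<Sum>c<N. \<Sum>d<N. ent B a b * ent ?V a c * (ent C c d * ent ?V b d))"
      by (intro sum.cong refl arg_cong2[where f = "(*)"] Vs)
    finally show ?thesis unfolding sum_quads VV_def by (simp add: mult_ac)
  qed
  also have "(\<Sum>(a, b, c, d)\<in>quads D. ent B a b * ent C c d * VV (a, d, b, c)) = trc (B * ?V * C * ?V)"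
  proof -
    have Cs: "ent C c d = ent C d c" for c d by (metis C(2) ent_trp)
    have "(\<Sum>a<N. \<Sum>b<N. \<Sum>c<N. \<Sum>d<N. ent B a b * ent C c d * VV (a, d, b, c)) = (\<Sum>a<N. \<Sum>b<N. \<Sum>d<N. \<Sum>c<N. ent B a b * ent C c d * VV (a, d, b, c))"
      by (intro sum.cong refl sum.swap)
    also have "\<dots> = (\<Sum>a<N. \<Sum>b<N. \<Sum>c<N. \<Sum>d<N. ent B a b * ent C c d * VV (a, c, b, d))"
      by (intro sum.cong refl arg_cong2[where f = "(*)"] Cs)
    finally show ?thesis unfolding t[symmetric] sum_quads .
  qed
  finally show ?thesis by simp
qed

end

lemma trc_sum: "trc (sum f A) = (\<Sum>j\<in>A. trc (f j))"
  by (induction A rule: infinite_finite_induct) auto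

context lmm_model
begin

lemma Bf_th: "j <= s ==> mat_dims N N (Bf th j)" "j <= s ==> trp (Bf th j) = Bf th j"
  using B_dims[OF th_ps] B_sym[OF th_ps] by auto

lemma info1_eq:
  assumes T: "contrast_mat D T" and jk: "j <= s" "k <= s"
  shows "info1 M D T c y th $$ (j, k) = Kq (Bf th j) (Bf th k) + Gent D th j k"
proof -
  have e: "partial_deriv i (restr_loglik D T c (y \<omega>)) th = - trc (Pf th * dVf th i) / 2 + qf (Bf th i) \<omega>" if "i <= s" for i \<omega>
    using partial_deriv_loglik[OF th_int that y_carrier T] form_shift[OF Bf_X[OF th_ps that]] by (simp add: fv_y qf_def)
  have "info1 M D T c y th $$ (j, k) = covariance_of M (\<lambda>\<omega>. partial_deriv j (restr_loglik D T c (y \<omega>)) th)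
      (\<lambda>\<omega>. partial_deriv k (restr_loglik D T c (y \<omega>)) th)" using jk by (simp add: info1_def)
  also have "\<dots> = Kq (Bf th j) (Bf th k) + Gent D th j k"
    unfolding e[OF jk(1)] e[OF jk(2)] using jk by (subst qf_cov) (auto simp: Bf_th Gent_trc[OF th_ps])
  finally show ?thesis .
qed

lemma info2_eq:
  assumes T: "contrast_mat D T" and jk: "j <= s" "k <= s"
  shows "info2 M D T c y th $$ (j, k) = - Gent D th j k"
proof -
  have sym: "trp (Mf th j k) = Mf th j k"
    using P_sym[OF th_ps] by (simp add: Mf_def trp_mult mult.assoc right_diff_distrib left_diff_distrib)
  have e: "partial_deriv j (partial_deriv k (restr_loglik D T c (y \<omega>))) th =
     (trc (Pf th * dVf th j * Pf th * dVf th k) - trc (Pf th * ddVf j k)) / 2 + qf (Mf th j k) \<omega>" for \<omega>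
    using partial_deriv2_loglik[OF th_int jk y_carrier T] form_shift[OF Mf_X[OF th_ps]] by (simp add: fv_y qf_def)
  have "info2 M D T c y th $$ (j, k) = expectation (\<lambda>\<omega>. partial_deriv j (partial_deriv k (restr_loglik D T c (y \<omega>))) th)"
    using jk by (simp add: info2_def)
  also have "\<dots> = (trc (Pf th * dVf th j * Pf th * dVf th k) - trc (Pf th * ddVf j k)) / 2 + trc (Mf th j k * Vf th)"
    unfolding e using qf_int[OF Mf_dims[OF th_ps]] qf_expect[OF Mf_dims[OF th_ps] sym] prob_space by simp
  finally show ?thesis using trc_Mf_V[OF th_ps jk] by simp
qed

text \<open>Exchanging the sums turns the cumulant part into a sum over single effects, weighted by
  the kappas; in this form it can be bounded from both sides.\<close>

lemma Kq_zc:
  assumes "mat_dims N N B" "mat_dims N N C"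
  shows "Kq B C = (\<Sum>e\<in>idx. kap e * (inner (zc e) (B * zc e) * inner (zc e) (C * zc e)))"
proof -
  have "(\<Sum>e\<in>idx. kap e * (inner (zc e) (B * zc e) * inner (zc e) (C * zc e))) =
     (\<Sum>e\<in>idx. \<Sum>(a, b, c, d)\<in>quads D. ent B a b * ent C c d * (kap e * zi a e * zi b e * zi c e * zi d e))"
    by (intro sum.cong refl) (simp add: quad_product[OF assms zc_dims] sum_distrib_left case_prod_beta zi_def mult_ac)
  also have "\<dots> = (\<Sum>q\<in>quads D. \<Sum>e\<in>idx. case q of (a, b, c, d) => ent B a b * ent C c d * (kap e * zi a e * zi b e * zi c e * zi d e))"
    by (rule sum.swap)
  also have "\<dots> = Kq B C"
    unfolding Kq_def kf_def S4_def by (intro sum.cong refl) (auto simp: sum_distrib_left)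
  finally show ?thesis ..
qed

text \<open>V is a sum of rank one matrices over the effects, so the trace is a double sum of
  nonnegative terms over pairs of effects. The left side keeps the pairs of an effect with
  itself.\<close>

lemma trc_BVBV_ge:
  assumes B: "mat_dims N N B" "trp B = B"
  shows "(\<Sum>e\<in>idx. (mv e)\<^sup>2 * (inner (zc e) (B * zc e))\<^sup>2) <= trc (B * Vf th * B * Vf th)"
proof -
  have mv: "0 <= mv e" for e by (simp add: mv_def)
  have "trc (B * Vf th * B * Vf th) = (\<Sum>e\<in>idx. mv e * trc (B * Vf th * B * (zc e * trp (zc e))))"
  proof -
    have "trc (A * Vf th) = (\<Sum>e\<in>idx. mv e * trc (A * (zc e * trp (zc e))))" for A
      unfolding trc_mult V_zc by (simp add: inner_sum_right)
    then show ?thesis .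
  qed
  also have "\<dots> = (\<Sum>e\<in>idx. mv e * inner (B * zc e) (Vf th * (B * zc e)))"
  proof (intro sum.cong refl arg_cong2[where f = "(*)"])
    fix e
    have "trc (B * Vf th * B * (zc e * trp (zc e))) = trc (trp (zc e) * (B * Vf th * B * zc e))"
      by (subst trc_commute) (simp add: mult.assoc)
    then show "trc (B * Vf th * B * (zc e * trp (zc e))) = inner (B * zc e) (Vf th * (B * zc e))"
      using B(2) by (simp add: trc_mult inner_times_left mult.assoc)
  qed
  also have "\<dots> \<ge> (\<Sum>e\<in>idx. (mv e)\<^sup>2 * (inner (zc e) (B * zc e))\<^sup>2)"
  proof (intro sum_mono)
    fix e assume e: "e \<in> idx"
    define x where "x = B * zc e"
    have x: "mat_dims N 1 x" unfolding x_def using B(1) zc_dims[OF e] by (rule mat_dims_mult)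
    have "mv e * inner x (zc e) * inner x (zc e) <= S2 idx (\<lambda>e. inner x (zc e)) (\<lambda>e. inner x (zc e))"
      unfolding S2_def using e fin mv by (intro member_le_sum) (auto simp: mult.assoc)
    also have "\<dots> = inner x (Vf th * x)" by (rule S2_inner[OF x x])
    finally have "mv e * (mv e * inner x (zc e) * inner x (zc e)) <= mv e * inner x (Vf th * x)"
      by (intro mult_left_mono mv)
    then show "(mv e)\<^sup>2 * (inner (zc e) (B * zc e))\<^sup>2 <= mv e * inner (B * zc e) (Vf th * (B * zc e))"
      by (simp add: x_def power2_eq_square inner_commute mult_ac)
  qed
  finally show ?thesis .
qed

lemma sum_Gent: "(\<Sum>j\<le>s. \<Sum>k\<le>s. x j * x k * Gent D th j k) = 2 * trc ((\<Sum>j\<le>s. x j *\<^sub>R Bf th j) * Vf th * (\<Sum>j\<le>s. x j *\<^sub>R Bf th j) * Vf th)"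
proof -
  have "(\<Sum>j\<le>s. x j *\<^sub>R Bf th j) * Vf th * (\<Sum>j\<le>s. x j *\<^sub>R Bf th j) * Vf th
     = (\<Sum>j\<le>s. \<Sum>k\<le>s. (x j * x k) *\<^sub>R (Bf th j * Vf th * Bf th k * Vf th))"
    by (simp add: sum_distrib_left sum_distrib_right scaleR_sum_right mult.assoc)
       (subst sum.swap, simp add: mult.commute)
  then show ?thesis
    by (simp add: trc_sum sum_distrib_left Gent_trc[OF th_ps] mult_ac)
qed

text \<open>With B the combination of the B_j, I is the sum of kappa_e w_e^2 plus G, and G is twice
  the trace of B V B V, which dominates the sum of sigma^4 w_e^2. Hence kappa \<ge> -(2 - C) sigma^4
  still leaves the share C / 2 of G; C \<le> 2 fixes the sign of the factor by which that domination
  is multiplied.\<close>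

lemma info1_form_bounds:
  fixes c :: real and x :: "nat => real"
  assumes T: "contrast_mat D T" and K: "0 <= K" "\<And>t. t <= s ==> kp t <= K * (\<sigma>sq t)\<^sup>2"
    and C: "\<And>t. t <= s ==> - (2 - C) * (\<sigma>sq t)\<^sup>2 <= kp t" "C <= 2"
  defines "G \<equiv> (\<Sum>j\<le>s. \<Sum>k\<le>s. x j * x k * Gent D th j k)"
    and "I \<equiv> (\<Sum>j\<le>s. \<Sum>k\<le>s. x j * x k * info1 M D T c y th $$ (j, k))"
  shows "C / 2 * G <= I" "I <= (1 + K / 2) * G" "0 <= G"
proof -
  define B where "B = (\<Sum>j\<le>s. x j *\<^sub>R Bf th j)"
  have B: "mat_dims N N B" "trp B = B" using Bf_th by (auto simp: B_def intro!: mat_dims_sum)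
  define w where "w e = inner (zc e) (B * zc e)" for e
  define q where "q = trc (B * Vf th * B * Vf th)"
  define m where "m = (\<Sum>e\<in>idx. (mv e)\<^sup>2 * (w e)\<^sup>2)"
  have mq: "m <= q" unfolding m_def q_def w_def by (rule trc_BVBV_ge[OF B])
  have m0: "0 <= m" unfolding m_def by (intro sum_nonneg) auto
  have G: "G = 2 * q" unfolding G_def q_def B_def by (rule sum_Gent)
  show "0 <= G" using G mq m0 by simp
  have w: "w e = (\<Sum>j\<le>s. x j * inner (zc e) (Bf th j * zc e))" for e
    by (simp add: w_def B_def sum_distrib_right inner_sum_right)
  have "(\<Sum>j\<le>s. \<Sum>k\<le>s. x j * x k * Kq (Bf th j) (Bf th k)) =
    (\<Sum>j\<le>s. \<Sum>k\<le>s. \<Sum>e\<in>idx. kap e * ((x j * inner (zc e) (Bf th j * zc e)) * (x k * inner (zc e) (Bf th k * zc e))))"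
    by (intro sum.cong refl) (simp add: Kq_zc Bf_th sum_distrib_left mult_ac)
  also have "\<dots> = (\<Sum>j\<le>s. \<Sum>e\<in>idx. \<Sum>k\<le>s. kap e * ((x j * inner (zc e) (Bf th j * zc e)) * (x k * inner (zc e) (Bf th k * zc e))))"
    by (intro sum.cong refl sum.swap)
  also have "\<dots> = (\<Sum>e\<in>idx. \<Sum>j\<le>s. \<Sum>k\<le>s. kap e * ((x j * inner (zc e) (Bf th j * zc e)) * (x k * inner (zc e) (Bf th k * zc e))))"
    by (rule sum.swap)
  also have "\<dots> = (\<Sum>e\<in>idx. kap e * (w e)\<^sup>2)"
    unfolding w power2_eq_square sum_product by (simp only: sum_distrib_left)
  finally have I: "I = (\<Sum>e\<in>idx. kap e * (w e)\<^sup>2) + G"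
    by (simp add: I_def G_def info1_eq[OF T] distrib_left sum.distrib)
  have "(\<Sum>e\<in>idx. kap e * (w e)\<^sup>2) <= (\<Sum>e\<in>idx. K * ((mv e)\<^sup>2 * (w e)\<^sup>2))"
    using K by (intro sum_mono) (auto simp: kap_eq mv_eq mult.assoc[symmetric] intro!: mult_right_mono)
  also have "\<dots> = K * m" by (simp add: m_def sum_distrib_left)
  also have "\<dots> <= K * q" using K mq by (intro mult_left_mono) auto
  finally show "I <= (1 + K / 2) * G" using I G by (simp add: algebra_simps)
  have "- (2 - C) * q <= - (2 - C) * m" using mq C(2) by (intro mult_left_mono_neg) auto
  also have "\<dots> = (\<Sum>e\<in>idx. - (2 - C) * ((mv e)\<^sup>2 * (w e)\<^sup>2))" by (simp only: m_def sum_distrib_left)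
  also have "\<dots> <= (\<Sum>e\<in>idx. kap e * (w e)\<^sup>2)"
  proof (intro sum_mono)
    fix e assume e: "e \<in> idx"
    then have "- (2 - C) * (mv e)\<^sup>2 <= kap e" using C(1)[of "fst e"] by (auto simp: kap_eq mv_eq)
    then have "- (2 - C) * (mv e)\<^sup>2 * (w e)\<^sup>2 <= kap e * (w e)\<^sup>2" by (intro mult_right_mono) auto
    then show "- (2 - C) * ((mv e)\<^sup>2 * (w e)\<^sup>2) <= kap e * (w e)\<^sup>2" by (simp add: mult.assoc)
  qed
  finally show "C / 2 * G <= I" using I G by (simp add: algebra_simps)
qed

subsection \<open>Grouping by the values of f\<close>

abbreviation "nz \<equiv> nonzero_quads D"

lemma finite_quads: "finite (quads D)" "finite nz" "finite (fclass D \<phi>)" "finite (fvals D)"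
  by (auto simp: quads_def nonzero_quads_def fclass_def fvals_def)

lemma fclass_nz: "\<phi> \<in> fvals D ==> {q \<in> nz. fcoef D q = \<phi>} = fclass D \<phi>"
  by (auto simp: fclass_def nonzero_quads_def fvals_def)

lemma sum_nz: "sum F nz = (\<Sum>\<phi>\<in>fvals D. sum F (fclass D \<phi>))" for F :: "quad => real"
proof -
  have "fcoef D ` nz = fvals D" by (auto simp: nonzero_quads_def fvals_def)
  then have "sum F nz = (\<Sum>\<phi>\<in>fvals D. sum F {q \<in> nz. fcoef D q = \<phi>})"
    using sum.image_gen[OF finite_quads(2), of F "fcoef D"] by simp
  then show ?thesis by (simp add: fclass_nz)
qed

lemma sum_nz_fcoef: "(\<Sum>q\<in>nz. H (fcoef D q)) = (\<Sum>\<phi>\<in>fvals D. hcount D \<phi> * H \<phi>)" for H :: "real vec => real"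
  unfolding sum_nz by (intro sum.cong refl) (simp add: fclass_def hcount_def)

lemma hcount_pos: "\<phi> \<in> fvals D ==> 0 < hcount D \<phi>"
  unfolding hcount_def by (auto simp: card_gt_0_iff finite_quads) (auto simp: fvals_def fclass_def)

lemma fcoef_swap: "fcoef D (a, c, b, d) = fcoef D (a, b, c, d)" "fcoef D (a, b, d, c) = fcoef D (a, b, c, d)"
  by (simp_all add: fcoef_def mult_ac)

lemma nz_swap: "(a, c, b, d) \<in> nz \<longleftrightarrow> (a, b, c, d) \<in> nz" "(a, b, d, c) \<in> nz \<longleftrightarrow> (a, b, c, d) \<in> nz"
  by (auto simp: nonzero_quads_def quads_def fcoef_swap)

text \<open>Passing to class averages changes nothing, because the cumulant is constant on each
  class of f and zero outside. Writing it as a fourth moment minus three pairings then gives the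
  factor 3: f is symmetric in its indices, so the three sums agree.\<close>

lemma info1_nz:
  assumes T: "contrast_mat D T" and jk: "j <= s" "k <= s"
  defines "cc q \<equiv> ccoef D th j k (fcoef D q)"
  shows "info1 M D T c y th $$ (j, k) = (\<Sum>q\<in>nz. cc q * expectation (uu q))
     - 3 * (\<Sum>(a, b, c, d)\<in>nz. cc (a, b, c, d) * (ent (Vf th) a c * ent (Vf th) b d)) + Gent D th j k"
proof -
  define F where "F = (\<lambda>(a, b, c, d). ent (Bf th j) a b * ent (Bf th k) c d)"
  have kf0: "kf q = 0" if "q \<in> quads D - nz" for q
    using that by (auto simp: kf_fcoef nonzero_quads_def)
  have "Kq (Bf th j) (Bf th k) = (\<Sum>q\<in>quads D. F q * kf q)"
    by (simp add: Kq_def F_def case_prod_beta)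
  also have "\<dots> = (\<Sum>q\<in>nz. F q * kf q)"
    using kf0 finite_quads by (intro sum.mono_neutral_right) (auto simp: nonzero_quads_def)
  also have "\<dots> = (\<Sum>\<phi>\<in>fvals D. \<Sum>q\<in>fclass D \<phi>. F q * (\<Sum>t\<le>s. kp t * \<phi> $ t))"
    unfolding sum_nz by (intro sum.cong refl) (auto simp: fclass_def kf_fcoef)
  also have "\<dots> = (\<Sum>\<phi>\<in>fvals D. hcount D \<phi> * (ccoef D th j k \<phi> * (\<Sum>t\<le>s. kp t * \<phi> $ t)))"
  proof (intro sum.cong refl)
    fix \<phi> assume \<phi>: "\<phi> \<in> fvals D"
    have "sum F (fclass D \<phi>) = (\<Sum>(i1, i2, i3, i4)\<in>fclass D \<phi>. Bmat D th j $$ (i1, i2) * Bmat D th k $$ (i3, i4))"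
      by (intro sum.cong refl) (auto simp: F_def fclass_def quads_def Bmat_ent[OF th_ps] jk)
    then have "hcount D \<phi> * ccoef D th j k \<phi> = sum F (fclass D \<phi>)"
      using hcount_pos[OF \<phi>] by (simp add: ccoef_def)
    then show "(\<Sum>q\<in>fclass D \<phi>. F q * (\<Sum>t\<le>s. kp t * \<phi> $ t)) = hcount D \<phi> * (ccoef D th j k \<phi> * (\<Sum>t\<le>s. kp t * \<phi> $ t))"
      by (simp add: sum_distrib_right[symmetric] mult.assoc[symmetric])
  qed
  also have "\<dots> = (\<Sum>q\<in>nz. cc q * (\<Sum>t\<le>s. kp t * fcoef D q $ t))"
    unfolding cc_def by (rule sum_nz_fcoef[symmetric])
  also have "\<dots> = (\<Sum>q\<in>nz. cc q * kf q)"
    by (intro sum.cong refl) (simp add: kf_fcoef nonzero_quads_def)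
  also have "\<dots> = (\<Sum>(a, b, c, d)\<in>nz. cc (a, b, c, d) * expectation (uu (a, b, c, d)) - cc (a, b, c, d) * VV (a, b, c, d)
      - cc (a, b, c, d) * VV (a, c, b, d) - cc (a, b, c, d) * VV (a, d, b, c))"
    by (intro sum.cong refl) (auto simp: nonzero_quads_def quads_def uu_expect algebra_simps)
  also have "\<dots> = (\<Sum>(a, b, c, d)\<in>nz. cc (a, b, c, d) * expectation (uu (a, b, c, d))) - (\<Sum>(a, b, c, d)\<in>nz. cc (a, b, c, d) * VV (a, b, c, d))
      - (\<Sum>(a, b, c, d)\<in>nz. cc (a, b, c, d) * VV (a, c, b, d)) - (\<Sum>(a, b, c, d)\<in>nz. cc (a, b, c, d) * VV (a, d, b, c))"
    unfolding sum_subtractf[symmetric] by (intro sum.cong refl) auto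
  also have "(\<Sum>(a, b, c, d)\<in>nz. cc (a, b, c, d) * VV (a, b, c, d)) = (\<Sum>(a, b, c, d)\<in>nz. cc (a, b, c, d) * VV (a, c, b, d))"
    by (rule sum.reindex_bij_witness[of _ "\<lambda>(a, b, c, d). (a, c, b, d)" "\<lambda>(a, b, c, d). (a, c, b, d)"])
       (auto simp: nz_swap cc_def fcoef_swap)
  also have "(\<Sum>(a, b, c, d)\<in>nz. cc (a, b, c, d) * VV (a, d, b, c)) = (\<Sum>(a, b, c, d)\<in>nz. cc (a, b, c, d) * VV (a, c, b, d))"
    by (rule sum.reindex_bij_witness[of _ "\<lambda>(a, b, c, d). (a, b, d, c)" "\<lambda>(a, b, c, d). (a, b, d, c)"])
       (auto simp: nz_swap cc_def fcoef_swap)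
  finally show ?thesis by (simp add: info1_eq[OF T jk] VV_def case_prod_beta)
qed

end

context lmm
begin

lemma Gam_V:
  assumes "a < N" "b < N"
  shows "\<theta> $ 0 * Gam D \<theta> a b = ent (Vf \<theta>) a b"
proof -
  have "ent (Wf t) a b = scalar_prod (row (Zmat D t) a) (row (Zmat D t) b)" if t: "t <= s" for t
  proof -
    have "ent (Wf t) a b = (\<Sum>q<neff D t. Zmat D t $$ (a, q) * Zmat D t $$ (b, q))"
      unfolding Wf_def ent_times_left[OF Z_dims[OF t]] using Zmat_carrier[OF t] assms by (simp add: Zf_def ent_fm)
    then show ?thesis using Zmat_carrier[OF t] assms by (simp add: scalar_prod_def atLeast0LessThan)
  qed
  then show ?thesis by (simp add: Vf_def Gam_def varc_def sum_distrib_left mult.assoc)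
qed

text \<open>The same shape as \<open>info1_nz\<close>, with fourth moments replaced by products of
  residuals and the parameter by a general one, so that the two can be subtracted term by
  term.\<close>

lemma poquim_nz:
  fixes \<theta> :: "real vec"
  assumes "j <= s" "k <= s"
  defines "cc q \<equiv> ccoef D \<theta> j k (fcoef D q)"
  shows "poquim D \<theta> z $$ (j, k) = (\<Sum>(a, b, c, d)\<in>nonzero_quads D. cc (a, b, c, d) * (u_hat D \<theta> z $ a * u_hat D \<theta> z $ b * u_hat D \<theta> z $ c * u_hat D \<theta> z $ d))
    - 3 * (\<Sum>(a, b, c, d)\<in>nonzero_quads D. cc (a, b, c, d) * (ent (Vf \<theta>) a c * ent (Vf \<theta>) b d)) + Gent D \<theta> j k"
proof -
  have "(\<theta> $ 0)\<^sup>2 * (\<Sum>(i1, i2, i3, i4)\<in>nonzero_quads D. cc (i1, i2, i3, i4) * Gam D \<theta> i1 i3 * Gam D \<theta> i2 i4)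
     = (\<Sum>(a, b, c, d)\<in>nonzero_quads D. cc (a, b, c, d) * ((\<theta> $ 0 * Gam D \<theta> a c) * (\<theta> $ 0 * Gam D \<theta> b d)))"
    by (simp add: sum_distrib_left case_prod_beta power2_eq_square mult_ac)
  also have "\<dots> = (\<Sum>(a, b, c, d)\<in>nonzero_quads D. cc (a, b, c, d) * (ent (Vf \<theta>) a c * ent (Vf \<theta>) b d))"
    by (intro sum.cong refl) (auto simp: nonzero_quads_def quads_def Gam_V)
  finally show ?thesis
    using assms by (simp add: poquim_def poquim11_def poquim12_def cc_def Gent_def)
qed

end

section \<open>Law of large numbers for products of four errors\<close>

lemma abs_weighted_sum_pow4:
  fixes w x :: "'a => real"
  shows "(\<Sum>i\<in>A. w i * x i) ^ 4 <= (\<Sum>i\<in>A. \<bar>w i\<bar>) ^ 3 * (\<Sum>i\<in>A. \<bar>w i\<bar> * x i ^ 4)"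
proof -
  have "(\<Sum>i\<in>A. w i * x i) = (\<Sum>i\<in>A. \<bar>w i\<bar> * (sgn (w i) * x i))"
    by (intro sum.cong refl) (simp add: mult.assoc[symmetric] abs_mult_sgn)
  also have "\<dots> ^ 4 <= (\<Sum>i\<in>A. \<bar>w i\<bar>) ^ 3 * (\<Sum>i\<in>A. \<bar>w i\<bar> * (sgn (w i) * x i) ^ 4)"
    by (rule weighted_sum_pow4) simp
  also have "(\<Sum>i\<in>A. \<bar>w i\<bar> * (sgn (w i) * x i) ^ 4) = (\<Sum>i\<in>A. \<bar>w i\<bar> * x i ^ 4)"
    by (intro sum.cong refl) (auto simp: sgn_real_def power_mult_distrib)
  finally show ?thesis .
qed

lemma abs_prod4_mono:
  fixes a b c d :: real
  assumes "\<bar>a\<bar> <= A" "\<bar>b\<bar> <= B" "\<bar>c\<bar> <= C" "\<bar>d\<bar> <= E"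
  shows "\<bar>a * b * c * d\<bar> <= A * B * C * E"
proof -
  have n: "0 <= A" "0 <= B" "0 <= C" "0 <= E" using assms by (meson abs_ge_zero order_trans)+
  have "\<bar>a\<bar> * \<bar>b\<bar> <= A * B" using assms n by (intro mult_mono abs_ge_zero) 
  then have "\<bar>a\<bar> * \<bar>b\<bar> * \<bar>c\<bar> <= A * B * C" using assms n by (intro mult_mono abs_ge_zero) simp_all
  then have "\<bar>a\<bar> * \<bar>b\<bar> * \<bar>c\<bar> * \<bar>d\<bar> <= A * B * C * E" using assms n by (intro mult_mono abs_ge_zero) simp_all
  then show ?thesis by (simp add: abs_mult)
qed

text \<open>With L the largest factor and m the largest deviation, telescoping bounds the left side
  by 4 (L + m)^3 m. If m \<le> \<tau> L this is at most 32 \<tau> L^4, otherwise L \<le> m / \<tau>.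
  The split allows deviations with small fourth moments to be played against factors whose fourth
  moments are merely bounded.\<close>

lemma prod4_diff:
  fixes a b c d a' b' c' d' \<tau> :: real
  assumes \<tau>: "0 < \<tau>" "\<tau> <= 1"
  shows "\<bar>a' * b' * c' * d' - a * b * c * d\<bar> <= 32 * \<tau> * (a ^ 4 + b ^ 4 + c ^ 4 + d ^ 4)
    + 32 / \<tau> ^ 3 * ((a' - a) ^ 4 + (b' - b) ^ 4 + (c' - c) ^ 4 + (d' - d) ^ 4)"
proof -
  define L where "L = max (max \<bar>a\<bar> \<bar>b\<bar>) (max \<bar>c\<bar> \<bar>d\<bar>)"
  define m where "m = max (max \<bar>a' - a\<bar> \<bar>b' - b\<bar>) (max \<bar>c' - c\<bar> \<bar>d' - d\<bar>)"
  have L: "\<bar>a\<bar> <= L" "\<bar>b\<bar> <= L" "\<bar>c\<bar> <= L" "\<bar>d\<bar> <= L" by (simp_all add: L_def le_max_iff_disj)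
  have m: "\<bar>a' - a\<bar> <= m" "\<bar>b' - b\<bar> <= m" "\<bar>c' - c\<bar> <= m" "\<bar>d' - d\<bar> <= m" by (simp_all add: m_def le_max_iff_disj)
  have L0: "0 <= L" and m0: "0 <= m" using L(1) m(1) by linarith+
  have L': "\<bar>a\<bar> <= L + m" "\<bar>b\<bar> <= L + m" "\<bar>c\<bar> <= L + m" "\<bar>b'\<bar> <= L + m" "\<bar>c'\<bar> <= L + m" "\<bar>d'\<bar> <= L + m"
    using L m m0 by linarith+
  have "a' * b' * c' * d' - a * b * c * d = (a' - a) * b' * c' * d' + a * (b' - b) * c' * d' + a * b * (c' - c) * d' + a * b * c * (d' - d)"
    by (simp add: algebra_simps)
  also have "\<bar>\<dots>\<bar> <= \<bar>(a' - a) * b' * c' * d'\<bar> + \<bar>a * (b' - b) * c' * d'\<bar> + \<bar>a * b * (c' - c) * d'\<bar> + \<bar>a * b * c * (d' - d)\<bar>"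
    by linarith
  also have "\<dots> <= m * (L + m) * (L + m) * (L + m) + (L + m) * m * (L + m) * (L + m) + (L + m) * (L + m) * m * (L + m) + (L + m) * (L + m) * (L + m) * m"
    by (intro add_mono abs_prod4_mono L' m)
  also have "\<dots> = 4 * (L + m) ^ 3 * m" by (simp add: power3_eq_cube algebra_simps)
  finally have 1: "\<bar>a' * b' * c' * d' - a * b * c * d\<bar> <= 4 * (L + m) ^ 3 * m" .
  have L4: "L ^ 4 <= a ^ 4 + b ^ 4 + c ^ 4 + d ^ 4"
  proof -
    have "L ^ 4 = a ^ 4 \<or> L ^ 4 = b ^ 4 \<or> L ^ 4 = c ^ 4 \<or> L ^ 4 = d ^ 4" unfolding L_def max_def by auto
    moreover have "0 <= a ^ 4" "0 <= b ^ 4" "0 <= c ^ 4" "0 <= d ^ 4" by auto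
    ultimately show ?thesis by linarith
  qed
  have m4: "m ^ 4 <= (a' - a) ^ 4 + (b' - b) ^ 4 + (c' - c) ^ 4 + (d' - d) ^ 4"
  proof -
    have "m ^ 4 = (a' - a) ^ 4 \<or> m ^ 4 = (b' - b) ^ 4 \<or> m ^ 4 = (c' - c) ^ 4 \<or> m ^ 4 = (d' - d) ^ 4"
      unfolding m_def max_def by auto
    moreover have "0 <= (a' - a) ^ 4" "0 <= (b' - b) ^ 4" "0 <= (c' - c) ^ 4" "0 <= (d' - d) ^ 4" by auto
    ultimately show ?thesis by linarith
  qed
  have "4 * (L + m) ^ 3 * m <= 32 * \<tau> * L ^ 4 + 32 / \<tau> ^ 3 * m ^ 4"
  proof (cases "m <= \<tau> * L")
    case True
    then have "m <= L" using \<tau> L0 by (meson mult_left_le_one_le order_trans less_imp_le)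
    then have "4 * (L + m) ^ 3 * m <= 4 * (2 * L) ^ 3 * (\<tau> * L)"
      using True L0 m0 by (intro mult_mono power_mono) auto
    also have "\<dots> = 32 * \<tau> * L ^ 4" by (simp add: power3_eq_cube power4_eq_xxxx)
    finally show ?thesis using \<tau> by (smt (verit) divide_nonneg_pos mult_nonneg_nonneg zero_le_even_power even_numeral zero_less_power)
  next
    case False
    then have "L <= m / \<tau>" using \<tau> by (simp add: field_simps)
    moreover have "m <= m / \<tau>" using \<tau> m0 mult_left_le_one_le[of m \<tau>] by (simp add: field_simps)
    ultimately have "4 * (L + m) ^ 3 * m <= 4 * (2 * (m / \<tau>)) ^ 3 * m"
      using L0 m0 by (intro mult_mono power_mono) auto
    also have "\<dots> = 32 / \<tau> ^ 3 * m ^ 4" by (simp add: power3_eq_cube power4_eq_xxxx)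
    finally show ?thesis using \<tau> by (smt (verit) mult_nonneg_nonneg zero_le_even_power even_numeral)
  qed
  also have "\<dots> <= 32 * \<tau> * (a ^ 4 + b ^ 4 + c ^ 4 + d ^ 4)
    + 32 / \<tau> ^ 3 * ((a' - a) ^ 4 + (b' - b) ^ 4 + (c' - c) ^ 4 + (d' - d) ^ 4)"
    using L4 m4 \<tau> by (intro add_mono mult_left_mono) auto
  finally show ?thesis using 1 by linarith
qed

lemma diff_pow4_le: "(a - b) ^ 4 <= 8 * (a ^ 4 + b ^ 4)" for a b :: real
proof -
  have "(\<Sum>i\<in>{True, False}. 1 * (if i then a else - b)) ^ 4 <= (\<Sum>i\<in>{True, False}. 1) ^ 3 * (\<Sum>i\<in>{True, False}. 1 * (if i then a else - b) ^ 4)"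
    by (rule weighted_sum_pow4) simp
  then show ?thesis by simp
qed

definition clip :: "real => real => real" where "clip B x = max (- B) (min B x)"

lemma clip_measurable [measurable]: "clip B \<in> borel_measurable borel"
  unfolding clip_def[abs_def] by measurable

lemma abs_clip_le: "0 <= B ==> \<bar>clip B x\<bar> <= B" by (auto simp: clip_def)

context lmm_model
begin

text \<open>The single effects are truncated, not u: so the truncated component is still a function
  of independent variables and depends on no effect outside its row of Z.\<close>

definition "uB B i \<omega> = (\<Sum>e\<in>idx. zi i e * clip B (ef e \<omega>))"
definition "uuB B = (\<lambda>(a, b, c, d) \<omega>. uB B a \<omega> * uB B b \<omega> * uB B c \<omega> * uB B d \<omega>)"
abbreviation "ui i \<omega> \<equiv> ent (u \<omega>) i 0"

text \<open>Convexity with the weights |w_e|. It applies to any function of the effects, in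
  particular to truncation remainders, which are not centred.\<close>

lemma transform_moment4:
  fixes g :: "real => real" and w :: "nat \<times> nat => real"
  assumes g[measurable]: "g \<in> borel_measurable borel" and gi: "\<And>t. t <= s ==> integrable (law t) (\<lambda>x. g x ^ 4)"
    and R: "(\<Sum>e\<in>idx. \<bar>w e\<bar>) <= R" and m: "\<And>t. t <= s ==> (\<integral>x. g x ^ 4 \<partial>law t) <= m"
  shows "integrable M (\<lambda>\<omega>. (\<Sum>e\<in>idx. w e * g (ef e \<omega>)) ^ 4)"
    "expectation (\<lambda>\<omega>. (\<Sum>e\<in>idx. w e * g (ef e \<omega>)) ^ 4) <= R ^ 4 * m"
proof -
  define l where "l = (\<Sum>e\<in>idx. \<bar>w e\<bar>)"
  have l0: "0 <= l" by (simp add: l_def sum_nonneg)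
  have i: "integrable M (\<lambda>\<omega>. g (ef e \<omega>) ^ 4)" if "e \<in> idx" for e
    using ef_integral(2)[OF that, of "\<lambda>x. g x ^ 4"] gi that by auto
  have i': "integrable M (\<lambda>\<omega>. l ^ 3 * (\<Sum>e\<in>idx. \<bar>w e\<bar> * g (ef e \<omega>) ^ 4))"
    using i by (intro integrable_mult_right Bochner_Integration.integrable_sum) auto
  have le: "(\<Sum>e\<in>idx. w e * g (ef e \<omega>)) ^ 4 <= l ^ 3 * (\<Sum>e\<in>idx. \<bar>w e\<bar> * g (ef e \<omega>) ^ 4)" for \<omega>
    unfolding l_def by (rule abs_weighted_sum_pow4)
  have [measurable]: "ef e \<in> borel_measurable M" if "e \<in> idx" for e using that by (rule rv)
  show int: "integrable M (\<lambda>\<omega>. (\<Sum>e\<in>idx. w e * g (ef e \<omega>)) ^ 4)"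
  proof (rule Bochner_Integration.integrable_bound[OF i'])
    show "(\<lambda>\<omega>. (\<Sum>e\<in>idx. w e * g (ef e \<omega>)) ^ 4) \<in> borel_measurable M"
      by (intro borel_measurable_power borel_measurable_sum borel_measurable_times borel_measurable_const measurable_compose[OF _ g]) (rule rv)
    show "AE \<omega> in M. norm ((\<Sum>e\<in>idx. w e * g (ef e \<omega>)) ^ 4) <= norm (l ^ 3 * (\<Sum>e\<in>idx. \<bar>w e\<bar> * g (ef e \<omega>) ^ 4))"
    proof (rule AE_I2)
      fix \<omega>
      have "norm ((\<Sum>e\<in>idx. w e * g (ef e \<omega>)) ^ 4) = (\<Sum>e\<in>idx. w e * g (ef e \<omega>)) ^ 4" by simp
      also note le[of \<omega>]
      finally show "norm ((\<Sum>e\<in>idx. w e * g (ef e \<omega>)) ^ 4) <= norm (l ^ 3 * (\<Sum>e\<in>idx. \<bar>w e\<bar> * g (ef e \<omega>) ^ 4))"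
        unfolding real_norm_def by linarith
    qed
  qed
  have "expectation (\<lambda>\<omega>. (\<Sum>e\<in>idx. w e * g (ef e \<omega>)) ^ 4) <= expectation (\<lambda>\<omega>. l ^ 3 * (\<Sum>e\<in>idx. \<bar>w e\<bar> * g (ef e \<omega>) ^ 4))"
    using int i' le by (intro integral_mono) auto
  also have "\<dots> = l ^ 3 * (\<Sum>e\<in>idx. \<bar>w e\<bar> * (\<integral>x. g x ^ 4 \<partial>law (fst e)))"
  proof -
    have "expectation (\<lambda>\<omega>. l ^ 3 * (\<Sum>e\<in>idx. \<bar>w e\<bar> * g (ef e \<omega>) ^ 4)) = l ^ 3 * (\<Sum>e\<in>idx. \<bar>w e\<bar> * expectation (\<lambda>\<omega>. g (ef e \<omega>) ^ 4))"
      using i by (simp add: Bochner_Integration.integral_sum)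
    then show ?thesis using ef_integral(1)[where g = "\<lambda>x. g x ^ 4"] by simp
  qed
  also have "\<dots> <= l ^ 3 * (\<Sum>e\<in>idx. \<bar>w e\<bar> * m)"
    using m l0 by (intro mult_left_mono sum_mono) auto
  also have "\<dots> = l ^ 4 * m" by (simp add: l_def sum_distrib_right[symmetric] power3_eq_cube power4_eq_xxxx)
  also have "\<dots> <= R ^ 4 * m"
  proof (intro mult_right_mono power_mono l0)
    show "l <= R" using R by (simp add: l_def)
    have "0 <= (\<integral>x. g x ^ 4 \<partial>law 0)" by (rule Bochner_Integration.integral_nonneg) simp
    from order_trans[OF this m[of 0]] show "0 <= m" by simp
  qed
  finally show "expectation (\<lambda>\<omega>. (\<Sum>e\<in>idx. w e * g (ef e \<omega>)) ^ 4) <= R ^ 4 * m" .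
qed

lemma ui_measurable [measurable]: "ui i \<in> borel_measurable M"
  unfolding ent_u[abs_def] by (rule lin_measurable) simp

lemma uB_measurable [measurable]: "uB B i \<in> borel_measurable M"
  unfolding uB_def[abs_def]
  by (intro borel_measurable_sum borel_measurable_times borel_measurable_const measurable_compose[OF rv clip_measurable])

lemma uuB_measurable [measurable]: "uuB B q \<in> borel_measurable M"
  by (cases q) (simp add: uuB_def)

lemma uu_measurable [measurable]: "uu q \<in> borel_measurable M"
  by (cases q) (simp add: uu_def)

lemma abs_uB_le:
  assumes "0 <= B" "(\<Sum>e\<in>idx. \<bar>zi i e\<bar>) <= R"
  shows "\<bar>uB B i \<omega>\<bar> <= R * B"
proof -
  have "\<bar>uB B i \<omega>\<bar> <= (\<Sum>e\<in>idx. \<bar>zi i e * clip B (ef e \<omega>)\<bar>)" unfolding uB_def by (rule sum_abs)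
  also have "\<dots> <= (\<Sum>e\<in>idx. \<bar>zi i e\<bar> * B)"
    using abs_clip_le[OF assms(1)] by (intro sum_mono) (auto simp: abs_mult intro: mult_left_mono)
  also have "\<dots> <= R * B" using assms by (simp add: sum_distrib_right[symmetric] mult_right_mono)
  finally show ?thesis .
qed

lemma abs_uuB_le:
  assumes B: "0 <= B" and R: "\<And>i. i < N ==> (\<Sum>e\<in>idx. \<bar>zi i e\<bar>) <= R" and q: "q \<in> quads D"
  shows "\<bar>uuB B q \<omega>\<bar> <= (R * B) ^ 4"
proof -
  obtain a b c d where q': "q = (a, b, c, d)" "a < N" "b < N" "c < N" "d < N" using q by (cases q) (auto simp: quads_def)
  have l: "\<bar>uB B i \<omega>\<bar> <= R * B" if "i < N" for i using abs_uB_le[OF B R[OF that]] .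
  have RB: "0 <= R * B" using l[OF q'(2)] by linarith
  show ?thesis using abs_prod4_mono[OF l[OF q'(2)] l[OF q'(3)] l[OF q'(4)] l[OF q'(5)]]
    by (simp add: q'(1) uuB_def power4_eq_xxxx)
qed

text \<open>The effects that enter at least one of the four components. \<open>overlap\<close> is
  the condition counted by \<open>hcount2\<close>, so quadruples outside that count involve disjoint
  sets of effects.\<close>

definition "supp q = {e \<in> idx. dsum D q (fst e) (snd e) \<noteq> 0}"
definition "overlap q1 q2 \<longleftrightarrow> (\<Sum>t\<le>s. \<Sum>q<neff D t. dsum D q1 t q * dsum D q2 t q) \<noteq> 0"

lemma overlap_iff: "overlap q1 q2 \<longleftrightarrow> (\<exists>t\<le>s. \<exists>q<neff D t. dsum D q1 t q \<noteq> 0 \<and> dsum D q2 t q \<noteq> 0)"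
  unfolding overlap_def by auto

lemma supp_disjoint: "\<not> overlap q1 q2 ==> supp q1 \<inter> supp q2 = {}"
  unfolding overlap_iff supp_def by fastforce

lemma uB_supp:
  assumes "i < N" "\<And>e. e \<in> idx ==> dind D i (fst e) (snd e) \<noteq> 0 ==> e \<in> A" "A \<subseteq> idx"
  shows "uB B i \<omega> = (\<Sum>e\<in>A. zi i e * clip B ((\<lambda>e\<in>A. ef e \<omega>) e))"
proof -
  have "zi i e = 0" if e: "e \<in> idx - A" for e
  proof -
    have "dind D i (fst e) (snd e) = 0" using e assms(2)[of e] by blast
    then have "Zmat D (fst e) $$ (i, snd e) = 0" by (simp add: dind_def split: if_splits)
    then show ?thesis using zi_eq[of e i] e assms(1) by simp
  qed
  then have "uB B i \<omega> = (\<Sum>e\<in>A. zi i e * clip B (ef e \<omega>))"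
    unfolding uB_def using assms(3) fin by (intro sum.mono_neutral_right) auto
  then show ?thesis by simp
qed

lemma uuB_uncorrelated:
  assumes B: "0 <= B" and R: "\<And>i. i < N ==> (\<Sum>e\<in>idx. \<bar>zi i e\<bar>) <= R"
    and q: "q1 \<in> quads D" "q2 \<in> quads D" "\<not> overlap q1 q2"
  shows "expectation (\<lambda>\<omega>. (uuB B q1 \<omega> - expectation (uuB B q1)) * (uuB B q2 \<omega> - expectation (uuB B q2))) = 0"
proof -
  \<comment> \<open>\<open>F\<close> expresses the truncated product through the effects in
    \<open>supp q\<close> alone, as independence of disjoint blocks demands.\<close>
  define F where "F = (\<lambda>A (a, b, c, d) x. (\<Sum>e\<in>A. zi a e * clip B (x e)) * (\<Sum>e\<in>A. zi b e * clip B (x e))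
     * (\<Sum>e\<in>A. zi c e * clip B (x e)) * (\<Sum>e\<in>A. zi d e * clip B (x e)))"
  have Fm: "F A q \<in> borel_measurable (PiM A (\<lambda>_. borel))" for A q
    unfolding F_def by (cases q)
      (auto intro!: borel_measurable_times borel_measurable_sum
        measurable_compose[OF measurable_component_singleton[of _ _ "\<lambda>_. borel"] clip_measurable])
  have FU: "uuB B q \<omega> = F (supp q) q (\<lambda>e\<in>supp q. ef e \<omega>)" if q: "q \<in> quads D" for q \<omega>
  proof -
    obtain a b c d where q': "q = (a, b, c, d)" "a < N" "b < N" "c < N" "d < N" using q by (cases q) (auto simp: quads_def)
    have "supp q \<subseteq> idx" by (auto simp: supp_def)
    moreover have "dsum D q t r = dind D a t r + dind D b t r + dind D c t r + dind D d t r" for t r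
      by (simp add: q'(1) dsum_def)
    ultimately show ?thesis unfolding q'(1) uuB_def F_def prod.case
      using q'(2-) by (subst (1 2 3 4) uB_supp[where A = "supp q"]) (auto simp: supp_def q'(1))
  qed
  have int: "integrable M (uuB B q)" if "q \<in> quads D" for q
    by (rule integrable_const_bound[where B = "(R * B) ^ 4"]) (auto intro!: AE_I2 abs_uuB_le[OF B R that])
  define E1 E2 where "E1 = expectation (uuB B q1)" and "E2 = expectation (uuB B q2)"
  have "expectation (\<lambda>\<omega>. (F (supp q1) q1 (\<lambda>e\<in>supp q1. ef e \<omega>) - E1) * (F (supp q2) q2 (\<lambda>e\<in>supp q2. ef e \<omega>) - E2))
     = expectation (\<lambda>\<omega>. F (supp q1) q1 (\<lambda>e\<in>supp q1. ef e \<omega>) - E1) * expectation (\<lambda>\<omega>. F (supp q2) q2 (\<lambda>e\<in>supp q2. ef e \<omega>) - E2)"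
  proof (rule disjoint_mult(1)[OF supp_disjoint[OF q(3)], where F = "\<lambda>x. F (supp q1) q1 x - E1" and G = "\<lambda>x. F (supp q2) q2 x - E2"])
    show "supp q1 \<subseteq> idx" "supp q2 \<subseteq> idx" by (auto simp: supp_def)
    show "(\<lambda>x. F (supp q1) q1 x - E1) \<in> borel_measurable (PiM (supp q1) (\<lambda>_. borel))"
      "(\<lambda>x. F (supp q2) q2 x - E2) \<in> borel_measurable (PiM (supp q2) (\<lambda>_. borel))"
      by (intro borel_measurable_diff Fm borel_measurable_const)+
    show "integrable M (\<lambda>\<omega>. F (supp q1) q1 (\<lambda>e\<in>supp q1. ef e \<omega>) - E1)" "integrable M (\<lambda>\<omega>. F (supp q2) q2 (\<lambda>e\<in>supp q2. ef e \<omega>) - E2)"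
      unfolding FU[OF q(1), symmetric] FU[OF q(2), symmetric] using int q by auto
  qed
  also have "expectation (\<lambda>\<omega>. F (supp q1) q1 (\<lambda>e\<in>supp q1. ef e \<omega>) - E1) = 0"
    unfolding FU[OF q(1), symmetric] using int[OF q(1)] prob_space by (simp add: E1_def)
  finally show ?thesis unfolding FU[OF q(1), symmetric] FU[OF q(2), symmetric] by (simp add: E1_def E2_def)
qed

text \<open>Only overlapping quadruples can be correlated. A centred product is at most 2 (R B)^4 in
  absolute value, so each covariance is at most 4 (R B)^8; grouping pairs by their two values of f
  produces the sum of (iv).\<close>

lemma lln_truncated:
  fixes cc :: "real vec => real"
  assumes B: "0 <= B" and R: "\<And>i. i < N ==> (\<Sum>e\<in>idx. \<bar>zi i e\<bar>) <= R"
  defines "Z \<equiv> \<lambda>\<omega>. \<Sum>q\<in>nz. cc (fcoef D q) * (uuB B q \<omega> - expectation (uuB B q))"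
  shows "integrable M (\<lambda>\<omega>. (Z \<omega>)\<^sup>2)" "integrable M Z"
    "expectation (\<lambda>\<omega>. (Z \<omega>)\<^sup>2) <= 4 * (R * B) ^ 8 * (\<Sum>f1\<in>fvals D. \<Sum>f2\<in>fvals D. hcount2 D f1 f2 * \<bar>cc f1 * cc f2\<bar>)"
proof -
  define b where "b = (R * B) ^ 4"
  define Y where "Y q \<omega> = uuB B q \<omega> - expectation (uuB B q)" for q \<omega>
  have bnd: "\<bar>uuB B q \<omega>\<bar> <= b" if "q \<in> quads D" for q \<omega> unfolding b_def by (rule abs_uuB_le[OF B R that])
  have int: "integrable M (uuB B q)" if "q \<in> quads D" for q
    by (rule integrable_const_bound[where B = b]) (auto intro!: AE_I2 bnd that)
  have Eb: "\<bar>expectation (uuB B q)\<bar> <= b" if "q \<in> quads D" for q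
  proof -
    have "norm (expectation (uuB B q)) <= expectation (\<lambda>\<omega>. norm (uuB B q \<omega>))" by (rule integral_norm_bound)
    also have "\<dots> <= expectation (\<lambda>_. b)" using int[OF that] bnd[OF that] by (intro integral_mono) auto
    finally show ?thesis by (simp add: prob_space)
  qed
  have Y: "\<bar>Y q \<omega>\<bar> <= 2 * b" if "q \<in> quads D" for q \<omega> using bnd[OF that, of \<omega>] Eb[OF that] by (auto simp: Y_def)
  have YY: "\<bar>Y q \<omega> * Y q' \<omega>\<bar> <= 4 * b\<^sup>2" if "q \<in> quads D" "q' \<in> quads D" for q q' \<omega>
    using mult_mono[OF Y[OF that(1)] Y[OF that(2)]] Y[OF that(1), of \<omega>] by (simp add: abs_mult power2_eq_square)
  have [measurable]: "Y q \<in> borel_measurable M" for q unfolding Y_def by measurable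
  have iYY: "integrable M (\<lambda>\<omega>. Y q \<omega> * Y q' \<omega>)" if "q \<in> quads D" "q' \<in> quads D" for q q'
    by (rule integrable_const_bound[where B = "4 * b\<^sup>2"]) (auto intro!: AE_I2 YY that)
  have nzq: "q \<in> quads D" if "q \<in> nz" for q using that by (auto simp: nonzero_quads_def)
  have Z2: "(Z \<omega>)\<^sup>2 = (\<Sum>q\<in>nz. \<Sum>q'\<in>nz. cc (fcoef D q) * cc (fcoef D q') * (Y q \<omega> * Y q' \<omega>))" for \<omega>
    unfolding Z_def Y_def power2_eq_square sum_product by (intro sum.cong refl) (simp add: mult_ac)
  show "integrable M Z" unfolding Z_def using int nzq
    by (intro Bochner_Integration.integrable_sum integrable_mult_right Bochner_Integration.integrable_diff) auto
  show "integrable M (\<lambda>\<omega>. (Z \<omega>)\<^sup>2)"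
    unfolding Z2 using iYY nzq by (intro Bochner_Integration.integrable_sum integrable_mult_right) auto
  have E0: "expectation (\<lambda>\<omega>. Y q \<omega> * Y q' \<omega>) = 0" if "q \<in> quads D" "q' \<in> quads D" "\<not> overlap q q'" for q q'
    unfolding Y_def by (rule uuB_uncorrelated[OF B R that])
  have E1: "\<bar>expectation (\<lambda>\<omega>. Y q \<omega> * Y q' \<omega>)\<bar> <= 4 * b\<^sup>2" if "q \<in> quads D" "q' \<in> quads D" for q q'
  proof -
    have "norm (expectation (\<lambda>\<omega>. Y q \<omega> * Y q' \<omega>)) <= expectation (\<lambda>\<omega>. norm (Y q \<omega> * Y q' \<omega>))" by (rule integral_norm_bound)
    also have "\<dots> <= expectation (\<lambda>_. 4 * b\<^sup>2)" using iYY[OF that] YY[OF that] by (intro integral_mono) auto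
    finally show ?thesis by (simp add: prob_space)
  qed
  have "expectation (\<lambda>\<omega>. (Z \<omega>)\<^sup>2) = (\<Sum>q\<in>nz. \<Sum>q'\<in>nz. cc (fcoef D q) * cc (fcoef D q') * expectation (\<lambda>\<omega>. Y q \<omega> * Y q' \<omega>))"
    unfolding Z2 using iYY nzq by (simp add: Bochner_Integration.integral_sum)
  also have "\<dots> <= (\<Sum>q\<in>nz. \<Sum>q'\<in>nz. \<bar>cc (fcoef D q) * cc (fcoef D q')\<bar> * (4 * b\<^sup>2) * (if overlap q q' then 1 else 0))"
  proof (intro sum_mono)
    fix q q' assume q: "q \<in> nz" "q' \<in> nz"
    have "cc (fcoef D q) * cc (fcoef D q') * expectation (\<lambda>\<omega>. Y q \<omega> * Y q' \<omega>) <= \<bar>cc (fcoef D q) * cc (fcoef D q')\<bar> * \<bar>expectation (\<lambda>\<omega>. Y q \<omega> * Y q' \<omega>)\<bar>"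
      by (metis abs_ge_self abs_mult)
    also have "\<dots> <= \<bar>cc (fcoef D q) * cc (fcoef D q')\<bar> * (4 * b\<^sup>2 * (if overlap q q' then 1 else 0))"
      using E0[OF nzq[OF q(1)] nzq[OF q(2)]] E1[OF nzq[OF q(1)] nzq[OF q(2)]] by (intro mult_left_mono) auto
    finally show "cc (fcoef D q) * cc (fcoef D q') * expectation (\<lambda>\<omega>. Y q \<omega> * Y q' \<omega>) <= \<bar>cc (fcoef D q) * cc (fcoef D q')\<bar> * (4 * b\<^sup>2) * (if overlap q q' then 1 else 0)"
      by (simp add: mult.assoc)
  qed
  also have "\<dots> = (\<Sum>f1\<in>fvals D. \<Sum>f2\<in>fvals D. \<Sum>q\<in>fclass D f1. \<Sum>q'\<in>fclass D f2. \<bar>cc f1 * cc f2\<bar> * (4 * b\<^sup>2) * (if overlap q q' then 1 else 0))"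
  proof -
    have "(\<Sum>q\<in>nz. \<Sum>q'\<in>nz. \<bar>cc (fcoef D q) * cc (fcoef D q')\<bar> * (4 * b\<^sup>2) * (if overlap q q' then 1 else 0))
      = (\<Sum>f1\<in>fvals D. \<Sum>q\<in>fclass D f1. \<Sum>f2\<in>fvals D. \<Sum>q'\<in>fclass D f2. \<bar>cc f1 * cc f2\<bar> * (4 * b\<^sup>2) * (if overlap q q' then 1 else 0))"
      unfolding sum_nz by (intro sum.cong refl) (auto simp: fclass_def)
    also have "\<dots> = (\<Sum>f1\<in>fvals D. \<Sum>f2\<in>fvals D. \<Sum>q\<in>fclass D f1. \<Sum>q'\<in>fclass D f2. \<bar>cc f1 * cc f2\<bar> * (4 * b\<^sup>2) * (if overlap q q' then 1 else 0))"
      by (intro sum.cong refl sum.swap)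
    finally show ?thesis .
  qed
  also have "\<dots> = (\<Sum>f1\<in>fvals D. \<Sum>f2\<in>fvals D. hcount2 D f1 f2 * \<bar>cc f1 * cc f2\<bar> * (4 * b\<^sup>2))"
  proof (intro sum.cong refl)
    fix f1 f2
    have h: "{(q1, q2). q1 \<in> fclass D f1 \<and> q2 \<in> fclass D f2 \<and> (\<Sum>t\<le>s. \<Sum>q<neff D t. dsum D q1 t q * dsum D q2 t q) \<noteq> 0}
       = {q \<in> fclass D f1 \<times> fclass D f2. overlap (fst q) (snd q)}"
      unfolding overlap_def[symmetric] by auto
    have "(\<Sum>q\<in>fclass D f1. \<Sum>q'\<in>fclass D f2. \<bar>cc f1 * cc f2\<bar> * (4 * b\<^sup>2) * (if overlap q q' then 1 else 0))
      = (\<Sum>q\<in>fclass D f1 \<times> fclass D f2. \<bar>cc f1 * cc f2\<bar> * (4 * b\<^sup>2) * (if overlap (fst q) (snd q) then 1 else 0))"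
      by (simp add: sum.cartesian_product case_prod_beta)
    also have "\<dots> = \<bar>cc f1 * cc f2\<bar> * (4 * b\<^sup>2) * (\<Sum>q\<in>fclass D f1 \<times> fclass D f2. if overlap (fst q) (snd q) then 1 else 0)"
      by (simp only: sum_distrib_left)
    also have "(\<Sum>q\<in>fclass D f1 \<times> fclass D f2. if overlap (fst q) (snd q) then 1 else 0) = hcount2 D f1 f2"
      unfolding hcount2_def h using finite_quads by (subst sum.inter_filter[symmetric]) auto
    finally show "(\<Sum>q\<in>fclass D f1. \<Sum>q'\<in>fclass D f2. \<bar>cc f1 * cc f2\<bar> * (4 * b\<^sup>2) * (if overlap q q' then 1 else 0))
      = hcount2 D f1 f2 * \<bar>cc f1 * cc f2\<bar> * (4 * b\<^sup>2)" by (simp add: mult_ac)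
  qed
  also have "\<dots> = 4 * (R * B) ^ 8 * (\<Sum>f1\<in>fvals D. \<Sum>f2\<in>fvals D. hcount2 D f1 f2 * \<bar>cc f1 * cc f2\<bar>)"
    by (simp add: sum_distrib_left b_def power_mult[symmetric] mult_ac)
  finally show "expectation (\<lambda>\<omega>. (Z \<omega>)\<^sup>2) <= 4 * (R * B) ^ 8 * (\<Sum>f1\<in>fvals D. \<Sum>f2\<in>fvals D. hcount2 D f1 f2 * \<bar>cc f1 * cc f2\<bar>)" .
qed

end

section \<open>Moments of the dominating series and of the averaged errors\<close>

context lmm_model
begin

lemma inner_u_measurable [measurable]: "(\<lambda>\<omega>. inner a (u \<omega>)) \<in> borel_measurable M"
  unfolding inner_u[abs_def] by (rule lin_measurable) simp

lemma Sser_measurable [measurable]: "(\<lambda>\<omega>. Sser th m a (u \<omega>)) \<in> borel_measurable M"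
  by (induction m arbitrary: a) auto

text \<open>Independence of the effects enters at m = 0, where the fourth moment of a form is at
  most K + 3 times its squared variance. Each further step costs a factor s + 1 for the number of
  terms and C by \<open>PW_contract\<close>, both to the fourth power.\<close>

lemma Sser_moment:
  assumes K: "0 <= K" "\<And>t. t <= s ==> kp t <= K * (\<sigma>sq t)\<^sup>2"
    and C: "0 <= C" "\<And>t. t <= s ==> 1 <= C * \<sigma>sq t"
  shows "mat_dims N 1 a ==> integrable M (\<lambda>\<omega>. Sser th m a (u \<omega>) ^ 4) \<and>
    expectation (\<lambda>\<omega>. Sser th m a (u \<omega>) ^ 4) <= (real (s + 1) * C) ^ (4 * m) * ((K + 3) * (qV th a)\<^sup>2)"
proof (induction m arbitrary: a)
  case 0
  have k: "kap e <= K * (mv e)\<^sup>2" if "e \<in> idx" for e using K(2)[of "fst e"] that by (auto simp: kap_eq mv_eq)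
  have "S2 idx (\<lambda>e. inner a (zc e)) (\<lambda>e. inner a (zc e)) = qV th a" unfolding qV_def by (rule S2_inner[OF 0 0])
  then show ?case using lin_int4[of idx "\<lambda>e. inner a (zc e)"] lin_pow4_expect[OF K(1) k, of "\<lambda>e. inner a (zc e)"]
    by (simp add: inner_u)
next
  case (Suc m)
  let ?a = "\<lambda>t. Pf th * Wf t * a"
  let ?r = "real (s + 1)"
  have d: "mat_dims N 1 (?a t)" if "t <= s" for t by (rule PW_dims[OF th_ps that Suc.prems])
  have IH: "integrable M (\<lambda>\<omega>. Sser th m (?a t) (u \<omega>) ^ 4)"
    "expectation (\<lambda>\<omega>. Sser th m (?a t) (u \<omega>) ^ 4) <= (?r * C) ^ (4 * m) * ((K + 3) * (qV th (?a t))\<^sup>2)" if "t <= s" for t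
    using Suc.IH[OF d[OF that]] by auto
  have le: "Sser th (Suc m) a (u \<omega>) ^ 4 <= ?r ^ 3 * (\<Sum>t\<le>s. Sser th m (?a t) (u \<omega>) ^ 4)" for \<omega>
    using weighted_sum_pow4[of "{..s}" "\<lambda>_. 1" "\<lambda>t. Sser th m (?a t) (u \<omega>)"] by simp
  have i: "integrable M (\<lambda>\<omega>. ?r ^ 3 * (\<Sum>t\<le>s. Sser th m (?a t) (u \<omega>) ^ 4))"
    using IH by (intro integrable_mult_right Bochner_Integration.integrable_sum) auto
  have int: "integrable M (\<lambda>\<omega>. Sser th (Suc m) a (u \<omega>) ^ 4)"
  proof (rule Bochner_Integration.integrable_bound[OF i])
    show "(\<lambda>\<omega>. Sser th (Suc m) a (u \<omega>) ^ 4) \<in> borel_measurable M" by measurable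
    show "AE \<omega> in M. norm (Sser th (Suc m) a (u \<omega>) ^ 4) <= norm (?r ^ 3 * (\<Sum>t\<le>s. Sser th m (?a t) (u \<omega>) ^ 4))"
    proof (rule AE_I2)
      fix \<omega>
      have "norm (Sser th (Suc m) a (u \<omega>) ^ 4) = Sser th (Suc m) a (u \<omega>) ^ 4" by (simp del: Sser.simps)
      also note le[of \<omega>]
      finally show "norm (Sser th (Suc m) a (u \<omega>) ^ 4) <= norm (?r ^ 3 * (\<Sum>t\<le>s. Sser th m (?a t) (u \<omega>) ^ 4))"
        unfolding real_norm_def by linarith
    qed
  qed
  have "expectation (\<lambda>\<omega>. Sser th (Suc m) a (u \<omega>) ^ 4) <= expectation (\<lambda>\<omega>. ?r ^ 3 * (\<Sum>t\<le>s. Sser th m (?a t) (u \<omega>) ^ 4))"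
    using int i le by (intro integral_mono) auto
  also have "\<dots> = ?r ^ 3 * (\<Sum>t\<le>s. expectation (\<lambda>\<omega>. Sser th m (?a t) (u \<omega>) ^ 4))"
    using IH by (simp add: Bochner_Integration.integral_sum)
  also have "\<dots> <= ?r ^ 3 * (\<Sum>t\<le>s. (?r * C) ^ (4 * m) * ((K + 3) * (C\<^sup>2 * qV th a)\<^sup>2))"
  proof (intro mult_left_mono sum_mono)
    fix t assume "t \<in> {..s}"
    then have t: "t <= s" by simp
    have "1 <= C * varc th t" using C(2)[OF t] by (simp add: varc_th[OF t])
    then have "(qV th (?a t))\<^sup>2 <= (C\<^sup>2 * qV th a)\<^sup>2"
      using PW_contract[OF th_ps t C(1)] qV_nonneg[OF th_ps] by (intro power_mono) auto
    then have "(?r * C) ^ (4 * m) * ((K + 3) * (qV th (?a t))\<^sup>2) <= (?r * C) ^ (4 * m) * ((K + 3) * (C\<^sup>2 * qV th a)\<^sup>2)"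
      using K C by (intro mult_left_mono) auto
    then show "expectation (\<lambda>\<omega>. Sser th m (?a t) (u \<omega>) ^ 4) <= (?r * C) ^ (4 * m) * ((K + 3) * (C\<^sup>2 * qV th a)\<^sup>2)"
      using IH(2)[OF t] by linarith
  qed simp
  also have "\<dots> = ?r ^ 3 * (?r * ((?r * C) ^ (4 * m) * ((K + 3) * (C\<^sup>2 * qV th a)\<^sup>2)))" by simp
  also have "\<dots> = (?r * C) ^ (4 * Suc m) * ((K + 3) * (qV th a)\<^sup>2)"
    by (simp add: power_add power_mult_distrib power3_eq_cube power2_eq_square power4_eq_xxxx mult_ac)
  finally show ?case using int by blast
qed

text \<open>Since 2 \<eta> (s + 1) C is at most 1, the moments of the terms decay like 2^{-m}; these
  sum to 2, and 16 is 8 times 2. The result is proportional to the squared variance of the form,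
  hence small for \<open>lev\<close>.\<close>

lemma dom4_moment:
  assumes K: "0 <= K" "\<And>t. t <= s ==> kp t <= K * (\<sigma>sq t)\<^sup>2"
    and C: "0 <= C" "\<And>t. t <= s ==> 1 <= C * \<sigma>sq t"
    and \<eta>: "0 <= \<eta>" "4 * \<eta> * (real (s + 1) * C) <= 1" and a: "mat_dims N 1 a"
  shows "integrable M (\<lambda>\<omega>. dom4 th \<eta> a (u \<omega>))"
    "expectation (\<lambda>\<omega>. dom4 th \<eta> a (u \<omega>)) <= 16 * ((K + 3) * (qV th a)\<^sup>2)"
proof -
  define F where "F m \<omega> = (1/2) ^ m * ((2 * \<eta>) ^ m * Sser th m a (u \<omega>)) ^ 4" for m \<omega>
  define Q where "Q = (K + 3) * (qV th a)\<^sup>2"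
  have Q0: "0 <= Q" using K by (simp add: Q_def)
  have C': "1 <= C * varc th t" if "t <= s" for t using C(2)[OF that] varc_th[OF that] by simp
  have F_eq: "F m \<omega> = (1/2) ^ m * ((2 * \<eta>) ^ (4 * m) * Sser th m a (u \<omega>) ^ 4)" for m \<omega>
    by (simp add: F_def power_mult_distrib power_mult[symmetric] mult.commute)
  note S = Sser_moment[OF K C a]
  have Fi: "integrable M (F m)" for m using S[of m] by (simp add: F_eq[abs_def])
  have F0: "0 <= F m \<omega>" for m \<omega> by (simp add: F_def)
  have E: "expectation (F m) <= (1/2) ^ m * Q" for m
  proof -
    have "expectation (F m) = (1/2) ^ m * ((2 * \<eta>) ^ (4 * m) * expectation (\<lambda>\<omega>. Sser th m a (u \<omega>) ^ 4))"
      by (simp add: F_eq[abs_def])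
    also have "\<dots> <= (1/2) ^ m * ((2 * \<eta>) ^ (4 * m) * ((real (s + 1) * C) ^ (4 * m) * Q))"
      using S[of m] \<eta> by (intro mult_left_mono) (auto simp: Q_def)
    also have "\<dots> = (1/2) ^ m * ((2 * \<eta> * (real (s + 1) * C)) ^ (4 * m) * Q)" by (simp add: power_mult_distrib mult.assoc)
    also have "\<dots> <= (1/2) ^ m * (1 * Q)"
      using \<eta> C(1) Q0 by (intro mult_left_mono mult_right_mono power_le_one) (auto intro!: mult_nonneg_nonneg)
    finally show ?thesis by simp
  qed
  have sm: "summable (\<lambda>m. F m \<omega>)" for \<omega>
    unfolding F_def by (rule summable_dom4[OF th_ps C(1) C' \<eta> a])
  have sE: "summable (\<lambda>m. expectation (\<lambda>\<omega>. norm (F m \<omega>)))"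
  proof (rule summable_comparison_test')
    show "summable (\<lambda>m. (1/2 :: real) ^ m * Q)" by (intro summable_mult2 summable_geometric) simp
    show "norm (expectation (\<lambda>\<omega>. norm (F m \<omega>))) <= (1/2) ^ m * Q" for m
      using E[of m] F0 by (simp add: Bochner_Integration.integral_nonneg)
  qed
  have d: "dom4 th \<eta> a (u \<omega>) = 8 * (\<Sum>m. F m \<omega>)" for \<omega> by (simp add: dom4_def F_def)
  have AEs: "AE \<omega> in M. summable (\<lambda>m. norm (F m \<omega>))" using sm F0 by simp
  show "integrable M (\<lambda>\<omega>. dom4 th \<eta> a (u \<omega>))"
    unfolding d by (intro integrable_mult_right integrable_suminf[OF Fi AEs sE])
  have "expectation (\<lambda>\<omega>. dom4 th \<eta> a (u \<omega>)) = 8 * (\<Sum>m. expectation (F m))"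
    unfolding d using integral_suminf[OF Fi AEs sE] by simp
  also have "(\<Sum>m. expectation (F m)) <= (\<Sum>m. (1/2) ^ m * Q)"
    using E sE F0 by (intro suminf_le) (auto intro!: summable_mult2 summable_geometric)
  also have "(\<Sum>m. (1/2) ^ m * Q) = 2 * Q"
    using suminf_mult2[of "\<lambda>m. (1/2 :: real) ^ m" Q] suminf_geometric[of "1/2 :: real"] by (simp add: summable_geometric)
  finally show "expectation (\<lambda>\<omega>. dom4 th \<eta> a (u \<omega>)) <= 16 * ((K + 3) * (qV th a)\<^sup>2)" by (simp add: Q_def)
qed

lemma ui_int4: "integrable M (\<lambda>\<omega>. ui i \<omega> ^ 4)"
  unfolding ent_u by (rule lin_int4) simp

text \<open>The truncated part has a small second moment, which bounds its first moment through |z|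
  \<le> r + z^2 / r. The remainder is treated by \<open>prod4_diff\<close>, summed absolutely
  against |c|; 128 is 4 times 32, for four factors. The level r is left free to be matched to the
  scale g_j g_k.\<close>

lemma lln_error:
  fixes cc :: "real vec => real"
  assumes B: "0 <= B" and R: "\<And>i. i < N ==> (\<Sum>e\<in>idx. \<bar>zi i e\<bar>) <= R"
    and m4: "\<And>t. t <= s ==> (\<integral>x. x ^ 4 \<partial>law t) <= m4"
    and tb: "\<And>t. t <= s ==> (\<integral>x. (x - clip B x) ^ 4 \<partial>law t) <= tb"
    and \<tau>: "0 < \<tau>" "\<tau> <= 1" and r: "0 < r"
  defines "Z \<equiv> \<lambda>\<omega>. \<Sum>q\<in>nz. cc (fcoef D q) * (uu q \<omega> - expectation (uu q))"
  shows "integrable M Z"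
    "expectation (\<lambda>\<omega>. \<bar>Z \<omega>\<bar>) <= r + 4 * (R * B) ^ 8 * (\<Sum>f1\<in>fvals D. \<Sum>f2\<in>fvals D. hcount2 D f1 f2 * \<bar>cc f1 * cc f2\<bar>) / r
      + 2 * (\<Sum>q\<in>nz. \<bar>cc (fcoef D q)\<bar>) * (128 * \<tau> * (R ^ 4 * m4) + 128 / \<tau> ^ 3 * (R ^ 4 * tb))"
proof -
  define Z1 where "Z1 \<omega> = (\<Sum>q\<in>nz. cc (fcoef D q) * (uuB B q \<omega> - expectation (uuB B q)))" for \<omega>
  define X where "X q \<omega> = uu q \<omega> - uuB B q \<omega>" for q \<omega>
  note l = lln_truncated[OF B R, of cc, folded Z1_def]
  have nzq: "q \<in> quads D" if "q \<in> nz" for q using that by (auto simp: nonzero_quads_def)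
  have iB: "integrable M (uuB B q)" if "q \<in> quads D" for q
    by (rule integrable_const_bound[where B = "(R * B) ^ 4"]) (auto intro!: AE_I2 abs_uuB_le[OF B R that])
  have iX: "integrable M (X q)" if "q \<in> nz" for q
    unfolding X_def using uu_int[of q] iB[OF nzq[OF that]] by simp
  have cm: "(\<lambda>x. x - clip B x) \<in> borel_measurable borel" by measurable
  have cl4: "integrable (law t) (\<lambda>x. (x - clip B x) ^ 4)" if t: "t <= s" for t
  proof (rule Bochner_Integration.integrable_bound[OF law4[OF t]])
    show "(\<lambda>x. (x - clip B x) ^ 4) \<in> borel_measurable (law t)"
      using cm by (subst measurable_cong_sets[OF law_sets[OF t] refl]) measurable
    have "\<bar>x - clip B x\<bar> <= \<bar>x\<bar>" for x using B by (auto simp: clip_def)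
    then have "(x - clip B x) ^ 4 <= x ^ 4" for x
      using power_mono[of "\<bar>x - clip B x\<bar>" "\<bar>x\<bar>" 4] by (simp add: power_abs)
    then show "AE x in law t. norm ((x - clip B x) ^ 4) <= norm (x ^ 4)"
      by (intro AE_I2) simp
  qed
  have u4: "expectation (\<lambda>\<omega>. ui i \<omega> ^ 4) <= R ^ 4 * m4" if "i < N" for i
    using transform_moment4(2)[of "\<lambda>x. x" "zi i" R m4] law4 R[OF that] m4 by (simp add: ent_u lin_def)
  have rem: "integrable M (\<lambda>\<omega>. (ui i \<omega> - uB B i \<omega>) ^ 4)" "expectation (\<lambda>\<omega>. (ui i \<omega> - uB B i \<omega>) ^ 4) <= R ^ 4 * tb" if "i < N" for i
  proof -
    have e: "ui i \<omega> - uB B i \<omega> = (\<Sum>e\<in>idx. zi i e * (ef e \<omega> - clip B (ef e \<omega>)))" for \<omega>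
      by (simp add: ent_u lin_def uB_def right_diff_distrib sum_subtractf)
    show "integrable M (\<lambda>\<omega>. (ui i \<omega> - uB B i \<omega>) ^ 4)" "expectation (\<lambda>\<omega>. (ui i \<omega> - uB B i \<omega>) ^ 4) <= R ^ 4 * tb"
      unfolding e using transform_moment4[OF cm cl4 R[OF that] tb] by auto
  qed
  have EX: "expectation (\<lambda>\<omega>. \<bar>X q \<omega>\<bar>) <= 128 * \<tau> * (R ^ 4 * m4) + 128 / \<tau> ^ 3 * (R ^ 4 * tb)" if q: "q \<in> nz" for q
  proof -
    obtain a b c d where q': "q = (a, b, c, d)" "a < N" "b < N" "c < N" "d < N" using nzq[OF q] by (cases q) (auto simp: quads_def)
    have le: "\<bar>X q \<omega>\<bar> <= 32 * \<tau> * (ui a \<omega> ^ 4 + ui b \<omega> ^ 4 + ui c \<omega> ^ 4 + ui d \<omega> ^ 4)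
      + 32 / \<tau> ^ 3 * ((ui a \<omega> - uB B a \<omega>) ^ 4 + (ui b \<omega> - uB B b \<omega>) ^ 4 + (ui c \<omega> - uB B c \<omega>) ^ 4 + (ui d \<omega> - uB B d \<omega>) ^ 4)" for \<omega>
    proof -
      have e: "(x - y) ^ 4 = (y - x) ^ 4" for x y :: real by (metis minus_diff_eq power_minus_even even_numeral)
      have "\<bar>X q \<omega>\<bar> = \<bar>uB B a \<omega> * uB B b \<omega> * uB B c \<omega> * uB B d \<omega> - ui a \<omega> * ui b \<omega> * ui c \<omega> * ui d \<omega>\<bar>"
        by (simp add: X_def uu_def uuB_def q'(1) abs_minus_commute)
      also note prod4_diff[OF \<tau>]
      finally show ?thesis by (simp only: e[of "uB B _ \<omega>"])
    qed
    have "expectation (\<lambda>\<omega>. \<bar>X q \<omega>\<bar>) <= expectation (\<lambda>\<omega>. 32 * \<tau> * (ui a \<omega> ^ 4 + ui b \<omega> ^ 4 + ui c \<omega> ^ 4 + ui d \<omega> ^ 4)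
      + 32 / \<tau> ^ 3 * ((ui a \<omega> - uB B a \<omega>) ^ 4 + (ui b \<omega> - uB B b \<omega>) ^ 4 + (ui c \<omega> - uB B c \<omega>) ^ 4 + (ui d \<omega> - uB B d \<omega>) ^ 4))"
      using iX[OF q] ui_int4 rem(1) q' le by (intro integral_mono) auto
    also have "\<dots> = 32 * \<tau> * (expectation (\<lambda>\<omega>. ui a \<omega> ^ 4) + expectation (\<lambda>\<omega>. ui b \<omega> ^ 4) + expectation (\<lambda>\<omega>. ui c \<omega> ^ 4) + expectation (\<lambda>\<omega>. ui d \<omega> ^ 4))
      + 32 / \<tau> ^ 3 * (expectation (\<lambda>\<omega>. (ui a \<omega> - uB B a \<omega>) ^ 4) + expectation (\<lambda>\<omega>. (ui b \<omega> - uB B b \<omega>) ^ 4)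
        + expectation (\<lambda>\<omega>. (ui c \<omega> - uB B c \<omega>) ^ 4) + expectation (\<lambda>\<omega>. (ui d \<omega> - uB B d \<omega>) ^ 4))"
      using ui_int4 rem(1) q' by simp
    also have "\<dots> <= 32 * \<tau> * (R ^ 4 * m4 + R ^ 4 * m4 + R ^ 4 * m4 + R ^ 4 * m4) + 32 / \<tau> ^ 3 * (R ^ 4 * tb + R ^ 4 * tb + R ^ 4 * tb + R ^ 4 * tb)"
      using u4 rem(2) q' \<tau> by (intro add_mono mult_left_mono) auto
    finally show ?thesis by (simp add: algebra_simps)
  qed
  define Z2 where "Z2 \<omega> = (\<Sum>q\<in>nz. cc (fcoef D q) * (X q \<omega> - expectation (X q)))" for \<omega>
  have Z: "Z \<omega> = Z1 \<omega> + Z2 \<omega>" for \<omega>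
  proof -
    have EX: "expectation (X q) = expectation (uu q) - expectation (uuB B q)" if "q \<in> nz" for q
      unfolding X_def using uu_int[of q] iB[OF nzq[OF that]] by simp
    show ?thesis
      unfolding Z_def Z1_def Z2_def sum.distrib[symmetric]
    proof (intro sum.cong refl)
      fix q assume q: "q \<in> nz"
      show "cc (fcoef D q) * (uu q \<omega> - expectation (uu q)) =
        cc (fcoef D q) * (uuB B q \<omega> - expectation (uuB B q)) + cc (fcoef D q) * (X q \<omega> - expectation (X q))"
        unfolding EX[OF q] X_def by (simp add: right_diff_distrib)
    qed
  qed
  have iZ2: "integrable M Z2" unfolding Z2_def using iX
    by (intro Bochner_Integration.integrable_sum integrable_mult_right Bochner_Integration.integrable_diff) auto
  show iZ: "integrable M Z" unfolding Z using l(2) iZ2 by simp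
  have 1: "expectation (\<lambda>\<omega>. \<bar>Z1 \<omega>\<bar>) <= r + 4 * (R * B) ^ 8 * (\<Sum>f1\<in>fvals D. \<Sum>f2\<in>fvals D. hcount2 D f1 f2 * \<bar>cc f1 * cc f2\<bar>) / r"
  proof -
    have "\<bar>z\<bar> <= r + z\<^sup>2 / r" for z
    proof (cases "\<bar>z\<bar> <= r")
      case True
      then show ?thesis using r by (smt (verit) divide_nonneg_pos zero_le_power2)
    next
      case False
      then have "\<bar>z\<bar> * r <= \<bar>z\<bar> * \<bar>z\<bar>" using r by (intro mult_left_mono) auto
      then have "\<bar>z\<bar> <= z\<^sup>2 / r" using r by (simp add: field_simps power2_eq_square)
      then show ?thesis using r by linarith
    qed
    then have "expectation (\<lambda>\<omega>. \<bar>Z1 \<omega>\<bar>) <= expectation (\<lambda>\<omega>. r + (Z1 \<omega>)\<^sup>2 / r)"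
      using l(1,2) by (intro integral_mono) auto
    also have "\<dots> = r + expectation (\<lambda>\<omega>. (Z1 \<omega>)\<^sup>2) / r" using l(1) prob_space by simp
    also have "\<dots> <= r + (4 * (R * B) ^ 8 * (\<Sum>f1\<in>fvals D. \<Sum>f2\<in>fvals D. hcount2 D f1 f2 * \<bar>cc f1 * cc f2\<bar>)) / r"
      using l(3) r by (intro add_left_mono divide_right_mono) auto
    finally show ?thesis .
  qed
  have 2: "expectation (\<lambda>\<omega>. \<bar>Z2 \<omega>\<bar>) <= (\<Sum>q\<in>nz. \<bar>cc (fcoef D q)\<bar> * (2 * (128 * \<tau> * (R ^ 4 * m4) + 128 / \<tau> ^ 3 * (R ^ 4 * tb))))"
  proof -
    have "\<bar>Z2 \<omega>\<bar> <= (\<Sum>q\<in>nz. \<bar>cc (fcoef D q)\<bar> * (\<bar>X q \<omega>\<bar> + \<bar>expectation (X q)\<bar>))" for \<omega>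
      unfolding Z2_def by (rule order_trans[OF sum_abs]) (auto intro!: sum_mono mult_left_mono simp: abs_mult)
    then have "expectation (\<lambda>\<omega>. \<bar>Z2 \<omega>\<bar>) <= expectation (\<lambda>\<omega>. \<Sum>q\<in>nz. \<bar>cc (fcoef D q)\<bar> * (\<bar>X q \<omega>\<bar> + \<bar>expectation (X q)\<bar>))"
      using iZ2 iX by (intro integral_mono) (auto intro!: Bochner_Integration.integrable_sum integrable_mult_right)
    also have "\<dots> = (\<Sum>q\<in>nz. \<bar>cc (fcoef D q)\<bar> * (expectation (\<lambda>\<omega>. \<bar>X q \<omega>\<bar>) + \<bar>expectation (X q)\<bar>))"
      using iX prob_space by (subst Bochner_Integration.integral_sum) (auto intro!: integrable_mult_right sum.cong)
    also have "\<dots> <= (\<Sum>q\<in>nz. \<bar>cc (fcoef D q)\<bar> * (2 * (128 * \<tau> * (R ^ 4 * m4) + 128 / \<tau> ^ 3 * (R ^ 4 * tb))))"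
    proof (intro sum_mono mult_left_mono)
      fix q assume q: "q \<in> nz"
      have "\<bar>expectation (X q)\<bar> <= expectation (\<lambda>\<omega>. \<bar>X q \<omega>\<bar>)" by (rule integral_abs_bound)
      then show "expectation (\<lambda>\<omega>. \<bar>X q \<omega>\<bar>) + \<bar>expectation (X q)\<bar> <= 2 * (128 * \<tau> * (R ^ 4 * m4) + 128 / \<tau> ^ 3 * (R ^ 4 * tb))"
        using add_mono[OF EX[OF q] order_trans[OF _ EX[OF q], of "\<bar>expectation (X q)\<bar>"]] by (simp add: algebra_simps)
    qed simp
    finally show ?thesis .
  qed
  have "(\<Sum>q\<in>nz. \<bar>cc (fcoef D q)\<bar> * (2 * b)) = 2 * (\<Sum>q\<in>nz. \<bar>cc (fcoef D q)\<bar>) * b" for b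
    by (simp add: sum_distrib_left sum_distrib_right mult_ac)
  note 2 = 2[unfolded this]
  have "expectation (\<lambda>\<omega>. \<bar>Z \<omega>\<bar>) <= expectation (\<lambda>\<omega>. \<bar>Z1 \<omega>\<bar> + \<bar>Z2 \<omega>\<bar>)"
    unfolding Z using l(2) iZ2 by (intro integral_mono) auto
  also have "\<dots> = expectation (\<lambda>\<omega>. \<bar>Z1 \<omega>\<bar>) + expectation (\<lambda>\<omega>. \<bar>Z2 \<omega>\<bar>)" using l(2) iZ2 by simp
  finally show "expectation (\<lambda>\<omega>. \<bar>Z \<omega>\<bar>) <= r + 4 * (R * B) ^ 8 * (\<Sum>f1\<in>fvals D. \<Sum>f2\<in>fvals D. hcount2 D f1 f2 * \<bar>cc f1 * cc f2\<bar>) / r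
      + 2 * (\<Sum>q\<in>nz. \<bar>cc (fcoef D q)\<bar>) * (128 * \<tau> * (R ^ 4 * m4) + 128 / \<tau> ^ 3 * (R ^ 4 * tb))"
    using add_mono[OF 1 2] by (rule order_trans)
qed

end

lemma abs_combine_le:
  fixes x1 :: real
  assumes "x1 - y1 = z + a + b" "x2 - y2 = c + d" "\<bar>a\<bar> <= A" "\<bar>b\<bar> <= B" "\<bar>c\<bar> <= C" "\<bar>d\<bar> <= E" "\<bar>g - g'\<bar> <= G"
  shows "\<bar>x1 - 3 * x2 + g - (y1 - 3 * y2 + g')\<bar> <= \<bar>z\<bar> + A + B + (3 * (C + E) + G)"
  using assms by argo

section \<open>Error of the POQUIM, uniformly near the true parameter\<close>

context lmm_model
begin

definition "sum4 f = (\<lambda>(a, b, c, d). f a + f b + f c + (f d :: real))" for f :: "nat => real"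

lemma u_hat_near:
  assumes C: "0 <= C" "\<And>t. t <= s ==> 1 <= C * \<sigma>sq t"
    and \<eta>: "0 <= \<eta>" "4 * \<eta> * (real (s + 1) * C) <= 1"
    and th': "\<theta>' \<in> param_space s" "\<And>t. t <= s ==> \<bar>varc \<theta>' t - varc th t\<bar> <= \<eta>"
    and i: "i < N"
  shows "(u_hat D \<theta>' (y \<omega>) $ i - ui i \<omega>) ^ 4 <= dom4 th \<eta> (lev th i) (u \<omega>)"
proof -
  have C': "1 <= C * varc th t" if "t <= s" for t using C(2)[OF that] varc_th[OF that] by simp
  note e = u_hat_eq[OF th_ps th'(1) y_carrier fv_y mat_dims_fv_carrier[OF beta] u_dims i]
  define v where "v = u \<omega> - (Vf \<theta>' - Vf th) * (Pf \<theta>' * u \<omega>)"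
  have "u_hat D \<theta>' (y \<omega>) $ i - ui i \<omega> = - inner (lev th i) v" using e(1)[of \<omega>] by (simp add: v_def)
  then have "(u_hat D \<theta>' (y \<omega>) $ i - ui i \<omega>) ^ 4 = inner (lev th i) v ^ 4" by simp
  also have "\<dots> <= dom4 th \<eta> (lev th i) (u \<omega>)"
    by (rule dom4_ge[OF th_ps C(1) C' \<eta> lev_dims[OF th_ps i], where c = "\<lambda>t. varc \<theta>' t - varc th t"])
       (use e(2)[of \<omega>] th'(2) in \<open>auto simp: v_def\<close>)
  finally show ?thesis .
qed

text \<open>An integrable majorant is produced in place of a supremum over \<open>\<theta>'\<close>,
  whose measurability would be in question. Its parts: \<open>Z\<close> for the deviation of
  products of errors from their means, \<open>E2\<close> for residuals in place of errors,
  \<open>E3\<close> for the coefficients at \<open>\<theta>'\<close>, and the constant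
  \<open>E4\<close> for the terms with V and the trace term.\<close>

lemma poquim_error:
  fixes c0 :: real
  assumes T: "contrast_mat D T" and jk: "j <= s" "k <= s"
    and K: "0 <= K" "\<And>t. t <= s ==> kp t <= K * (\<sigma>sq t)\<^sup>2"
    and C: "0 <= C" "\<And>t. t <= s ==> 1 <= C * \<sigma>sq t"
    and B: "0 <= B" and R: "\<And>i. i < N ==> (\<Sum>e\<in>idx. \<bar>zi i e\<bar>) <= R"
    and m4: "\<And>t. t <= s ==> (\<integral>x. x ^ 4 \<partial>law t) <= m4"
    and tb: "\<And>t. t <= s ==> (\<integral>x. (x - clip B x) ^ 4 \<partial>law t) <= tb"
    and \<tau>: "0 < \<tau>" "\<tau> <= 1" and r: "0 < r" and \<delta>: "0 < \<delta>" "\<delta> <= th $ 0 / 2"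
    and \<eta>: "0 <= \<eta>" "4 * \<eta> * (real (s + 1) * C) <= 1"
      "\<And>\<theta>' t. \<theta>' \<in> param_nbhd D th \<delta> ==> t <= s ==> \<bar>varc \<theta>' t - varc th t\<bar> <= \<eta>"
    and w: "\<And>\<theta>' a b. \<theta>' \<in> param_nbhd D th \<delta> ==> a < N ==> b < N ==> \<bar>ent (Vf \<theta>') a b - ent (Vf th) a b\<bar> <= w"
    and v: "\<And>\<theta>' a b. \<theta>' \<in> param_nbhd D th \<delta> ==> a < N ==> b < N ==> \<bar>ent (Vf \<theta>') a b\<bar> <= v"
    and l: "0 < l" "l <= lambda_min (transpose_mat (fixX D) * mat_inv (Vmat D th) * fixX D)"
    and X: "\<And>i. i < N ==> vec_norm2 (row (fixX D) i) <= CX"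
  defines "A \<equiv> (\<Sum>f\<in>fvals D. hcount D f * \<bar>ccoef D th j k f\<bar>)"
    and "Dd \<equiv> (\<Sum>f\<in>fvals D. hcount D f * ddev D th j k f \<delta>)"
    and "H2 \<equiv> (\<Sum>f1\<in>fvals D. \<Sum>f2\<in>fvals D. hcount2 D f1 f2 * \<bar>ccoef D th j k f1 * ccoef D th j k f2\<bar>)"
    and "U \<equiv> R ^ 4 * m4" and "\<Delta> \<equiv> 16 * ((K + 3) * (CX\<^sup>2 / l)\<^sup>2)"
  obtains Err where "integrable M Err" "\<And>\<omega>. 0 <= Err \<omega>"
    "\<And>\<omega> \<theta>'. \<theta>' \<in> param_nbhd D th \<delta> ==> \<bar>poquim D \<theta>' (y \<omega>) $$ (j, k) - info1 M D T c0 y th $$ (j, k)\<bar> <= Err \<omega>"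
    "expectation Err <= (r + 4 * (R * B) ^ 8 * H2 / r + 2 * A * (128 * \<tau> * U + 128 / \<tau> ^ 3 * (R ^ 4 * tb)))
      + A * (128 * \<tau> * U + 128 / \<tau> ^ 3 * \<Delta>) + Dd * (8 * (U + \<Delta>)) + 3 * (Dd * v\<^sup>2 + A * (2 * v * w)) + gdev D th j k \<delta>"
proof -
  define cc where "cc = ccoef D th j k"
  define dd where "dd f = ddev D th j k f \<delta>" for f
  define dom where "dom i \<omega> = dom4 th \<eta> (lev th i) (u \<omega>)" for i \<omega>
  define Z where "Z \<omega> = (\<Sum>q\<in>nz. cc (fcoef D q) * (uu q \<omega> - expectation (uu q)))" for \<omega>
  define u4 where "u4 i \<omega> = ui i \<omega> ^ 4" for i \<omega>
  define E2 where "E2 \<omega> = (\<Sum>q\<in>nz. \<bar>cc (fcoef D q)\<bar> * (32 * \<tau> * sum4 (\<lambda>i. u4 i \<omega>) q + 32 / \<tau> ^ 3 * sum4 (\<lambda>i. dom i \<omega>) q))" for \<omega>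
  define E3 where "E3 \<omega> = (\<Sum>q\<in>nz. dd (fcoef D q) * (2 * sum4 (\<lambda>i. u4 i \<omega> + dom i \<omega>) q))" for \<omega>
  define E4 where "E4 = 3 * (Dd * v\<^sup>2 + A * (2 * v * w)) + gdev D th j k \<delta>"
  define Err where "Err \<omega> = \<bar>Z \<omega>\<bar> + E2 \<omega> + E3 \<omega> + E4" for \<omega>
  have thn: "th \<in> param_nbhd D th \<delta>"
    using th_ps \<delta>(1) by (simp add: param_nbhd_def norm_fv[symmetric] fv_diff)
  have nzq: "q \<in> quads D" if "q \<in> nz" for q using that by (auto simp: nonzero_quads_def)
  have dd0: "0 <= dd f" for f using ddev_ge[OF th_ps \<delta>(2) jk thn, of f] by (simp add: dd_def)
  have A: "A = (\<Sum>q\<in>nz. \<bar>cc (fcoef D q)\<bar>)" unfolding A_def cc_def by (rule sum_nz_fcoef[symmetric])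
  have Dd: "Dd = (\<Sum>q\<in>nz. dd (fcoef D q))" unfolding Dd_def dd_def by (rule sum_nz_fcoef[symmetric])
  have "p <= N" using inj_dim_le[OF X_dims] X_inj by blast
  \<comment> \<open>An index exists, and at it the bounds v and w are seen to be
    nonnegative.\<close>
  then have "0 < N" using valid by (auto simp: valid_design_def)
  then have v0: "0 <= v" and w0: "0 <= w" using v[OF thn, of 0 0] w[OF thn, of 0 0] by auto
  have dom_i: "integrable M (dom i)" and dom_E: "expectation (dom i) <= \<Delta>" if i: "i < N" for i
  proof -
    note d = dom4_moment[OF K C \<eta>(1,2) lev_dims[OF th_ps i]]
    show "integrable M (dom i)" using d(1) by (simp add: dom_def[abs_def])
    have "qV th (lev th i) <= (vec_norm2 (row (fixX D) i))\<^sup>2 / l" by (rule qV_lev[OF th_ps i l])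
    also have "\<dots> <= CX\<^sup>2 / l"
      using X[OF i] l(1) by (intro divide_right_mono power_mono) (auto simp: norm_fv[symmetric])
    finally have "(qV th (lev th i))\<^sup>2 <= (CX\<^sup>2 / l)\<^sup>2" using qV_nonneg[OF th_ps] by (intro power_mono) auto
    then have "16 * ((K + 3) * (qV th (lev th i))\<^sup>2) <= \<Delta>" unfolding \<Delta>_def using K(1) by (intro mult_left_mono) auto
    with d(2) show "expectation (dom i) <= \<Delta>" by (simp add: dom_def[abs_def])
  qed
  have u4_i: "integrable M (u4 i)" for i unfolding u4_def[abs_def] by (rule ui_int4)
  have u4_E: "expectation (u4 i) <= U" if i: "i < N" for i
    using transform_moment4(2)[of "\<lambda>x. x" "zi i" R m4] law4 R[OF i] m4 by (simp add: ent_u lin_def U_def u4_def[abs_def])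
  have dom0: "0 <= dom i \<omega>" if i: "i < N" for i \<omega>
  proof -
    have "0 <= (u_hat D th (y \<omega>) $ i - ui i \<omega>) ^ 4" by simp
    also have "\<dots> <= dom i \<omega>"
      unfolding dom_def by (rule u_hat_near[OF C \<eta>(1,2) th_ps _ i]) (use \<eta>(3)[OF thn] in auto)
    finally show ?thesis .
  qed
  have s4E: "expectation (\<lambda>\<omega>. sum4 (\<lambda>i. f i \<omega>) q) <= 4 * m" and s4i: "integrable M (\<lambda>\<omega>. sum4 (\<lambda>i. f i \<omega>) q)"
    if q: "q \<in> nz" and f: "\<And>i. i < N ==> integrable M (f i) \<and> expectation (f i) <= m" for f :: "nat => 'w => real" and q m
  proof -
    obtain a b c d where q': "q = (a, b, c, d)" "a < N" "b < N" "c < N" "d < N" using nzq[OF q] by (cases q) (auto simp: quads_def)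
    have fi: "integrable M (f a)" "integrable M (f b)" "integrable M (f c)" "integrable M (f d)" using f q' by auto
    then show "integrable M (\<lambda>\<omega>. sum4 (\<lambda>i. f i \<omega>) q)" by (simp add: sum4_def q'(1))
    have "expectation (\<lambda>\<omega>. sum4 (\<lambda>i. f i \<omega>) q) = expectation (f a) + expectation (f b) + expectation (f c) + expectation (f d)"
      using fi by (simp add: sum4_def q'(1))
    then show "expectation (\<lambda>\<omega>. sum4 (\<lambda>i. f i \<omega>) q) <= 4 * m" using f[OF q'(2)] f[OF q'(3)] f[OF q'(4)] f[OF q'(5)] by linarith
  qed
  have su: "u4 i \<in> borel_measurable M" for i using u4_i by auto
  note su4 = s4i[of _ u4 U] s4E[of _ u4 U] and sd4 = s4i[of _ dom \<Delta>] s4E[of _ dom \<Delta>]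
    and sud = s4i[of _ "\<lambda>i \<omega>. u4 i \<omega> + dom i \<omega>" "U + \<Delta>"] s4E[of _ "\<lambda>i \<omega>. u4 i \<omega> + dom i \<omega>" "U + \<Delta>"]
  have f1: "\<And>i. i < N ==> integrable M (u4 i) \<and> expectation (u4 i) <= U" using u4_i u4_E by auto
  have f2: "\<And>i. i < N ==> integrable M (dom i) \<and> expectation (dom i) <= \<Delta>" using dom_i dom_E by auto
  have f3: "\<And>i. i < N ==> integrable M (\<lambda>\<omega>. u4 i \<omega> + dom i \<omega>) \<and> expectation (\<lambda>\<omega>. u4 i \<omega> + dom i \<omega>) <= U + \<Delta>"
    using f1 f2 by (simp add: add_mono)
  have l1: "integrable M Z" "expectation (\<lambda>\<omega>. \<bar>Z \<omega>\<bar>) <= r + 4 * (R * B) ^ 8 * H2 / r + 2 * A * (128 * \<tau> * U + 128 / \<tau> ^ 3 * (R ^ 4 * tb))"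
    using lln_error[OF B R m4 tb \<tau> r, of cc] by (simp_all add: Z_def[abs_def] A U_def H2_def cc_def)
  have i2: "integrable M E2"
    unfolding E2_def using su4(1)[OF _ f1] sd4(1)[OF _ f2]
    by (intro Bochner_Integration.integrable_sum integrable_mult_right Bochner_Integration.integrable_add) auto
  have e2: "expectation E2 <= A * (128 * \<tau> * U + 128 / \<tau> ^ 3 * \<Delta>)"
  proof -
    have "expectation E2 = (\<Sum>q\<in>nz. \<bar>cc (fcoef D q)\<bar> * (32 * \<tau> * expectation (\<lambda>\<omega>. sum4 (\<lambda>i. u4 i \<omega>) q) + 32 / \<tau> ^ 3 * expectation (\<lambda>\<omega>. sum4 (\<lambda>i. dom i \<omega>) q)))"
      unfolding E2_def using su4(1)[OF _ f1] sd4(1)[OF _ f2]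
      by (subst Bochner_Integration.integral_sum) (auto intro!: sum.cong)
    also have "\<dots> <= (\<Sum>q\<in>nz. \<bar>cc (fcoef D q)\<bar> * (32 * \<tau> * (4 * U) + 32 / \<tau> ^ 3 * (4 * \<Delta>)))"
      using su4(2)[OF _ f1] sd4(2)[OF _ f2] \<tau> by (intro sum_mono mult_left_mono add_mono) auto
    finally show ?thesis by (simp add: A sum_distrib_right[symmetric] mult.assoc)
  qed
  have i3: "integrable M E3"
    unfolding E3_def using sud(1)[OF _ f3] by (intro Bochner_Integration.integrable_sum integrable_mult_right) auto
  have e3: "expectation E3 <= Dd * (8 * (U + \<Delta>))"
  proof -
    have "expectation E3 = (\<Sum>q\<in>nz. dd (fcoef D q) * (2 * expectation (\<lambda>\<omega>. sum4 (\<lambda>i. u4 i \<omega> + dom i \<omega>) q)))"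
      unfolding E3_def using sud(1)[OF _ f3] by (subst Bochner_Integration.integral_sum) (auto intro!: sum.cong)
    also have "\<dots> <= (\<Sum>q\<in>nz. dd (fcoef D q) * (2 * (4 * (U + \<Delta>))))"
      using sud(2)[OF _ f3] dd0 by (intro sum_mono mult_left_mono) auto
    finally show ?thesis by (simp add: Dd sum_distrib_right[symmetric] mult.assoc)
  qed
  have point: "\<bar>poquim D \<theta>' (y \<omega>) $$ (j, k) - info1 M D T c0 y th $$ (j, k)\<bar> <= Err \<omega>" if th': "\<theta>' \<in> param_nbhd D th \<delta>" for \<omega> \<theta>'
  proof -
    have ps': "\<theta>' \<in> param_space s" using th' by (simp add: param_nbhd_def)
    define ch where "ch = ccoef D \<theta>' j k"
    define uh where "uh = u_hat D \<theta>' (y \<omega>)"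
    define P where "P = (\<lambda>(a, b, c, d). uh $ a * uh $ b * uh $ c * uh $ d)"
    define V2 where "V2 \<theta> = (\<lambda>(a, b, c, d). ent (Vf \<theta>) a c * ent (Vf \<theta>) b d)" for \<theta>
    have cd: "\<bar>ch f - cc f\<bar> <= dd f" for f unfolding ch_def cc_def dd_def by (rule ddev_ge[OF th_ps \<delta>(2) jk th'])
    have near: "(uh $ i - ui i \<omega>) ^ 4 <= dom i \<omega>" if i: "i < N" for i
      unfolding uh_def dom_def by (rule u_hat_near[OF C \<eta>(1,2) ps' _ i]) (use \<eta>(3)[OF th'] in auto)
    have uh4: "(uh $ i) ^ 4 <= 8 * (u4 i \<omega> + dom i \<omega>)" if i: "i < N" for i
    proof -
      have "(uh $ i) ^ 4 = (ui i \<omega> - (ui i \<omega> - uh $ i)) ^ 4" by simp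
      also have "\<dots> <= 8 * (ui i \<omega> ^ 4 + (ui i \<omega> - uh $ i) ^ 4)" by (rule diff_pow4_le)
      also have "(ui i \<omega> - uh $ i) ^ 4 = (uh $ i - ui i \<omega>) ^ 4" by (metis minus_diff_eq power_minus_even even_numeral)
      finally show ?thesis using near[OF i] by (simp add: u4_def)
    qed
    have P1: "\<bar>P q\<bar> <= 2 * sum4 (\<lambda>i. u4 i \<omega> + dom i \<omega>) q" if q: "q \<in> nz" for q
    proof -
      obtain a b c d where q': "q = (a, b, c, d)" "a < N" "b < N" "c < N" "d < N" using nzq[OF q] by (cases q) (auto simp: quads_def)
      show ?thesis using abs_prod4_le[of "uh $ a" "uh $ b" "uh $ c" "uh $ d"] uh4[OF q'(2)] uh4[OF q'(3)] uh4[OF q'(4)] uh4[OF q'(5)]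
        by (simp add: q'(1) P_def sum4_def)
    qed
    have P2: "\<bar>P q - uu q \<omega>\<bar> <= 32 * \<tau> * sum4 (\<lambda>i. u4 i \<omega>) q + 32 / \<tau> ^ 3 * sum4 (\<lambda>i. dom i \<omega>) q" if q: "q \<in> nz" for q
    proof -
      obtain a b c d where q': "q = (a, b, c, d)" "a < N" "b < N" "c < N" "d < N" using nzq[OF q] by (cases q) (auto simp: quads_def)
      have "\<bar>P q - uu q \<omega>\<bar> <= 32 * \<tau> * sum4 (\<lambda>i. u4 i \<omega>) q + 32 / \<tau> ^ 3 *
        ((uh $ a - ui a \<omega>) ^ 4 + (uh $ b - ui b \<omega>) ^ 4 + (uh $ c - ui c \<omega>) ^ 4 + (uh $ d - ui d \<omega>) ^ 4)"
        using prod4_diff[OF \<tau>, of "uh $ a" "uh $ b" "uh $ c" "uh $ d" "ui a \<omega>" "ui b \<omega>" "ui c \<omega>" "ui d \<omega>"]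
        by (simp add: q'(1) P_def uu_def sum4_def u4_def)
      also have "\<dots> <= 32 * \<tau> * sum4 (\<lambda>i. u4 i \<omega>) q + 32 / \<tau> ^ 3 * sum4 (\<lambda>i. dom i \<omega>) q"
        unfolding sum4_def q'(1) prod.case using \<tau> by (intro add_left_mono mult_left_mono add_mono near q') auto
      finally show ?thesis .
    qed
    have V1: "\<bar>V2 \<theta>' q\<bar> <= v\<^sup>2" and V3: "\<bar>V2 \<theta>' q - V2 th q\<bar> <= 2 * v * w" if q: "q \<in> nz" for q
    proof -
      obtain a b c d where q': "q = (a, b, c, d)" "a < N" "b < N" "c < N" "d < N" using nzq[OF q] by (cases q) (auto simp: quads_def)
      have x: "\<bar>ent (Vf \<theta>') a c\<bar> <= v" "\<bar>ent (Vf \<theta>') b d\<bar> <= v" "\<bar>ent (Vf th) a c\<bar> <= v" using v[OF th'] v[OF thn] q' by auto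
      have z: "\<bar>ent (Vf \<theta>') a c - ent (Vf th) a c\<bar> <= w" "\<bar>ent (Vf \<theta>') b d - ent (Vf th) b d\<bar> <= w" using w[OF th'] q' by auto
      show "\<bar>V2 \<theta>' q\<bar> <= v\<^sup>2" using mult_mono[OF x(1,2) v0 abs_ge_zero] by (simp add: q'(1) V2_def abs_mult power2_eq_square)
      have "V2 \<theta>' q - V2 th q = (ent (Vf \<theta>') a c - ent (Vf th) a c) * ent (Vf \<theta>') b d + ent (Vf th) a c * (ent (Vf \<theta>') b d - ent (Vf th) b d)"
        by (simp add: q'(1) V2_def algebra_simps)
      also have "\<bar>\<dots>\<bar> <= \<bar>ent (Vf \<theta>') a c - ent (Vf th) a c\<bar> * \<bar>ent (Vf \<theta>') b d\<bar> + \<bar>ent (Vf th) a c\<bar> * \<bar>ent (Vf \<theta>') b d - ent (Vf th) b d\<bar>"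
        by (metis abs_mult abs_triangle_ineq)
      also have "\<dots> <= w * v + v * w" by (intro add_mono mult_mono x z v0 w0 abs_ge_zero)
      finally show "\<bar>V2 \<theta>' q - V2 th q\<bar> <= 2 * v * w" by (simp add: mult_ac)
    qed
    have p: "poquim D \<theta>' (y \<omega>) $$ (j, k) = (\<Sum>q\<in>nz. ch (fcoef D q) * P q) - 3 * (\<Sum>q\<in>nz. ch (fcoef D q) * V2 \<theta>' q) + Gent D \<theta>' j k"
      unfolding poquim_nz[OF jk] by (simp add: ch_def P_def V2_def uh_def case_prod_beta)
    have i: "info1 M D T c0 y th $$ (j, k) = (\<Sum>q\<in>nz. cc (fcoef D q) * expectation (uu q)) - 3 * (\<Sum>q\<in>nz. cc (fcoef D q) * V2 th q) + Gent D th j k"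
      unfolding info1_nz[OF T jk] by (simp add: cc_def V2_def case_prod_beta)
    have 1: "(\<Sum>q\<in>nz. ch (fcoef D q) * P q) - (\<Sum>q\<in>nz. cc (fcoef D q) * expectation (uu q))
      = Z \<omega> + (\<Sum>q\<in>nz. cc (fcoef D q) * (P q - uu q \<omega>)) + (\<Sum>q\<in>nz. (ch (fcoef D q) - cc (fcoef D q)) * P q)"
      unfolding Z_def sum.distrib[symmetric] sum_subtractf[symmetric] by (intro sum.cong refl) (simp add: algebra_simps)
    have 2: "(\<Sum>q\<in>nz. ch (fcoef D q) * V2 \<theta>' q) - (\<Sum>q\<in>nz. cc (fcoef D q) * V2 th q)
      = (\<Sum>q\<in>nz. (ch (fcoef D q) - cc (fcoef D q)) * V2 \<theta>' q) + (\<Sum>q\<in>nz. cc (fcoef D q) * (V2 \<theta>' q - V2 th q))"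
      unfolding sum.distrib[symmetric] sum_subtractf[symmetric] by (intro sum.cong refl) (simp add: algebra_simps)
    have b: "\<bar>\<Sum>q\<in>nz. f q * g q\<bar> <= (\<Sum>q\<in>nz. f' q * g' q)" if "\<And>q. q \<in> nz ==> \<bar>f q\<bar> <= f' q" "\<And>q. q \<in> nz ==> \<bar>g q\<bar> <= g' q" for f g f' g' :: "quad => real"
    proof (rule order_trans[OF sum_abs sum_mono])
      fix q assume q: "q \<in> nz"
      show "\<bar>f q * g q\<bar> <= f' q * g' q" unfolding abs_mult
        using that(1)[OF q] that(2)[OF q] by (intro mult_mono) auto
    qed
    have b1: "\<bar>\<Sum>q\<in>nz. cc (fcoef D q) * (P q - uu q \<omega>)\<bar> <= E2 \<omega>" unfolding E2_def by (rule b) (use P2 in auto)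
    have b2: "\<bar>\<Sum>q\<in>nz. (ch (fcoef D q) - cc (fcoef D q)) * P q\<bar> <= E3 \<omega>" unfolding E3_def by (rule b) (use P1 cd in auto)
    have b3: "\<bar>\<Sum>q\<in>nz. (ch (fcoef D q) - cc (fcoef D q)) * V2 \<theta>' q\<bar> <= Dd * v\<^sup>2"
      unfolding Dd sum_distrib_right by (rule b) (use V1 cd in auto)
    have b4: "\<bar>\<Sum>q\<in>nz. cc (fcoef D q) * (V2 \<theta>' q - V2 th q)\<bar> <= A * (2 * v * w)"
      unfolding A sum_distrib_right by (rule b) (use V3 in auto)
    have b5: "\<bar>Gent D \<theta>' j k - Gent D th j k\<bar> <= gdev D th j k \<delta>" by (rule gdev_ge[OF th_ps \<delta>(2) jk th'])
    show ?thesis unfolding p i Err_def E4_def by (rule abs_combine_le[OF 1 2 b1 b2 b3 b4 b5])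
  qed
  show ?thesis
  proof (rule that[of Err])
    show "integrable M Err" unfolding Err_def using l1(1) i2 i3 by simp
    show "0 <= Err \<omega>" for \<omega> using point[OF thn, of \<omega>] by (meson abs_ge_zero order_trans)
    have "expectation Err = expectation (\<lambda>\<omega>. \<bar>Z \<omega>\<bar>) + expectation E2 + expectation E3 + E4"
      unfolding Err_def using l1(1) i2 i3 prob_space by simp
    then show "expectation Err <= (r + 4 * (R * B) ^ 8 * H2 / r + 2 * A * (128 * \<tau> * U + 128 / \<tau> ^ 3 * (R ^ 4 * tb)))
      + A * (128 * \<tau> * U + 128 / \<tau> ^ 3 * \<Delta>) + Dd * (8 * (U + \<Delta>)) + 3 * (Dd * v\<^sup>2 + A * (2 * v * w)) + gdev D th j k \<delta>"
      using l1(2) e2 e3 unfolding E4_def by linarith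
  qed (fact point)
qed

end

subsection \<open>Perturbation of the Wald form\<close>

text \<open>Cauchy-Schwarz in the form of H, for x and H x. Together with a bound for the inverse of
  H it gives a lower bound for the form of H, without a spectral decomposition.\<close>

lemma psdm_norm_bound:
  assumes H: "psdm H" and "mat_dims d d H" "mat_dims d 1 x"
    and b: "\<And>x. mat_dims d 1 x ==> norm (H * x) <= b * norm x"
  shows "(norm (H * x))\<^sup>2 <= b * inner x (H * x)"
proof (cases "norm (H * x) = 0")
  case True
  have "0 <= b * norm x" using b[OF assms(3)] norm_ge_zero[of "H * x"] by linarith
  then have "0 <= b * inner x (H * x)"
    using psdm_nonneg[OF H, of x] by (cases "x = 0") (auto simp: zero_le_mult_iff)
  then show ?thesis using True by simp
next
  case False
  let ?n = "norm (H * x)"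
  have d: "mat_dims d 1 (H * x)" using assms by (blast intro: mat_dims_mult)
  have "inner x (H * (H * x)) = ?n\<^sup>2"
    using inner_times_left[of H x "H * x"] psdm_sym[OF H] by (simp add: power2_norm_eq_inner)
  then have "(?n\<^sup>2)\<^sup>2 <= inner x (H * x) * inner (H * x) (H * (H * x))"
    using psdm_Cauchy_Schwarz[OF H, of x "H * x"] by simp
  also have "\<dots> <= inner x (H * x) * (?n * (b * ?n))"
    by (intro mult_left_mono psdm_nonneg[OF H] order_trans[OF norm_cauchy_schwarz mult_left_mono[OF b[OF d]]]) auto
  also have "\<dots> = (b * inner x (H * x)) * ?n\<^sup>2" by (simp add: power2_eq_square)
  finally have "?n\<^sup>2 * ?n\<^sup>2 <= (b * inner x (H * x)) * ?n\<^sup>2" by (simp add: power2_eq_square)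
  then show ?thesis by (rule mult_right_le_imp_le) (use False in simp)
qed

text \<open>x is H applied to Hi x, so the norm of Hi x is at least |x| / h, and F is evaluated at
  Hi x.\<close>

lemma sandwich_lower:
  assumes H: "H * Hi = idm d" "trp Hi = Hi" "mat_dims d d Hi" and x: "mat_dims d 1 x"
    and h: "\<And>x. mat_dims d 1 x ==> norm (H * x) <= h * norm x" "0 < h"
    and F: "\<And>x. mat_dims d 1 x ==> a * (norm x)\<^sup>2 <= inner x (F * x)" "0 <= a"
  shows "a / h\<^sup>2 * (norm x)\<^sup>2 <= inner x (Hi * F * Hi * x)"
proof -
  have d: "mat_dims d 1 (Hi * x)" using H(3) x by (rule mat_dims_mult)
  have "norm x = norm (H * (Hi * x))" using H(1) x by (simp add: mult.assoc[symmetric] idm_mult_left)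
  also have "\<dots> <= h * norm (Hi * x)" by (rule h(1)[OF d])
  finally have "(norm x)\<^sup>2 <= (h * norm (Hi * x))\<^sup>2" by (intro power_mono) auto
  then have "(norm x)\<^sup>2 / h\<^sup>2 <= (norm (Hi * x))\<^sup>2" using h(2) by (simp add: field_simps)
  then have "a * ((norm x)\<^sup>2 / h\<^sup>2) <= a * (norm (Hi * x))\<^sup>2" by (rule mult_left_mono[OF _ F(2)])
  also have "\<dots> <= inner (Hi * x) (F * (Hi * x))" by (rule F(1)[OF d])
  also have "\<dots> = inner x (Hi * F * Hi * x)"
    using inner_times_left[of Hi x "F * (Hi * x)"] H(2) by (simp add: mult.assoc)
  finally show ?thesis by simp
qed

text \<open>The perturbation contributes at most C e |x| \<le> |x| / 2, which is absorbed on the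
  left.\<close>

lemma perturbed_inj:
  assumes H: "mat_dims d 1 x" "norm x <= C * norm (H * x)" and e: "norm (H' - H) <= e" "C * e <= 1 / 2" "0 <= C"
  shows "norm x <= 2 * C * norm (H' * x)"
proof -
  have "norm ((H' - H) * x) <= e * norm x"
    using norm_mult_ineq[of "H' - H" x] e(1) by (meson mult_right_mono norm_ge_zero order_trans)
  moreover have "H * x = H' * x - (H' - H) * x" by (simp add: left_diff_distrib)
  then have "norm (H * x) <= norm (H' * x) + norm ((H' - H) * x)" by (metis norm_triangle_ineq4)
  ultimately have "C * norm (H * x) <= C * (norm (H' * x) + e * norm x)" using e(3) by (intro mult_left_mono) auto
  also have "\<dots> = C * norm (H' * x) + (C * e) * norm x" by (simp add: algebra_simps)
  also have "\<dots> <= C * norm (H' * x) + 1 / 2 * norm x" using e(2) by (intro add_left_mono mult_right_mono) auto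
  finally show ?thesis using H(2) by simp
qed

text \<open>The difference of the inverses is Hi' (H' - H) Hi up to sign, and Hi' is bounded by 2 C
  through \<open>perturbed_inj\<close>. The three summands of the constant come from changing the
  left factor, the middle one and the right one in turn.\<close>

lemma sandwich_close:
  assumes H: "H * Hi = idm d" "trp Hi = Hi" "mat_dims d d Hi" "mat_dims d d H"
    and H': "H' * Hi' = idm d" "Hi' * H' = idm d" "trp Hi' = Hi'" "mat_dims d d Hi'" "mat_dims d d H'"
    and C: "\<And>x. mat_dims d 1 x ==> norm x <= C * norm (H * x)" "0 <= C"
    and F: "\<And>x. mat_dims d 1 x ==> norm (F * x) <= b * norm x" "0 <= b"
    and e: "norm (H' - H) <= e" "norm (F' - F) <= e" "C * e <= 1 / 2" "e <= 1"
    and x: "mat_dims d 1 x" and z: "mat_dims d 1 z"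
  shows "\<bar>inner x (Hi' * F' * Hi' * z) - inner x (Hi * F * Hi * z)\<bar>
    <= e * (4 * C ^ 3 * (b + 1) + 2 * C\<^sup>2 + 2 * b * C ^ 3) * norm x * norm z"
proof -
  have e0: "0 <= e" using e(1) norm_ge_zero order_trans by blast
  have n1: "norm (Hi * v) <= C * norm v" if "mat_dims d 1 v" for v
    using C(1)[OF mat_dims_mult[OF H(3) that]] H(1) that by (simp add: mult.assoc[symmetric] idm_mult_left)
  have n2: "norm (Hi' * v) <= 2 * C * norm v" if "mat_dims d 1 v" for v
    using perturbed_inj[OF mat_dims_mult[OF H'(4) that] C(1) e(1,3) C(2)] mat_dims_mult[OF H'(4) that] H'(1) that
    by (simp add: mult.assoc[symmetric] idm_mult_left)
  have n3: "norm (Hi' * v - Hi * v) <= 2 * C\<^sup>2 * e * norm v" if v: "mat_dims d 1 v" for v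
  proof -
    have d: "mat_dims d 1 (Hi * v)" "mat_dims d 1 ((H' - H) * (Hi * v))"
      using H(3,4) H'(5) v by (auto intro!: mat_dims_mult simp: mat_dims_simps)
    have "Hi * v - Hi' * v = Hi' * ((H' - H) * (Hi * v))"
    proof -
      have "Hi' * ((H' - H) * (Hi * v)) = (Hi' * H') * (Hi * v) - Hi' * ((H * Hi) * v)"
        by (simp add: left_diff_distrib right_diff_distrib mult.assoc)
      then show ?thesis using H(1) H'(2) v d(1) by (simp add: idm_mult_left)
    qed
    then have "norm (Hi' * v - Hi * v) = norm (Hi' * ((H' - H) * (Hi * v)))" by (simp add: norm_minus_commute)
    also have "\<dots> <= 2 * C * norm ((H' - H) * (Hi * v))" by (rule n2[OF d(2)])
    also have "\<dots> <= 2 * C * (e * (C * norm v))"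
      using C(2) e0 by (intro mult_left_mono order_trans[OF norm_mult_ineq] mult_mono e(1) n1 v) auto
    finally show ?thesis by (simp add: power2_eq_square mult_ac)
  qed
  define x1 z1 x2 z2 where "x1 = Hi * x" and "z1 = Hi * z" and "x2 = Hi' * x" and "z2 = Hi' * z"
  have dz: "mat_dims d 1 z1" "mat_dims d 1 z2" "mat_dims d 1 (z2 - z1)"
    using H(3) H'(4) z by (auto simp: z1_def z2_def intro!: mat_dims_mult simp: mat_dims_simps)
  have Fz: "norm (F' * z2) <= (b + 1) * (2 * C * norm z)"
  proof -
    have "F' * z2 = F * z2 + (F' - F) * z2" by (simp add: left_diff_distrib)
    then have "norm (F' * z2) <= norm (F * z2) + norm ((F' - F) * z2)" by (metis norm_triangle_ineq)
    also have "\<dots> <= b * norm z2 + 1 * norm z2"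
      using e(2,4) by (intro add_mono F(1) dz order_trans[OF norm_mult_ineq] mult_right_mono) auto
    also have "\<dots> = (b + 1) * norm z2" by (simp add: algebra_simps)
    also have "\<dots> <= (b + 1) * (2 * C * norm z)" using F(2) n2[OF z] by (intro mult_left_mono) (auto simp: z2_def)
    finally show ?thesis .
  qed
  have eq: "inner x (Hi' * F' * Hi' * z) - inner x (Hi * F * Hi * z)
     = inner (x2 - x1) (F' * z2) + inner x1 ((F' - F) * z2) + inner x1 (F * (z2 - z1))"
  proof -
    have "inner x (Hi' * F' * Hi' * z) = inner x2 (F' * z2)"
      using inner_times_left[of Hi' x "F' * z2"] H'(3) by (simp add: mult.assoc x2_def z2_def)
    moreover have "inner x (Hi * F * Hi * z) = inner x1 (F * z1)"
      using inner_times_left[of Hi x "F * z1"] H(2) by (simp add: mult.assoc x1_def z1_def)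
    ultimately show ?thesis by (simp add: left_diff_distrib right_diff_distrib inner_diff_left inner_diff_right)
  qed
  have t1: "\<bar>inner (x2 - x1) (F' * z2)\<bar> <= (2 * C\<^sup>2 * e * norm x) * ((b + 1) * (2 * C * norm z))"
    using n3[OF x] Fz C(2) e0 by (intro order_trans[OF Cauchy_Schwarz_ineq2] mult_mono) (auto simp: x1_def x2_def)
  have t2: "\<bar>inner x1 ((F' - F) * z2)\<bar> <= (C * norm x) * (e * (2 * C * norm z))"
    using n1[OF x] n2[OF z] C(2) e0
    by (intro order_trans[OF Cauchy_Schwarz_ineq2] mult_mono order_trans[OF norm_mult_ineq] e(2)) (auto simp: x1_def z2_def)
  have "norm (F * (z2 - z1)) <= b * (2 * C\<^sup>2 * e * norm z)"
    using n3[OF z] F(2) by (intro order_trans[OF F(1)[OF dz(3)]] mult_left_mono) (auto simp: z1_def z2_def)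
  then have t3: "\<bar>inner x1 (F * (z2 - z1))\<bar> <= (C * norm x) * (b * (2 * C\<^sup>2 * e * norm z))"
    using n1[OF x] C(2) by (intro order_trans[OF Cauchy_Schwarz_ineq2] mult_mono) (auto simp: x1_def)
  have "(2 * C\<^sup>2 * e * norm x) * ((b + 1) * (2 * C * norm z)) + (C * norm x) * (e * (2 * C * norm z)) + (C * norm x) * (b * (2 * C\<^sup>2 * e * norm z))
    = e * (4 * C ^ 3 * (b + 1) + 2 * C\<^sup>2 + 2 * b * C ^ 3) * norm x * norm z"
    by (simp add: algebra_simps power2_eq_square power3_eq_cube)
  then show ?thesis using t1 t2 t3 unfolding eq by linarith
qed

text \<open>With A = K' \<Sigma> K and R the root of \<Sigma>, put Q = A^{-1/2} K' R; then Q Q' = I.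
  The vector w stands for A^{-1} K' v, so the Wald form in v is |Q R^{-1} v|^2.\<close>

lemma wald_isometry:
  assumes K: "mat_dims d r K" "\<And>v. mat_dims r 1 v ==> K * v = 0 ==> v = 0"
    and R: "mat_dims d d R" "trp R = R" "R * R = \<Sigma>" "mat_dims d d Ri" "R * Ri = idm d" "Ri * R = idm d"
  obtains Q where "mat_dims r d Q" "Q * trp Q = idm r"
    "\<And>v. mat_dims d 1 v ==> \<exists>w. mat_dims r 1 w \<and> trp K * \<Sigma> * K * w = trp K * v \<and>
        inner (trp K * v) w = (norm (Q * (Ri * v)))\<^sup>2"
proof -
  define A where "A = trp K * \<Sigma> * K"
  have A: "psdm A" "mat_dims r r A"
  proof -
    have "A = trp (R * K) * (R * K)" unfolding A_def R(3)[symmetric] by (simp add: trp_mult R(2) mult.assoc)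
    then show "psdm A" by (simp add: psdm_gram')
    show "mat_dims r r A" unfolding A_def R(3)[symmetric] using K(1) R(1) by (auto intro!: mat_dims_mult)
  qed
  have Ri: "R * v = 0 ==> mat_dims d 1 v ==> v = 0" for v
    using R(6) by (metis idm_mult_left mult.assoc mult_zero_right)
  have Ainj: "v = 0" if v: "mat_dims r 1 v" "A * v = 0" for v
  proof -
    have "inner v (A * v) = inner (R * (K * v)) (R * (K * v))"
      unfolding A_def R(3)[symmetric] using inner_times_left[of K v "R * (R * (K * v))"] inner_times_left[of R "K * v" "R * (K * v)"]
      by (simp add: R(2) mult.assoc)
    then have "R * (K * v) = 0" using v(2) by simp
    then have "K * v = 0" using Ri K(1) v(1) by (blast intro: mat_dims_mult)
    then show ?thesis using K(2) v(1) by simp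
  qed
  obtain S where S: "psdm S" "mat_dims r r S" "S * S = A" using psdm_sqrt_exists[OF A] .
  have S_inj: "v = 0" if "mat_dims r 1 v" "S * v = 0" for v
    using Ainj[OF that(1)] that(2) by (simp add: S(3)[symmetric] mult.assoc)
  obtain S' where S'J: "S' \<in> carrier_mat r r" "fm S' = S" using fm_surj[OF S(2)] by blast
  define Si where "Si = fm (mat_inv S')"
  have Si: "S * Si = idm r" "Si * S = idm r" "mat_dims r r Si"
    using fm_mat_inv[OF S'J(1)] S_inj unfolding S'J(2) Si_def by auto
  have Sit: "trp Si = Si"
  proof -
    have "trp Si = trp Si * (S * Si)" using Si by (simp add: idm_mult_right)
    also have "\<dots> = trp (S * Si) * Si" using psdm_sym[OF S(1)] by (simp add: trp_mult mult.assoc)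
    also have "\<dots> = Si" using Si by (simp add: idm_mult_left)
    finally show ?thesis .
  qed
  define Q where "Q = Si * trp K * R"
  have Q: "mat_dims r d Q" unfolding Q_def using Si(3) K(1) R(1) by (auto intro!: mat_dims_mult)
  have "Q * trp Q = Si * (S * S) * Si"
    unfolding S(3) A_def R(3)[symmetric] Q_def by (simp add: trp_mult R(2) Sit mult.assoc)
  also have "\<dots> = (Si * S) * (S * Si)" by (simp add: mult.assoc)
  finally have QQ: "Q * trp Q = idm r" unfolding Si by (simp add: idm_idm)
  have "\<exists>w. mat_dims r 1 w \<and> trp K * \<Sigma> * K * w = trp K * v \<and> inner (trp K * v) w = (norm (Q * (Ri * v)))\<^sup>2"
    if v: "mat_dims d 1 v" for v
  proof (intro exI[of _ "Si * (Si * (trp K * v))"] conjI)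
    have dK: "mat_dims r 1 (trp K * v)" using K(1) v by (auto intro!: mat_dims_mult)
    show "mat_dims r 1 (Si * (Si * (trp K * v)))" using Si(3) dK by (blast intro: mat_dims_mult)
    have "A * (Si * (Si * (trp K * v))) = S * ((S * Si) * (Si * (trp K * v)))" unfolding S(3)[symmetric] by (simp add: mult.assoc)
    also have "\<dots> = (S * Si) * (trp K * v)"
      unfolding Si(1) using idm_mult_left[OF mat_dims_mult[OF Si(3) dK]] by (simp add: mult.assoc[symmetric] Si(1))
    also have "\<dots> = trp K * v" unfolding Si(1) by (rule idm_mult_left[OF dK])
    finally show "trp K * \<Sigma> * K * (Si * (Si * (trp K * v))) = trp K * v" unfolding A_def .
    have "Q * (Ri * v) = Si * trp K * ((R * Ri) * v)" by (simp add: Q_def mult.assoc)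
    also have "\<dots> = Si * (trp K * v)" unfolding R(5) idm_mult_left[OF v] by (simp add: mult.assoc)
    finally show "inner (trp K * v) (Si * (Si * (trp K * v))) = (norm (Q * (Ri * v)))\<^sup>2"
      using inner_times_left[of Si "trp K * v" "Si * (trp K * v)"] by (simp add: Sit power2_norm_eq_inner)
  qed
  then show ?thesis using that[OF Q QQ] by blast
qed

lemma norm_coisometry_le:
  assumes "mat_dims r d Q" "Q * trp Q = idm r" "mat_dims d 1 v"
  shows "norm (Q * v) <= norm v"
proof -
  have Qv: "mat_dims r 1 (Q * v)" using assms(1,3) by (rule mat_dims_mult)
  have "(norm (trp Q * (Q * v)))\<^sup>2 = inner (Q * v) (Q * trp Q * (Q * v))"
    by (simp add: power2_norm_eq_inner inner_times_left mult.assoc)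
  also have "\<dots> = (norm (Q * v))\<^sup>2" unfolding assms(2) idm_mult_left[OF Qv] by (simp add: power2_norm_eq_inner)
  finally have n: "norm (trp Q * (Q * v)) = norm (Q * v)" by simp
  have "norm (Q * v) * norm (Q * v) = inner v (trp Q * (Q * v))"
    using inner_times_left[of Q v "Q * v"] by (simp add: power2_norm_eq_inner[symmetric] power2_eq_square)
  also have "\<dots> <= norm v * norm (Q * v)" using norm_cauchy_schwarz[of v "trp Q * (Q * v)"] n by simp
  finally show ?thesis by (cases "norm (Q * v) = 0") (auto simp: mult_le_cancel_right)
qed

text \<open>Since A' z = S = A w and A is symmetric, the difference equals w' A z - w' A' z, at most
  \<epsilon> n(w) n(z) in the norm n of A. As a form A' is at least half of A, whence n(z) \<le> 2
  n(w). The error is relative to the statistic, so nothing need be known about its size.\<close>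

lemma wald_near:
  assumes A: "psdm A" "\<And>x. mat_dims r 1 x ==> inner x (A * x) = 0 ==> x = 0"
    and close: "\<And>x z. mat_dims r 1 x ==> mat_dims r 1 z ==>
      \<bar>inner x (A' * z) - inner x (A * z)\<bar> <= \<epsilon> * sqrt (inner x (A * x)) * sqrt (inner z (A * z))"
    and \<epsilon>: "0 <= \<epsilon>" "\<epsilon> <= 1 / 2"
  shows "\<And>v. mat_dims r 1 v ==> A' * v = 0 ==> v = 0"
    and "\<And>z w S. mat_dims r 1 z ==> mat_dims r 1 w ==> A' * z = S ==> A * w = S ==>
      \<bar>inner S z - inner S w\<bar> <= 2 * \<epsilon> * inner S w"
proof -
  define n where "n x = sqrt (inner x (A * x))" for x
  have n: "0 <= n x" "n x * n x = inner x (A * x)" if "mat_dims r 1 x" for x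
    using psdm_nonneg[OF A(1), of x] by (auto simp: n_def)
  have key: "n z * n z <= 2 * inner z (A' * z)" if "mat_dims r 1 z" for z
  proof -
    have "\<bar>inner z (A' * z) - inner z (A * z)\<bar> <= \<epsilon> * (n z * n z)" using close[OF that that] unfolding n_def[symmetric] by (simp add: mult.assoc)
    moreover have "\<epsilon> * (n z * n z) <= 1 / 2 * (n z * n z)" using \<epsilon> by (intro mult_right_mono) auto
    ultimately show ?thesis unfolding n(2)[OF that] by linarith
  qed
  show "v = 0" if v: "mat_dims r 1 v" "A' * v = 0" for v
    using key[OF v(1)] n(2)[OF v(1)] v A(2)[OF v(1)] psdm_nonneg[OF A(1), of v] by auto
  fix z w S assume z: "mat_dims r 1 z" "A' * z = S" and w: "mat_dims r 1 w" "A * w = S"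
  have Sz: "inner S z = inner z (A * w)" by (simp add: w(2) inner_commute)
  have Sw: "inner S w = n w * n w" using w n(2)[OF w(1)] by (simp add: inner_commute)
  have "inner S w = inner w (A' * z)" by (simp add: z(2) inner_commute)
  then have "\<bar>inner S z - inner S w\<bar> <= \<epsilon> * n w * n z"
    using close[OF w(1) z(1)] inner_sym_swap[OF psdm_sym[OF A(1)], of z w] Sz by (simp add: n_def abs_minus_commute)
  moreover have "n z <= 2 * n w"
  proof -
    have "inner z (A' * z) = inner w (A * z)"
      using inner_sym_swap[OF psdm_sym[OF A(1)], of w z] by (simp add: z(2) w(2))
    moreover have "(inner w (A * z))\<^sup>2 <= inner w (A * w) * inner z (A * z)"
      by (rule psdm_Cauchy_Schwarz[OF A(1)])
    then have "\<bar>inner w (A * z)\<bar> <= n w * n z" unfolding n_def real_sqrt_mult[symmetric] by (metis real_sqrt_abs real_sqrt_le_mono)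
    ultimately have "n z * n z <= (2 * n w) * n z" using key[OF z(1)] by linarith
    then show ?thesis using n(1)[OF z(1)] n(1)[OF w(1)] by (cases "n z = 0") (auto simp: mult_le_cancel_right)
  qed
  then have "\<epsilon> * n w * n z <= \<epsilon> * n w * (2 * n w)" using \<epsilon>(1) n(1)[OF w(1)] by (intro mult_left_mono) auto
  ultimately show "\<bar>inner S z - inner S w\<bar> <= 2 * \<epsilon> * inner S w" unfolding Sw by linarith
qed

subsection \<open>Convergence to the chi-square law\<close>

abbreviation "stdn \<equiv> std_normal_distribution"
abbreviation gauss :: "nat => (nat => real) measure" where "gauss d \<equiv> (\<Pi>\<^sub>M i\<in>{..<d}. stdn)"

lemma prob_space_stdn: "prob_space stdn"
  using real_dist_normal_dist by (simp add: real_distribution_def)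

interpretation stdn: prob_space stdn by (rule prob_space_stdn)
interpretation gauss: product_sigma_finite "\<lambda>_::nat. stdn"
  by standard

lemma prob_space_gauss: "prob_space (gauss d)"
  by (intro prob_space_PiM prob_space_stdn)

lemma iexp_gauss: "(\<integral>z. iexp (\<Sum>j<d. a j * z j) \<partial>gauss d) = complex_of_real (exp (- (\<Sum>j<d. (a j)\<^sup>2) / 2))"
proof -
  have c: "(\<integral>x. iexp (t * x) \<partial>stdn) = complex_of_real (exp (- (t\<^sup>2) / 2))" for t
    using char_std_normal_distribution by (simp add: char_def fun_eq_iff)
  have i: "integrable stdn (\<lambda>x. iexp (t * x))" for t
    by (rule stdn.integrable_const_bound[where B = 1]) auto
  have "(\<integral>z. iexp (\<Sum>j<d. a j * z j) \<partial>gauss d) = (\<integral>z. (\<Prod>j<d. iexp (a j * z j)) \<partial>gauss d)"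
    by (simp add: exp_sum sum_distrib_left)
  also have "\<dots> = (\<Prod>j<d. \<integral>x. iexp (a j * x) \<partial>stdn)"
    using i by (intro gauss.product_integral_prod) auto
  also have "\<dots> = (\<Prod>j<d. complex_of_real (exp (- ((a j)\<^sup>2) / 2)))" unfolding c ..
  also have "\<dots> = complex_of_real (exp (- (\<Sum>j<d. (a j)\<^sup>2) / 2))"
    by (simp add: exp_sum[symmetric] of_real_prod[symmetric] sum_negf[symmetric] sum_divide_distrib del: of_real_prod)
  finally show ?thesis .
qed

text \<open>The squared norm of Q z, for a function z because \<open>tendsto_std_normal\<close>
  tests functions of sequences.\<close>

definition "qq Q r d z = (\<Sum>i<r. (\<Sum>j<d. ent Q i j * z j)\<^sup>2)" for z :: "nat => real"

lemma gauss_component [measurable]: "i < d ==> (\<lambda>z. z i) \<in> borel_measurable (gauss d)"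
  using measurable_component_singleton[of i "{..<d}" "\<lambda>_. stdn"] by (simp cong: measurable_cong_sets)

lemma gauss_linear [measurable]: "(\<lambda>z. \<Sum>j<d. a j * z j) \<in> borel_measurable (gauss d)"
  by (intro borel_measurable_sum borel_measurable_times borel_measurable_const gauss_component) auto

lemma qq_measurable [measurable]: "qq Q r d \<in> borel_measurable (gauss d)"
  unfolding qq_def[abs_def] by measurable

lemma sum_sq_measurable [measurable]: "(\<lambda>z. \<Sum>j<d. (z j)\<^sup>2) \<in> borel_measurable (gauss d)"
  by (intro borel_measurable_sum borel_measurable_power gauss_component) auto

lemma qq_nonneg: "0 <= qq Q r d z" by (simp add: qq_def sum_nonneg)

lemma qq_norm:
  assumes "mat_dims r d Q"
  shows "qq Q r d z = (norm (Q * of_fun d 1 (\<lambda>i _. z i)))\<^sup>2"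
proof -
  have d: "mat_dims r 1 (Q * of_fun d 1 (\<lambda>i _. z i))" using assms by (rule mat_dims_mult) simp
  have "ent (Q * of_fun d 1 (\<lambda>i _. z i)) i 0 = (\<Sum>j<d. ent Q i j * z j)" for i
    by (simp add: ent_times_left[OF assms])
  then show ?thesis unfolding power2_norm_eq_inner inner_fmat_left[OF d] by (simp add: qq_def power2_eq_square)
qed

text \<open>Writing $e^{-|Qz|^2/2}$ as a Gaussian average of characters and exchanging the two integrals
  replaces $Q z$ by $Q' w$, which has the norm of $w$.\<close>

lemma laplace_qq:
  assumes Q: "mat_dims r d Q" "Q * trp Q = idm r" and t: "0 <= t"
  shows "(\<integral>z. exp (- t * qq Q r d z) \<partial>gauss d) = (\<integral>w. exp (- t * (\<Sum>i<r. (w i)\<^sup>2)) \<partial>gauss r)"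
proof -
  interpret P: pair_prob_space "gauss d" "gauss r"
    by (intro pair_prob_space.intro pair_sigma_finite.intro prob_space_imp_sigma_finite prob_space_gauss)
  \<comment> \<open>The scale at which averaging the character over w gives exp(-t |Q z|^2), as q^2
    / 2 = t.\<close>
  define q where "q = sqrt (2 * t)"
  have q2: "q\<^sup>2 = 2 * t" using t by (simp add: q_def)
  define L where "L z w = (\<Sum>i<r. (q * (\<Sum>j<d. ent Q i j * z j)) * w i)" for z w :: "nat => real"
  have L': "L z w = (\<Sum>j<d. (q * (\<Sum>i<r. ent Q i j * w i)) * z j)" for z w
    unfolding L_def by (simp add: sum_distrib_left sum_distrib_right mult_ac) (rule sum.swap)
  have 1: "complex_of_real (exp (- t * qq Q r d z)) = (\<integral>w. iexp (L z w) \<partial>gauss r)" for z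
    unfolding L_def iexp_gauss by (simp add: power_mult_distrib q2 qq_def sum_distrib_left[symmetric])
  have 2: "(\<integral>z. iexp (L z w) \<partial>gauss d) = complex_of_real (exp (- t * (\<Sum>i<r. (w i)\<^sup>2)))" for w
  proof -
    have dt: "mat_dims d r (trp Q)" using Q(1) by simp
    have "(\<Sum>j<d. (\<Sum>i<r. ent Q i j * w i)\<^sup>2) = (norm (trp Q * of_fun r 1 (\<lambda>i _. w i)))\<^sup>2"
      using qq_norm[OF dt, of w] by (simp add: qq_def)
    also have "\<dots> = inner (of_fun r 1 (\<lambda>i _. w i)) (Q * trp Q * of_fun r 1 (\<lambda>i _. w i))"
      by (simp add: power2_norm_eq_inner inner_times_left mult.assoc)
    also have "\<dots> = (\<Sum>i<r. (w i)\<^sup>2)"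
      unfolding Q(2) idm_mult_left[OF mat_dims_of_fun] by (simp add: inner_fmat_left[OF mat_dims_of_fun] power2_eq_square)
    finally show ?thesis
      unfolding L' iexp_gauss by (simp add: power_mult_distrib q2 sum_distrib_left[symmetric])
  qed
  have Lm: "(\<lambda>(z, w). iexp (L z w)) \<in> borel_measurable (gauss d \<Otimes>\<^sub>M gauss r)"
  proof -
    have [measurable]: "(\<lambda>x. \<Sum>j<d. ent Q i j * fst x j) \<in> borel_measurable (gauss d \<Otimes>\<^sub>M gauss r)" for i
      by (rule measurable_compose[OF measurable_fst gauss_linear])
    have [measurable]: "i < r ==> (\<lambda>x. snd x i) \<in> borel_measurable (gauss d \<Otimes>\<^sub>M gauss r)" for i
      by (rule measurable_compose[OF measurable_snd gauss_component])
    have "(\<lambda>x. L (fst x) (snd x)) \<in> borel_measurable (gauss d \<Otimes>\<^sub>M gauss r)"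
      unfolding L_def by (intro borel_measurable_sum borel_measurable_times borel_measurable_const) auto
    then show ?thesis unfolding case_prod_beta by measurable
  qed
  have int: "integrable (gauss d \<Otimes>\<^sub>M gauss r) (\<lambda>(z, w). iexp (L z w))"
    by (rule P.integrable_const_bound[where B = 1]) (use Lm in auto)
  have "complex_of_real (\<integral>z. exp (- t * qq Q r d z) \<partial>gauss d) = (\<integral>z. complex_of_real (exp (- t * qq Q r d z)) \<partial>gauss d)"
    by (rule integral_complex_of_real[symmetric])
  also have "\<dots> = (\<integral>z. (\<integral>w. iexp (L z w) \<partial>gauss r) \<partial>gauss d)" unfolding 1 ..
  also have "\<dots> = (\<integral>w. (\<integral>z. iexp (L z w) \<partial>gauss d) \<partial>gauss r)"
    using P.Fubini_integral[OF int] by simp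
  also have "\<dots> = (\<integral>w. complex_of_real (exp (- t * (\<Sum>i<r. (w i)\<^sup>2))) \<partial>gauss r)" unfolding 2 ..
  also have "\<dots> = complex_of_real (\<integral>w. exp (- t * (\<Sum>i<r. (w i)\<^sup>2)) \<partial>gauss r)"
    by (rule integral_complex_of_real)
  finally show ?thesis by (simp only: of_real_eq_iff)
qed

lemma exp_neg_diff_le:
  fixes a b k :: real
  assumes "0 <= a" "0 <= b" "0 <= k"
  shows "\<bar>exp (- k * a) - exp (- k * b)\<bar> <= min 1 (k * \<bar>a - b\<bar>)"
proof -
  have *: "exp (- x) - exp (- y) <= min 1 (y - x) \<and> 0 <= exp (- x) - exp (- y)" if "0 <= x" "x <= y" for x y :: real
  proof -
    have "exp (- x) <= 1" "0 < exp (- y)" using that by auto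
    moreover have "1 - exp (- (y - x)) <= y - x" using exp_ge_add_one_self[of "- (y - x)"] by linarith
    then have "exp (- x) * (1 - exp (- (y - x))) <= 1 * (y - x)"
      using that by (intro mult_mono) auto
    moreover have "exp (- x) * exp (- (y - x)) = exp (- y)" by (simp add: exp_add[symmetric])
    moreover have "exp (- y) <= exp (- x)" using that by simp
    ultimately have "exp (- x) - exp (- y) <= 1" "exp (- x) - exp (- y) <= y - x" "0 <= exp (- x) - exp (- y)"
      unfolding right_diff_distrib by linarith+
    then show ?thesis by simp
  qed
  show ?thesis
  proof (cases "a <= b")
    case True
    then have "k * a <= k * b" using assms by (intro mult_left_mono)
    then show ?thesis using *[of "k * a" "k * b"] assms True by (simp add: right_diff_distrib abs_if)
  next
    case False
    then have "k * b <= k * a" using assms by (intro mult_left_mono) auto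
    then show ?thesis using *[of "k * b" "k * a"] assms False by (simp add: right_diff_distrib abs_if)
  qed
qed

lemma min_gauss_tendsto_0:
  assumes "(\<epsilon> :: nat => real) \<longlonglongrightarrow> 0" "\<And>m. 0 <= \<epsilon> m"
  shows "(\<lambda>m. \<integral>z. min 1 (\<epsilon> m * (\<Sum>j<d. (z j)\<^sup>2)) \<partial>gauss d) \<longlonglongrightarrow> 0"
proof -
  interpret prob_space "gauss d" by (rule prob_space_gauss)
  have "(\<lambda>m. \<integral>z. min 1 (\<epsilon> m * (\<Sum>j<d. (z j)\<^sup>2)) \<partial>gauss d) \<longlonglongrightarrow> (\<integral>z. min 1 (0 * (\<Sum>j<d. (z j)\<^sup>2)) \<partial>gauss d)"
  proof (rule integral_dominated_convergence[where w = "\<lambda>_. 1"])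
    show "AE z in gauss d. (\<lambda>m. min 1 (\<epsilon> m * (\<Sum>j<d. (z j)\<^sup>2))) \<longlonglongrightarrow> min 1 (0 * (\<Sum>j<d. (z j)\<^sup>2))"
      by (intro AE_I2 tendsto_intros assms)
    show "AE z in gauss d. norm (min 1 (\<epsilon> m * (\<Sum>j<d. (z j)\<^sup>2))) <= 1" for m
      using assms(2) by (intro AE_I2) (auto simp: sum_nonneg)
  qed auto
  then show ?thesis by simp
qed

context
  fixes M :: "nat => 'w measure" and d :: nat and Z :: "nat => 'w => real vec"
  assumes M: "\<And>n. prob_space (M n)" and Z: "\<And>n. random_vec (M n) d (Z n)"
    and conv: "tendsto_std_normal d M Z"
begin

abbreviation "pad n \<omega> \<equiv> (\<lambda>i. if i < d then Z n \<omega> $ i else 0)"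
abbreviation "sq n \<omega> \<equiv> (\<Sum>j<d. (Z n \<omega> $ j)\<^sup>2)"

lemma Z_comp [measurable]: "j < d ==> (\<lambda>\<omega>. Z n \<omega> $ j) \<in> borel_measurable (M n)"
  using Z by (simp add: random_vec_def)

lemma sq_measurable [measurable]: "sq n \<in> borel_measurable (M n)"
  by (intro borel_measurable_sum borel_measurable_power Z_comp) auto

lemma qqZ_measurable [measurable]: "(\<lambda>\<omega>. qq Q r d (pad n \<omega>)) \<in> borel_measurable (M n)"
  unfolding qq_def by (intro borel_measurable_sum borel_measurable_power borel_measurable_times borel_measurable_const) (auto intro: Z_comp)

lemma conv_gauss:
  fixes g :: "(nat => real) => real"
  assumes "continuous_on UNIV g" "bounded (range g)" "\<And>z. g (\<lambda>i. if i < d then z i else 0) = g z"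
  shows "(\<lambda>n. \<integral>\<omega>. g (pad n \<omega>) \<partial>M n) \<longlonglongrightarrow> (\<integral>z. g z \<partial>gauss d)"
  using conv assms unfolding tendsto_std_normal_def by auto

text \<open>A substitute for tightness: the integrand is a bounded continuous test function, and its
  Gaussian limit is small for small \<epsilon>. It absorbs both the replacement of Q_n by a limit
  and the relative error of the statistic.\<close>

lemma small_sq:
  assumes "0 < e"
  shows "\<exists>\<epsilon>>0. \<forall>\<^sub>F n in sequentially. (\<integral>\<omega>. min 1 (\<epsilon> * sq n \<omega>) \<partial>M n) < e"
proof -
  have "(\<lambda>m. \<integral>z. min 1 (inverse (real (Suc m)) * (\<Sum>j<d. (z j)\<^sup>2)) \<partial>gauss d) \<longlonglongrightarrow> 0"
    by (rule min_gauss_tendsto_0[OF LIMSEQ_inverse_real_of_nat]) auto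
  from order_tendstoD(2)[OF this assms] obtain m where
    m: "(\<integral>z. min 1 (inverse (real (Suc m)) * (\<Sum>j<d. (z j)\<^sup>2)) \<partial>gauss d) < e"
    by (auto simp: eventually_sequentially)
  define \<epsilon> where "\<epsilon> = inverse (real (Suc m))"
  have "0 < \<epsilon>" by (simp add: \<epsilon>_def)
  have "(\<lambda>n. \<integral>\<omega>. min 1 (\<epsilon> * (\<Sum>j<d. (pad n \<omega> j)\<^sup>2)) \<partial>M n) \<longlonglongrightarrow> (\<integral>z. min 1 (\<epsilon> * (\<Sum>j<d. (z j)\<^sup>2)) \<partial>gauss d)"
  proof (rule conv_gauss)
    show "continuous_on UNIV (\<lambda>z. min 1 (\<epsilon> * (\<Sum>j<d. (z j)\<^sup>2)) :: real)"
      by (intro continuous_intros continuous_on_product_coordinates)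
    show "bounded (range (\<lambda>z. min 1 (\<epsilon> * (\<Sum>j<d. (z j)\<^sup>2)) :: real))"
      using \<open>0 < \<epsilon>\<close> by (intro boundedI[of _ 1]) (auto simp: sum_nonneg)
  qed auto
  then have "\<forall>\<^sub>F n in sequentially. (\<integral>\<omega>. min 1 (\<epsilon> * (\<Sum>j<d. (pad n \<omega> j)\<^sup>2)) \<partial>M n) < e"
    by (rule order_tendstoD(2)) (use m in \<open>simp add: \<epsilon>_def\<close>)
  then show ?thesis using \<open>0 < \<epsilon>\<close> by (intro exI[of _ \<epsilon>]) simp
qed

lemma conv_qq_fixed:
  assumes "0 <= k"
  shows "(\<lambda>n. \<integral>\<omega>. exp (- k * qq Q r d (pad n \<omega>)) \<partial>M n) \<longlonglongrightarrow> (\<integral>z. exp (- k * qq Q r d z) \<partial>gauss d)"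
proof (rule conv_gauss)
  show "continuous_on UNIV (\<lambda>z. exp (- k * qq Q r d z))"
    unfolding qq_def by (intro continuous_intros continuous_on_product_coordinates)
  have "\<bar>exp (- k * qq Q r d z)\<bar> <= 1" for z using assms qq_nonneg[of Q r d z] by simp
  then show "bounded (range (\<lambda>z. exp (- k * qq Q r d z)))" by (intro boundedI[of _ 1]) auto
  show "exp (- k * qq Q r d (\<lambda>i. if i < d then z i else 0)) = exp (- k * qq Q r d z)" for z
    by (simp add: qq_def)
qed

text \<open>If the convergence failed, some subsequence would stay away from the limit. As |Q_n|^2 =
  r, compactness gives a further subsequence with Q_n converging to some Q0; weak convergence
  applies to the fixed Q0, and \<open>laplace_qq\<close> evaluates the result independently of Q0, a
  contradiction.\<close>

lemma conv_qq:
  assumes Q: "\<And>n. mat_dims r d (Q n)" "\<And>n. Q n * trp (Q n) = idm r" and k: "0 <= k"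
  shows "(\<lambda>n. \<integral>\<omega>. exp (- k * qq (Q n) r d (pad n \<omega>)) \<partial>M n) \<longlonglongrightarrow> (\<integral>w. exp (- k * (\<Sum>i<r. (w i)\<^sup>2)) \<partial>gauss r)"
proof (rule ccontr)
  let ?f = "\<lambda>n. \<integral>\<omega>. exp (- k * qq (Q n) r d (pad n \<omega>)) \<partial>M n" and ?l = "\<integral>w. exp (- k * (\<Sum>i<r. (w i)\<^sup>2)) \<partial>gauss r"
  assume "\<not> ?f \<longlonglongrightarrow> ?l"
  then obtain e where e: "0 < e" "\<not> (\<forall>\<^sub>F n in sequentially. dist (?f n) ?l < e)" unfolding tendsto_iff by blast
  from not_eventually_sequentiallyD[OF e(2)]
  obtain \<rho> :: "nat => nat" where "strict_mono \<rho> \<and> (\<forall>n. \<not> dist (?f (\<rho> n)) ?l < e)" by (elim exE)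
  then have \<rho>: "strict_mono \<rho>" "\<And>n. \<not> dist (?f (\<rho> n)) ?l < e" by auto
  have nQ: "(norm (Q n))\<^sup>2 = r" for n
  proof -
    have "(norm (Q n))\<^sup>2 = trc (Q n * trp (Q n))" by (simp add: trc_mult power2_norm_eq_inner)
    then show ?thesis unfolding Q(2) by (simp add: trc_gen[OF mat_dims_idm] ent_idm)
  qed
  then have nQ': "norm (Q n) = sqrt r" for n by (metis norm_ge_zero real_sqrt_unique)
  have "seq_compact {A. mat_dims r d A \<and> norm A <= sqrt r}"
    by (simp add: compact_imp_seq_compact compact_fmat)
  then obtain Q0 \<sigma> where Q0: "mat_dims r d Q0" "norm Q0 <= sqrt r" "strict_mono \<sigma>" "((\<lambda>n. Q (\<rho> n)) \<circ> \<sigma>) \<longlonglongrightarrow> Q0"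
    unfolding seq_compact_def using Q(1) nQ' by (metis (mono_tags, lifting) mem_Collect_eq order_refl)
  define \<tau> where "\<tau> n = \<rho> (\<sigma> n)" for n
  have \<tau>: "strict_mono \<tau>" unfolding \<tau>_def using \<rho>(1) Q0(3) by (simp add: strict_mono_def)
  have Ql: "(\<lambda>n. Q (\<tau> n)) \<longlonglongrightarrow> Q0" using Q0(4) by (simp add: \<tau>_def comp_def)
  have "(\<lambda>n. Q (\<tau> n) * trp (Q (\<tau> n))) \<longlonglongrightarrow> Q0 * trp Q0"
    by (intro tendsto_mult Ql bounded_linear.tendsto[OF bounded_linear_trp])
  then have QQ: "Q0 * trp Q0 = idm r" unfolding Q(2) by (simp add: LIMSEQ_const_iff)
  \<comment> \<open>The squared norms of A x and B x differ by at most |A - B| (|A| + |B|) |x|^2,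
    and both norms are at most sqrt r here.\<close>
  define K where "K n = k * (norm (Q (\<tau> n) - Q0) * (2 * sqrt r))" for n
  have K0: "0 <= K n" for n using k by (simp add: K_def)
  have "(\<lambda>n. K n) \<longlonglongrightarrow> k * (norm (Q0 - Q0) * (2 * sqrt r))"
    unfolding K_def by (intro tendsto_intros Ql)
  then have K: "K \<longlonglongrightarrow> 0" by simp
  have close: "\<bar>exp (- k * qq (Q (\<tau> n)) r d (pad m \<omega>)) - exp (- k * qq Q0 r d (pad m \<omega>))\<bar> <= min 1 (K n * sq m \<omega>)" for n m \<omega>
  proof -
    define x where "x = of_fun d 1 (\<lambda>i _. pad m \<omega> i)"
    let ?A = "Q (\<tau> n)"
    have al: "(a * n) * (q * n + q * n) = a * (2 * q) * (n * n)" for a n q :: real by (simp add: algebra_simps)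
    have nx: "(norm x)\<^sup>2 = sq m \<omega>" unfolding x_def power2_norm_eq_inner by (simp add: inner_fmat_left[OF mat_dims_of_fun] power2_eq_square)
    have "\<bar>qq ?A r d (pad m \<omega>) - qq Q0 r d (pad m \<omega>)\<bar> = \<bar>(norm (?A * x))\<^sup>2 - (norm (Q0 * x))\<^sup>2\<bar>"
      unfolding qq_norm[OF Q(1)] qq_norm[OF Q0(1)] x_def ..
    also have "\<dots> = \<bar>norm (?A * x) - norm (Q0 * x)\<bar> * (norm (?A * x) + norm (Q0 * x))"
      by (simp add: power2_eq_square square_diff_square_factored abs_mult)
    also have "\<dots> <= norm (?A * x - Q0 * x) * (sqrt r * norm x + sqrt r * norm x)"
    proof (intro mult_mono add_mono norm_triangle_ineq3)
      show "norm (?A * x) <= sqrt r * norm x" using norm_mult_ineq[of ?A x] nQ' by simp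
      show "norm (Q0 * x) <= sqrt r * norm x" using norm_mult_ineq[of Q0 x] Q0(2) by (meson mult_right_mono norm_ge_zero order_trans)
    qed auto
    also have "\<dots> <= (norm (?A - Q0) * norm x) * (sqrt r * norm x + sqrt r * norm x)"
      by (intro mult_right_mono) (auto simp: left_diff_distrib[symmetric] norm_mult_ineq)
    also have "\<dots> = norm (?A - Q0) * (2 * sqrt r) * sq m \<omega>" unfolding nx[symmetric] unfolding power2_eq_square by (rule al)
    finally have "k * \<bar>qq ?A r d (pad m \<omega>) - qq Q0 r d (pad m \<omega>)\<bar> <= k * (norm (?A - Q0) * (2 * sqrt r) * sq m \<omega>)"
      by (rule mult_left_mono[OF _ k])
    then have "k * \<bar>qq ?A r d (pad m \<omega>) - qq Q0 r d (pad m \<omega>)\<bar> <= K n * sq m \<omega>" by (simp add: K_def mult.assoc)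
    then show ?thesis using exp_neg_diff_le[OF qq_nonneg qq_nonneg k, of ?A r d "pad m \<omega>" Q0 r d "pad m \<omega>"] by linarith
  qed
  obtain \<epsilon> where \<epsilon>: "0 < \<epsilon>" "\<forall>\<^sub>F n in sequentially. (\<integral>\<omega>. min 1 (\<epsilon> * sq n \<omega>) \<partial>M n) < e / 2"
    using small_sq[of "e / 2"] e(1) by auto
  have fix_l: "(\<lambda>n. \<integral>\<omega>. exp (- k * qq Q0 r d (pad n \<omega>)) \<partial>M n) \<longlonglongrightarrow> ?l"
    using conv_qq_fixed[OF k, of Q0 r] laplace_qq[OF Q0(1) QQ k] by simp
  have "\<forall>\<^sub>F n in sequentially. (\<integral>\<omega>. min 1 (\<epsilon> * sq n \<omega>) \<partial>M n) < e / 2 \<and> dist (\<integral>\<omega>. exp (- k * qq Q0 r d (pad n \<omega>)) \<partial>M n) ?l < e / 2"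
    using \<epsilon>(2) tendstoD[OF fix_l, of "e / 2"] e(1) by (auto intro: eventually_conj)
  then have "\<forall>\<^sub>F n in sequentially. (\<integral>\<omega>. min 1 (\<epsilon> * sq (\<tau> n) \<omega>) \<partial>M (\<tau> n)) < e / 2 \<and> dist (\<integral>\<omega>. exp (- k * qq Q0 r d (pad (\<tau> n) \<omega>)) \<partial>M (\<tau> n)) ?l < e / 2"
    by (rule eventually_subseq[OF \<tau>])
  moreover have "\<forall>\<^sub>F n in sequentially. K n < \<epsilon>" using order_tendstoD(2)[OF K \<epsilon>(1)] .
  ultimately have "\<forall>\<^sub>F n in sequentially. dist (?f (\<tau> n)) ?l < e"
  proof eventually_elim
    case (elim n)
    let ?m = "\<tau> n"
    interpret m: prob_space "M ?m" by (rule M)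
    have b: "norm (exp (- k * qq A r d (pad ?m \<omega>))) <= 1" for A \<omega> using k qq_nonneg[of A r d "pad ?m \<omega>"] by simp
    have i: "integrable (M ?m) (\<lambda>\<omega>. exp (- k * qq A r d (pad ?m \<omega>)))" for A
      by (rule m.integrable_const_bound[where B = 1]) (use b in auto)
    have i2: "integrable (M ?m) (\<lambda>\<omega>. min 1 (\<epsilon> * sq ?m \<omega>))"
      using \<epsilon>(1) by (intro m.integrable_const_bound[where B = 1]) (auto simp: sum_nonneg)
    have "\<bar>?f ?m - (\<integral>\<omega>. exp (- k * qq Q0 r d (pad ?m \<omega>)) \<partial>M ?m)\<bar> = \<bar>\<integral>\<omega>. exp (- k * qq (Q ?m) r d (pad ?m \<omega>)) - exp (- k * qq Q0 r d (pad ?m \<omega>)) \<partial>M ?m\<bar>"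
      using i by simp
    also have "\<dots> <= (\<integral>\<omega>. \<bar>exp (- k * qq (Q ?m) r d (pad ?m \<omega>)) - exp (- k * qq Q0 r d (pad ?m \<omega>))\<bar> \<partial>M ?m)"
      by (rule integral_abs_bound)
    also have "\<dots> <= (\<integral>\<omega>. min 1 (\<epsilon> * sq ?m \<omega>) \<partial>M ?m)"
    proof (intro integral_mono i2 integrable_abs Bochner_Integration.integrable_diff i)
      fix \<omega>
      have "K n * sq ?m \<omega> <= \<epsilon> * sq ?m \<omega>" using elim by (intro mult_right_mono) (auto simp: sum_nonneg)
      then show "\<bar>exp (- k * qq (Q ?m) r d (pad ?m \<omega>)) - exp (- k * qq Q0 r d (pad ?m \<omega>))\<bar> <= min 1 (\<epsilon> * sq ?m \<omega>)"
        using close[of n ?m \<omega>] by linarith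
    qed
    finally show ?case using elim unfolding dist_real_def by linarith
  qed
  then obtain n where "dist (?f (\<tau> n)) ?l < e" by (auto simp: eventually_sequentially)
  then show False using \<rho>(2)[of "\<sigma> n"] unfolding \<tau>_def by contradiction
qed

text \<open>Laplace transforms at natural numbers suffice: in the variable exp(-x) in [0, 1] they
  are the moments, and polynomials approximate continuous functions uniformly there. X enters only
  through its closeness to q on events of large probability.\<close>

lemma weak_conv_near:
  fixes X q :: "nat => 'w => real" and L :: "'c measure" and f :: "'c => real"
  assumes X [measurable]: "\<And>n. X n \<in> borel_measurable (M n)" and q [measurable]: "\<And>n. q n \<in> borel_measurable (M n)"
    and q0: "\<And>n \<omega>. 0 <= q n \<omega>"
    and L: "prob_space L" and f [measurable]: "f \<in> borel_measurable L" and f0: "\<And>x. 0 <= f x"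
    and lap: "\<And>k. (\<lambda>n. \<integral>\<omega>. exp (- real k * q n \<omega>) \<partial>M n) \<longlonglongrightarrow> (\<integral>x. exp (- real k * f x) \<partial>L)"
    and near: "\<And>\<epsilon> \<eta>. 0 < \<epsilon> ==> 0 < \<eta> ==> \<forall>\<^sub>F n in sequentially. \<exists>A\<in>sets (M n). 1 - \<eta> <= measure (M n) A \<and>
         (\<forall>\<omega>\<in>A. \<bar>X n \<omega> - q n \<omega>\<bar> <= \<epsilon> * sq n \<omega>)"
  shows "weak_conv_m (\<lambda>n. distr (M n) borel (X n)) (distr L borel f)"
proof (rule integral_cts_step_conv_imp_weak_conv)
  show "real_distribution (distr (M n) borel (X n))" for n
    by (rule prob_space.real_distribution_distr[OF M X])
  show "real_distribution (distr L borel f)"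
    by (rule prob_space.real_distribution_distr[OF L f])
  fix a b :: real assume ab: "a < b"
  have cm [measurable]: "cts_step a b \<in> borel_measurable borel"
    by (intro borel_measurable_continuous_onI uniformly_continuous_imp_continuous cts_step_uniformly_continuous ab)
  have cb: "\<bar>cts_step a b x\<bar> <= 1" for x using ab by (simp add: cts_step_def field_simps)
  have cl: "\<bar>cts_step a b x - cts_step a b z\<bar> <= min 1 (\<bar>x - z\<bar> / (b - a))" for x z
  proof -
    have *: "cts_step a b x = max 0 (min 1 ((b - x) / (b - a)))" for x using ab by (auto simp: cts_step_def field_simps)
    have "\<bar>max 0 (min 1 u) - max 0 (min 1 v)\<bar> <= min 1 \<bar>u - v\<bar>" for u v :: real by (auto simp: max_def min_def)
    from this[of "(b - x) / (b - a)" "(b - z) / (b - a)"]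
    have "\<bar>cts_step a b x - cts_step a b z\<bar> <= min 1 \<bar>(b - x) / (b - a) - (b - z) / (b - a)\<bar>" unfolding * .
    moreover have "\<bar>(b - x) / (b - a) - (b - z) / (b - a)\<bar> = \<bar>x - z\<bar> / (b - a)"
      using ab by (simp add: diff_divide_distrib[symmetric] abs_divide abs_minus_commute)
    ultimately show ?thesis by simp
  qed
  \<comment> \<open>The test function after the substitution t = exp(-x). It vanishes for x \<ge> b,
    so cutting t off at exp(-b) avoids the logarithm of 0 and leaves h continuous on [0, 1].\<close>
  define h where "h t = cts_step a b (- ln (max t (exp (- b))))" for t :: real
  have hexp: "h (exp (- x)) = cts_step a b x" for x
  proof (cases "x <= b")
    case True
    then show ?thesis by (simp add: h_def)
  next
    case False
    then show ?thesis using ab by (simp add: h_def cts_step_def)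
  qed
  have hc: "continuous_on {0..1} h"
  proof -
    have "max t (exp (- b)) \<noteq> 0" for t :: real by (metis exp_gt_zero less_irrefl less_max_iff_disj)
    then have "continuous_on {0..1} (\<lambda>t. - ln (max t (exp (- b))))" by (intro continuous_intros) auto
    then show ?thesis
      unfolding h_def by (rule continuous_on_compose2[OF uniformly_continuous_imp_continuous[OF cts_step_uniformly_continuous[OF ab]]]) auto
  qed
  have base: "(\<lambda>n. \<integral>\<omega>. cts_step a b (q n \<omega>) \<partial>M n) \<longlonglongrightarrow> (\<integral>x. cts_step a b (f x) \<partial>L)"
  proof (rule tendstoI)
    fix e :: real assume e: "0 < e"
    obtain p where p: "real_polynomial_function p" "\<And>t. t \<in> {0..1} ==> \<bar>h t - p t\<bar> < e / 3"
      using Stone_Weierstrass_real_polynomial_function[OF compact_Icc hc, of "e / 3"] e by auto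
    then obtain c m where pe: "p = (\<lambda>t. \<Sum>i\<le>m. c i * t ^ i)" unfolding real_polynomial_function_iff_sum by auto
    have pow: "exp (- x) ^ i = exp (- real i * x)" for x :: real and i by (simp add: exp_of_nat_mult[symmetric])
    have ib: "integrable N (\<lambda>\<omega>. exp (- real i * Y \<omega>))" if "prob_space N" "Y \<in> borel_measurable N" "\<And>\<omega>. 0 <= Y \<omega>"
      for N :: "'x measure" and Y i
      using that by (intro finite_measure.integrable_const_bound[where B = 1]) (auto simp: prob_space_def)
    have pint: "\<bar>(\<integral>\<omega>. cts_step a b (Y \<omega>) \<partial>N) - (\<Sum>i\<le>m. c i * (\<integral>\<omega>. exp (- real i * Y \<omega>) \<partial>N))\<bar> <= e / 3"
      if N: "prob_space N" and Y: "Y \<in> borel_measurable N" "\<And>\<omega>. 0 <= Y \<omega>" for N :: "'x measure" and Y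
    proof -
      interpret N: prob_space N by fact
      have [measurable]: "Y \<in> borel_measurable N" by fact
      have i1: "integrable N (\<lambda>\<omega>. cts_step a b (Y \<omega>))" by (rule N.integrable_const_bound[where B = 1]) (use cb in auto)
      have i2: "integrable N (\<lambda>\<omega>. \<Sum>i\<le>m. c i * exp (- real i * Y \<omega>))" using ib[OF N Y] by auto
      have "(\<Sum>i\<le>m. c i * (\<integral>\<omega>. exp (- real i * Y \<omega>) \<partial>N)) = (\<integral>\<omega>. (\<Sum>i\<le>m. c i * exp (- real i * Y \<omega>)) \<partial>N)"
        using ib[OF N Y] by (subst Bochner_Integration.integral_sum) auto
      then have "\<bar>(\<integral>\<omega>. cts_step a b (Y \<omega>) \<partial>N) - (\<Sum>i\<le>m. c i * (\<integral>\<omega>. exp (- real i * Y \<omega>) \<partial>N))\<bar>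
          = \<bar>\<integral>\<omega>. cts_step a b (Y \<omega>) - (\<Sum>i\<le>m. c i * exp (- real i * Y \<omega>)) \<partial>N\<bar>"
        using i1 i2 by simp
      also have "\<dots> <= (\<integral>\<omega>. \<bar>cts_step a b (Y \<omega>) - (\<Sum>i\<le>m. c i * exp (- real i * Y \<omega>))\<bar> \<partial>N)"
        by (rule integral_abs_bound)
      also have "\<dots> <= (\<integral>\<omega>. e / 3 \<partial>N)"
      proof (intro integral_mono integrable_abs Bochner_Integration.integrable_diff i1 i2)
        fix \<omega>
        show "\<bar>cts_step a b (Y \<omega>) - (\<Sum>i\<le>m. c i * exp (- real i * Y \<omega>))\<bar> <= e / 3"
          using p(2)[of "exp (- Y \<omega>)"] Y(2)[of \<omega>] unfolding hexp pe pow by simp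
      qed auto
      finally show ?thesis by (simp add: N.prob_space)
    qed
    have "(\<lambda>n. \<Sum>i\<le>m. c i * (\<integral>\<omega>. exp (- real i * q n \<omega>) \<partial>M n)) \<longlonglongrightarrow> (\<Sum>i\<le>m. c i * (\<integral>x. exp (- real i * f x) \<partial>L))"
      by (intro tendsto_intros lap)
    from tendstoD[OF this, of "e / 3"] e
    have "\<forall>\<^sub>F n in sequentially. \<bar>(\<Sum>i\<le>m. c i * (\<integral>\<omega>. exp (- real i * q n \<omega>) \<partial>M n)) - (\<Sum>i\<le>m. c i * (\<integral>x. exp (- real i * f x) \<partial>L))\<bar> < e / 3"
      by (simp add: dist_real_def)
    then show "\<forall>\<^sub>F n in sequentially. dist (\<integral>\<omega>. cts_step a b (q n \<omega>) \<partial>M n) (\<integral>x. cts_step a b (f x) \<partial>L) < e"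
    proof eventually_elim
      case (elim n)
      then show ?case using pint[OF M q q0, of n] pint[OF L f f0] unfolding dist_real_def by argo
    qed
  qed
  have "(\<lambda>n. \<integral>\<omega>. cts_step a b (X n \<omega>) \<partial>M n) \<longlonglongrightarrow> (\<integral>x. cts_step a b (f x) \<partial>L)"
  proof (rule tendstoI)
    fix e :: real assume e: "0 < e"
    obtain \<epsilon> where \<epsilon>: "0 < \<epsilon>" "\<forall>\<^sub>F n in sequentially. (\<integral>\<omega>. min 1 (\<epsilon> * sq n \<omega>) \<partial>M n) < e / 3"
      using small_sq[of "e / 3"] e by auto
    \<comment> \<open>The step function has slope 1 / (b - a) in absolute value, hence this accuracy
      for X against q.\<close>
    have "0 < \<epsilon> * (b - a)" "0 < e / 3" using \<epsilon>(1) ab e by auto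
    note nr = near[OF this]
    have bs: "\<forall>\<^sub>F n in sequentially. dist (\<integral>\<omega>. cts_step a b (q n \<omega>) \<partial>M n) (\<integral>x. cts_step a b (f x) \<partial>L) < e / 3"
      by (rule tendstoD[OF base]) (use e in simp)
    show "\<forall>\<^sub>F n in sequentially. dist (\<integral>\<omega>. cts_step a b (X n \<omega>) \<partial>M n) (\<integral>x. cts_step a b (f x) \<partial>L) < e"
      using \<epsilon>(2) nr bs
    proof eventually_elim
      case (elim n)
      interpret N: prob_space "M n" by (rule M)
      obtain A where A: "A \<in> sets (M n)" "1 - e / 3 <= measure (M n) A" "\<And>\<omega>. \<omega> \<in> A ==> \<bar>X n \<omega> - q n \<omega>\<bar> <= \<epsilon> * (b - a) * sq n \<omega>"
        using elim(2) by blast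
      have ix: "integrable (M n) (\<lambda>\<omega>. cts_step a b (Y \<omega>))" if "Y \<in> borel_measurable (M n)" for Y
        by (rule N.integrable_const_bound[where B = 1]) (use cb that in auto)
      have im: "integrable (M n) (\<lambda>\<omega>. min 1 (\<epsilon> * sq n \<omega>))"
        using \<epsilon>(1) by (intro N.integrable_const_bound[where B = 1]) (auto simp: sum_nonneg)
      have iA: "integrable (M n) (indicator A :: _ => real)"
        by (rule N.integrable_const_bound[where B = 1]) (use A(1) in \<open>auto simp: indicator_def\<close>)
      have ii: "integrable (M n) (\<lambda>\<omega>. 1 - indicator A \<omega> :: real)"
        by (rule N.integrable_const_bound[where B = 1]) (use A(1) in \<open>auto simp: indicator_def\<close>)
      have "\<bar>(\<integral>\<omega>. cts_step a b (X n \<omega>) \<partial>M n) - (\<integral>\<omega>. cts_step a b (q n \<omega>) \<partial>M n)\<bar> = \<bar>\<integral>\<omega>. cts_step a b (X n \<omega>) - cts_step a b (q n \<omega>) \<partial>M n\<bar>"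
        using ix[OF X] ix[OF q] by simp
      also have "\<dots> <= (\<integral>\<omega>. \<bar>cts_step a b (X n \<omega>) - cts_step a b (q n \<omega>)\<bar> \<partial>M n)" by (rule integral_abs_bound)
      also have "\<dots> <= (\<integral>\<omega>. min 1 (\<epsilon> * sq n \<omega>) + (1 - indicator A \<omega>) \<partial>M n)"
      proof (rule integral_mono)
        show "integrable (M n) (\<lambda>\<omega>. \<bar>cts_step a b (X n \<omega>) - cts_step a b (q n \<omega>)\<bar>)"
          by (intro integrable_abs Bochner_Integration.integrable_diff ix X q)
        show "integrable (M n) (\<lambda>\<omega>. min 1 (\<epsilon> * sq n \<omega>) + (1 - indicator A \<omega>))"
          by (rule Bochner_Integration.integrable_add[OF im ii])
        fix \<omega>
        have s0: "0 <= min 1 (\<epsilon> * sq n \<omega>)" using \<epsilon>(1) by (auto simp: sum_nonneg)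
        show "\<bar>cts_step a b (X n \<omega>) - cts_step a b (q n \<omega>)\<bar> <= min 1 (\<epsilon> * sq n \<omega>) + (1 - indicator A \<omega>)"
        proof (cases "\<omega> \<in> A")
          case True
          then have "\<bar>X n \<omega> - q n \<omega>\<bar> / (b - a) <= \<epsilon> * sq n \<omega>" using A(3)[OF True] ab by (simp add: field_simps)
          then show ?thesis using cl[of "X n \<omega>" "q n \<omega>"] True by simp
        next
          case False
          then have "indicator A \<omega> = (0 :: real)" by simp
          moreover have "\<bar>cts_step a b (X n \<omega>) - cts_step a b (q n \<omega>)\<bar> <= 1" using cl[of "X n \<omega>" "q n \<omega>"] by simp
          ultimately show ?thesis using s0 by linarith
        qed
      qed
      also have "\<dots> = (\<integral>\<omega>. min 1 (\<epsilon> * sq n \<omega>) \<partial>M n) + (1 - measure (M n) A)"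
        using im ii iA A(1) by (simp add: N.prob_space)
      finally show ?case using elim(1,3) A(2) unfolding dist_real_def by argo
    qed
  qed
  then show "(\<lambda>n. integral\<^sup>L (distr (M n) borel (X n)) (cts_step a b)) \<longlonglongrightarrow> integral\<^sup>L (distr L borel f) (cts_step a b)"
    by (simp add: integral_distr)
qed

end

subsection \<open>The information matrices along the sequence of models\<close>

lemma small_factor:
  fixes c e :: real
  assumes "0 <= c" "0 < e"
  obtains t where "0 < t" "t <= 1" "c * t <= e"
proof (rule that[of "min 1 (e / (c + 1))"])
  have "c * min 1 (e / (c + 1)) <= c * (e / (c + 1))" using assms by (intro mult_left_mono) auto
  also have "\<dots> <= e" using assms by (simp add: field_simps)
  finally show "c * min 1 (e / (c + 1)) <= e" .
qed (use assms in auto)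

lemma ev_at_right_mult_le:
  fixes c e :: real
  assumes "0 < e"
  shows "\<forall>\<^sub>F \<delta> in at_right 0. c * \<delta> <= e"
proof -
  have "((\<lambda>\<delta>. c * \<delta>) \<longlongrightarrow> c * 0) (at_right 0)" by (intro tendsto_intros)
  then have "\<forall>\<^sub>F \<delta> in at_right 0. c * \<delta> < e" using assms by (intro order_tendstoD(2)) auto
  then show ?thesis by (rule eventually_mono) simp
qed

text \<open>Eight errors of at most e S each, with S for the scale g_j g_k: two from the truncated
  law of large numbers, four that are multiples of A, one multiple of \<open>Dd\<close> and
  \<open>gd\<close>. The numbers 384, 256, 128 and 6 collect the multiples of A in the bound of
  \<open>poquim_error\<close>.\<close>

lemma error_budget:
  fixes S e A a Dd z H2 h c U \<tau> q \<Delta> v w gd :: real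
  assumes "0 < S" "0 < e" "0 <= A" "A <= a * S" "Dd <= z * S" "H2 <= h * S\<^sup>2" "0 <= c" "c / e * h <= e"
    and a: "a * (384 * \<tau> * U) <= e" "a * (256 / \<tau> ^ 3 * q) <= e" "a * (128 / \<tau> ^ 3 * \<Delta>) <= e" "6 * a * v * w <= e"
    and z: "0 <= z" "z * (8 * (U + 1) + 3 * v\<^sup>2) <= e" "0 <= \<Delta>" "\<Delta> <= 1" and gd: "gd <= e * S"
    and nonneg: "0 <= U" "0 <= v" "0 <= w" "0 < \<tau>" "0 <= q"
  shows "(e * S + c * H2 / (e * S) + 2 * A * (128 * \<tau> * U + 128 / \<tau> ^ 3 * q))
      + A * (128 * \<tau> * U + 128 / \<tau> ^ 3 * \<Delta>) + Dd * (8 * (U + \<Delta>)) + 3 * (Dd * v\<^sup>2 + A * (2 * v * w)) + gd <= 8 * e * S"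
proof -
  have "c * H2 / (e * S) <= c * (h * S\<^sup>2) / (e * S)" using assms by (intro divide_right_mono mult_left_mono) auto
  also have "\<dots> = (c / e * h) * S" using assms by (simp add: power2_eq_square)
  also have "\<dots> <= e * S" using assms by (intro mult_right_mono) auto
  finally have 1: "c * H2 / (e * S) <= e * S" .
  let ?t = "384 * \<tau> * U + 256 / \<tau> ^ 3 * q + 128 / \<tau> ^ 3 * \<Delta> + 6 * v * w"
  have "A * ?t <= (a * S) * ?t" using assms by (intro mult_right_mono) auto
  also have "\<dots> = (a * (384 * \<tau> * U) + a * (256 / \<tau> ^ 3 * q) + a * (128 / \<tau> ^ 3 * \<Delta>) + 6 * a * v * w) * S" by (simp add: algebra_simps)
  also have "\<dots> <= (4 * e) * S" using a assms by (intro mult_right_mono) auto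
  finally have 2: "A * ?t <= (4 * e) * S" .
  have "Dd * (8 * (U + \<Delta>) + 3 * v\<^sup>2) <= (z * S) * (8 * (U + \<Delta>) + 3 * v\<^sup>2)" using assms by (intro mult_right_mono) auto
  also have "\<dots> <= (z * S) * (8 * (U + 1) + 3 * v\<^sup>2)" using assms by (intro mult_left_mono) auto
  also have "\<dots> = (z * (8 * (U + 1) + 3 * v\<^sup>2)) * S" by simp
  also have "\<dots> <= e * S" using z assms by (intro mult_right_mono) auto
  finally have 3: "Dd * (8 * (U + \<Delta>) + 3 * v\<^sup>2) <= e * S" .
  have eq: "(e * S + c * H2 / (e * S) + 2 * A * (128 * \<tau> * U + 128 / \<tau> ^ 3 * q))
      + A * (128 * \<tau> * U + 128 / \<tau> ^ 3 * \<Delta>) + Dd * (8 * (U + \<Delta>)) + 3 * (Dd * v\<^sup>2 + A * (2 * v * w)) + gd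
    = e * S + c * H2 / (e * S) + A * ?t + Dd * (8 * (U + \<Delta>) + 3 * v\<^sup>2) + gd" by (simp add: algebra_simps)
  show ?thesis unfolding eq using 1 2 3 gd by linarith
qed

lemma clip_tail_tendsto_0:
  assumes "sets L = sets borel" "integrable L (\<lambda>x :: real. x ^ 4)"
  shows "(\<lambda>m. \<integral>x. (x - clip (real m) x) ^ 4 \<partial>L) \<longlonglongrightarrow> 0"
proof -
  have [measurable]: "clip B \<in> borel_measurable L" "(\<lambda>x. x) \<in> borel_measurable L" for B
    using clip_measurable measurable_ident by (simp_all add: measurable_cong_sets[OF assms(1) refl])
  have "(\<lambda>m. \<integral>x. (x - clip (real m) x) ^ 4 \<partial>L) \<longlonglongrightarrow> (\<integral>x. 0 \<partial>L)"
  proof (rule integral_dominated_convergence[where w = "\<lambda>x. x ^ 4"])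
    show "AE x in L. (\<lambda>m. (x - clip (real m) x) ^ 4) \<longlonglongrightarrow> 0"
    proof (rule AE_I2)
      fix x
      have "\<forall>\<^sub>F m in sequentially. \<bar>x\<bar> <= real m" by real_asymp
      then have "\<forall>\<^sub>F m in sequentially. (x - clip (real m) x) ^ 4 = 0" by eventually_elim (auto simp: clip_def)
      then show "(\<lambda>m. (x - clip (real m) x) ^ 4) \<longlonglongrightarrow> 0" by (rule tendsto_eventually)
    qed
    have "\<bar>x - clip (real m) x\<bar> <= \<bar>x\<bar>" for x m by (auto simp: clip_def)
    then have "\<bar>x - clip (real m) x\<bar> ^ 4 <= \<bar>x\<bar> ^ 4" for x m by (intro power_mono) auto
    then show "AE x in L. norm ((x - clip (real m) x) ^ 4) <= x ^ 4" for m
      by (intro AE_I2) (simp add: power_even_abs)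
  qed (use assms in auto)
  then show ?thesis by simp
qed

context lmm_model
begin

lemma design_row_bounds:
  assumes C: "\<And>t i. t \<in> {1..s} ==> i < N ==> (\<Sum>q<neff D t. \<bar>Zmat D t $$ (i, q)\<bar>) <= C" and C1: "1 <= C"
  shows "i < N ==> (\<Sum>e\<in>idx. \<bar>zi i e\<bar>) <= real (s + 1) * C"
    and "t <= s ==> a < N ==> b < N ==> \<bar>ent (Wf t) a b\<bar> <= C\<^sup>2"
proof -
  \<comment> \<open>Condition (ii) begins at t = 1. For t = 0 a row of the identity has sum 1, which
    is where \<open>1 <= C\<close> is used.\<close>
  have r: "(\<Sum>q<neff D t. \<bar>Zmat D t $$ (i, q)\<bar>) <= C" if "t <= s" "i < N" for t i
  proof (cases "t = 0")
    case True
    have "(\<Sum>q<neff D t. \<bar>Zmat D t $$ (i, q)\<bar>) = (\<Sum>q<N. if q = i then 1 else 0)"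
      using True that(2) by (intro sum.cong) (auto simp: Zmat_def neff_def)
    then show ?thesis using C1 that(2) by simp
  qed (use C that in auto)
  show "(\<Sum>e\<in>idx. \<bar>zi i e\<bar>) <= real (s + 1) * C" if i: "i < N"
  proof -
    have "(\<Sum>e\<in>idx. \<bar>zi i e\<bar>) = (\<Sum>e\<in>idx. \<bar>Zmat D (fst e) $$ (i, snd e)\<bar>)"
      using i by (intro sum.cong) (auto simp: zi_eq)
    also have "\<dots> = (\<Sum>t\<le>s. \<Sum>q<neff D t. \<bar>Zmat D t $$ (i, q)\<bar>)"
      by (subst sum.Sigma) (auto simp: case_prod_beta)
    also have "\<dots> <= (\<Sum>t\<le>s. C)" using r i by (intro sum_mono) auto
    finally show ?thesis by simp
  qed
  show "\<bar>ent (Wf t) a b\<bar> <= C\<^sup>2" if t: "t <= s" and ab: "a < N" "b < N"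
  proof -
    have e: "ent (Zf t) i q = Zmat D t $$ (i, q)" if "i < N" "q < neff D t" for i q
      using Zmat_carrier[OF t] that by (simp add: Zf_def ent_fm)
    have "ent (Wf t) a b = (\<Sum>q<neff D t. ent (Zf t) a q * ent (Zf t) b q)"
      unfolding Wf_def ent_times_left[OF Z_dims[OF t]] by simp
    also have "\<dots> = (\<Sum>q<neff D t. Zmat D t $$ (a, q) * Zmat D t $$ (b, q))"
      using e ab by (intro sum.cong) auto
    also have "\<bar>\<dots>\<bar> <= (\<Sum>q<neff D t. \<bar>Zmat D t $$ (a, q)\<bar> * \<bar>Zmat D t $$ (b, q)\<bar>)"
      by (rule order_trans[OF sum_abs]) (simp add: abs_mult)
    also have "\<dots> <= (\<Sum>q<neff D t. \<bar>Zmat D t $$ (a, q)\<bar> * C)"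
    proof (intro sum_mono mult_left_mono)
      fix q assume "q \<in> {..<neff D t}"
      then have "\<bar>Zmat D t $$ (b, q)\<bar> <= (\<Sum>q<neff D t. \<bar>Zmat D t $$ (b, q)\<bar>)" by (intro member_le_sum) auto
      then show "\<bar>Zmat D t $$ (b, q)\<bar> <= C" using r[OF t ab(2)] by linarith
    qed auto
    also have "\<dots> = (\<Sum>q<neff D t. \<bar>Zmat D t $$ (a, q)\<bar>) * C" by (simp add: sum_distrib_right)
    also have "\<dots> <= C * C" using r[OF t ab(1)] C1 by (intro mult_right_mono) auto
    finally show ?thesis by (simp add: power2_eq_square)
  qed
qed

text \<open>The variance components are products of two coordinates. The Lipschitz constant involves
  the true parameter only, so that \<delta> can be chosen before n.\<close>

lemma varc_near:
  assumes "\<theta>' \<in> param_nbhd D th \<delta>" "\<delta> <= 1" "0 < \<delta>" "t <= s"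
  shows "\<bar>varc \<theta>' t - varc th t\<bar> <= (2 + (\<Sum>i\<le>s. 2 * th $ i)) * \<delta>"
proof -
  have c: "\<bar>\<theta>' $ i - th $ i\<bar> <= \<delta>" if "i <= s" for i
    by (rule nbhd_coord[OF param_space_carrier[OF th_ps] assms(1) that])
  have p: "0 <= th $ i" if "i <= s" for i
    using th_ps that by (cases "i = 0") (auto simp: param_space_def)
  have m: "th $ i <= (\<Sum>i\<le>s. th $ i)" if "i <= s" for i using that p by (intro member_le_sum) auto
  show ?thesis
  proof (cases "t = 0")
    case True
    have "\<bar>varc \<theta>' t - varc th t\<bar> <= 1 * \<delta>" using c[of 0] True by (simp add: varc_def gam_def)
    also have "\<dots> <= (2 + (\<Sum>i\<le>s. 2 * th $ i)) * \<delta>"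
      using assms(3) p by (intro mult_right_mono) (auto intro!: add_increasing2 sum_nonneg)
    finally show ?thesis .
  next
    case False
    have "varc \<theta>' t - varc th t = (\<theta>' $ 0 - th $ 0) * \<theta>' $ t + th $ 0 * (\<theta>' $ t - th $ t)"
      using False by (simp add: varc_def gam_def algebra_simps)
    then have "\<bar>varc \<theta>' t - varc th t\<bar> <= \<bar>\<theta>' $ 0 - th $ 0\<bar> * \<bar>\<theta>' $ t\<bar> + \<bar>th $ 0\<bar> * \<bar>\<theta>' $ t - th $ t\<bar>"
      by (metis abs_mult abs_triangle_ineq)
    also have "\<dots> <= \<delta> * (th $ t + 1) + th $ 0 * \<delta>"
      using c[of 0] c[OF assms(4)] p[OF assms(4)] p[of 0] assms(2,3) by (intro add_mono mult_mono) auto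
    also have "\<dots> = (th $ t + 1 + th $ 0) * \<delta>" by (simp add: algebra_simps)
    also have "\<dots> <= (2 + (\<Sum>i\<le>s. 2 * th $ i)) * \<delta>"
      using m[OF assms(4)] m[of 0] assms(3) by (intro mult_right_mono) (auto simp: sum_distrib_left[symmetric])
    finally show ?thesis .
  qed
qed

lemma ent_V_near:
  assumes c: "\<And>t. t <= s ==> \<bar>varc \<theta>' t - varc th t\<bar> <= \<eta>" "\<And>t. t <= s ==> \<bar>varc th t\<bar> <= m"
    and W: "\<And>t. t <= s ==> \<bar>ent (Wf t) a b\<bar> <= W" "0 <= W"
  shows "\<bar>ent (Vf \<theta>') a b - ent (Vf th) a b\<bar> <= real (s + 1) * (\<eta> * W)"
    and "\<bar>ent (Vf \<theta>') a b\<bar> <= real (s + 1) * ((m + \<eta>) * W)"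
proof -
  have e: "ent (Vf x) a b = (\<Sum>t\<le>s. varc x t * ent (Wf t) a b)" for x
    by (simp add: Vf_def)
  have "\<bar>ent (Vf \<theta>') a b - ent (Vf th) a b\<bar> <= (\<Sum>t\<le>s. \<bar>varc \<theta>' t - varc th t\<bar> * \<bar>ent (Wf t) a b\<bar>)"
    unfolding e sum_subtractf[symmetric] left_diff_distrib[symmetric] abs_mult[symmetric] by (rule sum_abs)
  also have "\<dots> <= (\<Sum>t\<le>s. \<eta> * W)" using c W
  proof (intro sum_mono mult_mono)
    fix t assume "t \<in> {..s}"
    then show "0 <= \<eta>" using c(1)[of t] by simp
  qed auto
  finally show "\<bar>ent (Vf \<theta>') a b - ent (Vf th) a b\<bar> <= real (s + 1) * (\<eta> * W)" by simp
  have "\<bar>ent (Vf \<theta>') a b\<bar> <= (\<Sum>t\<le>s. \<bar>varc \<theta>' t\<bar> * \<bar>ent (Wf t) a b\<bar>)"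
    unfolding e abs_mult[symmetric] by (rule sum_abs)
  also have "\<dots> <= (\<Sum>t\<le>s. (m + \<eta>) * W)"
  proof (intro sum_mono mult_mono)
    fix t assume "t \<in> {..s}"
    then have "t <= s" by simp
    from c(1)[OF this] c(2)[OF this] show "\<bar>varc \<theta>' t\<bar> <= m + \<eta>" "0 <= m + \<eta>" by linarith+
  qed (use W in auto)
  finally show "\<bar>ent (Vf \<theta>') a b\<bar> <= real (s + 1) * ((m + \<eta>) * W)" by simp
qed

end

text \<open>Asks for a measurable event inside the property. The property itself, with an estimate
  inserted into functions of the parameter, would otherwise have to be shown measurable.\<close>

definition whp :: "(nat => 'w measure) => (nat => 'w => bool) => bool" where
  "whp M P \<longleftrightarrow> (\<forall>\<eta>>0. \<forall>\<^sub>F n in sequentially. \<exists>A\<in>sets (M n). 1 - \<eta> <= measure (M n) A \<and> (\<forall>\<omega>\<in>A. P n \<omega>))"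

lemma whp_mono: "whp M P ==> (\<And>n \<omega>. \<omega> \<in> space (M n) ==> P n \<omega> ==> Q n \<omega>) ==> whp M Q"
  unfolding whp_def
proof (intro allI impI)
  fix \<eta> :: real
  assume P: "\<forall>\<eta>>0. \<forall>\<^sub>F n in sequentially. \<exists>A\<in>sets (M n). 1 - \<eta> <= measure (M n) A \<and> (\<forall>\<omega>\<in>A. P n \<omega>)"
    and Q: "\<And>n \<omega>. \<omega> \<in> space (M n) ==> P n \<omega> ==> Q n \<omega>" and "0 < \<eta>"
  then have "\<forall>\<^sub>F n in sequentially. \<exists>A\<in>sets (M n). 1 - \<eta> <= measure (M n) A \<and> (\<forall>\<omega>\<in>A. P n \<omega>)" by blast
  then show "\<forall>\<^sub>F n in sequentially. \<exists>A\<in>sets (M n). 1 - \<eta> <= measure (M n) A \<and> (\<forall>\<omega>\<in>A. Q n \<omega>)"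
  proof eventually_elim
    case (elim n)
    then obtain A where A: "A \<in> sets (M n)" "1 - \<eta> <= measure (M n) A" "\<forall>\<omega>\<in>A. P n \<omega>" by blast
    then have "\<forall>\<omega>\<in>A. Q n \<omega>" using Q sets.sets_into_space[OF A(1)] by blast
    then show ?case using A by blast
  qed
qed

lemma whp_conj:
  assumes M: "\<And>n. prob_space (M n)" and P: "whp M P" and Q: "whp M Q"
  shows "whp M (\<lambda>n \<omega>. P n \<omega> \<and> Q n \<omega>)"
  unfolding whp_def
proof (intro allI impI)
  fix \<eta> :: real assume "0 < \<eta>"
  then have "0 < \<eta> / 2" by simp
  with P Q have "\<forall>\<^sub>F n in sequentially. \<exists>A\<in>sets (M n). 1 - \<eta> / 2 <= measure (M n) A \<and> (\<forall>\<omega>\<in>A. P n \<omega>)"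
    "\<forall>\<^sub>F n in sequentially. \<exists>A\<in>sets (M n). 1 - \<eta> / 2 <= measure (M n) A \<and> (\<forall>\<omega>\<in>A. Q n \<omega>)"
    unfolding whp_def by blast+
  then show "\<forall>\<^sub>F n in sequentially. \<exists>A\<in>sets (M n). 1 - \<eta> <= measure (M n) A \<and> (\<forall>\<omega>\<in>A. P n \<omega> \<and> Q n \<omega>)"
  proof eventually_elim
    case (elim n)
    interpret prob_space "M n" by (rule M)
    obtain A B where AB: "A \<in> sets (M n)" "1 - \<eta> / 2 <= prob A" "\<forall>\<omega>\<in>A. P n \<omega>"
      "B \<in> sets (M n)" "1 - \<eta> / 2 <= prob B" "\<forall>\<omega>\<in>B. Q n \<omega>" using elim by blast
    have "prob (A \<union> B) = prob A + prob (B - A)" using AB by (simp add: finite_measure_Union')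
    moreover have "prob (B - A) = prob B - prob (B \<inter> A)" using AB by (simp add: finite_measure_Diff')
    moreover have "prob (A \<union> B) <= 1" by simp
    ultimately have "1 - \<eta> <= prob (A \<inter> B)" using AB(2,5) by (simp add: Int_commute)
    then show ?case using AB by (intro bexI[of _ "A \<inter> B"]) auto
  qed
qed

lemma whp_finite:
  assumes M: "\<And>n. prob_space (M n)" and "finite I" and "\<And>i. i \<in> I ==> whp M (P i)"
  shows "whp M (\<lambda>n \<omega>. \<forall>i\<in>I. P i n \<omega>)"
  using assms(2,3)
proof (induction I rule: finite_induct)
  case empty
  have "1 - \<eta> <= measure (M n) (space (M n))" if "0 < \<eta>" for \<eta> n
    using prob_space.prob_space[OF M, of n] that by simp
  then show ?case unfolding whp_def by (auto intro!: always_eventually bexI[of _ "space (M _)"])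
next
  case (insert i I)
  have "whp M (\<lambda>n \<omega>. P i n \<omega> \<and> (\<forall>i\<in>I. P i n \<omega>))" using insert by (intro whp_conj M) auto
  then show ?case by (rule whp_mono) auto
qed

section \<open>The sequence of models and convergence of the POQUIM\<close>

locale lmm_seq =
  fixes M :: "nat => 'w measure" and D :: "nat => lmm_design" and s :: nat and law :: "nat => real measure"
    and \<sigma>sq :: "nat => real" and \<alpha> :: "nat => nat => nat => 'w => real" and \<beta> :: "nat => real vec"
    and y :: "nat => 'w => real vec" and \<theta> :: "real vec" and g :: "nat => nat => real"
    and T :: "nat => real mat" and c :: "nat => real" and est :: "nat => 'w => real vec"
  assumes design: "\<And>n. valid_design (D n) \<and> nfac (D n) = s"
    and laws: "\<And>t. t <= s ==> effect_law (law t) (\<sigma>sq t)"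
    and effects: "\<And>n. mixed_effects (M n) (D n) law (\<alpha> n)"
    and beta: "\<And>n. \<beta> n \<in> carrier_vec (dim_col (fixX (D n)))"
    and y: "\<And>n. y n = response (D n) (\<beta> n) (\<alpha> n)"
    and theta: "\<theta> = true_param s \<sigma>sq"
    and i: "\<And>t. t <= s ==> 0 < \<sigma>sq t \<and> integrable (law t) (\<lambda>x. x ^ 4) \<and> 0 < variance_of (law t) (\<lambda>x. x\<^sup>2)"
    and ii_X: "\<exists>C. \<forall>n. \<forall>i<nobs (D n). vec_norm2 (row (fixX (D n)) i) <= C"
    and ii_Z: "\<exists>C. \<forall>n. \<forall>t\<in>{1..s}. \<forall>i<nobs (D n). (\<Sum>q<neff (D n) t. \<bar>Zmat (D n) t $$ (i, q)\<bar>) <= C"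
    and g_pos: "\<And>n j. j <= s ==> 0 < g n j"
    and iii_X: "filterlim (\<lambda>n. lambda_min
          (transpose_mat (fixX (D n)) * mat_inv (Vmat (D n) \<theta>) * fixX (D n))) at_top sequentially"
    and iv_bounded: "\<And>j k. j <= s ==> k <= s ==> \<exists>C. \<forall>n.
          (\<Sum>f\<in>fvals (D n). hcount (D n) f * \<bar>ccoef (D n) \<theta> j k f\<bar>) / (g n j * g n k) <= C"
    and iv_small: "\<And>j k. j <= s ==> k <= s ==> (\<lambda>n.
          (\<Sum>f1\<in>fvals (D n). \<Sum>f2\<in>fvals (D n).
             hcount2 (D n) f1 f2 * \<bar>ccoef (D n) \<theta> j k f1 * ccoef (D n) \<theta> j k f2\<bar>)
          / (g n j * g n k)\<^sup>2) \<longlonglongrightarrow> 0"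
    and v_G: "\<And>j k. j <= s ==> k <= s ==> uniform_limit UNIV
          (\<lambda>\<delta> n. gdev (D n) \<theta> j k \<delta> / (g n j * g n k)) (\<lambda>n. 0) (at_right 0)"
    and v_c: "\<And>j k. j <= s ==> k <= s ==> uniform_limit UNIV
          (\<lambda>\<delta> n. (\<Sum>f\<in>fvals (D n). hcount (D n) f * ddev (D n) \<theta> j k f \<delta>) / (g n j * g n k))
          (\<lambda>n. 0) (at_right 0)"
    and T: "\<And>n. contrast_mat (D n) (T n)"
    and est: "\<And>n. random_vec (M n) (s + 1) (est n)" "\<And>n \<omega>. \<omega> \<in> space (M n) ==> est n \<omega> \<in> param_space s"
      "vec_tendsto_in_prob M est \<theta>"
begin

lemma model: "lmm_model (D n) (M n) law \<sigma>sq (\<alpha> n) (\<beta> n) (y n)"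
  using design[of n] effects[of n] beta[of n] y[of n] laws i by unfold_locales auto

lemma M_prob: "prob_space (M n)" using effects[of n] by (simp add: mixed_effects_def)

lemma theta_ps: "\<theta> \<in> param_space s"
  using i by (auto simp: theta true_param_def param_space_def intro!: divide_nonneg_nonneg less_imp_le)

lemma est_carrier: "\<omega> \<in> space (M n) ==> est n \<omega> \<in> carrier_vec (s + 1)"
  using est(1)[of n] by (simp add: random_vec_def)

abbreviation "S n j k \<equiv> g n j * g n k"
abbreviation "I1 n j k \<equiv> info1 (M n) (D n) (T n) (c n) (y n) \<theta> $$ (j, k)"

text \<open>The order of the choices is the point. The constants of (i), (ii) and (iv) come first,
  then \<tau>, then the truncation level B for this \<tau>, then \<delta> from (v); finally n is
  taken large, which by (iv) and (iii) makes the variance and the leverages small. So \<delta> does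
  not depend on n.\<close>

lemma poquim_expect:
  assumes jk: "j <= s" "k <= s" and \<epsilon>: "0 < \<epsilon>"
  obtains \<delta> where "0 < \<delta>" "\<forall>\<^sub>F n in sequentially. \<exists>Err. integrable (M n) Err \<and> (\<forall>\<omega>. 0 <= Err \<omega>) \<and>
      (\<forall>\<omega> \<theta>'. \<theta>' \<in> param_nbhd (D n) \<theta> \<delta> \<longrightarrow> \<bar>poquim (D n) \<theta>' (y n \<omega>) $$ (j, k) - I1 n j k\<bar> <= Err \<omega> \<and>
          \<bar>Gent (D n) \<theta>' j k - Gent (D n) \<theta> j k\<bar> <= \<epsilon> * S n j k) \<and>
      (\<integral>\<omega>. Err \<omega> \<partial>M n) <= \<epsilon> * S n j k"
proof -
  define e where "e = \<epsilon> / 8"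
  have e: "0 < e" using \<epsilon> by (simp add: e_def)
  have Sp: "0 < S n j k" for n using g_pos jk by simp
  obtain a0 where a0: "\<And>n. (\<Sum>f\<in>fvals (D n). hcount (D n) f * \<bar>ccoef (D n) \<theta> j k f\<bar>) / S n j k <= a0"
    using iv_bounded[OF jk] by blast
  define a where "a = max 0 a0"
  have a: "0 <= a" "\<And>n. (\<Sum>f\<in>fvals (D n). hcount (D n) f * \<bar>ccoef (D n) \<theta> j k f\<bar>) <= a * S n j k"
  proof -
    show "0 <= a" by (simp add: a_def)
    fix n
    have "(\<Sum>f\<in>fvals (D n). hcount (D n) f * \<bar>ccoef (D n) \<theta> j k f\<bar>) / S n j k <= a" using a0[of n] by (simp add: a_def)
    then show "(\<Sum>f\<in>fvals (D n). hcount (D n) f * \<bar>ccoef (D n) \<theta> j k f\<bar>) <= a * S n j k"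
      using Sp[of n] by (simp add: pos_divide_le_eq)
  qed
  obtain CX where CX: "\<And>n i. i < nobs (D n) ==> vec_norm2 (row (fixX (D n)) i) <= CX" using ii_X by blast
  obtain C0 where C0: "\<And>n t i. t \<in> {1..s} ==> i < nobs (D n) ==> (\<Sum>q<neff (D n) t. \<bar>Zmat (D n) t $$ (i, q)\<bar>) <= C0"
    using ii_Z by blast
  define CZ where "CZ = max 1 C0"
  have CZ: "1 <= CZ" "\<And>n t i. t \<in> {1..s} ==> i < nobs (D n) ==> (\<Sum>q<neff (D n) t. \<bar>Zmat (D n) t $$ (i, q)\<bar>) <= CZ"
    using C0 by (auto simp: CZ_def le_max_iff_disj)
  define R where "R = real (s + 1) * CZ"
  have R0: "0 <= R" using CZ(1) by (simp add: R_def)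
  define kp where "kp t = (\<integral>x. x ^ 4 \<partial>law t) - 3 * (\<sigma>sq t)\<^sup>2" for t
  define K where "K = (\<Sum>t\<le>s. \<bar>kp t\<bar> / (\<sigma>sq t)\<^sup>2)"
  have K: "0 <= K" "\<And>t. t <= s ==> kp t <= K * (\<sigma>sq t)\<^sup>2"
  proof -
    show "0 <= K" by (auto simp: K_def intro!: sum_nonneg)
    fix t assume t: "t <= s"
    then have "\<bar>kp t\<bar> / (\<sigma>sq t)\<^sup>2 <= K" unfolding K_def by (intro member_le_sum) auto
    then have "\<bar>kp t\<bar> <= K * (\<sigma>sq t)\<^sup>2" using i[OF t] by (simp add: pos_divide_le_eq)
    then show "kp t <= K * (\<sigma>sq t)\<^sup>2" by linarith
  qed
  define C where "C = (\<Sum>t\<le>s. 1 / \<sigma>sq t)"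
  have C: "0 <= C" "\<And>t. t <= s ==> 1 <= C * \<sigma>sq t"
  proof -
    have p: "0 <= 1 / \<sigma>sq t" if "t <= s" for t using i[OF that] by simp
    show "0 <= C" unfolding C_def using p by (intro sum_nonneg) auto
    fix t assume t: "t <= s"
    then have "1 / \<sigma>sq t <= C" unfolding C_def using p by (intro member_le_sum) auto
    then show "1 <= C * \<sigma>sq t" using i[OF t] by (simp add: pos_divide_le_eq)
  qed
  define m4 where "m4 = (\<Sum>t\<le>s. \<integral>x. x ^ 4 \<partial>law t)"
  have i4: "0 <= (\<integral>x. x ^ 4 \<partial>law t)" for t by (rule Bochner_Integration.integral_nonneg) simp
  have m4: "0 <= m4" "\<And>t. t <= s ==> (\<integral>x. x ^ 4 \<partial>law t) <= m4"
    using i4 by (auto simp: m4_def intro!: sum_nonneg member_le_sum)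
  define U where "U = R ^ 4 * m4"
  have U0: "0 <= U" using m4(1) R0 by (simp add: U_def)
  obtain \<tau> where \<tau>: "0 < \<tau>" "\<tau> <= 1" "a * (384 * U) * \<tau> <= e"
    using small_factor[of "a * (384 * U)" e] a(1) U0 e by auto
  \<comment> \<open>The truncation level comes after \<tau>, because the tail is multiplied by
    \<tau>^{-3}.\<close>
  define tb where "tb m = (\<Sum>t\<le>s. \<integral>x. (x - clip (real m) x) ^ 4 \<partial>law t)" for m
  have "tb \<longlonglongrightarrow> (\<Sum>t\<le>s. 0)"
    unfolding tb_def
  proof (intro tendsto_sum clip_tail_tendsto_0)
    fix t assume "t \<in> {..s}"
    then show "sets (law t) = sets borel" "integrable (law t) (\<lambda>x. x ^ 4)" using laws[of t] i[of t] by (auto simp: effect_law_def)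
  qed
  then have "(\<lambda>m. a * (256 / \<tau> ^ 3 * (R ^ 4 * tb m))) \<longlonglongrightarrow> a * (256 / \<tau> ^ 3 * (R ^ 4 * 0))" by (intro tendsto_intros) simp
  then have "\<forall>\<^sub>F m in sequentially. a * (256 / \<tau> ^ 3 * (R ^ 4 * tb m)) < e" using e by (intro order_tendstoD(2)) auto
  then obtain B where B: "a * (256 / \<tau> ^ 3 * (R ^ 4 * tb B)) < e" by (auto simp: eventually_sequentially)
  have j4: "0 <= (\<integral>x. (x - clip (real B) x) ^ 4 \<partial>law t)" for t by (rule Bochner_Integration.integral_nonneg) simp
  have tb0: "0 <= tb B" "\<And>t. t <= s ==> (\<integral>x. (x - clip (real B) x) ^ 4 \<partial>law t) <= tb B"
    using j4 by (auto simp: tb_def intro!: sum_nonneg member_le_sum)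
  define b where "b = 2 + (\<Sum>i\<le>s. 2 * \<theta> $ i)"
  have th0: "0 <= \<theta> $ i" if "i <= s" for i using theta_ps that by (cases "i = 0") (auto simp: param_space_def)
  have b0: "0 <= b" unfolding b_def using th0 by (auto intro!: add_nonneg_nonneg sum_nonneg)
  define ms where "ms = (\<Sum>t\<le>s. \<sigma>sq t)"
  have \<sigma>0: "0 <= \<sigma>sq t" if "t <= s" for t using i[OF that] by simp
  have ms: "0 <= ms" "\<And>t. t <= s ==> \<sigma>sq t <= ms"
    using \<sigma>0 by (auto simp: ms_def intro!: sum_nonneg member_le_sum)
  define v where "v = real (s + 1) * ((ms + b) * CZ\<^sup>2)"
  have v0: "0 <= v" using ms(1) b0 by (simp add: v_def)
  obtain \<zeta> where \<zeta>: "0 < \<zeta>" "(8 * (U + 1) + 3 * v\<^sup>2) * \<zeta> <= e"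
    using small_factor[of "8 * (U + 1) + 3 * v\<^sup>2" e] U0 e by auto
  have d0: "dist x 0 < z ==> x < z" for x z :: real by (simp add: dist_real_def)
  have ev1: "\<forall>\<^sub>F \<delta> in at_right 0. \<forall>n. (\<Sum>f\<in>fvals (D n). hcount (D n) f * ddev (D n) \<theta> j k f \<delta>) / S n j k < \<zeta>"
    using uniform_limitD[OF v_c[OF jk] \<zeta>(1)] by (rule eventually_mono) (blast intro: d0)
  have ev2: "\<forall>\<^sub>F \<delta> in at_right 0. \<forall>n. gdev (D n) \<theta> j k \<delta> / S n j k < e"
    using uniform_limitD[OF v_G[OF jk] e] by (rule eventually_mono) (blast intro: d0)
  have "\<forall>\<^sub>F \<delta> in at_right 0. 0 < \<delta> \<and> 1 * \<delta> <= 1 \<and> 1 * \<delta> <= \<theta> $ 0 / 2 \<and> (4 * b * (real (s + 1) * C)) * \<delta> <= 1 \<and>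
      (6 * a * v * (real (s + 1) * (b * CZ\<^sup>2))) * \<delta> <= e \<and>
      (\<forall>n. (\<Sum>f\<in>fvals (D n). hcount (D n) f * ddev (D n) \<theta> j k f \<delta>) / S n j k < \<zeta>) \<and>
      (\<forall>n. gdev (D n) \<theta> j k \<delta> / S n j k < e)"
    by (intro eventually_conj ev_at_right_mult_le ev1 ev2 e)
       (use theta_ps in \<open>auto simp: eventually_at_right_less param_space_def\<close>)
  note hap = eventually_happens'[OF trivial_limit_at_right_real this]
  obtain \<delta> where \<delta>: "0 < \<delta>" "\<delta> <= 1" "\<delta> <= \<theta> $ 0 / 2" "(4 * b * (real (s + 1) * C)) * \<delta> <= 1"
      "(6 * a * v * (real (s + 1) * (b * CZ\<^sup>2))) * \<delta> <= e"
      "\<And>n. (\<Sum>f\<in>fvals (D n). hcount (D n) f * ddev (D n) \<theta> j k f \<delta>) / S n j k < \<zeta>"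
      "\<And>n. gdev (D n) \<theta> j k \<delta> / S n j k < e"
    using hap by (elim exE conjE, intro that) auto
  \<comment> \<open>The accuracy demanded of the vanishing sum in (iv). Its factor grows with B,
    which is fixed by now.\<close>
  obtain h where h: "0 < h" "4 * (R * real B) ^ 8 / e * h <= e"
    using small_factor[of "4 * (R * real B) ^ 8 / e" e] R0 e by auto
  define cl where "cl = 16 * ((K + 3) * (CX\<^sup>2)\<^sup>2)"
  have cl0: "0 <= cl" using K(1) by (simp add: cl_def)
  define d1 where "d1 = a * (128 / \<tau> ^ 3)"
  have d10: "0 <= d1" using a(1) \<tau>(1) by (simp add: d1_def)
  \<comment> \<open>\<open>q\<close> is the reciprocal of the level demanded of the smallest
    eigenvalue. The single inequality yields both \<Delta> \<le> 1 and d1 \<Delta> \<le> e.\<close>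
  obtain q where q: "0 < q" "q <= 1" "(cl * (1 + d1)) * q <= min 1 e"
    using small_factor[of "cl * (1 + d1)" "min 1 e"] cl0 d10 e by auto
  define l where "l = 1 / q"
  define \<Delta> where "\<Delta> = 16 * ((K + 3) * (CX\<^sup>2 / l)\<^sup>2)"
  have "\<Delta> = cl * (q * q)" by (simp add: \<Delta>_def cl_def l_def power_mult_distrib power2_eq_square)
  also have "\<dots> <= cl * (1 * q)" using cl0 q by (intro mult_left_mono mult_right_mono) auto
  finally have \<Delta>q: "\<Delta> <= cl * q" by simp
  have \<Delta>0: "0 <= \<Delta>" using K(1) by (simp add: \<Delta>_def)
  have "cl * q + d1 * (cl * q) <= min 1 e" using q(3) by (simp add: algebra_simps)
  moreover have "d1 * \<Delta> <= d1 * (cl * q)" "0 <= d1 * (cl * q)" "0 <= cl * q"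
    using \<Delta>q d10 cl0 q(1) by (auto intro!: mult_left_mono)
  ultimately have \<Delta>: "\<Delta> <= 1" "d1 * \<Delta> <= e" using \<Delta>q by auto
  have evl: "\<forall>\<^sub>F n in sequentially. l <= lambda_min (transpose_mat (fixX (D n)) * mat_inv (Vmat (D n) \<theta>) * fixX (D n))"
    using iii_X by (simp add: filterlim_at_top)
  have evh: "\<forall>\<^sub>F n in sequentially. (\<Sum>f1\<in>fvals (D n). \<Sum>f2\<in>fvals (D n).
      hcount2 (D n) f1 f2 * \<bar>ccoef (D n) \<theta> j k f1 * ccoef (D n) \<theta> j k f2\<bar>) / (S n j k)\<^sup>2 < h"
    using iv_small[OF jk] h(1) by (rule order_tendstoD(2))
  show ?thesis
  proof (rule that[OF \<delta>(1)])
    show "\<forall>\<^sub>F n in sequentially. \<exists>Err. integrable (M n) Err \<and> (\<forall>\<omega>. 0 <= Err \<omega>) \<and>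
      (\<forall>\<omega> \<theta>'. \<theta>' \<in> param_nbhd (D n) \<theta> \<delta> \<longrightarrow> \<bar>poquim (D n) \<theta>' (y n \<omega>) $$ (j, k) - I1 n j k\<bar> <= Err \<omega> \<and>
          \<bar>Gent (D n) \<theta>' j k - Gent (D n) \<theta> j k\<bar> <= \<epsilon> * S n j k) \<and>
      (\<integral>\<omega>. Err \<omega> \<partial>M n) <= \<epsilon> * S n j k"
      using evl evh
    proof eventually_elim
      case (elim n)
      interpret m: lmm_model "D n" "M n" law \<sigma>sq "\<alpha> n" "\<beta> n" "y n" by (rule model)
      have ns: "nfac (D n) = s" using design by simp
      have th: "true_param (nfac (D n)) \<sigma>sq = \<theta>" by (simp add: ns theta)
      define \<eta> where "\<eta> = b * \<delta>"
      have \<eta>0: "0 <= \<eta>" "\<eta> <= b" using b0 \<delta>(1,2) by (auto simp: \<eta>_def mult_left_le)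
      define w where "w = real (s + 1) * (\<eta> * CZ\<^sup>2)"
      have w0: "0 <= w" using \<eta>0(1) by (simp add: w_def)
      have vn: "\<bar>m.varc \<theta>' t - m.varc \<theta> t\<bar> <= \<eta>" if "\<theta>' \<in> param_nbhd (D n) \<theta> \<delta>" "t <= s" for \<theta>' t
        using m.varc_near[of \<theta>' \<delta> t] that \<delta>(1,2) unfolding ns theta[symmetric] \<eta>_def b_def by simp
      have vt: "\<bar>m.varc \<theta> t\<bar> <= ms" if "t <= s" for t
        using m.varc_th[of t] that ms(2)[OF that] \<sigma>0[OF that] unfolding ns theta[symmetric] by simp
      have Wb: "\<bar>ent (m.Wf t) x z\<bar> <= CZ\<^sup>2" if "t <= s" "x < nobs (D n)" "z < nobs (D n)" for t x z
        using m.design_row_bounds(2)[of CZ t x z] CZ that unfolding ns by blast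
      have wn: "\<bar>ent (m.Vf \<theta>') x z - ent (m.Vf \<theta>) x z\<bar> <= w" "\<bar>ent (m.Vf \<theta>') x z\<bar> <= v"
        if \<theta>': "\<theta>' \<in> param_nbhd (D n) \<theta> \<delta>" and "x < nobs (D n)" "z < nobs (D n)" for \<theta>' x z
      proof -
        note V = m.ent_V_near[of \<theta>' \<eta> ms x z "CZ\<^sup>2", unfolded ns theta[symmetric], OF vn[OF \<theta>'] vt Wb[OF _ that(2,3)]]
        show "\<bar>ent (m.Vf \<theta>') x z - ent (m.Vf \<theta>) x z\<bar> <= w" using V(1) by (simp add: w_def)
        have "\<bar>ent (m.Vf \<theta>') x z\<bar> <= real (s + 1) * ((ms + \<eta>) * CZ\<^sup>2)" using V(2) by simp
        also have "\<dots> <= v" unfolding v_def using \<eta>0(2) by (intro mult_left_mono mult_right_mono) auto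
        finally show "\<bar>ent (m.Vf \<theta>') x z\<bar> <= v" .
      qed
      have \<eta>C: "4 * \<eta> * (real (s + 1) * C) <= 1" using \<delta>(4) by (simp add: \<eta>_def mult_ac)
      have l0: "0 < l" using q(1) by (simp add: l_def)
      \<comment> \<open>The free level r of \<open>lln_error\<close> is taken proportional to the
        scale, so that all errors are measured in units of g_j g_k.\<close>
      have r0: "0 < e * S n j k" using e Sp by simp
      have Rb: "(\<Sum>e\<in>Sigma {..s} (\<lambda>t. {..<neff (D n) t}). \<bar>m.zi i e\<bar>) <= R" if "i < nobs (D n)" for i
        unfolding R_def using m.design_row_bounds(1)[of CZ i, unfolded ns] CZ that by blast
      have kpb: "m.kp t <= K * (\<sigma>sq t)\<^sup>2" if "t <= s" for t using K(2)[OF that] by (simp add: m.kp_def kp_def)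
      have B0: "0 <= real B" by simp
      note P = m.poquim_error[unfolded ns theta[symmetric], OF T jk K(1) kpb C B0 Rb m4(2) tb0(2) \<tau>(1,2) r0 \<delta>(1,3) \<eta>0(1) \<eta>C vn wn(1) wn(2) l0 elim(1) CX]
      obtain Err where Err: "integrable (M n) Err" "\<And>\<omega>. 0 <= Err \<omega>"
        "\<And>\<omega> \<theta>'. \<theta>' \<in> param_nbhd (D n) \<theta> \<delta> ==> \<bar>poquim (D n) \<theta>' (y n \<omega>) $$ (j, k) - I1 n j k\<bar> <= Err \<omega>"
        "(\<integral>\<omega>. Err \<omega> \<partial>M n) <= (e * S n j k + 4 * (R * real B) ^ 8 * (\<Sum>f1\<in>fvals (D n). \<Sum>f2\<in>fvals (D n).
              hcount2 (D n) f1 f2 * \<bar>ccoef (D n) \<theta> j k f1 * ccoef (D n) \<theta> j k f2\<bar>) / (e * S n j k)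
            + 2 * (\<Sum>f\<in>fvals (D n). hcount (D n) f * \<bar>ccoef (D n) \<theta> j k f\<bar>) * (128 * \<tau> * U + 128 / \<tau> ^ 3 * (R ^ 4 * tb B)))
          + (\<Sum>f\<in>fvals (D n). hcount (D n) f * \<bar>ccoef (D n) \<theta> j k f\<bar>) * (128 * \<tau> * U + 128 / \<tau> ^ 3 * \<Delta>)
          + (\<Sum>f\<in>fvals (D n). hcount (D n) f * ddev (D n) \<theta> j k f \<delta>) * (8 * (U + \<Delta>))
          + 3 * ((\<Sum>f\<in>fvals (D n). hcount (D n) f * ddev (D n) \<theta> j k f \<delta>) * v\<^sup>2
            + (\<Sum>f\<in>fvals (D n). hcount (D n) f * \<bar>ccoef (D n) \<theta> j k f\<bar>) * (2 * v * w)) + gdev (D n) \<theta> j k \<delta>"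
        unfolding U_def \<Delta>_def
      proof (rule P[where ?c0.0 = "c n"], goal_cases)
        case (15 Err)
        show ?case by (rule 15(1)[OF 15(2-5)])
      qed assumption+
      have G: "\<bar>Gent (D n) \<theta>' j k - Gent (D n) \<theta> j k\<bar> <= \<epsilon> * S n j k" if "\<theta>' \<in> param_nbhd (D n) \<theta> \<delta>" for \<theta>'
      proof -
        have "\<bar>Gent (D n) \<theta>' j k - Gent (D n) \<theta> j k\<bar> <= gdev (D n) \<theta> j k \<delta>"
          by (rule m.gdev_ge) (use theta_ps jk that \<delta>(3) in \<open>auto simp: ns\<close>)
        also have "\<dots> <= e * S n j k" using \<delta>(7)[of n] Sp[of n] by (simp add: pos_divide_less_eq)
        also have "\<dots> <= \<epsilon> * S n j k" using Sp[of n] \<epsilon> by (intro mult_right_mono) (auto simp: e_def)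
        finally show ?thesis .
      qed
      have "(\<integral>\<omega>. Err \<omega> \<partial>M n) <= 8 * e * S n j k"
      proof (rule order_trans[OF Err(4)], rule error_budget[where a = a and z = \<zeta> and h = h])
        show "0 <= (\<Sum>f\<in>fvals (D n). hcount (D n) f * \<bar>ccoef (D n) \<theta> j k f\<bar>)"
          by (intro sum_nonneg) (auto simp: hcount_def)
        show "(\<Sum>f\<in>fvals (D n). hcount (D n) f * ddev (D n) \<theta> j k f \<delta>) <= \<zeta> * S n j k"
          using \<delta>(6)[of n] Sp[of n] by (simp add: pos_divide_less_eq)
        have s2: "0 < (S n j k)\<^sup>2" by (rule zero_less_power[OF Sp])
        show "(\<Sum>f1\<in>fvals (D n). \<Sum>f2\<in>fvals (D n). hcount2 (D n) f1 f2 * \<bar>ccoef (D n) \<theta> j k f1 * ccoef (D n) \<theta> j k f2\<bar>) <= h * (S n j k)\<^sup>2"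
          by (rule less_imp_le, rule iffD1[OF pos_divide_less_eq[OF s2]], rule elim(2))
        show "gdev (D n) \<theta> j k \<delta> <= e * S n j k" using \<delta>(7)[of n] Sp[of n] by (simp add: pos_divide_less_eq)
        show "a * (384 * \<tau> * U) <= e" using \<tau>(3) by (simp add: mult_ac)
        show "a * (128 / \<tau> ^ 3 * \<Delta>) <= e" using \<Delta>(2) by (simp add: d1_def mult_ac)
        show "6 * a * v * w <= e" using \<delta>(5) by (simp add: w_def \<eta>_def mult_ac)
        show "\<zeta> * (8 * (U + 1) + 3 * v\<^sup>2) <= e" using \<zeta>(2) by (simp add: mult_ac)
      qed (use Sp e a h(2) R0 B \<zeta>(1) \<Delta>(1) \<Delta>0 U0 v0 w0 \<tau>(1) tb0(1) in auto)
      then have "(\<integral>\<omega>. Err \<omega> \<partial>M n) <= \<epsilon> * S n j k" by (simp add: e_def)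
      then show ?case using Err(1,2,3) G by blast
    qed
  qed
qed

text \<open>The majorant holds for every parameter in the ball, so the random estimate may be
  inserted as soon as consistency places it there; Markov's inequality treats the majorant.\<close>

lemma poquim_whp:
  assumes jk: "j <= s" "k <= s" and e: "0 < e"
  shows "whp M (\<lambda>n \<omega>. \<bar>Gent (D n) (est n \<omega>) j k - Gent (D n) \<theta> j k\<bar> <= e * S n j k \<and>
    \<bar>poquim (D n) (est n \<omega>) (y n \<omega>) $$ (j, k) - I1 n j k\<bar> <= e * S n j k)"
  unfolding whp_def
proof (intro allI impI)
  fix \<eta> :: real assume \<eta>: "0 < \<eta>"
  \<comment> \<open>The minimum serves twice: \<epsilon> \<le> e, and the quotient \<epsilon> / e in
    Markov's inequality is at most \<eta> / 2.\<close>
  define \<epsilon> where "\<epsilon> = e * min 1 (\<eta> / 2)"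
  have \<epsilon>: "0 < \<epsilon>" "\<epsilon> <= e" "\<epsilon> <= e * (\<eta> / 2)" using e \<eta> by (auto simp: \<epsilon>_def mult_left_le)
  have Sp: "0 < S n j k" for n using g_pos jk by simp
  obtain \<delta> where \<delta>: "0 < \<delta>" "\<forall>\<^sub>F n in sequentially. \<exists>Err. integrable (M n) Err \<and> (\<forall>\<omega>. 0 <= Err \<omega>) \<and>
      (\<forall>\<omega> \<theta>'. \<theta>' \<in> param_nbhd (D n) \<theta> \<delta> \<longrightarrow> \<bar>poquim (D n) \<theta>' (y n \<omega>) $$ (j, k) - I1 n j k\<bar> <= Err \<omega> \<and>
          \<bar>Gent (D n) \<theta>' j k - Gent (D n) \<theta> j k\<bar> <= \<epsilon> * S n j k) \<and>
      (\<integral>\<omega>. Err \<omega> \<partial>M n) <= \<epsilon> * S n j k"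
    using poquim_expect[OF jk \<epsilon>(1)] by blast
  have "(\<lambda>n. measure (M n) {\<omega> \<in> space (M n). vec_norm2 (est n \<omega> - \<theta>) > \<delta>}) \<longlonglongrightarrow> 0"
    using est(3) \<delta>(1) by (simp add: vec_tendsto_in_prob_def)
  then have "\<forall>\<^sub>F n in sequentially. measure (M n) {\<omega> \<in> space (M n). vec_norm2 (est n \<omega> - \<theta>) > \<delta>} < \<eta> / 2"
    using \<eta> by (intro order_tendstoD(2)) auto
  with \<delta>(2) show "\<forall>\<^sub>F n in sequentially. \<exists>A\<in>sets (M n). 1 - \<eta> <= measure (M n) A \<and> (\<forall>\<omega>\<in>A.
      \<bar>Gent (D n) (est n \<omega>) j k - Gent (D n) \<theta> j k\<bar> <= e * S n j k \<and>
      \<bar>poquim (D n) (est n \<omega>) (y n \<omega>) $$ (j, k) - I1 n j k\<bar> <= e * S n j k)"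
  proof eventually_elim
    case (elim n)
    interpret prob_space "M n" by (rule M_prob)
    obtain Err where Err: "integrable (M n) Err" "\<And>\<omega>. 0 <= Err \<omega>"
      "\<And>\<omega> \<theta>'. \<theta>' \<in> param_nbhd (D n) \<theta> \<delta> ==> \<bar>poquim (D n) \<theta>' (y n \<omega>) $$ (j, k) - I1 n j k\<bar> <= Err \<omega>"
      "\<And>\<theta>'. \<theta>' \<in> param_nbhd (D n) \<theta> \<delta> ==> \<bar>Gent (D n) \<theta>' j k - Gent (D n) \<theta> j k\<bar> <= \<epsilon> * S n j k"
      "(\<integral>\<omega>. Err \<omega> \<partial>M n) <= \<epsilon> * S n j k" using elim(1) by blast
    have [measurable]: "Err \<in> borel_measurable (M n)" using Err(1) by auto
    have thc: "\<theta> \<in> carrier_vec (s + 1)" using theta_ps by (simp add: param_space_def)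
    have vn: "vec_norm2 (est n \<omega> - \<theta>) = sqrt (\<Sum>i<s+1. (est n \<omega> $ i - \<theta> $ i)\<^sup>2)" if "\<omega> \<in> space (M n)" for \<omega>
      using est_carrier[OF that] thc
      by (auto simp: vec_norm2_def scalar_prod_def power2_eq_square atLeast0LessThan intro!: sum.cong)
    have [measurable]: "i < s + 1 ==> (\<lambda>\<omega>. est n \<omega> $ i) \<in> borel_measurable (M n)" for i
      using est(1)[of n] by (simp add: random_vec_def)
    have "(\<lambda>\<omega>. sqrt (\<Sum>i<s+1. (est n \<omega> $ i - \<theta> $ i)\<^sup>2)) \<in> borel_measurable (M n)"
      by (intro measurable_compose[OF _ borel_measurable_sqrt] borel_measurable_sum borel_measurable_power borel_measurable_diff) auto
    then have [measurable]: "(\<lambda>\<omega>. vec_norm2 (est n \<omega> - \<theta>)) \<in> borel_measurable (M n)"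
      using vn by (simp cong: measurable_cong)
    let ?E = "{\<omega> \<in> space (M n). e * S n j k <= Err \<omega>}" and ?F = "{\<omega> \<in> space (M n). vec_norm2 (est n \<omega> - \<theta>) > \<delta>}"
    have eS: "0 < e * S n j k" using e Sp[of n] by simp
    have "prob ?E <= (\<integral>\<omega>. Err \<omega> \<partial>M n) / (e * S n j k)"
      by (rule integral_Markov_inequality_measure[where A = "{}"]) (use eS Err(1,2) in auto)
    also have "\<dots> <= \<eta> / 2"
    proof -
      have "\<epsilon> * S n j k <= e * (\<eta> / 2) * S n j k" using Sp[of n] \<epsilon>(3) by (intro mult_right_mono) auto
      then have "(\<integral>\<omega>. Err \<omega> \<partial>M n) <= \<eta> / 2 * (e * S n j k)" using Err(5) by (simp add: mult_ac)
      then show ?thesis using eS by (simp only: pos_divide_le_eq)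
    qed
    finally have E: "prob ?E <= \<eta> / 2" .
    have m: "?E \<in> events" "?F \<in> events" by measurable
    have "prob (?E \<union> ?F) <= prob ?E + prob ?F" by (rule measure_Un_le[OF m])
    then have "1 - \<eta> <= prob (space (M n) - (?E \<union> ?F))" using E elim(2) m by (simp add: prob_compl)
    moreover have "\<bar>Gent (D n) (est n \<omega>) j k - Gent (D n) \<theta> j k\<bar> <= e * S n j k \<and>
      \<bar>poquim (D n) (est n \<omega>) (y n \<omega>) $$ (j, k) - I1 n j k\<bar> <= e * S n j k" if "\<omega> \<in> space (M n) - (?E \<union> ?F)" for \<omega>
    proof -
      have "est n \<omega> \<in> param_nbhd (D n) \<theta> \<delta>" using that est(2)[of \<omega> n] design[of n] by (auto simp: param_nbhd_def)
      from Err(3)[OF this, of \<omega>] Err(4)[OF this] have "\<bar>poquim (D n) (est n \<omega>) (y n \<omega>) $$ (j, k) - I1 n j k\<bar> <= Err \<omega>"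
        "\<bar>Gent (D n) (est n \<omega>) j k - Gent (D n) \<theta> j k\<bar> <= \<epsilon> * S n j k" .
      moreover have "Err \<omega> < e * S n j k" using that by auto
      moreover have "\<epsilon> * S n j k <= e * S n j k" using \<epsilon>(2) Sp[of n] by (intro mult_right_mono) auto
      ultimately show ?thesis by linarith
    qed
    ultimately show ?case using m by (intro bexI[of _ "space (M n) - (?E \<union> ?F)"]) auto
  qed
qed

end

subsection \<open>The Wald statistic\<close>

text \<open>For a positive semidefinite matrix an upper bound of the form is one of the operator
  norm; again Cauchy-Schwarz in the form takes the place of the spectral theorem.\<close>

lemma psdm_norm_le:
  assumes A: "psdm A" "mat_dims d d A" and x: "mat_dims d 1 x"
    and b: "\<And>x. mat_dims d 1 x ==> inner x (A * x) <= b * (norm x)\<^sup>2"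
  shows "norm (A * x) <= b * norm x"
proof (cases "norm (A * x) = 0")
  case True
  have "0 <= b * (norm x)\<^sup>2" using b[OF x] psdm_nonneg[OF A(1), of x] by linarith
  then show ?thesis using True by (cases "x = 0") (auto simp: zero_le_mult_iff)
next
  case False
  let ?n = "norm (A * x)"
  have d: "mat_dims d 1 (A * x)" using A(2) x by (rule mat_dims_mult)
  have "inner x (A * (A * x)) = ?n\<^sup>2"
    using inner_times_left[of A x "A * x"] psdm_sym[OF A(1)] by (simp add: power2_norm_eq_inner)
  then have "(?n\<^sup>2)\<^sup>2 <= inner x (A * x) * inner (A * x) (A * (A * x))"
    using psdm_Cauchy_Schwarz[OF A(1), of x "A * x"] by simp
  also have "\<dots> <= (b * (norm x)\<^sup>2) * (b * ?n\<^sup>2)"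
    using b[OF x] psdm_nonneg[OF A(1), of x] by (intro mult_mono b[OF x] b[OF d] psdm_nonneg[OF A(1)]) auto
  finally have "(?n * ?n) * (?n * ?n) <= ((b * norm x) * (b * norm x)) * (?n * ?n)"
    by (simp add: power2_eq_square mult_ac)
  then have "?n * ?n <= (b * norm x) * (b * norm x)" by (rule mult_right_le_imp_le) (use False in simp)
  then have "?n\<^sup>2 <= (b * norm x)\<^sup>2" by (simp add: power2_eq_square)
  moreover have "0 <= b * norm x"
  proof -
    have "0 <= b * (norm x)\<^sup>2" using b[OF x] psdm_nonneg[OF A(1), of x] by linarith
    then show ?thesis by (cases "x = 0") (auto simp: zero_le_mult_iff)
  qed
  ultimately show ?thesis by (rule power2_le_imp_le)
qed

text \<open>A random inverse is tied to its matrix only where that matrix is nonsingular; hence the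
  conditional premise on J', which is discharged here by perturbation from H. The constant k is that
  of \<open>sandwich_close\<close> times h^2 / a, the price for replacing |gi x|^2 by the form of
  \<Sigma>.\<close>

lemma scaled_sandwich_close:
  assumes g: "gd * gi = idm d" "gi * gd = idm d" "trp gd = gd" "trp gi = gi" "mat_dims d d gd" "mat_dims d d gi"
    and H: "H * Hi = idm d" "trp Hi = Hi" "mat_dims d d Hi" "mat_dims d d H"
    and C: "\<And>x. mat_dims d 1 x ==> norm x <= C * norm (H * x)" "0 <= C"
    and h: "\<And>x. mat_dims d 1 x ==> norm (H * x) <= h * norm x" "0 < h"
    and F: "\<And>x. mat_dims d 1 x ==> norm (F * x) <= b * norm x" "0 <= b"
      "\<And>x. mat_dims d 1 x ==> a * (norm x)\<^sup>2 <= inner x (F * x)" "0 < a"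
    and G': "trp G' = G'" "mat_dims d d G'" and I': "mat_dims d d I'" and J': "mat_dims d d J'"
      "(\<And>v. mat_dims d 1 v ==> G' * v = 0 ==> v = 0) ==> J' * G' = - idm d \<and> G' * J' = - idm d"
    and e: "norm (gi * G' * gi - H) <= e" "norm (gi * I' * gi - F) <= e" "C * e <= 1 / 2" "e <= 1"
    and x: "mat_dims d 1 x" and z: "mat_dims d 1 z"
  defines "\<Sigma> \<equiv> gi * (Hi * F * Hi) * gi" and "\<Sigma>' \<equiv> J' * I' * J'"
    and "k \<equiv> (4 * C ^ 3 * (b + 1) + 2 * C\<^sup>2 + 2 * b * C ^ 3) * h\<^sup>2 / a"
  shows "\<bar>inner x (\<Sigma>' * z) - inner x (\<Sigma> * z)\<bar> <= (e * k) * sqrt (inner x (\<Sigma> * x)) * sqrt (inner z (\<Sigma> * z))"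
proof -
  have e0: "0 <= e" using e(1) norm_ge_zero order_trans by blast
  define H' where "H' = gi * G' * gi"
  have dH': "mat_dims d d H'" unfolding H'_def using g(6) G'(2) by (blast intro: mat_dims_mult)
  have inj: "v = 0" if v: "mat_dims d 1 v" "G' * v = 0" for v
  proof -
    have dv: "mat_dims d 1 (gd * v)" using g(5) v(1) by (rule mat_dims_mult)
    have giv: "gi * (gd * v) = v" using g(2) v(1) by (simp add: mult.assoc[symmetric] idm_mult_left)
    have "H' * (gd * v) = gi * (G' * (gi * (gd * v)))" by (simp add: H'_def mult.assoc)
    then have "H' * (gd * v) = 0" unfolding giv v(2) by simp
    then have "norm (gd * v) <= 0"
      using perturbed_inj[OF dv C(1)[OF dv] e(1)[folded H'_def] e(3) C(2)] by simp
    then show ?thesis using giv by simp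
  qed
  have J: "J' * G' = - idm d" "G' * J' = - idm d" using J'(2)[OF inj] by auto
  \<comment> \<open>J' inverts -G', hence the sign. It occurs twice in \<open>\<Sigma>'\<close> and
    disappears there.\<close>
  define Hi' where "Hi' = - (gd * J' * gd)"
  have dHi': "mat_dims d d Hi'" unfolding Hi'_def using g(5) J'(1) by (auto intro!: mat_dims_mult)
  have H'Hi': "H' * Hi' = idm d"
  proof -
    have "H' * Hi' = - (gi * (G' * ((gi * gd) * J')) * gd)" by (simp add: H'_def Hi'_def mult.assoc)
    also have "(gi * gd) * J' = J'" unfolding g(2) by (rule idm_mult_left[OF J'(1)])
    finally show ?thesis using g(2) J(2) idm_mult_right[OF g(6)] by (simp add: mult.assoc)
  qed
  have Hi'H': "Hi' * H' = idm d"
  proof -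
    have "Hi' * H' = - (gd * (J' * ((gd * gi) * G')) * gi)" by (simp add: H'_def Hi'_def mult.assoc)
    also have "(gd * gi) * G' = G'" unfolding g(1) by (rule idm_mult_left[OF G'(2)])
    finally show ?thesis using g(1) J(1) idm_mult_right[OF g(5)] by (simp add: mult.assoc)
  qed
  have symH': "trp H' = H'" unfolding H'_def by (simp add: trp_mult g(4) G'(1) mult.assoc)
  have symHi': "trp Hi' = Hi'"
  proof -
    have dt: "mat_dims d d (trp Hi')" using dHi' by simp
    have "trp Hi' = trp Hi' * (H' * Hi')" unfolding H'Hi' by (rule idm_mult_right[OF dt, symmetric])
    also have "\<dots> = trp (H' * Hi') * Hi'" by (simp add: trp_mult symH' mult.assoc)
    finally show ?thesis unfolding H'Hi' by (simp add: idm_mult_left[OF dHi'])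
  qed
  define F' where "F' = gi * I' * gi"
  have "gi * (Hi' * F' * Hi') * gi = (gi * gd) * J' * (gd * gi) * I' * (gi * gd) * J' * (gd * gi)"
    by (simp add: F'_def Hi'_def mult.assoc)
  also have "\<dots> = \<Sigma>'"
    unfolding g(1,2) \<Sigma>'_def using J'(1) I' by (simp add: idm_mult_left idm_mult_right mult.assoc mat_dims_mult)
  finally have \<Sigma>': "\<Sigma>' = gi * (Hi' * F' * Hi') * gi" by simp
  have sc: "inner u (gi * A * gi * w) = inner (gi * u) (A * (gi * w))" for u w A
    using inner_times_left[of gi u "A * (gi * w)"] g(4) by (simp add: mult.assoc)
  have dx: "mat_dims d 1 (gi * u)" if "mat_dims d 1 u" for u using g(6) that by (rule mat_dims_mult)
  let ?k = "4 * C ^ 3 * (b + 1) + 2 * C\<^sup>2 + 2 * b * C ^ 3"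
  have k0: "0 <= ?k" using C(2) F(2) by auto
  have main: "\<bar>inner x (\<Sigma>' * z) - inner x (\<Sigma> * z)\<bar> <= e * ?k * norm (gi * x) * norm (gi * z)"
    unfolding \<Sigma>' \<Sigma>_def sc
    by (rule sandwich_close[OF H H'Hi' Hi'H' symHi' dHi' dH' C F(1,2) e(1)[folded H'_def] e(2)[folded F'_def] e(3,4) dx[OF x] dx[OF z]])
  have pos: "0 <= inner u (\<Sigma> * u)" if u: "mat_dims d 1 u" for u
  proof -
    have "0 <= a / h\<^sup>2 * (norm (gi * u))\<^sup>2" using F(4) by simp
    also have "\<dots> <= inner u (\<Sigma> * u)"
      unfolding \<Sigma>_def sc by (rule sandwich_lower[OF H(1,2,3) dx[OF u] h F(3)]) (use F(4) in auto)
    finally show ?thesis .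
  qed
  have n: "norm (gi * u) <= sqrt (h\<^sup>2 / a) * sqrt (inner u (\<Sigma> * u))" if u: "mat_dims d 1 u" for u
  proof -
    have "a / h\<^sup>2 * (norm (gi * u))\<^sup>2 <= inner u (\<Sigma> * u)"
      unfolding \<Sigma>_def sc by (rule sandwich_lower[OF H(1,2,3) dx[OF u] h F(3)]) (use F(4) in auto)
    then have "(norm (gi * u))\<^sup>2 <= h\<^sup>2 / a * inner u (\<Sigma> * u)" using h(2) F(4) by (simp add: field_simps)
    then show ?thesis unfolding real_sqrt_mult[symmetric] by (rule real_le_rsqrt)
  qed
  have "e * ?k * norm (gi * x) * norm (gi * z)
      <= e * ?k * (sqrt (h\<^sup>2 / a) * sqrt (inner x (\<Sigma> * x))) * (sqrt (h\<^sup>2 / a) * sqrt (inner z (\<Sigma> * z)))"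
  proof (intro mult_mono n x z mult_nonneg_nonneg e0 k0 order_refl)
    show "0 <= sqrt (h\<^sup>2 / a)" using F(4) by simp
    show "0 <= sqrt (inner x (\<Sigma> * x))" using pos[OF x] by simp
  qed auto
  also have "\<dots> = e * k * sqrt (inner x (\<Sigma> * x)) * sqrt (inner z (\<Sigma> * z))"
  proof -
    have sq: "sqrt (h\<^sup>2 / a) * sqrt (h\<^sup>2 / a) = h\<^sup>2 / a" using F(4) by simp
    have "e * ?k * (sqrt (h\<^sup>2 / a) * p) * (sqrt (h\<^sup>2 / a) * q) = e * ?k * (sqrt (h\<^sup>2 / a) * sqrt (h\<^sup>2 / a)) * p * q" for p q
      by (simp only: mult_ac)
    then show ?thesis unfolding sq by (simp add: k_def)
  qed
  finally show ?thesis using main by linarith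
qed

lemma form_ent:
  assumes "mat_dims d d A" "mat_dims d 1 x"
  shows "inner x (A * x) = (\<Sum>j<d. \<Sum>k<d. ent x j 0 * ent x k 0 * ent A j k)"
proof -
  have "inner x (A * x) = (\<Sum>j<d. ent x j 0 * ent (A * x) j 0)" using inner_fmat_left[OF assms(2)] by simp
  also have "\<dots> = (\<Sum>j<d. \<Sum>k<d. ent x j 0 * ent x k 0 * ent A j k)"
    by (simp add: ent_times_left[OF assms(1)] sum_distrib_left mult_ac)
  finally show ?thesis .
qed

lemma diag_times_diag:
  "of_fun d d (\<lambda>i j. if i = j then a i else 0) * of_fun d d (\<lambda>i j. if i = j then b i else 0)
    = of_fun d d (\<lambda>i j. if i = j then a i * b i else 0)"
proof (rule fmat_eqI)
  fix i j
  have "ent (of_fun d d (\<lambda>i j. if i = j then a i else 0) * of_fun d d (\<lambda>i j. if i = j then b i else 0)) i j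
    = (\<Sum>q<d. if q = i then (if j < d \<and> i = j then a i * b i else 0) else 0)"
    unfolding ent_times_left[OF mat_dims_of_fun] by (intro sum.cong refl) auto
  also have "\<dots> = ent (of_fun d d (\<lambda>i j. if i = j then a i * b i else 0)) i j" by auto
  finally show "ent (of_fun d d (\<lambda>i j. if i = j then a i else 0) * of_fun d d (\<lambda>i j. if i = j then b i else 0)) i j
    = ent (of_fun d d (\<lambda>i j. if i = j then a i * b i else 0)) i j" .
qed

section \<open>Rescaling of the information matrices\<close>

context lmm_seq
begin

text \<open>The diagonal matrix G of condition (iii), followed by its inverse.\<close>

definition "gd n = of_fun (s + 1) (s + 1) (\<lambda>i j. if i = j then g n i else 0)"
definition "gi n = of_fun (s + 1) (s + 1) (\<lambda>i j. if i = j then 1 / g n i else 0)"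

lemma g_dims: "mat_dims (s + 1) (s + 1) (gd n)" "mat_dims (s + 1) (s + 1) (gi n)"
  by (simp_all only: gd_def gi_def mat_dims_of_fun)

lemma gd_gi: "gd n * gi n = idm (s + 1)" "gi n * gd n = idm (s + 1)" "trp (gd n) = gd n" "trp (gi n) = gi n"
proof -
  have p: "g n i \<noteq> 0" if "i < s + 1" for i using g_pos[of i n] that by simp
  show "gd n * gi n = idm (s + 1)" "gi n * gd n = idm (s + 1)"
    unfolding gd_def gi_def diag_times_diag by (rule fmat_eqI; use p in \<open>auto simp: idm_def\<close>)+
  show "trp (gd n) = gd n" "trp (gi n) = gi n"
    by (rule fmat_eqI, auto simp: gd_def gi_def)+
qed

lemma ent_gi:
  assumes "mat_dims (s + 1) (s + 1) A" "j <= s" "k <= s"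
  shows "ent (gi n * A * gi n) j k = ent A j k / S n j k"
proof -
  have d: "mat_dims (s + 1) (s + 1) (gi n * A)" using g_dims(2) assms(1) by (rule mat_dims_mult)
  have "ent (gi n * A) j q = ent A j q / g n j" if "q < s + 1" for q
  proof -
    have "ent (gi n * A) j q = (\<Sum>q'<s+1. if q' = j then ent A j q / g n j else 0)"
      unfolding ent_times_left[OF g_dims(2)] using assms(2) that by (intro sum.cong refl) (auto simp: gi_def)
    then show ?thesis using assms(2) by simp
  qed
  then have "ent (gi n * A * gi n) j k = (\<Sum>q<s+1. ent A j q / g n j * ent (gi n) q k)"
    unfolding ent_times_left[OF d] by (intro sum.cong) auto
  also have "\<dots> = (\<Sum>q<s+1. if q = k then ent A j k / g n j / g n k else 0)"
    using assms(3) by (intro sum.cong refl) (auto simp: gi_def)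
  finally show ?thesis using assms(3) by simp
qed

text \<open>Rescaling divides entry (j, k) by g_j g_k, the scale of the entrywise errors. Summing (s
  + 1)^2 entries is crude but harmless, as s is fixed.\<close>

lemma norm_gi_le:
  assumes A: "mat_dims (s + 1) (s + 1) A" and e: "\<And>j k. j <= s ==> k <= s ==> \<bar>ent A j k\<bar> <= e * S n j k"
  shows "norm (gi n * A * gi n) <= real (s + 1) * (real (s + 1) * e)"
proof -
  have d: "mat_dims (s + 1) (s + 1) (gi n * A * gi n)" using g_dims(2) A by (blast intro: mat_dims_mult)
  have "norm (gi n * A * gi n) <= (\<Sum>j<s+1. \<Sum>k<s+1. \<bar>ent (gi n * A * gi n) j k\<bar>)" by (rule norm_le_sum_ent[OF d])
  also have "\<dots> <= (\<Sum>j<s+1. \<Sum>k<s+1. e)"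
  proof (intro sum_mono)
    fix j k assume "j \<in> {..<s+1}" "k \<in> {..<s+1}"
    then have jk: "j <= s" "k <= s" by auto
    then have "0 < S n j k" using g_pos by simp
    then show "\<bar>ent (gi n * A * gi n) j k\<bar> <= e"
      unfolding ent_gi[OF A jk] abs_divide using e[OF jk] by (simp only: abs_of_pos pos_divide_le_eq)
  qed
  finally show ?thesis by simp
qed

lemma fm_diag_inv: "mat_inv (diag_of (s + 1) (g n)) \<in> carrier_mat (s + 1) (s + 1)" "fm (mat_inv (diag_of (s + 1) (g n))) = gi n"
proof -
  have c: "diag_of (s + 1) (g n) \<in> carrier_mat (s + 1) (s + 1)" by (simp add: diag_of_def)
  have f: "fm (diag_of (s + 1) (g n)) = gd n" by (rule fmat_eqI) (auto simp: fm_def gd_def diag_of_def)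
  have inj: "v = 0" if "mat_dims (s + 1) 1 v" "fm (diag_of (s + 1) (g n)) * v = 0" for v
    using that gd_gi(2)[of n] unfolding f by (metis idm_mult_left mult.assoc mult_zero_right)
  show "mat_inv (diag_of (s + 1) (g n)) \<in> carrier_mat (s + 1) (s + 1)" by (rule mat_inv_left_right(1)[OF c inj])
  note i = fm_mat_inv[OF c inj]
  have "fm (mat_inv (diag_of (s + 1) (g n))) = fm (mat_inv (diag_of (s + 1) (g n))) * (gd n * gi n)"
    unfolding gd_gi(1) by (rule idm_mult_right[OF i(3), symmetric])
  also have "\<dots> = gi n" using i(2) idm_mult_left[OF g_dims(2)] unfolding f by (simp add: mult.assoc[symmetric])
  finally show "fm (mat_inv (diag_of (s + 1) (g n))) = gi n" .
qed

definition "Gf n = fm (Gmat (D n) \<theta>)"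
definition "Ifm n = fm (info1 (M n) (D n) (T n) (c n) (y n) \<theta>)"
text \<open>It is these rescaled matrices that are bounded from above and below uniformly in
  n.\<close>

definition "Hf n = gi n * Gf n * gi n"
definition "Ff n = gi n * Ifm n * gi n"

lemma nfac_D: "nfac (D n) = s" using design by simp

lemma Gmat_carrier: "Gmat (D n) x \<in> carrier_mat (s + 1) (s + 1)" by (simp add: Gmat_def nfac_D)
lemma info1_carrier: "info1 (M n) (D n) (T n) (c n) (y n) \<theta> \<in> carrier_mat (s + 1) (s + 1)" by (simp add: info1_def nfac_D)

lemma GI_dims: "mat_dims (s + 1) (s + 1) (Gf n)" "mat_dims (s + 1) (s + 1) (Ifm n)"
  "mat_dims (s + 1) (s + 1) (Hf n)" "mat_dims (s + 1) (s + 1) (Ff n)"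
proof -
  show G: "mat_dims (s + 1) (s + 1) (Gf n)" unfolding Gf_def by (rule mat_dims_fm_carrier[OF Gmat_carrier])
  show I: "mat_dims (s + 1) (s + 1) (Ifm n)" unfolding Ifm_def by (rule mat_dims_fm_carrier[OF info1_carrier])
  show "mat_dims (s + 1) (s + 1) (Hf n)" "mat_dims (s + 1) (s + 1) (Ff n)"
    unfolding Hf_def Ff_def using G I g_dims(2) by (blast intro: mat_dims_mult)+
qed

lemma trp_fm_Gmat: "x \<in> param_space s ==> trp (fm (Gmat (D n) x)) = fm (Gmat (D n) x)"
proof -
  assume x: "x \<in> param_space s"
  interpret m: lmm_model "D n" "M n" law \<sigma>sq "\<alpha> n" "\<beta> n" "y n" by (rule model)
  show ?thesis
    by (rule fmat_eqI) (use m.Gent_sym[unfolded nfac_D, OF x] in \<open>auto simp: fm_def Gmat_def nfac_D\<close>)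
qed

lemma trp_I: "trp (Ifm n) = Ifm n"
  unfolding Ifm_def
  by (rule fmat_eqI) (auto simp: fm_def info1_def nfac_D covariance_of_def mult.commute)

text \<open>The laws do not change with n, so sums and minima of ratios over t \<le> s are constants
  for the whole sequence. The element 2 in the minimum secures the bound C \<le> 2 of
  \<open>info1_form_bounds\<close>.\<close>

lemma info_form:
  obtains cl cu where "0 < cl" "0 <= cu"
    "\<And>n x. mat_dims (s + 1) 1 x ==> cl * inner x (Gf n * x) <= inner x (Ifm n * x) \<and> inner x (Ifm n * x) <= cu * inner x (Gf n * x) \<and> 0 <= inner x (Gf n * x)"
proof -
  define kp where "kp t = (\<integral>x. x ^ 4 \<partial>law t) - 3 * (\<sigma>sq t)\<^sup>2" for t
  define K where "K = (\<Sum>t\<le>s. \<bar>kp t\<bar> / (\<sigma>sq t)\<^sup>2)"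
  have K: "0 <= K" "\<And>t. t <= s ==> kp t <= K * (\<sigma>sq t)\<^sup>2"
  proof -
    show "0 <= K" by (auto simp: K_def intro!: sum_nonneg)
    fix t assume t: "t <= s"
    then have "\<bar>kp t\<bar> / (\<sigma>sq t)\<^sup>2 <= K" unfolding K_def by (intro member_le_sum) auto
    then have "\<bar>kp t\<bar> <= K * (\<sigma>sq t)\<^sup>2" using i[OF t] by (simp add: pos_divide_le_eq)
    then show "kp t <= K * (\<sigma>sq t)\<^sup>2" by linarith
  qed
  define C where "C = Min (insert 2 ((\<lambda>t. variance_of (law t) (\<lambda>x. x\<^sup>2) / (\<sigma>sq t)\<^sup>2) ` {..s}))"
  have C: "0 < C" "C <= 2" "\<And>t. t <= s ==> C * (\<sigma>sq t)\<^sup>2 <= variance_of (law t) (\<lambda>x. x\<^sup>2)"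
  proof -
    have "0 < variance_of (law t) (\<lambda>x. x\<^sup>2) / (\<sigma>sq t)\<^sup>2" if "t <= s" for t using i[OF that] by simp
    then show "0 < C" unfolding C_def by (subst Min_gr_iff) auto
    show "C <= 2" unfolding C_def by (rule Min_le) auto
    fix t assume t: "t <= s"
    have "C <= variance_of (law t) (\<lambda>x. x\<^sup>2) / (\<sigma>sq t)\<^sup>2" unfolding C_def using t by (intro Min_le) auto
    then show "C * (\<sigma>sq t)\<^sup>2 <= variance_of (law t) (\<lambda>x. x\<^sup>2)" using i[OF t] by (simp add: pos_le_divide_eq)
  qed
  show ?thesis
  proof (rule that[of "C / 2" "1 + K / 2"])
    fix n x assume x: "mat_dims (s + 1) 1 x"
    interpret m: lmm_model "D n" "M n" law \<sigma>sq "\<alpha> n" "\<beta> n" "y n" by (rule model)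
    have kb: "m.kp t <= K * (\<sigma>sq t)\<^sup>2" if "t <= s" for t using K(2)[OF that] by (simp add: m.kp_def kp_def)
    have kc: "- (2 - C) * (\<sigma>sq t)\<^sup>2 <= m.kp t" if "t <= s" for t
      using m.kp_variance[of t] C(3)[OF that] that by (simp add: nfac_D algebra_simps)
    have f: "inner x (Gf n * x) = (\<Sum>j\<le>s. \<Sum>k\<le>s. ent x j 0 * ent x k 0 * Gent (D n) \<theta> j k)"
      "inner x (Ifm n * x) = (\<Sum>j\<le>s. \<Sum>k\<le>s. ent x j 0 * ent x k 0 * I1 n j k)"
      unfolding form_ent[OF GI_dims(1) x] form_ent[OF GI_dims(2) x] lessThan_Suc_atMost[symmetric] Suc_eq_plus1[symmetric]
      by (auto intro!: sum.cong simp: Gf_def Ifm_def fm_def Gmat_def info1_def nfac_D)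
    note b = m.info1_form_bounds(1,2)[unfolded nfac_D theta[symmetric], OF T K(1) kb kc C(2), where x = "\<lambda>j. ent x j 0" and c = "c n"]
      m.info1_form_bounds(3)[unfolded nfac_D theta[symmetric], OF T K(1) kb kc C(2), where x = "\<lambda>j. ent x j 0"]
    show "C / 2 * inner x (Gf n * x) <= inner x (Ifm n * x) \<and> inner x (Ifm n * x) <= (1 + K / 2) * inner x (Gf n * x) \<and> 0 <= inner x (Gf n * x)"
      unfolding f using b by blast
  qed (use C(1) K(1) in auto)
qed

lemma info2_fm: "fm (info2 (M n) (D n) (T n) (c n) (y n) \<theta>) = - Gf n" "info2 (M n) (D n) (T n) (c n) (y n) \<theta> \<in> carrier_mat (s + 1) (s + 1)"
proof -
  interpret m: lmm_model "D n" "M n" law \<sigma>sq "\<alpha> n" "\<beta> n" "y n" by (rule model)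
  show ca: "info2 (M n) (D n) (T n) (c n) (y n) \<theta> \<in> carrier_mat (s + 1) (s + 1)" by (simp add: info2_def nfac_D)
  have "info2 (M n) (D n) (T n) (c n) (y n) \<theta> = - Gmat (D n) \<theta>"
    by (rule eq_matI) (use ca Gmat_carrier[of n \<theta>] m.info2_eq[unfolded nfac_D theta[symmetric], OF T] in \<open>auto simp: Gmat_def nfac_D\<close>)
  then show "fm (info2 (M n) (D n) (T n) (c n) (y n) \<theta>) = - Gf n" by (simp add: Gf_def fm_uminus)
qed

end

context lmm_seq
begin

text \<open>For H the bounds are condition (iii); \<open>psdm_norm_bound\<close> turns the bounded
  inverse into a lower bound of the form. F inherits everything, because its form lies between two
  positive multiples of that of H.\<close>

lemma scaled_bounds:
  assumes above: "mats_bounded_above (\<lambda>n.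
      mat_inv (diag_of (s + 1) (g n)) * Gmat (D n) \<theta> * mat_inv (diag_of (s + 1) (g n)))"
    and below: "mats_bounded_below (\<lambda>n.
      mat_inv (diag_of (s + 1) (g n)) * Gmat (D n) \<theta> * mat_inv (diag_of (s + 1) (g n)))"
  obtains C h b a where "0 <= C" "0 < h" "0 <= b" "0 < a"
    "\<And>n x. mat_dims (s + 1) 1 x ==> norm x <= C * norm (Hf n * x)"
    "\<And>n x. mat_dims (s + 1) 1 x ==> norm (Hf n * x) <= h * norm x"
    "\<And>n x. mat_dims (s + 1) 1 x ==> norm (Ff n * x) <= b * norm x"
    "\<And>n x. mat_dims (s + 1) 1 x ==> a * (norm x)\<^sup>2 <= inner x (Ff n * x)"
proof -
  define HJ where "HJ n = mat_inv (diag_of (s + 1) (g n)) * Gmat (D n) \<theta> * mat_inv (diag_of (s + 1) (g n))" for n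
  have HJ: "HJ n \<in> carrier_mat (s + 1) (s + 1)" for n
    unfolding HJ_def using fm_diag_inv(1) Gmat_carrier by (intro mult_carrier_mat)
  have fHJ: "fm (HJ n) = Hf n" for n
  proof -
    have c: "mat_inv (diag_of (s + 1) (g n)) \<in> carrier_mat (s + 1) (s + 1)" by (rule fm_diag_inv(1))
    then have "fm (HJ n) = fm (mat_inv (diag_of (s + 1) (g n))) * Gf n * fm (mat_inv (diag_of (s + 1) (g n)))"
      unfolding HJ_def Gf_def using Gmat_carrier[of n \<theta>] by (simp add: fm_mult mult.assoc)
    then show ?thesis unfolding fm_diag_inv(2) Hf_def .
  qed
  obtain C1 where C1: "\<And>n. mat_norm2 (HJ n) <= C1" using above unfolding mats_bounded_above_def HJ_def by blast
  obtain C2 where C2: "\<And>n. invertible_mat (HJ n)" "\<And>n. mat_norm2 (mat_inv (HJ n)) <= C2"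
    using below unfolding mats_bounded_below_def HJ_def by blast
  define h where "h = max 1 C1"
  define C where "C = max 1 C2"
  have hpos: "0 < h" "0 < C" by (auto simp: h_def C_def)
  have h: "norm (Hf n * x) <= h * norm x" if "mat_dims (s + 1) 1 x" for n x
  proof -
    have "norm (Hf n * x) <= C1 * norm x"
      using norm_mult_le_mat_norm2[OF HJ that C1, of n] unfolding fHJ .
    also have "\<dots> <= h * norm x" by (intro mult_right_mono) (auto simp: h_def)
    finally show ?thesis .
  qed
  have Cb: "norm x <= C * norm (Hf n * x)" if x: "mat_dims (s + 1) 1 x" for n x
  proof -
    have inj: "v = 0" if "mat_dims (s + 1) 1 v" "fm (HJ n) * v = 0" for v
      by (rule invertible_inj[OF HJ C2(1) that])
    have dH: "mat_dims (s + 1) 1 (Hf n * x)" using GI_dims(3) x by (rule mat_dims_mult)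
    have "x = fm (mat_inv (HJ n)) * (Hf n * x)"
      using fm_mat_inv(2)[OF HJ inj] idm_mult_left[OF x] unfolding fHJ by (simp add: mult.assoc[symmetric])
    then have "norm x = norm (fm (mat_inv (HJ n)) * (Hf n * x))" by simp
    also have "\<dots> <= C2 * norm (Hf n * x)"
      by (rule norm_mult_le_mat_norm2[OF mat_inv_left_right(1)[OF HJ inj] dH C2(2)])
    also have "\<dots> <= C * norm (Hf n * x)" by (intro mult_right_mono) (auto simp: C_def)
    finally show ?thesis .
  qed
  obtain cl cu where cc: "0 < cl" "0 <= cu"
    "\<And>n x. mat_dims (s + 1) 1 x ==> cl * inner x (Gf n * x) <= inner x (Ifm n * x) \<and> inner x (Ifm n * x) <= cu * inner x (Gf n * x) \<and> 0 <= inner x (Gf n * x)"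
    using info_form by blast
  have sc: "inner x (gi n * A * gi n * x) = inner (gi n * x) (A * (gi n * x))" for x n A
    using inner_times_left[of "gi n" x "A * (gi n * x)"] gd_gi(4) by (simp add: mult.assoc)
  have dx: "mat_dims (s + 1) 1 (gi n * x)" if "mat_dims (s + 1) 1 x" for x n using g_dims(2) that by (rule mat_dims_mult)
  have F: "cl * inner x (Hf n * x) <= inner x (Ff n * x)" "inner x (Ff n * x) <= cu * inner x (Hf n * x)" "0 <= inner x (Hf n * x)"
    if "mat_dims (s + 1) 1 x" for n x
    using cc(3)[OF dx[OF that], of n n] unfolding Hf_def Ff_def sc by blast+
  have symH: "trp (Hf n) = Hf n" for n
    unfolding Hf_def using trp_fm_Gmat[OF theta_ps, of n] by (simp add: trp_mult gd_gi(4) mult.assoc Gf_def)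
  have symF: "trp (Ff n) = Ff n" for n
    unfolding Ff_def by (simp add: trp_mult gd_gi(4) mult.assoc trp_I)
  have psH: "psdm (Hf n)" for n by (rule psdm_colI[OF symH F(3) GI_dims(3)])
  have psF: "psdm (Ff n)" for n
  proof (rule psdm_colI[OF symF _ GI_dims(4)])
    fix x assume x: "mat_dims (s + 1) 1 x"
    have "0 <= cl * inner x (Hf n * x)" using cc(1) F(3)[OF x, of n] by simp
    then show "0 <= inner x (Ff n * x)" using F(1)[OF x, of n] by linarith
  qed
  have b1: "inner x (Ff n * x) <= (cu * h) * (norm x)\<^sup>2" if x: "mat_dims (s + 1) 1 x" for n x
  proof -
    have "inner x (Hf n * x) <= norm x * (h * norm x)"
      by (rule order_trans[OF norm_cauchy_schwarz]) (intro mult_left_mono h x norm_ge_zero)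
    then have "cu * inner x (Hf n * x) <= cu * (norm x * (h * norm x))" using cc(2) by (rule mult_left_mono)
    then show ?thesis using F(2)[OF x, of n] by (simp add: power2_eq_square mult_ac)
  qed
  have a1: "cl / (C\<^sup>2 * h) * (norm x)\<^sup>2 <= inner x (Ff n * x)" if x: "mat_dims (s + 1) 1 x" for n x
  proof -
    have "(norm x)\<^sup>2 <= (C * norm (Hf n * x))\<^sup>2" using Cb[OF x] by (intro power_mono) auto
    also have "\<dots> = C\<^sup>2 * (norm (Hf n * x))\<^sup>2" by (simp add: power_mult_distrib)
    also have "\<dots> <= C\<^sup>2 * (h * inner x (Hf n * x))"
      by (intro mult_left_mono psdm_norm_bound[OF psH GI_dims(3) x h]) auto
    finally have "(norm x)\<^sup>2 / (C\<^sup>2 * h) <= inner x (Hf n * x)" using hpos by (simp add: pos_divide_le_eq mult_ac)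
    then have "cl * ((norm x)\<^sup>2 / (C\<^sup>2 * h)) <= cl * inner x (Hf n * x)" using cc(1) by (intro mult_left_mono) auto
    then show ?thesis using F(1)[OF x, of n] by simp
  qed
  show ?thesis
    by (rule that[of C h "cu * h" "cl / (C\<^sup>2 * h)"])
       (use hpos cc h Cb a1 psdm_norm_le[OF psF GI_dims(4) _ b1] in auto)
qed

text \<open>The expected Hessian is minus the trace matrix. Its inverse occurs twice, so the signs
  cancel, and the inner factors of G cancel against its inverse.\<close>

lemma SigmaR_scaled:
  assumes Hi: "Hf n * Hi = idm (s + 1)" "Hi * Hf n = idm (s + 1)" "mat_dims (s + 1) (s + 1) Hi"
  shows "fm (SigmaR (M n) (D n) (T n) (c n) (y n) \<theta>) = gi n * (Hi * Ff n * Hi) * gi n"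
    and "SigmaR (M n) (D n) (T n) (c n) (y n) \<theta> \<in> carrier_mat (s + 1) (s + 1)"
proof -
  let ?N = "info2 (M n) (D n) (T n) (c n) (y n) \<theta>"
  have G: "Gf n = gd n * Hf n * gd n"
  proof -
    have "gd n * Hf n * gd n = (gd n * gi n) * Gf n * (gi n * gd n)" by (simp add: Hf_def mult.assoc)
    then show ?thesis unfolding gd_gi idm_mult_left[OF GI_dims(1)] idm_mult_right[OF GI_dims(1)] by (rule sym)
  qed
  define Gi where "Gi = gi n * Hi * gi n"
  have dGi: "mat_dims (s + 1) (s + 1) Gi" unfolding Gi_def using g_dims(2) Hi(3) by (blast intro: mat_dims_mult)
  have GiG: "Gi * Gf n = idm (s + 1)"
  proof -
    have "Gi * Gf n = gi n * (Hi * ((gi n * gd n) * Hf n)) * gd n" by (simp add: Gi_def G mult.assoc)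
    then show ?thesis unfolding gd_gi(2) idm_mult_left[OF GI_dims(3)] Hi(2) idm_mult_right[OF g_dims(2)] by (simp add: gd_gi(2))
  qed
  have GGi: "Gf n * Gi = idm (s + 1)"
  proof -
    have "Gf n * Gi = gd n * (Hf n * ((gd n * gi n) * Hi)) * gi n" by (simp add: Gi_def G mult.assoc)
    then show ?thesis unfolding gd_gi(1) idm_mult_left[OF Hi(3)] Hi(1) idm_mult_right[OF g_dims(1)] by (simp add: gd_gi(1))
  qed
  have inj: "v = 0" if v: "mat_dims (s + 1) 1 v" "fm ?N * v = 0" for v
  proof -
    have "Gf n * v = 0" using v(2) unfolding info2_fm by simp
    then have "Gi * Gf n * v = 0" by (simp add: mult.assoc)
    then show ?thesis unfolding GiG idm_mult_left[OF v(1)] .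
  qed
  have Ni: "fm ?N * fm (mat_inv ?N) = idm (s + 1)" "fm (mat_inv ?N) * fm ?N = idm (s + 1)" "mat_dims (s + 1) (s + 1) (fm (mat_inv ?N))"
    by (rule fm_mat_inv[OF info2_fm(2)], erule (1) inj)+
  have Nc: "mat_inv ?N \<in> carrier_mat (s + 1) (s + 1)"
    by (rule mat_inv_left_right(1)[OF info2_fm(2)], erule (1) inj)
  have "fm (mat_inv ?N) = fm (mat_inv ?N) * (Gf n * Gi)" unfolding GGi by (rule idm_mult_right[OF Ni(3), symmetric])
  also have "\<dots> = - (fm (mat_inv ?N) * fm ?N) * Gi" by (simp add: info2_fm(1) mult.assoc)
  finally have N: "fm (mat_inv ?N) = - Gi" unfolding Ni(2) by (simp only: mult_minus_left idm_mult_left[OF dGi])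
  have "fm (SigmaR (M n) (D n) (T n) (c n) (y n) \<theta>) = fm (mat_inv ?N) * Ifm n * fm (mat_inv ?N)"
    unfolding SigmaR_def Ifm_def using Nc info1_carrier[of n] by (simp add: fm_mult mult.assoc)
  also have "\<dots> = gi n * (Hi * Ff n * Hi) * gi n" unfolding N by (simp add: Gi_def Ff_def mult.assoc)
  finally show "fm (SigmaR (M n) (D n) (T n) (c n) (y n) \<theta>) = gi n * (Hi * Ff n * Hi) * gi n" .
  show "SigmaR (M n) (D n) (T n) (c n) (y n) \<theta> \<in> carrier_mat (s + 1) (s + 1)"
    unfolding SigmaR_def using Nc info1_carrier[of n] by (intro mult_carrier_mat)
qed

end

text \<open>Injectivity at the outcome considered excludes the arbitrary values of a random
  inverse.\<close>

lemma random_inverse_mult: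
  assumes "random_inverse M d A B" "\<omega> \<in> space M" "A \<omega> \<in> carrier_mat d d"
    and inj: "\<And>v. mat_dims d 1 v ==> fm (A \<omega>) * v = 0 ==> v = 0"
  shows "fm (A \<omega>) * fm (B \<omega>) = idm d" "fm (B \<omega>) * fm (A \<omega>) = idm d"
proof -
  have B: "B \<omega> \<in> carrier_mat d d" using assms(1,2) by (simp add: random_inverse_def random_mat_def)
  have "inverts_mat (A \<omega>) (B \<omega>)" "inverts_mat (B \<omega>) (A \<omega>)"
    using assms(1,2) mat_inv_left_right(4)[OF assms(3) inj] by (auto simp: random_inverse_def)
  then have "A \<omega> * B \<omega> = 1\<^sub>m d" "B \<omega> * A \<omega> = 1\<^sub>m d" using assms(3) B by (auto simp: inverts_mat_def)
  then show "fm (A \<omega>) * fm (B \<omega>) = idm d" "fm (B \<omega>) * fm (A \<omega>) = idm d"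
    using assms(3) B by (metis carrier_matD fm_mult fm_one)+
qed

theorem theorem4:
  fixes M :: "nat \<Rightarrow> 'w measure"
    and D :: "nat \<Rightarrow> lmm_design"
    and s r :: nat
    and law :: "nat \<Rightarrow> real measure"
    and \<sigma>sq :: "nat \<Rightarrow> real"
    and \<alpha> :: "nat \<Rightarrow> nat \<Rightarrow> nat \<Rightarrow> 'w \<Rightarrow> real"
    and \<beta> :: "nat \<Rightarrow> real vec"
    and y :: "nat \<Rightarrow> 'w \<Rightarrow> real vec"
    and \<theta> :: "real vec"
    and g :: "nat \<Rightarrow> nat \<Rightarrow> real"
    and T :: "nat \<Rightarrow> real mat"
    and c :: "nat \<Rightarrow> real"
    and est :: "nat \<Rightarrow> 'w \<Rightarrow> real vec"
    and K :: "real mat"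
    and \<phi> :: "real vec"
    and J Sig W :: "nat \<Rightarrow> 'w \<Rightarrow> real mat"
  assumes design: "\<And>n. valid_design (D n) \<and> nfac (D n) = s"
    and sizes: "filterlim (\<lambda>n. nobs (D n)) at_top sequentially"
    and laws: "\<And>t. t \<le> s \<Longrightarrow> effect_law (law t) (\<sigma>sq t)"
    and effects: "\<And>n. mixed_effects (M n) (D n) law (\<alpha> n)"
    and beta: "\<And>n. \<beta> n \<in> carrier_vec (dim_col (fixX (D n)))"
    and y: "\<And>n. y n = response (D n) (\<beta> n) (\<alpha> n)"
    and theta: "\<theta> = true_param s \<sigma>sq"
    and i: "\<And>t. t \<le> s \<Longrightarrow> 0 < \<sigma>sq t \<and> integrable (law t) (\<lambda>x. x ^ 4) \<and> 0 < variance_of (law t) (\<lambda>x. x\<^sup>2)"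
    and ii_X: "\<exists>C. \<forall>n. \<forall>i<nobs (D n). vec_norm2 (row (fixX (D n)) i) \<le> C"
    and ii_Z: "\<exists>C. \<forall>n. \<forall>t\<in>{1..s}. \<forall>i<nobs (D n). (\<Sum>q<neff (D n) t. \<bar>Zmat (D n) t $$ (i, q)\<bar>) \<le> C"
    and g_pos: "\<And>n j. j \<le> s \<Longrightarrow> 0 < g n j"
    and iii_above: "mats_bounded_above (\<lambda>n.
          mat_inv (diag_of (s + 1) (g n)) * Gmat (D n) \<theta> * mat_inv (diag_of (s + 1) (g n)))"
    and iii_below: "mats_bounded_below (\<lambda>n.
          mat_inv (diag_of (s + 1) (g n)) * Gmat (D n) \<theta> * mat_inv (diag_of (s + 1) (g n)))"
    and iii_X: "filterlim (\<lambda>n. lambda_min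
          (transpose_mat (fixX (D n)) * mat_inv (Vmat (D n) \<theta>) * fixX (D n))) at_top sequentially"
    and iv_bounded: "\<And>j k. j \<le> s \<Longrightarrow> k \<le> s \<Longrightarrow> \<exists>C. \<forall>n.
          (\<Sum>f\<in>fvals (D n). hcount (D n) f * \<bar>ccoef (D n) \<theta> j k f\<bar>) / (g n j * g n k) \<le> C"
    and iv_small: "\<And>j k. j \<le> s \<Longrightarrow> k \<le> s \<Longrightarrow> (\<lambda>n.
          (\<Sum>f1\<in>fvals (D n). \<Sum>f2\<in>fvals (D n).
             hcount2 (D n) f1 f2 * \<bar>ccoef (D n) \<theta> j k f1 * ccoef (D n) \<theta> j k f2\<bar>)
          / (g n j * g n k)\<^sup>2) \<longlonglongrightarrow> 0"
    and v_G: "\<And>j k. j \<le> s \<Longrightarrow> k \<le> s \<Longrightarrow> uniform_limit UNIV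
          (\<lambda>\<delta> n. gdev (D n) \<theta> j k \<delta> / (g n j * g n k)) (\<lambda>n. 0) (at_right 0)"
    and v_c: "\<And>j k. j \<le> s \<Longrightarrow> k \<le> s \<Longrightarrow> uniform_limit UNIV
          (\<lambda>\<delta> n. (\<Sum>f\<in>fvals (D n). hcount (D n) f * ddev (D n) \<theta> j k f \<delta>) / (g n j * g n k))
          (\<lambda>n. 0) (at_right 0)"
    and T: "\<And>n. contrast_mat (D n) (T n)"
    and reml: "reml_estimator s M D T c y \<theta> est"
    and normality: "tendsto_std_normal (s + 1) M (\<lambda>n \<omega>.
          mat_inv (mat_sqrt (SigmaR (M n) (D n) (T n) (c n) (y n) \<theta>)) *\<^sub>v (est n \<omega> - \<theta>))"
    and K: "K \<in> carrier_mat (s + 1) r" "vec_space.rank (s + 1) K = r"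
    and phi: "\<phi> \<in> carrier_vec r"
    and H0: "transpose_mat K *\<^sub>v \<theta> = \<phi>"
    and J: "\<And>n. random_inverse (M n) (s + 1) (\<lambda>\<omega>. info2_at (D n) (est n \<omega>)) (J n)"
    and Sig: "\<And>n \<omega>. Sig n \<omega> = J n \<omega> * poquim (D n) (est n \<omega>) (y n \<omega>) * J n \<omega>"
    and W: "\<And>n. random_inverse (M n) r (\<lambda>\<omega>. transpose_mat K * Sig n \<omega> * K) (W n)"
  shows "weak_conv_m
      (\<lambda>n. distr (M n) borel (\<lambda>\<omega>.
         scalar_prod (transpose_mat K *\<^sub>v est n \<omega> - \<phi>) (W n \<omega> *\<^sub>v (transpose_mat K *\<^sub>v est n \<omega> - \<phi>))))
      (chi_square r)"
proof -
  interpret lmm_seq M D s law \<sigma>sq \<alpha> \<beta> y \<theta> g T c est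
    using reml by unfold_locales
      (use design laws effects beta y theta i ii_X ii_Z g_pos iii_X iv_bounded iv_small v_G v_c T in
        \<open>auto simp: reml_estimator_def\<close>)
  define \<Sigma>J where "\<Sigma>J n = SigmaR (M n) (D n) (T n) (c n) (y n) \<theta>" for n
  define \<Sigma> where "\<Sigma> n = fm (\<Sigma>J n)" for n
  define Km where "Km = fm K"
  have dK: "mat_dims (s + 1) r Km" unfolding Km_def by (rule mat_dims_fm_carrier[OF K(1)])
  have Kinj: "v = 0" if "mat_dims r 1 v" "Km * v = 0" for v
    using full_rank_inj[OF K that(1)] that(2) by (simp add: Km_def)
  have thc: "\<theta> \<in> carrier_vec (s + 1)" using theta_ps by (simp add: param_space_def)
  obtain C h b a where cons: "0 <= C" "0 < h" "0 <= b" "0 < a"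
    "\<And>n x. mat_dims (s + 1) 1 x ==> norm x <= C * norm (Hf n * x)"
    "\<And>n x. mat_dims (s + 1) 1 x ==> norm (Hf n * x) <= h * norm x"
    "\<And>n x. mat_dims (s + 1) 1 x ==> norm (Ff n * x) <= b * norm x"
    "\<And>n x. mat_dims (s + 1) 1 x ==> a * (norm x)\<^sup>2 <= inner x (Ff n * x)"
    using scaled_bounds[OF iii_above iii_below] by metis
  have symH: "trp (Hf n) = Hf n" for n
    unfolding Hf_def using trp_fm_Gmat[OF theta_ps, of n] by (simp add: trp_mult gd_gi(4) mult.assoc Gf_def)
  have Hinj: "v = 0" if v: "mat_dims (s + 1) 1 v" "Hf n * v = 0" for n v
    using cons(5)[OF v(1), of n] v(2) by simp
  have "\<exists>Hi. mat_dims (s + 1) (s + 1) Hi \<and> Hf n * Hi = idm (s + 1) \<and> Hi * Hf n = idm (s + 1)" for n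
    by (rule inj_inverse_exists[OF GI_dims(3) Hinj]) auto
  then obtain Hi where Hi: "\<And>n. mat_dims (s + 1) (s + 1) (Hi n)" "\<And>n. Hf n * Hi n = idm (s + 1)" "\<And>n. Hi n * Hf n = idm (s + 1)"
    by metis
  have symHi: "trp (Hi n) = Hi n" for n
  proof -
    have dt: "mat_dims (s + 1) (s + 1) (trp (Hi n))" using Hi(1) by simp
    have "trp (Hi n) = trp (Hi n) * (Hf n * Hi n)" unfolding Hi(2) by (rule idm_mult_right[OF dt, symmetric])
    also have "\<dots> = trp (Hf n * Hi n) * Hi n" by (simp add: trp_mult symH mult.assoc)
    finally show ?thesis unfolding Hi(2) by (simp only: trp_idm idm_mult_left[OF Hi(1)])
  qed
  have \<Sigma>eq: "\<Sigma> n = gi n * (Hi n * Ff n * Hi n) * gi n" for n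
    unfolding \<Sigma>_def \<Sigma>J_def by (rule SigmaR_scaled(1)[OF Hi(2) Hi(3) Hi(1)])
  have \<Sigma>Jc: "\<Sigma>J n \<in> carrier_mat (s + 1) (s + 1)" for n
    unfolding \<Sigma>J_def by (rule SigmaR_scaled(2)[OF Hi(2) Hi(3) Hi(1)])
  have d\<Sigma>: "mat_dims (s + 1) (s + 1) (\<Sigma> n)" for n unfolding \<Sigma>_def by (rule mat_dims_fm_carrier[OF \<Sigma>Jc])
  have dgx: "mat_dims (s + 1) 1 (gi n * x)" if "mat_dims (s + 1) 1 x" for x n using g_dims(2) that by (rule mat_dims_mult)
  have \<Sigma>low: "a / h\<^sup>2 * (norm (gi n * x))\<^sup>2 <= inner x (\<Sigma> n * x)" if x: "mat_dims (s + 1) 1 x" for n x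
  proof -
    have "inner x (\<Sigma> n * x) = inner (gi n * x) (Hi n * Ff n * Hi n * (gi n * x))"
      using inner_times_left[of "gi n" x "Hi n * Ff n * Hi n * (gi n * x)"] gd_gi(4) unfolding \<Sigma>eq by (simp add: mult.assoc)
    moreover have "a / h\<^sup>2 * (norm (gi n * x))\<^sup>2 <= inner (gi n * x) (Hi n * Ff n * Hi n * (gi n * x))"
      by (rule sandwich_lower[OF Hi(2) symHi Hi(1) dgx[OF x] cons(6,2,8)]) (use cons(4) in auto)
    ultimately show ?thesis by simp
  qed
  have symI: "trp (Ff n) = Ff n" for n
    unfolding Ff_def by (simp add: trp_mult gd_gi(4) mult.assoc trp_I)
  have sym\<Sigma>: "trp (\<Sigma> n) = \<Sigma> n" for n
    unfolding \<Sigma>eq by (simp add: trp_mult gd_gi(4) symHi symI mult.assoc)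
  have ps\<Sigma>: "psdm (\<Sigma> n)" for n
  proof (rule psdm_colI[OF sym\<Sigma> _ d\<Sigma>])
    fix x assume x: "mat_dims (s + 1) 1 x"
    have "0 <= a / h\<^sup>2 * (norm (gi n * x))\<^sup>2" using cons(4) by simp
    then show "0 <= inner x (\<Sigma> n * x)" using \<Sigma>low[OF x, of n] by linarith
  qed
  have pd\<Sigma>: "x = 0" if x: "mat_dims (s + 1) 1 x" "inner x (\<Sigma> n * x) = 0" for n x
  proof -
    have "a / h\<^sup>2 * (norm (gi n * x))\<^sup>2 <= 0" using \<Sigma>low[OF x(1), of n] x(2) by simp
    moreover have "0 < a / h\<^sup>2" using cons(2,4) by simp
    ultimately have "(norm (gi n * x))\<^sup>2 <= 0" by (meson mult_pos_pos not_less)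
    then have "gi n * x = 0" by simp
    then have "gd n * gi n * x = 0" by (simp add: mult.assoc)
    then show ?thesis unfolding gd_gi(1) idm_mult_left[OF x(1)] .
  qed
  define RJ where "RJ n = mat_sqrt (\<Sigma>J n)" for n
  note R = mat_sqrt[OF \<Sigma>Jc ps\<Sigma>[unfolded \<Sigma>_def], folded RJ_def \<Sigma>_def]
  have dR: "mat_dims (s + 1) (s + 1) (fm (RJ n))" for n by (rule mat_dims_fm_carrier[OF R(1)])
  have Rinj: "v = 0" if v: "mat_dims (s + 1) 1 v" "fm (RJ n) * v = 0" for n v
    using pd\<Sigma>[OF v(1), of n] v(2) by (simp add: R(3)[symmetric] mult.assoc)
  define BJ where "BJ n = mat_inv (RJ n)" for n
  have Ri: "fm (RJ n) * fm (BJ n) = idm (s + 1)" "fm (BJ n) * fm (RJ n) = idm (s + 1)" "mat_dims (s + 1) (s + 1) (fm (BJ n))" for n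
    unfolding BJ_def by (rule fm_mat_inv[OF R(1)], erule (1) Rinj)+
  have BJc: "BJ n \<in> carrier_mat (s + 1) (s + 1)" for n
    unfolding BJ_def by (rule mat_inv_left_right(1)[OF R(1)], erule (1) Rinj)
  have "\<exists>Q. mat_dims r (s + 1) Q \<and> Q * trp Q = idm r \<and> (\<forall>v. mat_dims (s + 1) 1 v \<longrightarrow>
      (\<exists>w. mat_dims r 1 w \<and> trp Km * \<Sigma> n * Km * w = trp Km * v \<and> inner (trp Km * v) w = (norm (Q * (fm (BJ n) * v)))\<^sup>2))" for n
    by (rule wald_isometry[OF dK _ dR[of n] psdm_sym[OF R(2)[of n]] R(3)[of n] Ri(3)[of n] Ri(1)[of n] Ri(2)[of n]])
       ((rule Kinj; assumption) | blast)+
  then obtain Q where Q: "\<And>n. mat_dims r (s + 1) (Q n)" "\<And>n. Q n * trp (Q n) = idm r"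
    "\<And>n v. mat_dims (s + 1) 1 v ==> \<exists>w. mat_dims r 1 w \<and> trp Km * \<Sigma> n * Km * w = trp Km * v \<and>
        inner (trp Km * v) w = (norm (Q n * (fm (BJ n) * v)))\<^sup>2" by metis
  define Z where "Z n \<omega> = BJ n *\<^sub>v (est n \<omega> - \<theta>)" for n \<omega>
  have Zn: "tendsto_std_normal (s + 1) M Z"
    using normality unfolding Z_def[abs_def] BJ_def RJ_def \<Sigma>J_def .
  have est_m: "(\<lambda>\<omega>. est n \<omega> $ j) \<in> borel_measurable (M n)" if "j < s + 1" for n j
    using est(1)[of n] that by (simp add: random_vec_def)
  have Zc: "random_vec (M n) (s + 1) (Z n)" for n
    unfolding random_vec_def
  proof (intro conjI ballI allI impI)
    fix \<omega> assume \<omega>: "\<omega> \<in> space (M n)"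
    show "Z n \<omega> \<in> carrier_vec (s + 1)"
      unfolding Z_def by (intro mult_mat_vec_carrier[OF BJc] minus_carrier_vec est_carrier[OF \<omega>] thc)
  next
    fix q assume q: "q < s + 1"
    have "(\<lambda>\<omega>. \<Sum>j<s+1. BJ n $$ (q, j) * (est n \<omega> $ j - \<theta> $ j)) \<in> borel_measurable (M n)"
      by (intro borel_measurable_sum borel_measurable_times borel_measurable_diff borel_measurable_const est_m) auto
    moreover have "Z n \<omega> $ q = (\<Sum>j<s+1. BJ n $$ (q, j) * (est n \<omega> $ j - \<theta> $ j))" if "\<omega> \<in> space (M n)" for \<omega>
      using BJc[of n] q est_carrier[OF that] thc by (auto simp: Z_def scalar_prod_def atLeast0LessThan intro!: sum.cong)
    ultimately show "(\<lambda>\<omega>. Z n \<omega> $ q) \<in> borel_measurable (M n)" by (simp cong: measurable_cong)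
  qed
  define Sv where "Sv n \<omega> = transpose_mat K *\<^sub>v est n \<omega> - \<phi>" for n \<omega>
  define X where "X n \<omega> = scalar_prod (Sv n \<omega>) (W n \<omega> *\<^sub>v Sv n \<omega>)" for n \<omega>
  have Svc: "Sv n \<omega> \<in> carrier_vec r" for n \<omega> unfolding Sv_def by (rule carrier_vecI, subst index_minus_vec(2), rule carrier_vecD[OF phi])
  have Wc: "W n \<omega> \<in> carrier_mat r r" if "\<omega> \<in> space (M n)" for n \<omega>
    using W[of n] that by (simp add: random_inverse_def random_mat_def)
  have Xm: "X n \<in> borel_measurable (M n)" for n
  proof -
    have sm: "(\<lambda>\<omega>. Sv n \<omega> $ q) \<in> borel_measurable (M n)" if q: "q < r" for q
    proof -
      have "(\<lambda>\<omega>. (\<Sum>j<s+1. K $$ (j, q) * est n \<omega> $ j) - \<phi> $ q) \<in> borel_measurable (M n)"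
        by (intro borel_measurable_sum borel_measurable_times borel_measurable_diff borel_measurable_const est_m) auto
      moreover have "Sv n \<omega> $ q = (\<Sum>j<s+1. K $$ (j, q) * est n \<omega> $ j) - \<phi> $ q" if "\<omega> \<in> space (M n)" for \<omega>
        using K(1) q est_carrier[OF that] phi by (auto simp: Sv_def scalar_prod_def atLeast0LessThan intro!: sum.cong)
      ultimately show ?thesis by (simp cong: measurable_cong)
    qed
    have wm: "(\<lambda>\<omega>. W n \<omega> $$ (p, q)) \<in> borel_measurable (M n)" if "p < r" "q < r" for p q
      using W[of n] that by (simp add: random_inverse_def random_mat_def)
    have "(\<lambda>\<omega>. \<Sum>p<r. Sv n \<omega> $ p * (\<Sum>q<r. W n \<omega> $$ (p, q) * Sv n \<omega> $ q)) \<in> borel_measurable (M n)"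
      by (intro borel_measurable_sum borel_measurable_times sm wm) auto
    moreover have "X n \<omega> = (\<Sum>p<r. Sv n \<omega> $ p * (\<Sum>q<r. W n \<omega> $$ (p, q) * Sv n \<omega> $ q))" if "\<omega> \<in> space (M n)" for \<omega>
      using Wc[OF that] Svc[of n \<omega>] by (auto simp: X_def scalar_prod_def atLeast0LessThan intro!: sum.cong)
    ultimately show ?thesis by (simp cong: measurable_cong)
  qed
  define q where "q n \<omega> = qq (Q n) r (s + 1) (\<lambda>i. if i < s + 1 then Z n \<omega> $ i else 0)" for n \<omega>
  have qn: "q n \<omega> = (norm (Q n * fv (Z n \<omega>)))\<^sup>2" "(\<Sum>j<s+1. (Z n \<omega> $ j)\<^sup>2) = (norm (fv (Z n \<omega>)))\<^sup>2" if "\<omega> \<in> space (M n)" for n \<omega>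
  proof -
    have z: "Z n \<omega> \<in> carrier_vec (s + 1)" using Zc[of n] that by (simp add: random_vec_def)
    have o: "of_fun (s + 1) 1 (\<lambda>i _. if i < s + 1 then Z n \<omega> $ i else 0) = fv (Z n \<omega>)"
      by (rule fmat_eqI) (use z in \<open>auto simp: fv_def\<close>)
    show "q n \<omega> = (norm (Q n * fv (Z n \<omega>)))\<^sup>2" unfolding q_def qq_norm[OF Q(1)] o ..
    show "(\<Sum>j<s+1. (Z n \<omega> $ j)\<^sup>2) = (norm (fv (Z n \<omega>)))\<^sup>2"
      using z unfolding power2_norm_eq_inner by (simp add: inner_fv scalar_prod_def power2_eq_square atLeast0LessThan)
  qed
  \<comment> \<open>The constant of \<open>scaled_sandwich_close\<close>; it is the same for all
    n.\<close>
  define k where "k = (4 * C ^ 3 * (b + 1) + 2 * C\<^sup>2 + 2 * b * C ^ 3) * h\<^sup>2 / a"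
  have k0: "0 <= k" using cons(1-4) by (simp add: k_def)
  have near: "\<forall>\<^sub>F n in sequentially. \<exists>A\<in>sets (M n). 1 - \<eta> <= measure (M n) A \<and>
         (\<forall>\<omega>\<in>A. \<bar>X n \<omega> - q n \<omega>\<bar> <= \<epsilon> * (\<Sum>j<s+1. (Z n \<omega> $ j)\<^sup>2))" if \<epsilon>: "0 < \<epsilon>" and \<eta>: "0 < \<eta>" for \<epsilon> \<eta>
  proof -
    \<comment> \<open>One choice meets three demands: C e and e k at most 1/2 for the perturbation
      lemmas, and 2 e k at most \<epsilon> for the final estimate.\<close>
    obtain e where e: "0 < e" "e <= 1" "(C + 2 * k) * e <= min (1 / 2) \<epsilon>"
      using small_factor[of "C + 2 * k" "min (1 / 2) \<epsilon>"] cons(1) k0 \<epsilon> by auto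
    have ek0: "0 <= C * e" "0 <= e * k" using cons(1) k0 e(1) by auto
    have "C * e + 2 * (e * k) <= min (1 / 2) \<epsilon>" using e(3) by (simp add: algebra_simps)
    then have ek: "C * e <= 1 / 2" "e * k <= 1 / 2" "2 * (e * k) <= \<epsilon>" using ek0 by auto
    \<comment> \<open>The entrywise accuracy that becomes e after the summation in
      \<open>norm_gi_le\<close>.\<close>
    define e0 where "e0 = e / (real (s + 1) * real (s + 1))"
    have e0: "0 < e0" "real (s + 1) * (real (s + 1) * e0) = e"
    proof -
      show "0 < e0" unfolding e0_def using e(1) by (intro divide_pos_pos mult_pos_pos) auto
      have "m * (m * (e / (m * m))) = e" if "m \<noteq> 0" for m :: real using that by simp
      then show "real (s + 1) * (real (s + 1) * e0) = e" unfolding e0_def by simp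
    qed
    \<comment> \<open>The number of pairs (j, k) does not depend on n, so finitely many events are
      intersected.\<close>
    have "whp M (\<lambda>n \<omega>. \<forall>p\<in>{..s} \<times> {..s}. \<bar>Gent (D n) (est n \<omega>) (fst p) (snd p) - Gent (D n) \<theta> (fst p) (snd p)\<bar> <= e0 * S n (fst p) (snd p) \<and>
      \<bar>poquim (D n) (est n \<omega>) (y n \<omega>) $$ (fst p, snd p) - I1 n (fst p) (snd p)\<bar> <= e0 * S n (fst p) (snd p))"
      by (intro whp_finite M_prob poquim_whp e0(1)) auto
    then have "whp M (\<lambda>n \<omega>. \<bar>X n \<omega> - q n \<omega>\<bar> <= \<epsilon> * (\<Sum>j<s+1. (Z n \<omega> $ j)\<^sup>2))"
    proof (rule whp_mono)
      fix n \<omega> assume \<omega>: "\<omega> \<in> space (M n)"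
        and ev: "\<forall>p\<in>{..s} \<times> {..s}. \<bar>Gent (D n) (est n \<omega>) (fst p) (snd p) - Gent (D n) \<theta> (fst p) (snd p)\<bar> <= e0 * S n (fst p) (snd p) \<and>
      \<bar>poquim (D n) (est n \<omega>) (y n \<omega>) $$ (fst p, snd p) - I1 n (fst p) (snd p)\<bar> <= e0 * S n (fst p) (snd p)"
      have evG: "\<bar>Gent (D n) (est n \<omega>) j l - Gent (D n) \<theta> j l\<bar> <= e0 * S n j l"
        and evI: "\<bar>poquim (D n) (est n \<omega>) (y n \<omega>) $$ (j, l) - I1 n j l\<bar> <= e0 * S n j l" if "j <= s" "l <= s" for j l
        using bspec[OF ev, of "(j, l)"] that by auto
      define G' where "G' = fm (Gmat (D n) (est n \<omega>))"
      define I' where "I' = fm (poquim (D n) (est n \<omega>) (y n \<omega>))"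
      define J' where "J' = fm (J n \<omega>)"
      have pc: "poquim (D n) (est n \<omega>) (y n \<omega>) \<in> carrier_mat (s + 1) (s + 1)" by (simp add: poquim_def nfac_D)
      have Jc: "J n \<omega> \<in> carrier_mat (s + 1) (s + 1)" using J[of n] \<omega> by (simp add: random_inverse_def random_mat_def)
      have dG': "mat_dims (s + 1) (s + 1) G'" unfolding G'_def by (rule mat_dims_fm_carrier[OF Gmat_carrier])
      have dI': "mat_dims (s + 1) (s + 1) I'" unfolding I'_def by (rule mat_dims_fm_carrier[OF pc])
      have dJ': "mat_dims (s + 1) (s + 1) J'" unfolding J'_def by (rule mat_dims_fm_carrier[OF Jc])
      have symG': "trp G' = G'" unfolding G'_def by (rule trp_fm_Gmat[OF est(2)[OF \<omega>]])
      \<comment> \<open>Exactly the conditional premise of \<open>scaled_sandwich_close\<close>;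
        nonsingularity of G' is not yet known at this point.\<close>
      have Ginv: "J' * G' = - idm (s + 1) \<and> G' * J' = - idm (s + 1)" if inj: "\<And>v. mat_dims (s + 1) 1 v ==> G' * v = 0 ==> v = 0"
      proof -
        have f: "fm (info2_at (D n) (est n \<omega>)) = - G'" by (simp add: info2_at_def G'_def fm_uminus)
        have ca: "info2_at (D n) (est n \<omega>) \<in> carrier_mat (s + 1) (s + 1)" using Gmat_carrier by (simp add: info2_at_def)
        have i: "v = 0" if "mat_dims (s + 1) 1 v" "fm (info2_at (D n) (est n \<omega>)) * v = 0" for v
          using inj[OF that(1)] that(2) unfolding f by simp
        have "fm (info2_at (D n) (est n \<omega>)) * J' = idm (s + 1)" "J' * fm (info2_at (D n) (est n \<omega>)) = idm (s + 1)"
          unfolding J'_def by (rule random_inverse_mult[OF J \<omega> ca]; rule i; assumption)+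
        then show ?thesis unfolding f by (metis minus_equation_iff mult_minus_left mult_minus_right)
      qed
      have nG: "norm (gi n * G' * gi n - Hf n) <= e"
      proof -
        have "gi n * G' * gi n - Hf n = gi n * (G' - Gf n) * gi n" by (simp add: Hf_def left_diff_distrib right_diff_distrib)
        moreover have "norm (gi n * (G' - Gf n) * gi n) <= real (s + 1) * (real (s + 1) * e0)"
          by (rule norm_gi_le) (use dG' GI_dims(1) evG in \<open>auto simp: G'_def Gf_def ent_fm Gmat_def nfac_D\<close>)
        ultimately show ?thesis unfolding e0(2) by simp
      qed
      have nI: "norm (gi n * I' * gi n - Ff n) <= e"
      proof -
        have "gi n * I' * gi n - Ff n = gi n * (I' - Ifm n) * gi n" by (simp add: Ff_def left_diff_distrib right_diff_distrib)
        moreover have "norm (gi n * (I' - Ifm n) * gi n) <= real (s + 1) * (real (s + 1) * e0)"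
          by (rule norm_gi_le) (use dI' GI_dims(2) evI pc info1_carrier[of n] in \<open>auto simp: I'_def Ifm_def ent_fm\<close>)
        ultimately show ?thesis unfolding e0(2) by simp
      qed
      define \<Sigma>' where "\<Sigma>' = J' * I' * J'"
      have close: "\<bar>inner x (\<Sigma>' * z) - inner x (\<Sigma> n * z)\<bar> <= (e * k) * sqrt (inner x (\<Sigma> n * x)) * sqrt (inner z (\<Sigma> n * z))"
        if "mat_dims (s + 1) 1 x" "mat_dims (s + 1) 1 z" for x z
        unfolding \<Sigma>'_def \<Sigma>eq k_def
        by (rule scaled_sandwich_close[OF gd_gi g_dims Hi(2) symHi Hi(1) GI_dims(3) cons(5,1,6,2,7,3,8,4) symG' dG' dI' dJ' Ginv nG nI ek(1) e(2) that])
      define A where "A = trp Km * \<Sigma> n * Km"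
      define A' where "A' = trp Km * \<Sigma>' * Km"
      have fS: "inner x (trp Km * B * Km * z) = inner (Km * x) (B * (Km * z))" for x z B
        using inner_times_left[of Km x "B * (Km * z)"] by (simp add: mult.assoc)
      have dKx: "mat_dims (s + 1) 1 (Km * x)" if "mat_dims r 1 x" for x using dK that by (rule mat_dims_mult)
      have psA: "psdm A" unfolding A_def by (rule psdm_conj[OF ps\<Sigma>])
      have pdA: "x = 0" if "mat_dims r 1 x" "inner x (A * x) = 0" for x
        using pd\<Sigma>[OF dKx[OF that(1)], of n] Kinj[OF that(1)] that(2) unfolding A_def fS by simp
      have closeA: "\<bar>inner x (A' * z) - inner x (A * z)\<bar> <= (e * k) * sqrt (inner x (A * x)) * sqrt (inner z (A * z))"
        if "mat_dims r 1 x" "mat_dims r 1 z" for x z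
        unfolding A_def A'_def fS by (rule close[OF dKx[OF that(1)] dKx[OF that(2)]])
      have wn1: "u = 0" if "mat_dims r 1 u" "A' * u = 0" for u
        by (rule wald_near(1)[OF psA _ _ ek0(2) ek(2) that]) (rule pdA closeA; assumption)+
      define v where "v = fv (est n \<omega> - \<theta>)"
      have dv: "mat_dims (s + 1) 1 v" unfolding v_def by (rule mat_dims_fv_carrier) (use est_carrier[OF \<omega>] thc in auto)
      have Sigc: "Sig n \<omega> \<in> carrier_mat (s + 1) (s + 1)" unfolding Sig using Jc pc by (intro mult_carrier_mat)
      have fSig: "fm (Sig n \<omega>) = \<Sigma>'" unfolding Sig \<Sigma>'_def J'_def I'_def using Jc pc by (simp add: fm_mult mult.assoc)
      have fA': "fm (transpose_mat K * Sig n \<omega> * K) = A'"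
        unfolding A'_def fSig[symmetric] Km_def using K(1) Sigc by (simp add: fm_mult fm_transpose mult.assoc)
      have cA': "transpose_mat K * Sig n \<omega> * K \<in> carrier_mat r r" using K(1) Sigc by simp
      \<comment> \<open>On this event A' is nonsingular because it is close to A, so W is a true
        inverse.\<close>
      have WA: "A' * fm (W n \<omega>) = idm r"
      proof -
        have "fm (transpose_mat K * Sig n \<omega> * K) * fm (W n \<omega>) = idm r"
        proof (rule random_inverse_mult(1)[OF W \<omega> cA'])
          fix u assume "mat_dims r 1 u" "fm (transpose_mat K * Sig n \<omega> * K) * u = 0"
          then show "u = 0" unfolding fA' by (rule wn1)
        qed
        then show ?thesis unfolding fA' .
      qed
      \<comment> \<open>The null hypothesis enters here: with phi = K' \<theta> the contrast is K'
        applied to the estimation error.\<close>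
      have fSv: "fv (Sv n \<omega>) = trp Km * v"
      proof -
        have t: "fv (transpose_mat K *\<^sub>v u) = trp Km * fv u" if "u \<in> carrier_vec (s + 1)" for u
          using K(1) that by (simp add: fm_mult_vec fm_transpose Km_def)
        have "fv (Sv n \<omega>) = fv (transpose_mat K *\<^sub>v est n \<omega>) - fv (transpose_mat K *\<^sub>v \<theta>)"
          unfolding Sv_def H0[symmetric] using K(1) by (intro fv_diff) simp
        then show ?thesis
          unfolding t[OF est_carrier[OF \<omega>]] t[OF thc] v_def using est_carrier[OF \<omega>] thc by (simp add: fv_diff right_diff_distrib)
      qed
      define z where "z = fm (W n \<omega>) * (trp Km * v)"
      have dKt: "mat_dims r (s + 1) (trp Km)" using dK by simp
      have dKv: "mat_dims r 1 (trp Km * v)" by (rule mat_dims_mult[OF dKt dv])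
      have dz: "mat_dims r 1 z" unfolding z_def by (rule mat_dims_mult[OF mat_dims_fm_carrier[OF Wc[OF \<omega>]] dKv])
      have Az: "A' * z = trp Km * v"
      proof -
        have "A' * z = (A' * fm (W n \<omega>)) * (trp Km * v)" by (simp only: z_def mult.assoc)
        also have "\<dots> = trp Km * v" unfolding WA by (rule idm_mult_left[OF dKv])
        finally show ?thesis .
      qed
      have Xz: "X n \<omega> = inner (trp Km * v) z"
      proof -
        have dS: "dim_vec (Sv n \<omega>) = r" using Svc by (rule carrier_vecD)
        have dW: "dim_row (W n \<omega>) = r" "dim_col (W n \<omega>) = r" using Wc[OF \<omega>] by (rule carrier_matD)+
        have "X n \<omega> = scalar_prod (Sv n \<omega>) (W n \<omega> *\<^sub>v Sv n \<omega>)" by (rule X_def)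
        also have "\<dots> = inner (fv (Sv n \<omega>)) (fv (W n \<omega> *\<^sub>v Sv n \<omega>))"
          by (rule inner_fv[symmetric]) (simp only: dS dW dim_mult_mat_vec)
        also have "fv (W n \<omega> *\<^sub>v Sv n \<omega>) = fm (W n \<omega>) * fv (Sv n \<omega>)" by (rule fm_mult_vec) (simp only: dS dW)
        finally show ?thesis unfolding fSv z_def .
      qed
      have fZ: "fv (Z n \<omega>) = fm (BJ n) * v"
        unfolding Z_def v_def by (rule fm_mult_vec) (use carrier_matD(2)[OF BJc[of n]] carrier_vecD[OF thc] in simp)
      obtain w where w0: "mat_dims r 1 w" "trp Km * \<Sigma> n * Km * w = trp Km * v" "inner (trp Km * v) w = (norm (Q n * (fm (BJ n) * v)))\<^sup>2"
        using Q(3)[OF dv, of n] by (elim exE conjE) (rule that)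
      note w = w0(1) w0(2)[folded A_def] w0(3)
      have qw: "q n \<omega> = inner (trp Km * v) w" by (simp only: qn(1)[OF \<omega>] fZ w(3))
      have dZ: "mat_dims (s + 1) 1 (fv (Z n \<omega>))" by (rule mat_dims_fv_carrier) (use Zc[of n] \<omega> in \<open>simp add: random_vec_def\<close>)
      \<comment> \<open>The error is relative to q, and q is at most |Z_n|^2 because Q is a
        coisometry; this is the closeness asked for by \<open>weak_conv_near\<close>.\<close>
      have "\<bar>X n \<omega> - q n \<omega>\<bar> <= 2 * (e * k) * q n \<omega>" unfolding Xz qw
        by (rule wald_near(2)[OF psA _ _ ek0(2) ek(2) dz w(1) Az w(2)]) (rule pdA closeA; assumption)+
      also have "\<dots> <= \<epsilon> * (\<Sum>j<s+1. (Z n \<omega> $ j)\<^sup>2)"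
      proof (rule mult_mono[OF ek(3)])
        show "q n \<omega> <= (\<Sum>j<s+1. (Z n \<omega> $ j)\<^sup>2)"
          unfolding qn[OF \<omega>] by (intro power_mono norm_coisometry_le[OF Q(1,2) dZ]) simp
        show "0 <= q n \<omega>" unfolding qn[OF \<omega>] by simp
      qed (use \<epsilon> in simp)
      finally show "\<bar>X n \<omega> - q n \<omega>\<bar> <= \<epsilon> * (\<Sum>j<s+1. (Z n \<omega> $ j)\<^sup>2)" .
    qed
    then show ?thesis using \<eta> unfolding whp_def by blast
  qed
  have qm: "q n \<in> borel_measurable (M n)" for n
    unfolding q_def by (rule qqZ_measurable[OF M_prob Zc Zn])
  have "weak_conv_m (\<lambda>n. distr (M n) borel (X n)) (distr (gauss r) borel (\<lambda>z. \<Sum>i<r. (z i)\<^sup>2))"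
  proof (rule weak_conv_near[OF M_prob Zc Zn Xm qm _ prob_space_gauss sum_sq_measurable _ _ near])
    show "0 <= q n \<omega>" for n \<omega> unfolding q_def by (rule qq_nonneg)
    show "0 <= (\<Sum>i<r. (z i)\<^sup>2)" for z :: "nat => real" by (rule sum_nonneg) simp
    show "(\<lambda>n. \<integral>\<omega>. exp (- real k * q n \<omega>) \<partial>M n) \<longlonglongrightarrow> (\<integral>x. exp (- real k * (\<Sum>i<r. (x i)\<^sup>2)) \<partial>gauss r)" for k
      unfolding q_def by (rule conv_qq[OF M_prob Zc Zn Q(1,2)]) simp
  qed
  then show ?thesis unfolding chi_square_def X_def[abs_def] Sv_def .
qed

end
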